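(* Let $\mathcal{C}$ be a braided finite tensor category over an algebraically closed field $k$. If the linear map $$\Omega_{\mathcal{C}}:\mathrm{Hom}_{\mathcal{C}}(\mathbb{1},\mathbb{F})\to\mathrm{Hom}_{\mathcal{C}}(\mathbb{F},\mathbb{1}),\quad f\mapsto\omega_{\mathcal{C}}\circ(f\otimes\mathrm{id}_{\mathbb{F}})$$ is injective, then the M\"uger center of $\mathcal{C}$ is trivial.
   Context: A finite abelian category over $k$ is a $k$-linear category equivalent to the category of finite-dimensional modules over some finite-dimensional $k$-algebra. A finite tensor category over $k$ is a rigid monoidal category that is a finite abelian category over $k$, whose tensor product is $k$-linear in each variable, and whose unit object $\mathbb{1}$ is simple. Monoidal categories are assumed strict. The left dual of $X$ is $X^*$, with evaluation $\mathrm{ev}_X:X^*\otimes X\to\mathbb{1}$. Let $\sigma$ be the braiding of $\mathcal{C}$. The coend $\mathbb{F}=\int^{X\in\mathcal{C}}X^*\otimes X$ exists in $\mathcal{C}$; let $i(X):X^*\otimes X\to\mathbb{F}$ be its universal dinatural transformation. The morphism $\omega_{\mathcal{C}}:\mathbb{F}\otimes\mathbb{F}\to\mathbb{1}$ is the unique one such that for all $X,Y\in\mathcal{C}$ $$\omega_{\mathcal{C}}\circ(i(X)\otimes i(Y))=(\mathrm{ev}_X\otimes\mathrm{ev}_Y)\circ(\mathrm{id}_{X^*}\otimes\sigma_{Y^*,X}\sigma_{X,Y^*}\otimes\mathrm{id}_Y).$$ The M\"uger center $\mathcal{C}'$ is the full subcategory of $\mathcal{C}$ consisting of all objects $X$ such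 that $\sigma_{Y,X}\circ\sigma_{X,Y}=\mathrm{id}_{X\otimes Y}$ for all $Y\in\mathcal{C}$. It is trivial if every object of $\mathcal{C}'$ is isomorphic to a direct sum of finitely many copies of $\mathbb{1}$. *)

theory Defs
  imports "Jordan_Normal_Form.VS_Connect"
begin

section \<open>Categories\<close>

text \<open>
  A category is given by a set of objects and a set of arrows with domain and codomain, so that
  distinct hom-sets are disjoint. Composition is written in the applicative order: \<open>g \<cdot> f\<close> is
  \<open>g\<close> after \<open>f\<close>; its value is irrelevant when \<open>Cod f \<noteq> Dom g\<close>.
\<close>

record ('o, 'm) cat =
  Obj :: "'o set"
  Arr :: "'m set"
  Dom :: "'m \<Rightarrow> 'o"
  Cod :: "'m \<Rightarrow> 'o"
  Ide :: "'o \<Rightarrow> 'm"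
  Comp :: "'m \<Rightarrow> 'm \<Rightarrow> 'm" (infixr \<open>\<cdot>\<index>\<close> 55)

definition Hom :: "('o, 'm, 'z) cat_scheme \<Rightarrow> 'o \<Rightarrow> 'o \<Rightarrow> 'm set"
  where "Hom C X Y = {f \<in> Arr C. Dom C f = X \<and> Cod C f = Y}"

locale category =
  fixes C :: "('o, 'm, 'z) cat_scheme" (structure)
  assumes Dom_in: "f \<in> Arr C \<Longrightarrow> Dom C f \<in> Obj C"
    and Cod_in: "f \<in> Arr C \<Longrightarrow> Cod C f \<in> Obj C"
    and Ide_in: "X \<in> Obj C \<Longrightarrow> Ide C X \<in> Hom C X X"
    and Comp_in: "f \<in> Hom C X Y \<Longrightarrow> g \<in> Hom C Y Z \<Longrightarrow> g \<cdot> f \<in> Hom C X Z"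
    and Ide_left: "f \<in> Hom C X Y \<Longrightarrow> Ide C Y \<cdot> f = f"
    and Ide_right: "f \<in> Hom C X Y \<Longrightarrow> f \<cdot> Ide C X = f"
    and Comp_assoc: "f \<in> Hom C X Y \<Longrightarrow> g \<in> Hom C Y Z \<Longrightarrow> h \<in> Hom C Z W \<Longrightarrow>
      (h \<cdot> g) \<cdot> f = h \<cdot> (g \<cdot> f)"

context
  fixes C :: "('o, 'm, 'z) cat_scheme" (structure)
begin

definition inverse_arrows :: "'m \<Rightarrow> 'm \<Rightarrow> bool"
  where "inverse_arrows f g \<longleftrightarrow> f \<in> Arr C \<and> g \<in> Hom C (Cod C f) (Dom C f) \<and>
    g \<cdot> f = Ide C (Dom C f) \<and> f \<cdot> g = Ide C (Cod C f)"

definition is_iso :: "'m \<Rightarrow> bool"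
  where "is_iso f \<longleftrightarrow> (\<exists>g. inverse_arrows f g)"

definition isomorphic :: "'o \<Rightarrow> 'o \<Rightarrow> bool"
  where "isomorphic X Y \<longleftrightarrow> (\<exists>f \<in> Hom C X Y. is_iso f)"

definition is_mono :: "'m \<Rightarrow> bool"
  where "is_mono f \<longleftrightarrow> f \<in> Arr C \<and>
    (\<forall>W. \<forall>g \<in> Hom C W (Dom C f). \<forall>h \<in> Hom C W (Dom C f). f \<cdot> g = f \<cdot> h \<longrightarrow> g = h)"

definition is_zero_object :: "'o \<Rightarrow> bool"
  where "is_zero_object Z \<longleftrightarrow> Z \<in> Obj C \<and>
    (\<forall>X \<in> Obj C. (\<exists>!f. f \<in> Hom C Z X) \<and> (\<exists>!f. f \<in> Hom C X Z))"

text \<open>A nonzero object whose only subobjects are the zero object and the whole object.\<close>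

definition is_simple :: "'o \<Rightarrow> bool"
  where "is_simple X \<longleftrightarrow> X \<in> Obj C \<and> \<not> is_zero_object X \<and>
    (\<forall>Y \<in> Obj C. \<forall>f \<in> Hom C Y X. is_mono f \<longrightarrow> is_zero_object Y \<or> is_iso f)"

end

definition full_subcategory :: "('o, 'm, 'z) cat_scheme \<Rightarrow> 'o set \<Rightarrow> ('o, 'm, 'z) cat_scheme"
  where "full_subcategory C S =
    C\<lparr>Obj := Obj C \<inter> S, Arr := {f \<in> Arr C. Dom C f \<in> S \<and> Cod C f \<in> S}\<rparr>"


section \<open>Linear categories\<close>

text \<open>
  The ground field is the type \<open>'k\<close>; \<open>class_ring\<close> is that field viewed as a ring record.
  The linear structure on all hom-sets is given by global operations on arrows, of which only the
  restriction to each single hom-set matters.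
\<close>

record ('k, 'o, 'm) klin_cat = "('o, 'm) cat" +
  Add :: "'m \<Rightarrow> 'm \<Rightarrow> 'm"
  Zero :: "'o \<Rightarrow> 'o \<Rightarrow> 'm"
  Scale :: "'k \<Rightarrow> 'm \<Rightarrow> 'm"

text \<open>The ring multiplication fields of a \<open>module\<close> record are not used by \<open>vectorspace\<close>.\<close>

definition hom_space :: "('k, 'o, 'm, 'z) klin_cat_scheme \<Rightarrow> 'o \<Rightarrow> 'o \<Rightarrow> ('k, 'm) module"
  where "hom_space C X Y =
    \<lparr>carrier = Hom C X Y, mult = undefined, one = undefined,
     zero = Zero C X Y, add = Add C, smult = Scale C\<rparr>"

locale klinear_category = category C
  for C :: "('k :: field, 'o, 'm, 'z) klin_cat_scheme" (structure) +
  assumes vectorspace_hom: "X \<in> Obj C \<Longrightarrow> Y \<in> Obj C \<Longrightarrow>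
      vectorspace (class_ring :: 'k ring) (hom_space C X Y)"
    and Comp_Add_left: "f \<in> Hom C X Y \<Longrightarrow> g \<in> Hom C Y Z \<Longrightarrow> g' \<in> Hom C Y Z \<Longrightarrow>
      Add C g g' \<cdot> f = Add C (g \<cdot> f) (g' \<cdot> f)"
    and Comp_Add_right: "f \<in> Hom C X Y \<Longrightarrow> f' \<in> Hom C X Y \<Longrightarrow> g \<in> Hom C Y Z \<Longrightarrow>
      g \<cdot> Add C f f' = Add C (g \<cdot> f) (g \<cdot> f')"
    and Comp_Scale_left: "f \<in> Hom C X Y \<Longrightarrow> g \<in> Hom C Y Z \<Longrightarrow>
      Scale C a g \<cdot> f = Scale C a (g \<cdot> f)"
    and Comp_Scale_right: "f \<in> Hom C X Y \<Longrightarrow> g \<in> Hom C Y Z \<Longrightarrow>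
      g \<cdot> Scale C a f = Scale C a (g \<cdot> f)"

text \<open>\<open>D\<close> is a direct sum of \<open>n\<close> copies of \<open>X\<close>, with injections \<open>inj\<close> and projections \<open>pr\<close>.\<close>

definition is_direct_sum_copies :: "('k, 'o, 'm, 'z) klin_cat_scheme \<Rightarrow> nat \<Rightarrow> 'o \<Rightarrow> 'o \<Rightarrow> bool"
  where "is_direct_sum_copies C n X D \<longleftrightarrow> D \<in> Obj C \<and>
    (\<exists>inj pr. (\<forall>j<n. inj j \<in> Hom C X D \<and> pr j \<in> Hom C D X) \<and>
      (\<forall>i<n. \<forall>j<n. pr i \<cdot>\<^bsub>C\<^esub> inj j = (if i = j then Ide C X else Zero C X X)) \<and>
      finsum (hom_space C D D) (\<lambda>j. inj j \<cdot>\<^bsub>C\<^esub> pr j) {..<n} = Ide C D)"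

locale klinear_functor = C: klinear_category C + D: klinear_category D
  for C :: "('k :: field, 'o1, 'm1, 'z1) klin_cat_scheme"
    and D :: "('k, 'o2, 'm2, 'z2) klin_cat_scheme"
    and Fo :: "'o1 \<Rightarrow> 'o2" and Fm :: "'m1 \<Rightarrow> 'm2" +
  assumes Fo_in: "X \<in> Obj C \<Longrightarrow> Fo X \<in> Obj D"
    and Fm_in: "f \<in> Hom C X Y \<Longrightarrow> Fm f \<in> Hom D (Fo X) (Fo Y)"
    and Fm_Ide: "X \<in> Obj C \<Longrightarrow> Fm (Ide C X) = Ide D (Fo X)"
    and Fm_Comp: "f \<in> Hom C X Y \<Longrightarrow> g \<in> Hom C Y Z \<Longrightarrow> Fm (g \<cdot>\<^bsub>C\<^esub> f) = Fm g \<cdot>\<^bsub>D\<^esub> Fm f"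
    and Fm_Add: "f \<in> Hom C X Y \<Longrightarrow> f' \<in> Hom C X Y \<Longrightarrow> Fm (Add C f f') = Add D (Fm f) (Fm f')"
    and Fm_Scale: "f \<in> Hom C X Y \<Longrightarrow> Fm (Scale C a f) = Scale D a (Fm f)"

text \<open>A natural isomorphism from \<open>(Fo, Fm)\<close> to \<open>(Go, Gm)\<close>, both functors from \<open>C\<close> to \<open>D\<close>.\<close>

definition natural_iso ::
  "('o1, 'm1, 'z1) cat_scheme \<Rightarrow> ('o2, 'm2, 'z2) cat_scheme \<Rightarrow>
    ('o1 \<Rightarrow> 'o2) \<Rightarrow> ('m1 \<Rightarrow> 'm2) \<Rightarrow> ('o1 \<Rightarrow> 'o2) \<Rightarrow> ('m1 \<Rightarrow> 'm2) \<Rightarrow> ('o1 \<Rightarrow> 'm2) \<Rightarrow> bool"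
  where "natural_iso C D Fo Fm Go Gm \<eta> \<longleftrightarrow>
    (\<forall>X \<in> Obj C. \<eta> X \<in> Hom D (Fo X) (Go X) \<and> is_iso D (\<eta> X)) \<and>
    (\<forall>X Y. \<forall>f \<in> Hom C X Y. \<eta> Y \<cdot>\<^bsub>D\<^esub> Fm f = Gm f \<cdot>\<^bsub>D\<^esub> \<eta> X)"

definition klinear_equivalent ::
  "('k :: field, 'o1, 'm1, 'z1) klin_cat_scheme \<Rightarrow> ('k, 'o2, 'm2, 'z2) klin_cat_scheme \<Rightarrow> bool"
  where "klinear_equivalent C D \<longleftrightarrow>
    (\<exists>Fo Fm Go Gm \<eta> \<epsilon>. klinear_functor C D Fo Fm \<and> klinear_functor D C Go Gm \<and>
      natural_iso C C id id (Go \<circ> Fo) (Gm \<circ> Fm) \<eta> \<and>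
      natural_iso D D (Fo \<circ> Go) (Fm \<circ> Gm) id id \<epsilon>)"


section \<open>Finite abelian categories\<close>

text \<open>Associative unital algebras, not necessarily commutative, of finite dimension.\<close>

locale fd_algebra = ring A + vectorspace "class_ring :: 'k ring" A
  for A :: "('k :: field, 'a) module" (structure) +
  assumes smult_mult_left: "x \<in> carrier A \<Longrightarrow> y \<in> carrier A \<Longrightarrow> (c \<odot> x) \<otimes> y = c \<odot> (x \<otimes> y)"
    and smult_mult_right: "x \<in> carrier A \<Longrightarrow> y \<in> carrier A \<Longrightarrow> x \<otimes> (c \<odot> y) = c \<odot> (x \<otimes> y)"
    and finite_dimensional: "fin_dim"

text \<open>
  A finite-dimensional left \<open>A\<close>-module is presented with underlying space \<open>k\<^sup>m\<close> as a pair
  \<open>(m, \<rho>)\<close>, where \<open>\<rho> : A \<rightarrow> Mat\<^sub>m(k)\<close> is a unital algebra homomorphism; up to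
  isomorphism this covers every finite-dimensional module. A morphism carries its
  domain and codomain; its last component is the matrix of an \<open>A\<close>-linear map. Values of \<open>\<rho>\<close>
  outside the carrier of \<open>A\<close> are unconstrained, which only adds isomorphic copies of objects.
\<close>

definition fd_modules :: "('k :: field, 'a) module \<Rightarrow> (nat \<times> ('a \<Rightarrow> 'k mat)) set"
  where "fd_modules A = {(m, \<rho>). \<rho> \<in> Ring.ring_hom A (ring_mat TYPE('k) m ()) \<and>
    (\<forall>c. \<forall>a \<in> carrier A. \<rho> (c \<odot>\<^bsub>A\<^esub> a) = c \<cdot>\<^sub>m \<rho> a)}"

definition fd_module_maps ::
  "('k :: field, 'a) module \<Rightarrow> nat \<times> ('a \<Rightarrow> 'k mat) \<Rightarrow> nat \<times> ('a \<Rightarrow> 'k mat) \<Rightarrow> 'k mat set"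
  where "fd_module_maps A M N = {T \<in> carrier_mat (fst N) (fst M).
    \<forall>a \<in> carrier A. T * snd M a = snd N a * T}"

type_synonym ('k, 'a) fd_mod = "nat \<times> ('a \<Rightarrow> 'k mat)"

definition fd_mod_cat :: "('k :: field, 'a) module \<Rightarrow>
    ('k, ('k, 'a) fd_mod, ('k, 'a) fd_mod \<times> ('k, 'a) fd_mod \<times> 'k mat) klin_cat"
  where "fd_mod_cat A =
    \<lparr>Obj = fd_modules A,
     Arr = {(M, N, T). M \<in> fd_modules A \<and> N \<in> fd_modules A \<and> T \<in> fd_module_maps A M N},
     Dom = (\<lambda>(M, N, T). M),
     Cod = (\<lambda>(M, N, T). N),
     Ide = (\<lambda>M. (M, M, 1\<^sub>m (fst M))),
     Comp = (\<lambda>(N, P, S) (M, N', T). (M, P, S * T)),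
     Add = (\<lambda>(M, N, S) (M', N', T). (M, N, S + T)),
     Zero = (\<lambda>M N. (M, N, 0\<^sub>m (fst N) (fst M))),
     Scale = (\<lambda>c (M, N, T). (M, N, c \<cdot>\<^sub>m T))\<rparr>"

lemma (in fd_algebra) klinear_category_fd_mod_cat: "klinear_category (fd_mod_cat A)"
proof -
  have car: "snd M a \<in> carrier_mat (fst M) (fst M)" if "M \<in> fd_modules A" "a \<in> carrier A" for M a
    using that by (auto simp: fd_modules_def Ring.ring_hom_def ring_mat_simps)
  have mapD: "T \<in> carrier_mat (fst N) (fst M)" if "T \<in> fd_module_maps A M N" for T M N
    using that by (simp add: fd_module_maps_def)
  have one: "1\<^sub>m (fst M) \<in> fd_module_maps A M M" if "M \<in> fd_modules A" for M
    using left_mult_one_mat[OF car[OF that]] right_mult_one_mat[OF car[OF that]]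
    by (simp add: fd_module_maps_def)
  have comp: "S * T \<in> fd_module_maps A M P"
    if MNP: "M \<in> fd_modules A" "N \<in> fd_modules A" "P \<in> fd_modules A"
      and T: "T \<in> fd_module_maps A M N" and S: "S \<in> fd_module_maps A N P" for S T M N P
  proof -
    have "S * T * snd M a = snd P a * (S * T)" if a: "a \<in> carrier A" for a
    proof -
      note [simp] = assoc_mult_mat[OF mapD[OF S] mapD[OF T] car[OF MNP(1) a]]
        assoc_mult_mat[OF mapD[OF S] car[OF MNP(2) a] mapD[OF T], symmetric]
        assoc_mult_mat[OF car[OF MNP(3) a] mapD[OF S] mapD[OF T], symmetric]
      show ?thesis using S T a by (simp add: fd_module_maps_def)
    qed
    with mapD[OF S] mapD[OF T] show ?thesis by (simp add: fd_module_maps_def)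
  qed
  have add: "S + T \<in> fd_module_maps A M N"
    if MN: "M \<in> fd_modules A" "N \<in> fd_modules A"
      and S: "S \<in> fd_module_maps A M N" and T: "T \<in> fd_module_maps A M N" for S T M N
    using add_mult_distrib_mat[OF mapD[OF S] mapD[OF T] car[OF MN(1)]]
      mult_add_distrib_mat[OF car[OF MN(2)] mapD[OF S] mapD[OF T]] S T
    by (simp add: fd_module_maps_def)
  have scale: "c \<cdot>\<^sub>m T \<in> fd_module_maps A M N"
    if MN: "M \<in> fd_modules A" "N \<in> fd_modules A" and T: "T \<in> fd_module_maps A M N" for c T M N
    using mult_smult_assoc_mat[OF mapD[OF T] car[OF MN(1)]] T
      mult_smult_distrib[OF car[OF MN(2)] mapD[OF T]]
    by (simp add: fd_module_maps_def)
  have zero: "0\<^sub>m (fst N) (fst M) \<in> fd_module_maps A M N"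
    if MN: "M \<in> fd_modules A" "N \<in> fd_modules A" for M N
    using left_mult_zero_mat[OF car[OF MN(1)]] right_mult_zero_mat[OF car[OF MN(2)]]
    by (simp add: fd_module_maps_def)
  have Obj: "Obj (fd_mod_cat A) = fd_modules A" by (simp add: fd_mod_cat_def)
  have Hom: "f \<in> Hom (fd_mod_cat A) M N \<longleftrightarrow>
      (\<exists>T. f = (M, N, T) \<and> M \<in> fd_modules A \<and> N \<in> fd_modules A \<and> T \<in> fd_module_maps A M N)" for f M N
    by (auto simp: fd_mod_cat_def Hom_def)
  have ops: "Ide (fd_mod_cat A) M = (M, M, 1\<^sub>m (fst M))"
    "Comp (fd_mod_cat A) (N, P, S) (M, N', T) = (M, P, S * T)"
    "Add (fd_mod_cat A) (M, N, S) (M', N', T) = (M, N, S + T)"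
    "Zero (fd_mod_cat A) M N = (M, N, 0\<^sub>m (fst N) (fst M))"
    "Scale (fd_mod_cat A) c (M, N, T) = (M, N, c \<cdot>\<^sub>m T)" for M N N' M' P S T c
    by (simp_all add: fd_mod_cat_def)
  have cat: "category (fd_mod_cat A)"
  proof
    show "Dom (fd_mod_cat A) f \<in> Obj (fd_mod_cat A)" "Cod (fd_mod_cat A) f \<in> Obj (fd_mod_cat A)"
      if "f \<in> Arr (fd_mod_cat A)" for f
      using that by (auto simp: fd_mod_cat_def)
  next
    fix f g h X Y Z W
    assume f: "f \<in> Hom (fd_mod_cat A) X Y"
    show "Ide (fd_mod_cat A) Y \<cdot>\<^bsub>fd_mod_cat A\<^esub> f = f" "f \<cdot>\<^bsub>fd_mod_cat A\<^esub> Ide (fd_mod_cat A) X = f"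
      using f by (auto simp: Hom ops dest!: mapD)
    assume g: "g \<in> Hom (fd_mod_cat A) Y Z"
    show "g \<cdot>\<^bsub>fd_mod_cat A\<^esub> f \<in> Hom (fd_mod_cat A) X Z"
      using f g by (auto simp: Hom ops intro: comp)
    assume h: "h \<in> Hom (fd_mod_cat A) Z W"
    show "(h \<cdot>\<^bsub>fd_mod_cat A\<^esub> g) \<cdot>\<^bsub>fd_mod_cat A\<^esub> f = h \<cdot>\<^bsub>fd_mod_cat A\<^esub> (g \<cdot>\<^bsub>fd_mod_cat A\<^esub> f)"
      using f g h by (auto simp: Hom ops intro!: assoc_mult_mat dest!: mapD)
  qed (auto simp: Obj Hom ops one)
  have vs: "vectorspace (class_ring :: 'k ring) (hom_space (fd_mod_cat A) X Y)"
    if "X \<in> Obj (fd_mod_cat A)" "Y \<in> Obj (fd_mod_cat A)" for X Y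
  proof -
    have XY: "X \<in> fd_modules A" "Y \<in> fd_modules A" using that by (simp_all add: Obj)
    have inv: "- 1 \<cdot>\<^sub>m T + T = 0\<^sub>m (fst Y) (fst X)" if "T \<in> carrier_mat (fst Y) (fst X)" for T :: "'k mat"
      using that by auto
    show ?thesis unfolding vectorspace_def
    proof (intro conjI class_field moduleI abelian_groupI class_cring.is_cring)
      fix x assume x: "x \<in> carrier (hom_space (fd_mod_cat A) X Y)"
      show "\<exists>y\<in>carrier (hom_space (fd_mod_cat A) X Y).
            y \<oplus>\<^bsub>hom_space (fd_mod_cat A) X Y\<^esub> x = \<zero>\<^bsub>hom_space (fd_mod_cat A) X Y\<^esub>"
        using x XY inv
        by (intro bexI[of _ "Scale (fd_mod_cat A) (- 1) x"])
          (auto simp: hom_space_def Hom ops intro: scale dest: mapD)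
    qed (use XY in \<open>auto simp: hom_space_def Hom ops add zero scale\<close>,
        (auto dest!: mapD intro!: eq_matI simp: algebra_simps))
  qed
  show ?thesis
  proof (intro klinear_category.intro cat klinear_category_axioms.intro vs)
  qed (auto simp: Hom ops intro!: add_mult_distrib_mat mult_add_distrib_mat mult_smult_distrib
      mult_smult_assoc_mat dest!: mapD)
qed

text \<open>
  The carrier type \<open>'k vec\<close> is no restriction on the algebra: every finite-dimensional algebra
  can be transported to some \<open>k\<^sup>n\<close>, i.e. to \<open>carrier_vec n\<close>.
\<close>

locale finite_abelian_category = klinear_category C
  for C :: "('k :: field, 'o, 'm, 'z) klin_cat_scheme" (structure) +
  assumes equivalent_fd_mod:
    "\<exists>A :: ('k, 'k vec) module. fd_algebra A \<and> klinear_equivalent C (fd_mod_cat A)"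


section \<open>Finite tensor categories\<close>

text \<open>
  The left dual \<open>X\<^sup>\<star>\<close> of each object, together with its evaluation and coevaluation, is part of the
  structure; left duals are unique up to unique isomorphism.
\<close>

record ('k, 'o, 'm) rigid_cat = "('k, 'o, 'm) klin_cat" +
  Unit :: "'o" (\<open>\<I>\<index>\<close>)
  TensorO :: "'o \<Rightarrow> 'o \<Rightarrow> 'o" (infixr \<open>\<otimes>\<^sub>o\<index>\<close> 70)
  TensorM :: "'m \<Rightarrow> 'm \<Rightarrow> 'm" (infixr \<open>\<otimes>\<^sub>m\<index>\<close> 70)
  LDual :: "'o \<Rightarrow> 'o" (\<open>_\<^sup>\<star>\<index>\<close> [1000] 999)
  Ev :: "'o \<Rightarrow> 'm"
  Coev :: "'o \<Rightarrow> 'm"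

locale strict_monoidal_category = category C
  for C :: "('k :: field, 'o, 'm, 'z) rigid_cat_scheme" (structure) +
  assumes Unit_in: "\<I> \<in> Obj C"
    and TensorO_in: "X \<in> Obj C \<Longrightarrow> Y \<in> Obj C \<Longrightarrow> X \<otimes>\<^sub>o Y \<in> Obj C"
    and TensorM_in: "f \<in> Hom C X Y \<Longrightarrow> g \<in> Hom C Z W \<Longrightarrow> f \<otimes>\<^sub>m g \<in> Hom C (X \<otimes>\<^sub>o Z) (Y \<otimes>\<^sub>o W)"
    and TensorM_Ide: "X \<in> Obj C \<Longrightarrow> Y \<in> Obj C \<Longrightarrow> Ide C X \<otimes>\<^sub>m Ide C Y = Ide C (X \<otimes>\<^sub>o Y)"
    and TensorM_Comp: "f \<in> Hom C X Y \<Longrightarrow> f' \<in> Hom C Y Z \<Longrightarrow> g \<in> Hom C U V \<Longrightarrow> g' \<in> Hom C V W \<Longrightarrow>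
      (f' \<cdot> f) \<otimes>\<^sub>m (g' \<cdot> g) = (f' \<otimes>\<^sub>m g') \<cdot> (f \<otimes>\<^sub>m g)"
    and TensorO_assoc: "X \<in> Obj C \<Longrightarrow> Y \<in> Obj C \<Longrightarrow> Z \<in> Obj C \<Longrightarrow>
      (X \<otimes>\<^sub>o Y) \<otimes>\<^sub>o Z = X \<otimes>\<^sub>o (Y \<otimes>\<^sub>o Z)"
    and TensorM_assoc: "f \<in> Arr C \<Longrightarrow> g \<in> Arr C \<Longrightarrow> h \<in> Arr C \<Longrightarrow>
      (f \<otimes>\<^sub>m g) \<otimes>\<^sub>m h = f \<otimes>\<^sub>m (g \<otimes>\<^sub>m h)"
    and TensorO_Unit: "X \<in> Obj C \<Longrightarrow> \<I> \<otimes>\<^sub>o X = X" "X \<in> Obj C \<Longrightarrow> X \<otimes>\<^sub>o \<I> = X"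
    and TensorM_Unit: "f \<in> Arr C \<Longrightarrow> Ide C \<I> \<otimes>\<^sub>m f = f" "f \<in> Arr C \<Longrightarrow> f \<otimes>\<^sub>m Ide C \<I> = f"

text \<open>
  \<open>Y\<close> is a left dual of \<open>X\<close> (equivalently, \<open>X\<close> is a right dual of \<open>Y\<close>) with evaluation
  \<open>e : Y \<otimes> X \<rightarrow> \<I>\<close> and coevaluation \<open>c : \<I> \<rightarrow> X \<otimes> Y\<close>.
\<close>

definition is_left_dual ::
  "('k, 'o, 'm, 'z) rigid_cat_scheme \<Rightarrow> 'o \<Rightarrow> 'o \<Rightarrow> 'm \<Rightarrow> 'm \<Rightarrow> bool"
  where "is_left_dual C X Y e c \<longleftrightarrow> X \<in> Obj C \<and> Y \<in> Obj C \<and>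
    e \<in> Hom C (Y \<otimes>\<^sub>o\<^bsub>C\<^esub> X) \<I>\<^bsub>C\<^esub> \<and> c \<in> Hom C \<I>\<^bsub>C\<^esub> (X \<otimes>\<^sub>o\<^bsub>C\<^esub> Y) \<and>
    (Ide C X \<otimes>\<^sub>m\<^bsub>C\<^esub> e) \<cdot>\<^bsub>C\<^esub> (c \<otimes>\<^sub>m\<^bsub>C\<^esub> Ide C X) = Ide C X \<and>
    (e \<otimes>\<^sub>m\<^bsub>C\<^esub> Ide C Y) \<cdot>\<^bsub>C\<^esub> (Ide C Y \<otimes>\<^sub>m\<^bsub>C\<^esub> c) = Ide C Y"

locale rigid_monoidal_category = strict_monoidal_category C
  for C :: "('k :: field, 'o, 'm, 'z) rigid_cat_scheme" (structure) +
  assumes left_dual: "X \<in> Obj C \<Longrightarrow> is_left_dual C X (X\<^sup>\<star>) (Ev C X) (Coev C X)"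
    and right_dual: "X \<in> Obj C \<Longrightarrow> \<exists>Y e c. is_left_dual C Y X e c"

locale finite_tensor_category = finite_abelian_category C + rigid_monoidal_category C
  for C :: "('k :: field, 'o, 'm, 'z) rigid_cat_scheme" (structure) +
  assumes TensorM_Add_left: "f \<in> Hom C X Y \<Longrightarrow> f' \<in> Hom C X Y \<Longrightarrow> g \<in> Hom C Z W \<Longrightarrow>
      Add C f f' \<otimes>\<^sub>m g = Add C (f \<otimes>\<^sub>m g) (f' \<otimes>\<^sub>m g)"
    and TensorM_Add_right: "f \<in> Hom C X Y \<Longrightarrow> g \<in> Hom C Z W \<Longrightarrow> g' \<in> Hom C Z W \<Longrightarrow>
      f \<otimes>\<^sub>m Add C g g' = Add C (f \<otimes>\<^sub>m g) (f \<otimes>\<^sub>m g')"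
    and TensorM_Scale_left: "f \<in> Hom C X Y \<Longrightarrow> g \<in> Hom C Z W \<Longrightarrow>
      Scale C a f \<otimes>\<^sub>m g = Scale C a (f \<otimes>\<^sub>m g)"
    and TensorM_Scale_right: "f \<in> Hom C X Y \<Longrightarrow> g \<in> Hom C Z W \<Longrightarrow>
      f \<otimes>\<^sub>m Scale C a g = Scale C a (f \<otimes>\<^sub>m g)"
    and Unit_simple: "is_simple C \<I>"

record ('k, 'o, 'm) braided_cat = "('k, 'o, 'm) rigid_cat" +
  Braiding :: "'o \<Rightarrow> 'o \<Rightarrow> 'm" (\<open>\<sigma>\<index>\<close>)

locale braided_finite_tensor_category = finite_tensor_category C
  for C :: "('k :: field, 'o, 'm, 'z) braided_cat_scheme" (structure) +
  assumes Braiding_in: "X \<in> Obj C \<Longrightarrow> Y \<in> Obj C \<Longrightarrow> \<sigma> X Y \<in> Hom C (X \<otimes>\<^sub>o Y) (Y \<otimes>\<^sub>o X)"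
    and Braiding_iso: "X \<in> Obj C \<Longrightarrow> Y \<in> Obj C \<Longrightarrow> is_iso C (\<sigma> X Y)"
    and Braiding_natural: "f \<in> Hom C X X' \<Longrightarrow> g \<in> Hom C Y Y' \<Longrightarrow>
      \<sigma> X' Y' \<cdot> (f \<otimes>\<^sub>m g) = (g \<otimes>\<^sub>m f) \<cdot> \<sigma> X Y"
    and hexagon_left: "X \<in> Obj C \<Longrightarrow> Y \<in> Obj C \<Longrightarrow> Z \<in> Obj C \<Longrightarrow>
      \<sigma> (X \<otimes>\<^sub>o Y) Z = (\<sigma> X Z \<otimes>\<^sub>m Ide C Y) \<cdot> (Ide C X \<otimes>\<^sub>m \<sigma> Y Z)"
    and hexagon_right: "X \<in> Obj C \<Longrightarrow> Y \<in> Obj C \<Longrightarrow> Z \<in> Obj C \<Longrightarrow>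
      \<sigma> X (Y \<otimes>\<^sub>o Z) = (Ide C Y \<otimes>\<^sub>m \<sigma> X Z) \<cdot> (\<sigma> X Y \<otimes>\<^sub>m Ide C Z)"


section \<open>The coend \<open>F\<close> and its pairing\<close>

context
  fixes C :: "('k, 'o, 'm, 'z) rigid_cat_scheme" (structure)
begin

text \<open>For \<open>f : X \<rightarrow> Y\<close>, the left dual arrow \<open>f\<^sup>\<star> : Y\<^sup>\<star> \<rightarrow> X\<^sup>\<star>\<close>.\<close>

definition dual_arrow :: "'m \<Rightarrow> 'm"
  where "dual_arrow f = (let X = Dom C f; Y = Cod C f in
    (Ev C Y \<otimes>\<^sub>m Ide C (X\<^sup>\<star>)) \<cdot> (Ide C (Y\<^sup>\<star>) \<otimes>\<^sub>m f \<otimes>\<^sub>m Ide C (X\<^sup>\<star>)) \<cdot> (Ide C (Y\<^sup>\<star>) \<otimes>\<^sub>m Coev C X))"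

text \<open>\<open>j\<close> is a dinatural transformation from \<open>(X, Y) \<mapsto> X\<^sup>\<star> \<otimes> Y\<close> to the constant object \<open>Z\<close>.\<close>

definition is_dinatural :: "'o \<Rightarrow> ('o \<Rightarrow> 'm) \<Rightarrow> bool"
  where "is_dinatural Z j \<longleftrightarrow> Z \<in> Obj C \<and>
    (\<forall>X \<in> Obj C. j X \<in> Hom C (X\<^sup>\<star> \<otimes>\<^sub>o X) Z) \<and>
    (\<forall>X Y. \<forall>f \<in> Hom C X Y.
      j Y \<cdot> (Ide C (Y\<^sup>\<star>) \<otimes>\<^sub>m f) = j X \<cdot> (dual_arrow f \<otimes>\<^sub>m Ide C X))"

definition is_coend :: "'o \<Rightarrow> ('o \<Rightarrow> 'm) \<Rightarrow> bool"
  where "is_coend F i \<longleftrightarrow> is_dinatural F i \<and>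
    (\<forall>Z j. is_dinatural Z j \<longrightarrow>
      (\<exists>!h. h \<in> Hom C F Z \<and> (\<forall>X \<in> Obj C. h \<cdot> i X = j X)))"

end

context
  fixes C :: "('k, 'o, 'm, 'z) braided_cat_scheme" (structure)
begin

definition omega :: "'o \<Rightarrow> ('o \<Rightarrow> 'm) \<Rightarrow> 'm"
  where "omega F i = (THE w. w \<in> Hom C (F \<otimes>\<^sub>o F) \<I> \<and>
    (\<forall>X \<in> Obj C. \<forall>Y \<in> Obj C.
      w \<cdot> (i X \<otimes>\<^sub>m i Y) =
        (Ev C X \<otimes>\<^sub>m Ev C Y) \<cdot> (Ide C (X\<^sup>\<star>) \<otimes>\<^sub>m (\<sigma> (Y\<^sup>\<star>) X \<cdot> \<sigma> X (Y\<^sup>\<star>)) \<otimes>\<^sub>m Ide C Y)))"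

text \<open>By strictness, \<open>f \<otimes> id\<^sub>F\<close> with \<open>f : \<I> \<rightarrow> F\<close> is an arrow \<open>F = \<I> \<otimes> F \<rightarrow> F \<otimes> F\<close>.\<close>

definition Omega :: "'o \<Rightarrow> ('o \<Rightarrow> 'm) \<Rightarrow> 'm \<Rightarrow> 'm"
  where "Omega F i f = omega F i \<cdot> (f \<otimes>\<^sub>m Ide C F)"


section \<open>The Mueger center\<close>

definition mueger_center :: "('k, 'o, 'm, 'z) braided_cat_scheme"
  where "mueger_center = full_subcategory C
    {X \<in> Obj C. \<forall>Y \<in> Obj C. \<sigma> Y X \<cdot> \<sigma> X Y = Ide C (X \<otimes>\<^sub>o Y)}"

definition mueger_center_trivial :: bool
  where "mueger_center_trivial \<longleftrightarrow>
    (\<forall>X \<in> Obj mueger_center. \<exists>n D. is_direct_sum_copies C n \<I> D \<and> isomorphic C X D)"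

end

end

theory Submission
  imports Defs "Jordan_Normal_Form.Char_Poly"
begin

text \<open>
  Realize \<open>\<C>\<close> fully faithfully by matrices as modules over a finite-dimensional algebra \<open>A\<close>. Let \<open>X\<close>
  be transparent and let \<open>u : \<I> \<rightarrow> F\<close> be \<open>i(\<I>)\<close> composed with the coevaluation of \<open>\<I>\<close>. Since the double
  braiding with \<open>X\<close> is trivial, \<open>i(X)\<close> and \<open>u \<cdot> ev\<^sub>X\<close> have the same pairing with \<open>F\<close>, and injectivity of
  \<open>\<Omega>\<close> shows that they agree on all arrows \<open>\<I> \<rightarrow> X\<^sup>\<star> \<otimes> X\<close>.

  If \<open>X\<close> is irreducible, apply this to the coevaluation (made an arrow to \<open>X\<^sup>\<star> \<otimes> X\<close> by the braiding) and
  map \<open>F\<close> further by the dinatural transformation of matrix coefficients: the character of \<open>X\<close> is a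
  multiple of that of \<open>\<I>\<close>, so by Burnside's theorem \<open>Ann(\<I>)\<close> annihilates \<open>X\<close> and \<open>X\<close> contains \<open>\<I>\<close>.
  An induction on the dimension of \<open>X\<close> along \<open>\<I> \<rightarrow> X \<rightarrow> W\<close> then gives \<open>i(X) = u \<cdot> ev\<^sub>X\<close> for all transparent
  \<open>X\<close>. Comparing matrix coefficients once more, \<open>Ann(\<I>)\<close> annihilates \<open>X\<close>; as \<open>A / Ann(\<I>)\<close> is a matrix
  algebra by Burnside's theorem, \<open>X\<close> is a direct sum of copies of \<open>\<I>\<close>.
\<close>


section \<open>Burnside's theorem\<close>

text \<open>Injectivity of \<Omega> speaks only about arrows \<open>\<I> \<rightarrow> F\<close>,
  whereas \<open>i X\<close> and \<open>u \<cdot> Ev C X\<close> live on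
  \<open>X\<^sup>\<star> \<otimes>\<^sub>o X\<close>, and arrows from \<open>\<I>\<close> need not
  separate the arrows out of that object. This gap shapes the proof. For irreducible
  \<open>X\<close> a single arrow, the braided coevaluation, carries enough information: it records
  the whole character, and over an algebraically closed field every matrix entry of an irreducible
  module is a value of its character. No dimension has to be invertible, so the characteristic is
  arbitrary. Along \<open>\<I> \<rightarrow> X \<rightarrow> W\<close> the difference of the two
  arrows is confined to one arrow \<open>W \<rightarrow> F\<close>; there arrows from
  \<open>\<I>\<close> do separate, because by induction the algebra acts on \<open>W\<close> as on a
  sum of copies of \<open>\<I>\<close>, and injectivity applies again. The description by modules is
  blind to the tensor product. The objects \<open>P\<close> and \<open>J\<close> bridge this: they
  turn matrix coefficients into a dinatural family with values in an object of the category, to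
  which the universal property of the coend applies.\<close>

lemma mult_mat_unit_vec:
  fixes A :: "'k :: semiring_1 mat"
  assumes "A \<in> carrier_mat m n" "j < n"
  shows "A *\<^sub>v unit_vec n j = col A j"
  using assms by (intro eq_vecI) auto

section \<open>Linear algebra: eigenvalues, dimension, bases of subspaces\<close>

lemma eigenvalue_exists:
  fixes T :: "'k :: alg_closed_field mat"
  assumes T: "T \<in> carrier_mat m m" and m: "m > 0"
  shows "\<exists>c. eigenvalue T c"
proof -
  have "degree (char_poly T) > 0" using degree_monic_char_poly[OF T] m by simp
  from alg_closed_imp_poly_has_root[OF this] obtain c where "poly (char_poly T) c = 0" by blast
  with eigenvalue_root_char_poly[OF T] show ?thesis by auto
qed

text \<open>Otherwise zero padding makes both matrices square without changing the product. The
  one-sided inverse is then two-sided, although the padded \<open>Y'\<close> has a zero row, the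
  first of them with index \<open>m\<close>.\<close>

lemma left_inverse_dim_le:
  fixes Y L :: "'k :: field mat"
  assumes Y: "Y \<in> carrier_mat m r" and L: "L \<in> carrier_mat r m" and LY: "L * Y = 1\<^sub>m r"
  shows "r \<le> m"
proof (rule ccontr)
  assume "\<not> r \<le> m"
  hence mr: "m < r" by simp
  define Y' where "Y' = mat r r (\<lambda>(i,j). if i < m then Y $$ (i,j) else 0)"
  define L' where "L' = mat r r (\<lambda>(i,j). if j < m then L $$ (i,j) else 0)"
  have c: "Y' \<in> carrier_mat r r" "L' \<in> carrier_mat r r" by (auto simp: Y'_def L'_def)
  have "L' * Y' = L * Y"
  proof (rule eq_matI)
    fix i j assume "i < dim_row (L * Y)" "j < dim_col (L * Y)"
    hence ij: "i < r" "j < r" using L Y by auto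
    have "(L' * Y') $$ (i,j) = (\<Sum>l<r. if l < m then L $$ (i,l) * Y $$ (l,j) else 0)"
      using ij by (auto simp: L'_def Y'_def scalar_prod_def lessThan_atLeast0 intro!: sum.cong)
    also have "\<dots> = (\<Sum>l<m. L $$ (i,l) * Y $$ (l,j))"
      using mr by (intro sum.mono_neutral_cong_right) auto
    also have "\<dots> = (L * Y) $$ (i,j)"
      using ij L Y by (auto simp: scalar_prod_def lessThan_atLeast0 intro!: sum.cong)
    finally show "(L' * Y') $$ (i,j) = (L * Y) $$ (i,j)" .
  qed (use L Y c in auto)
  with LY have "L' * Y' = 1\<^sub>m r" by simp
  hence "Y' * L' = 1\<^sub>m r" using mat_mult_left_right_inverse[OF c(2,1)] by simp
  hence "(Y' * L') $$ (m,m) = 1" using mr by simp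
  moreover have "(Y' * L') $$ (m,m) = 0" using mr by (simp add: Y'_def L'_def scalar_prod_def)
  ultimately show False by simp
qed

text \<open>Greedy choice: as long as the range of \<open>Y\<close> misses some \<open>w \<in> W\<close>, the matrix
  \<open>Y\<close> is extended by the column \<open>w - Y L w\<close>.\<close>

lemma subspace_matrix:
  fixes W :: "'k :: field vec set"
  assumes W: "W \<subseteq> carrier_vec m" and W0: "0\<^sub>v m \<in> W"
    and Wadd: "\<And>v w. v \<in> W \<Longrightarrow> w \<in> W \<Longrightarrow> v + w \<in> W"
    and Wsm: "\<And>c v. v \<in> W \<Longrightarrow> c \<cdot>\<^sub>v v \<in> W"
  obtains r Y L where "Y \<in> carrier_mat m r" "L \<in> carrier_mat r m" "L * Y = 1\<^sub>m r"
    "\<And>w. w \<in> carrier_vec m \<Longrightarrow> w \<in> W \<longleftrightarrow> Y *\<^sub>v (L *\<^sub>v w) = w"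
proof -
  define Q where "Q r \<longleftrightarrow> (\<exists>Y L. Y \<in> carrier_mat m r \<and> L \<in> carrier_mat r m \<and> L * Y = 1\<^sub>m r \<and>
    (\<forall>v \<in> carrier_vec r. Y *\<^sub>v v \<in> W))" for r
  \<comment> \<open>A one-sided inverse bounds the number of columns by \<open>m\<close>, so a
    largest choice exists.\<close>
  have bd: "\<forall>r. Q r \<longrightarrow> r \<le> m" unfolding Q_def using left_inverse_dim_le by blast
  have empty: "0\<^sub>m m 0 *\<^sub>v v = 0\<^sub>v m" if "v \<in> carrier_vec 0" for v :: "'k vec"
    using that by (intro eq_vecI) (auto simp: scalar_prod_def)
  have "Q 0" unfolding Q_def
    by (rule exI[of _ "0\<^sub>m m 0"], rule exI[of _ "0\<^sub>m 0 m"])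
      (use W0 in \<open>auto simp: empty\<close>)
  from GreatestI_nat[of Q, OF this] bd have G: "Q (Greatest Q)" by blast
  define r where "r = Greatest Q"
  from G obtain Y L where Y: "Y \<in> carrier_mat m r" and L: "L \<in> carrier_mat r m" and LY: "L * Y = 1\<^sub>m r"
    and YW: "\<And>v. v \<in> carrier_vec r \<Longrightarrow> Y *\<^sub>v v \<in> W" unfolding Q_def r_def by blast
  have nQ: "\<not> Q (Suc r)"
  proof
    assume "Q (Suc r)"
    hence "Suc r \<le> Greatest Q" using Greatest_le_nat[of Q "Suc r" m] bd by blast
    thus False by (simp add: r_def)
  qed
  have "Y *\<^sub>v (L *\<^sub>v w) = w" if w: "w \<in> W" for w
  proof (rule ccontr)
    assume ne: "Y *\<^sub>v (L *\<^sub>v w) \<noteq> w"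
    have wc: "w \<in> carrier_vec m" using w W by auto
    define w' where "w' = w - Y *\<^sub>v (L *\<^sub>v w)"
    have Lw: "L *\<^sub>v w \<in> carrier_vec r" using L wc by simp
    have w'c: "w' \<in> carrier_vec m" using wc Y L by (simp add: w'_def)
    have "w' = w + (- 1) \<cdot>\<^sub>v (Y *\<^sub>v (L *\<^sub>v w))" using wc Y by (auto simp: w'_def)
    hence w'W: "w' \<in> W" using Wadd[OF w Wsm[OF YW[OF Lw]]] by simp
    have Lw': "L *\<^sub>v w' = 0\<^sub>v r"
    proof -
      have "L *\<^sub>v w' = L *\<^sub>v w - L *\<^sub>v (Y *\<^sub>v (L *\<^sub>v w))"
        unfolding w'_def using L Y wc by (intro mult_minus_distrib_mat_vec) auto
      also have "L *\<^sub>v (Y *\<^sub>v (L *\<^sub>v w)) = (L * Y) *\<^sub>v (L *\<^sub>v w)"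
        using L Y Lw by (intro assoc_mult_mat_vec[symmetric]) auto
      finally show ?thesis using LY Lw by simp
    qed
    have "w' \<noteq> 0\<^sub>v m"
    proof
      assume z: "w' = 0\<^sub>v m"
      have "w = w' + Y *\<^sub>v (L *\<^sub>v w)" using wc Y by (auto simp: w'_def)
      moreover have "Y *\<^sub>v (L *\<^sub>v w) \<in> carrier_vec m" using Y L wc by simp
      ultimately show False using z ne by simp
    qed
    then obtain s where s: "s < m" "w' $ s \<noteq> 0" using w'c by (metis carrier_vecD eq_vecI index_zero_vec)
    \<comment> \<open>\<open>u\<close> annihilates the range of \<open>Y\<close> and takes the value \<open>1\<close> at \<open>w'\<close>\<close>
    define u where "u = (1 / w' $ s) \<cdot>\<^sub>v (unit_vec m s - (Y * L)\<^sup>T *\<^sub>v unit_vec m s)"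
    have YLc: "Y * L \<in> carrier_mat m m" using Y L by simp
    have uc: "u \<in> carrier_vec m" using YLc unfolding u_def by simp
    have uv: "u \<bullet> v = (1 / w' $ s) * (v $ s - (Y *\<^sub>v (L *\<^sub>v v)) $ s)" if v: "v \<in> carrier_vec m" for v
    proof -
      have "((Y * L)\<^sup>T *\<^sub>v unit_vec m s) \<bullet> v = unit_vec m s \<bullet> ((Y * L) *\<^sub>v v)"
        using transpose_vec_mult_scalar[OF YLc v, of "unit_vec m s"] by simp
      also have "\<dots> = (Y *\<^sub>v (L *\<^sub>v v)) $ s"
        using Y L v s assoc_mult_mat_vec[OF Y L v] by simp
      finally have e: "((Y * L)\<^sup>T *\<^sub>v unit_vec m s) \<bullet> v = (Y *\<^sub>v (L *\<^sub>v v)) $ s" .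
      have c: "(Y * L)\<^sup>T *\<^sub>v unit_vec m s \<in> carrier_vec m" using YLc by simp
      show ?thesis unfolding u_def
        using v s e YLc minus_scalar_prod_distrib[OF unit_vec_carrier c v]
          smult_scalar_prod_distrib[OF minus_carrier_vec[OF unit_vec_carrier c] v]
        by simp
    qed
    have uw': "u \<bullet> w' = 1" using uv[OF w'c] Lw' Y s by simp
    have uY: "u \<bullet> col Y j = 0" if j: "j < r" for j
    proof -
      have "Y *\<^sub>v (L *\<^sub>v col Y j) = Y *\<^sub>v col (L * Y) j"
        by (simp only: col_mult2[OF L Y j])
      also have "\<dots> = col Y j" using LY Y j by (simp add: mult_mat_unit_vec)
      finally show ?thesis using uv[of "col Y j"] Y j by simp
    qed
    \<comment> \<open>\<open>L\<close> kills \<open>w'\<close> and \<open>u\<close> kills the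
      columns of \<open>Y\<close>, so the block product of the enlarged matrices is again the
      identity.\<close>
    define Y2 where "Y2 = mat m (Suc r) (\<lambda>(i,j). if j < r then Y $$ (i,j) else w' $ i)"
    define L2 where "L2 = mat (Suc r) m (\<lambda>(i,j). if i < r then L $$ (i,j) else u $ j)"
    have c2: "Y2 \<in> carrier_mat m (Suc r)" "L2 \<in> carrier_mat (Suc r) m" by (auto simp: Y2_def L2_def)
    have rowL2: "row L2 i = (if i < r then row L i else u)" if "i < Suc r" for i
      using that L uc by (auto simp: L2_def)
    have colY2: "col Y2 j = (if j < r then col Y j else w')" if "j < Suc r" for j
      using that Y w'c by (auto simp: Y2_def)
    have "L2 * Y2 = 1\<^sub>m (Suc r)"
    proof (rule eq_matI)
      fix i j assume "i < dim_row (1\<^sub>m (Suc r) :: 'k mat)" "j < dim_col (1\<^sub>m (Suc r) :: 'k mat)"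
      hence ij: "i < Suc r" "j < Suc r" by auto
      have LYij: "row L i \<bullet> col Y j = (if i = j then 1 else 0)" if "i < r" "j < r"
        using arg_cong[OF LY, of "\<lambda>A. A $$ (i,j)"] that L Y by simp
      have Lwi: "row L i \<bullet> w' = 0" if "i < r"
        using arg_cong[OF Lw', of "\<lambda>A. A $ i"] that L w'c by simp
      show "(L2 * Y2) $$ (i,j) = 1\<^sub>m (Suc r) $$ (i,j)"
        using ij c2 rowL2[OF ij(1)] colY2[OF ij(2)] LYij Lwi uY uw' by auto
    qed (use c2 in auto)
    moreover have "Y2 *\<^sub>v v \<in> W" if v: "v \<in> carrier_vec (Suc r)" for v
    proof -
      define v' where "v' = vec r (\<lambda>j. v $ j)"
      have "Y2 *\<^sub>v v = Y *\<^sub>v v' + (v $ r) \<cdot>\<^sub>v w'"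
        using v Y w'c
        by (intro eq_vecI) (auto simp: Y2_def v'_def scalar_prod_def intro!: sum.cong)
      thus ?thesis using Wadd[OF YW[of v'] Wsm[OF w'W]] by (simp add: v'_def)
    qed
    ultimately have "Q (Suc r)" unfolding Q_def using c2 by blast
    with nQ show False by simp
  qed
  moreover have "w \<in> W" if "w \<in> carrier_vec m" "Y *\<^sub>v (L *\<^sub>v w) = w" for w
    using YW[of "L *\<^sub>v w"] that L by simp
  ultimately show thesis using that[OF Y L LY] by blast
qed

text \<open>Irreducibility as cyclicity of every nonzero vector. When the image of \<open>S\<close>
  is a unital algebra, this excludes proper nonzero invariant subspaces without mentioning
  subspaces.\<close>

definition irreducible_rep :: "'a set \<Rightarrow> nat \<Rightarrow> ('a \<Rightarrow> 'k :: field mat) \<Rightarrow> bool"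
  where "irreducible_rep S m \<rho> \<longleftrightarrow> m > 0 \<and>
    (\<forall>v \<in> carrier_vec m. \<forall>w \<in> carrier_vec m. v \<noteq> 0\<^sub>v m \<longrightarrow> (\<exists>a \<in> S. \<rho> a *\<^sub>v v = w))"

text \<open>\<open>T\<close> has an eigenvector because the field is algebraically closed. That
  vector is cyclic and \<open>T\<close> commutes with the action, so its eigenvalue is the factor of
  \<open>T\<close> on every vector.\<close>

lemma schur:
  fixes \<rho> :: "'a \<Rightarrow> 'k :: alg_closed_field mat"
  assumes irr: "irreducible_rep S m \<rho>" and \<rho>: "\<And>a. a \<in> S \<Longrightarrow> \<rho> a \<in> carrier_mat m m"
    and T: "T \<in> carrier_mat m m" and comm: "\<And>a. a \<in> S \<Longrightarrow> T * \<rho> a = \<rho> a * T"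
  obtains c where "T = c \<cdot>\<^sub>m 1\<^sub>m m"
proof -
  from eigenvalue_exists[OF T] irr obtain c v where v: "v \<in> carrier_vec m" "v \<noteq> 0\<^sub>v m" "T *\<^sub>v v = c \<cdot>\<^sub>v v"
    using T unfolding irreducible_rep_def eigenvalue_def eigenvector_def by auto
  have "T *\<^sub>v w = c \<cdot>\<^sub>v w" if w: "w \<in> carrier_vec m" for w
  proof -
    from irr v w obtain a where a: "a \<in> S" "\<rho> a *\<^sub>v v = w" unfolding irreducible_rep_def by blast
    have "T *\<^sub>v w = (T * \<rho> a) *\<^sub>v v" using assoc_mult_mat_vec[OF T \<rho>[OF a(1)] v(1)] a by simp
    also have "\<dots> = \<rho> a *\<^sub>v (T *\<^sub>v v)" using assoc_mult_mat_vec[OF \<rho>[OF a(1)] T v(1)] comm[OF a(1)] by simp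
    also have "\<dots> = c \<cdot>\<^sub>v w" using v a mult_mat_vec[OF \<rho>[OF a(1)] v(1)] by simp
    finally show ?thesis .
  qed
  note * = this
  have "T $$ (i,j) = (c \<cdot>\<^sub>m 1\<^sub>m m) $$ (i,j)" if ij: "i < m" "j < m" for i j
  proof -
    have "T $$ (i,j) = (T *\<^sub>v unit_vec m j) $ i" using T ij by (simp add: mult_mat_unit_vec)
    also have "\<dots> = c * (if i = j then 1 else 0)" using *[of "unit_vec m j"] ij by simp
    finally show ?thesis using ij by simp
  qed
  thus thesis using T by (intro that[of c] eq_matI) auto
qed

text \<open>Only the image of \<rho> matters: it is a unital algebra of matrices. Stating closure by
  existence avoids any operations on \<open>S\<close>.\<close>

locale matrix_algebra_rep =
  fixes S :: "'a set" and m :: nat and \<rho> :: "'a \<Rightarrow> 'k :: field mat"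
  assumes rep_carrier: "a \<in> S \<Longrightarrow> \<rho> a \<in> carrier_mat m m"
    and rep_one: "\<exists>a \<in> S. \<rho> a = 1\<^sub>m m"
    and rep_add: "a \<in> S \<Longrightarrow> b \<in> S \<Longrightarrow> \<exists>c \<in> S. \<rho> c = \<rho> a + \<rho> b"
    and rep_mult: "a \<in> S \<Longrightarrow> b \<in> S \<Longrightarrow> \<exists>c \<in> S. \<rho> c = \<rho> a * \<rho> b"
    and rep_smult: "a \<in> S \<Longrightarrow> \<exists>c \<in> S. \<rho> c = x \<cdot>\<^sub>m \<rho> a"
begin

lemma rep_col_mult: "a \<in> S \<Longrightarrow> b \<in> S \<Longrightarrow> j < m \<Longrightarrow> col (\<rho> a * \<rho> b) j = \<rho> a *\<^sub>v col (\<rho> b) j"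
  using rep_carrier by (metis carrier_matD(2) col_mult2)

lemma rep_diff:
  assumes "a \<in> S" "b \<in> S"
  shows "\<exists>c \<in> S. \<rho> c = \<rho> a - \<rho> b"
proof -
  obtain b' where b': "b' \<in> S" "\<rho> b' = (-1) \<cdot>\<^sub>m \<rho> b" using rep_smult assms by blast
  obtain c where "c \<in> S" "\<rho> c = \<rho> a + \<rho> b'" using rep_add assms b' by blast
  moreover have "\<rho> a + \<rho> b' = \<rho> a - \<rho> b" using b' rep_carrier assms by (intro eq_matI) auto
  ultimately show ?thesis by metis
qed

lemma rep_sum:
  assumes "\<And>j. j < (n::nat) \<Longrightarrow> a j \<in> S"
  shows "\<exists>c \<in> S. \<forall>i<m. \<forall>l<m. \<rho> c $$ (i,l) = (\<Sum>j<n. \<rho> (a j) $$ (i,l))"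
  using assms
proof (induction n)
  case 0
  obtain u where u: "u \<in> S" "\<rho> u = 1\<^sub>m m" using rep_one by blast
  obtain c where "c \<in> S" "\<rho> c = 0 \<cdot>\<^sub>m \<rho> u" using rep_smult[OF u(1)] by blast
  with u show ?case by (intro bexI[of _ c]) auto
next
  case (Suc n)
  then obtain c where c: "c \<in> S" "\<forall>i<m. \<forall>l<m. \<rho> c $$ (i,l) = (\<Sum>j<n. \<rho> (a j) $$ (i,l))" by auto
  obtain d where "d \<in> S" "\<rho> d = \<rho> c + \<rho> (a n)" using rep_add c Suc.prems by blast
  with c show ?case using rep_carrier[OF c(1)] rep_carrier[OF Suc.prems[of n]]
    by (intro bexI[of _ d]) auto
qed

end

text \<open>The values of \<open>\<rho> a\<close> on the first \<open>n\<close> basis vectors can be prescribed, by induction on \<open>n\<close>.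
  Otherwise \<open>\<rho> a e\<^sub>n\<close> would be a function of the \<open>\<rho> a e\<^sub>j\<close> with \<open>j < n\<close>, linear over the algebra; by
  Schur's lemma \<open>e\<^sub>n\<close> would then be a linear combination of these \<open>e\<^sub>j\<close>.\<close>

lemma (in matrix_algebra_rep) prescribe_columns:
  assumes irr: "irreducible_rep S m \<rho>"
    and schur: "\<And>T. T \<in> carrier_mat m m \<Longrightarrow> (\<And>a. a \<in> S \<Longrightarrow> T * \<rho> a = \<rho> a * T) \<Longrightarrow> \<exists>c. T = c \<cdot>\<^sub>m 1\<^sub>m m"
    and B: "\<And>j. j < n \<Longrightarrow> B j \<in> carrier_vec m" and n: "n \<le> m"
  shows "\<exists>a \<in> S. \<forall>j<n. col (\<rho> a) j = B j"
  using B n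
proof (induction n arbitrary: B)
  case 0
  show ?case using rep_one by auto
next
  case (Suc n)
  note IH = Suc.IH
  have n: "n < m" using Suc.prems by simp
  have col[simp]: "col (\<rho> a) j \<in> carrier_vec m" if "a \<in> S" for a j
    using rep_carrier[OF that] by (metis carrier_matD(1) carrier_vec_dim_vec dim_col)
  show ?case
  proof (cases "\<exists>a \<in> S. (\<forall>j<n. col (\<rho> a) j = 0\<^sub>v m) \<and> col (\<rho> a) n \<noteq> 0\<^sub>v m")
    case True
    then obtain a where a: "a \<in> S" "\<And>j. j < n \<Longrightarrow> col (\<rho> a) j = 0\<^sub>v m" "col (\<rho> a) n \<noteq> 0\<^sub>v m" by blast
    \<comment> \<open>\<open>b\<close> is right on the first \<open>n\<close> vectors. As
      \<open>a\<close> vanishes on these but not on the next one, a multiple of \<open>a\<close>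
      corrects the last column of \<open>b\<close> and nothing else.\<close>
    from IH[of B] Suc.prems obtain b where b: "b \<in> S" "\<And>j. j < n \<Longrightarrow> col (\<rho> b) j = B j" by auto
    have "B n - col (\<rho> b) n \<in> carrier_vec m" using Suc.prems b by simp
    with irr a obtain d where d: "d \<in> S" "\<rho> d *\<^sub>v col (\<rho> a) n = B n - col (\<rho> b) n"
      unfolding irreducible_rep_def using col[OF a(1)] by blast
    obtain e where e: "e \<in> S" "\<rho> e = \<rho> d * \<rho> a" using rep_mult d a by blast
    obtain f where f: "f \<in> S" "\<rho> f = \<rho> e + \<rho> b" using rep_add e b by blast
    have "col (\<rho> f) j = B j" if j: "j < Suc n" for j
    proof -
      have "col (\<rho> f) j = \<rho> d *\<^sub>v col (\<rho> a) j + col (\<rho> b) j"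
        using f e rep_col_mult[OF d(1) a(1), of j] n j rep_carrier[OF e(1)] rep_carrier[OF b(1)]
          rep_carrier[OF f(1)]
        by (intro eq_vecI) (auto simp: index_mult_mat)
      also have "\<dots> = B j"
      proof (cases "j = n")
        case True
        have "B n - col (\<rho> b) n + col (\<rho> b) n = B n"
          using Suc.prems(1)[of n] rep_carrier[OF b(1)] n by (intro eq_vecI) auto
        with True d show ?thesis by simp
      next
        case False
        hence "j < n" using j by simp
        moreover have "\<rho> d *\<^sub>v 0\<^sub>v m = 0\<^sub>v m" using rep_carrier[OF d(1)] by (intro eq_vecI) auto
        moreover have "0\<^sub>v m + B j = B j" using Suc.prems(1)[OF j] by simp
        ultimately show ?thesis using a b by simp
      qed
      finally show ?thesis .
    qed
    with f show ?thesis by blast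
  next
    case False
    hence F: "col (\<rho> a) n = 0\<^sub>v m" if "a \<in> S" "\<And>j. j < n \<Longrightarrow> col (\<rho> a) j = 0\<^sub>v m" for a using that by blast
    \<comment> \<open>The induction hypothesis supplies elementary prescriptions on the first
      \<open>n\<close> vectors, from which every other one is assembled linearly.\<close>
    have "\<exists>a \<in> S. \<forall>j'<n. col (\<rho> a) j' = (if j' = j then unit_vec m l else 0\<^sub>v m)" for j l
      by (rule IH) (use n in auto)
    then obtain h where h: "\<And>j l. h j l \<in> S"
      "\<And>j l j'. j' < n \<Longrightarrow> col (\<rho> (h j l)) j' = (if j' = j then unit_vec m l else 0\<^sub>v m)"
      by metis
    \<comment> \<open>\<open>T j\<close> is the matrix of \<open>\<rho> a e\<^sub>j \<mapsto> \<rho> a e\<^sub>n\<close>, for \<open>a\<close> annihilating all \<open>e\<^sub>l\<close> with \<open>j \<noteq> l < n\<close>\<close>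
    define T where "T j = mat m m (\<lambda>(i,l). \<rho> (h j l) $$ (i,n))" for j
    have T: "T j \<in> carrier_mat m m" for j by (simp add: T_def)
    \<comment> \<open>Subtract from \<open>a\<close> the combination of the \<open>h j l\<close>
      with the entries of \<open>\<rho> a\<close> as coefficients. The difference kills the first
      \<open>n\<close> basis vectors, hence by \<open>F\<close> also the next one.\<close>
    have key: "col (\<rho> a) n $ i = (\<Sum>j<n. (\<Sum>l<m. T j $$ (i,l) * \<rho> a $$ (l,j)))"
      if a: "a \<in> S" and i: "i < m" for a i
    proof -
      have "\<forall>j l. \<exists>c \<in> S. \<rho> c = \<rho> a $$ (l,j) \<cdot>\<^sub>m \<rho> (h j l)" using rep_smult h by blast
      then obtain g where g: "\<And>j l. g j l \<in> S" "\<And>j l. \<rho> (g j l) = \<rho> a $$ (l,j) \<cdot>\<^sub>m \<rho> (h j l)" by metis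
      have "\<forall>j. \<exists>c \<in> S. \<forall>i<m. \<forall>l<m. \<rho> c $$ (i,l) = (\<Sum>l'<m. \<rho> (g j l') $$ (i,l))"
        using rep_sum g by blast
      then obtain g' where g': "\<And>j. g' j \<in> S"
        "\<And>j i l. i < m \<Longrightarrow> l < m \<Longrightarrow> \<rho> (g' j) $$ (i,l) = (\<Sum>l'<m. \<rho> (g j l') $$ (i,l))" by metis
      from rep_sum[of n g', OF g'(1)] obtain b where b: "b \<in> S"
        "\<And>i l. i < m \<Longrightarrow> l < m \<Longrightarrow> \<rho> b $$ (i,l) = (\<Sum>j<n. \<rho> (g' j) $$ (i,l))" by metis
      have bent: "\<rho> b $$ (i,l) = (\<Sum>j<n. \<Sum>l'<m. \<rho> a $$ (l',j) * \<rho> (h j l') $$ (i,l))" if "i < m" "l < m" for i l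
        using b(2) g'(2) that g(2) carrier_matD[OF rep_carrier[OF h(1)]] by (auto intro!: sum.cong)
      obtain d where d: "d \<in> S" "\<rho> d = \<rho> a - \<rho> b" using rep_diff a b by blast
      have hent: "\<rho> (h j l) $$ (i,j') = (if j' = j \<and> i = l then 1 else 0)" if "i < m" "j' < n" "l < m" for i j j' l
        using arg_cong[OF h(2)[OF that(2), of j l], of "\<lambda>v. v $ i"] that n rep_carrier[OF h(1), of j l]
        by (auto split: if_splits)
      have "col (\<rho> d) j = 0\<^sub>v m" if j: "j < n" for j
      proof (rule eq_vecI)
        fix i assume "i < dim_vec (0\<^sub>v m :: 'k vec)"
        hence i: "i < m" by simp
        have "\<rho> b $$ (i,j) = (\<Sum>j'<n. \<Sum>l'<m. if j' = j \<and> l' = i then \<rho> a $$ (l',j') else 0)"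
          unfolding bent[OF i less_trans[OF j n]] using hent[OF i j] by (auto intro!: sum.cong)
        also have "\<dots> = (\<Sum>j'<n. if j' = j then \<rho> a $$ (i,j') else 0)"
          using i by (intro sum.cong) (auto simp: sum.delta)
        also have "\<dots> = \<rho> a $$ (i,j)" using j by simp
        finally show "col (\<rho> d) j $ i = 0\<^sub>v m $ i"
          using d rep_carrier[OF a] rep_carrier[OF b(1)] i j n by simp
      qed (use rep_carrier[OF d(1)] in auto)
      from F[OF d(1) this] have "\<rho> d $$ (i,n) = 0" using i n rep_carrier[OF d(1)]
        by (metis carrier_matD index_col index_zero_vec(1))
      hence "\<rho> a $$ (i,n) = \<rho> b $$ (i,n)" using d rep_carrier[OF a] rep_carrier[OF b(1)] i n by simp
      also have "\<dots> = (\<Sum>j<n. (\<Sum>l<m. T j $$ (i,l) * \<rho> a $$ (l,j)))"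
        unfolding bent[OF i n] using i by (auto simp: T_def intro!: sum.cong)
      finally show ?thesis using i n rep_carrier[OF a] by simp
    qed
    \<comment> \<open>\<open>T j\<close> commutes with the action: among the first \<open>n\<close>
      columns of \<open>\<rho> a * \<rho> (h j l)\<close> only the \<open>j\<close>-th can be
      nonzero, and it is column \<open>l\<close> of \<open>\<rho> a\<close>. Its last column, read
      off directly and by \<open>key\<close>, gives the two sides.\<close>
    have "\<exists>c. T j = c \<cdot>\<^sub>m 1\<^sub>m m" if j: "j < n" for j
    proof (rule schur[OF T])
      fix a assume a: "a \<in> S"
      show "T j * \<rho> a = \<rho> a * T j"
      proof (rule eq_matI)
        fix i l assume "i < dim_row (\<rho> a * T j)" "l < dim_col (\<rho> a * T j)"
        hence il: "i < m" "l < m" using rep_carrier[OF a] T[of j] by auto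
        obtain b where b: "b \<in> S" "\<rho> b = \<rho> a * \<rho> (h j l)" using rep_mult a h by blast
        have colb: "col (\<rho> b) j' = (if j' = j then col (\<rho> a) l else 0\<^sub>v m)" if j': "j' < n" for j'
          using rep_col_mult[OF a h(1), of j' j l] h(2)[OF j', of j l] b j' n il rep_carrier[OF a]
          by (auto simp: mult_mat_unit_vec)
        have bent: "\<rho> b $$ (l',j') = (if j' = j then \<rho> a $$ (l',l) else 0)" if "l' < m" "j' < n" for l' j'
          using arg_cong[OF colb[OF that(2)], of "\<lambda>v. v $ l'"] that n il rep_carrier[OF a] rep_carrier[OF b(1)]
          by (auto split: if_splits)
        have "(\<rho> a * T j) $$ (i,l) = (\<rho> a *\<^sub>v col (\<rho> (h j l)) n) $ i"
          using il rep_carrier[OF a] rep_carrier[OF h(1), of j l] n T[of j]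
          by (auto simp: T_def scalar_prod_def)
        also have "\<dots> = col (\<rho> b) n $ i" using rep_col_mult[OF a h(1) n] b by simp
        also have "\<dots> = (\<Sum>j'<n. if j' = j then (\<Sum>l'<m. T j' $$ (i,l') * \<rho> a $$ (l',l)) else 0)"
          unfolding key[OF b(1) il(1)] using bent by (intro sum.cong) auto
        also have "\<dots> = (T j * \<rho> a) $$ (i,l)"
          using j il rep_carrier[OF a] T[of j] by (auto simp: scalar_prod_def lessThan_atLeast0)
        finally show "(T j * \<rho> a) $$ (i,l) = (\<rho> a * T j) $$ (i,l)" by simp
      qed (use rep_carrier[OF a] T[of j] in auto)
    qed
    then obtain c where c: "\<And>j. j < n \<Longrightarrow> T j = c j \<cdot>\<^sub>m 1\<^sub>m m" by metis
    obtain u where u: "u \<in> S" "\<rho> u = 1\<^sub>m m" using rep_one by blast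
    have "col (\<rho> u) n $ n = 0"
      unfolding key[OF u(1) n] using c n u
      by (auto intro!: sum.neutral)
    hence False using u n by simp
    thus ?thesis ..
  qed
qed

text \<open>Prescribing all \<open>m\<close> columns prescribes the matrix.\<close>

lemma (in matrix_algebra_rep) burnside_if_schur:
  assumes irr: "irreducible_rep S m \<rho>"
    and schur: "\<And>T. T \<in> carrier_mat m m \<Longrightarrow> (\<And>a. a \<in> S \<Longrightarrow> T * \<rho> a = \<rho> a * T) \<Longrightarrow> \<exists>c. T = c \<cdot>\<^sub>m 1\<^sub>m m"
    and B: "B \<in> carrier_mat m m"
  shows "\<exists>a \<in> S. \<rho> a = B"
proof -
  from prescribe_columns[OF irr schur, of m "col B"] B obtain a where
    a: "a \<in> S" "\<And>j. j < m \<Longrightarrow> col (\<rho> a) j = col B j" by auto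
  hence "\<rho> a = B" using B rep_carrier[OF a(1)] by (intro mat_col_eqI) auto
  with a show ?thesis by blast
qed

lemma burnside:
  fixes \<rho> :: "'a \<Rightarrow> 'k :: alg_closed_field mat"
  assumes "matrix_algebra_rep S m \<rho>" and irr: "irreducible_rep S m \<rho>" and B: "B \<in> carrier_mat m m"
  shows "\<exists>a \<in> S. \<rho> a = B"
proof -
  interpret matrix_algebra_rep S m \<rho> by fact
  show ?thesis
    by (rule burnside_if_schur[OF irr _ B]) (metis schur[OF irr rep_carrier])
qed

section \<open>Working rules for modules given by matrices\<close>

lemma fd_modulesD:
  assumes "(m, r) \<in> fd_modules A" "a \<in> carrier A"
  shows "r a \<in> carrier_mat m m"
    and "b \<in> carrier A \<Longrightarrow> r (a \<otimes>\<^bsub>A\<^esub> b) = r a * r b"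
    and "b \<in> carrier A \<Longrightarrow> r (a \<oplus>\<^bsub>A\<^esub> b) = r a + r b"
    and "r (c \<odot>\<^bsub>A\<^esub> a) = c \<cdot>\<^sub>m r a"
    and "r (\<one>\<^bsub>A\<^esub>) = 1\<^sub>m m"
  using assms by (auto simp: fd_modules_def Ring.ring_hom_def ring_mat_simps)

lemma fd_modulesI:
  assumes "\<And>a. a \<in> carrier A \<Longrightarrow> r a \<in> carrier_mat m m"
    and "\<And>a b. a \<in> carrier A \<Longrightarrow> b \<in> carrier A \<Longrightarrow> r (a \<otimes>\<^bsub>A\<^esub> b) = r a * r b"
    and "\<And>a b. a \<in> carrier A \<Longrightarrow> b \<in> carrier A \<Longrightarrow> r (a \<oplus>\<^bsub>A\<^esub> b) = r a + r b"
    and "\<And>c a. a \<in> carrier A \<Longrightarrow> r (c \<odot>\<^bsub>A\<^esub> a) = c \<cdot>\<^sub>m r a"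
    and "r (\<one>\<^bsub>A\<^esub>) = 1\<^sub>m m"
  shows "(m, r) \<in> fd_modules A"
  using assms by (auto simp: fd_modules_def Ring.ring_hom_def ring_mat_simps)


section \<open>Regular and coregular modules\<close>

context fd_algebra
begin

lemma ring_A: "ring A"
  using fd_algebra_axioms by (rule fd_algebra.axioms)

lemmas A_one = monoid.one_closed[OF ring.is_monoid[OF ring_A]]
  and A_mult = monoid.m_closed[OF ring.is_monoid[OF ring_A]]
  and A_assoc = monoid.m_assoc[OF ring.is_monoid[OF ring_A]]
  and A_l_one = monoid.l_one[OF ring.is_monoid[OF ring_A]]
  and A_r_one = monoid.r_one[OF ring.is_monoid[OF ring_A]]

lemma A_distrib:
  assumes "x \<in> carrier A" "y \<in> carrier A" "z \<in> carrier A"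
  shows "(x \<oplus> y) \<otimes> z = x \<otimes> z \<oplus> y \<otimes> z" "z \<otimes> (x \<oplus> y) = z \<otimes> x \<oplus> z \<otimes> y"
  using assms by (simp_all add: ring.ring_simprules[OF ring_A])

text \<open>A basis \<open>b\<close> with its coordinate functions. The expansion of
  \<open>x\<close> is stated only after applying a linear functional, so that all sums are taken in
  the field and none in \<open>A\<close>.\<close>

definition coordinates :: "nat \<Rightarrow> (nat \<Rightarrow> 'a) \<Rightarrow> ('a \<Rightarrow> nat \<Rightarrow> 'k) \<Rightarrow> bool"
  where "coordinates n b co \<longleftrightarrow> (\<forall>l<n. b l \<in> carrier A) \<and>
    (\<forall>\<phi>. (\<forall>x \<in> carrier A. \<forall>y \<in> carrier A. \<phi> (x \<oplus> y) = \<phi> x + \<phi> y) \<longrightarrow>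
      (\<forall>c. \<forall>x \<in> carrier A. \<phi> (c \<odot> x) = c * \<phi> x) \<longrightarrow>
      (\<forall>x \<in> carrier A. \<phi> x = (\<Sum>l<n. co x l * \<phi> (b l)))) \<and>
    (\<forall>l<n. \<forall>x \<in> carrier A. \<forall>y \<in> carrier A. co (x \<oplus> y) l = co x l + co y l) \<and>
    (\<forall>l<n. \<forall>c. \<forall>x \<in> carrier A. co (c \<odot> x) l = c * co x l) \<and>
    (\<forall>l<n. \<forall>j<n. co (b j) l = (if l = j then 1 else 0))"

lemma linear_lincomb:
  fixes \<phi> :: "'a \<Rightarrow> 'k"
  assumes add: "\<And>x y. x \<in> carrier A \<Longrightarrow> y \<in> carrier A \<Longrightarrow> \<phi> (x \<oplus> y) = \<phi> x + \<phi> y"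
    and sm: "\<And>c x. x \<in> carrier A \<Longrightarrow> \<phi> (c \<odot> x) = c * \<phi> x"
    and B: "finite B" "B \<subseteq> carrier A"
  shows "\<phi> (lincomb f B) = (\<Sum>x\<in>B. f x * \<phi> x)"
  using B
proof (induction B rule: finite_induct)
  case empty
  have "\<phi> \<zero> + \<phi> \<zero> = \<phi> \<zero>" using add[of \<zero> \<zero>] by simp
  hence "\<phi> \<zero> = 0" by (metis add_cancel_right_right)
  thus ?case by (simp add: lincomb_def)
next
  case (insert v B)
  have "lincomb f (B \<union> {v}) = f v \<odot> v \<oplus> lincomb f B"
    using insert by (intro lincomb_insert) auto
  moreover have "lincomb f B \<in> carrier A" using insert by (intro lincomb_closed) auto
  moreover have "f v \<odot> v \<in> carrier A" using insert by (intro smult_closed) auto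
  ultimately show ?case using insert add sm by simp
qed

text \<open>The coordinates are the unique coefficients with respect to a finite basis; uniqueness
  makes them linear and gives their values on the basis itself.\<close>

lemma coordinates_exist:
  obtains n b co where "coordinates n b co"
proof -
  obtain B where B: "finite B" "basis B" using finite_basis_exists[OF finite_dimensional] by blast
  have BA: "B \<subseteq> carrier A" using B by (auto simp: basis_def)
  have ex: "\<exists>!f. f \<in> B \<rightarrow>\<^sub>E UNIV \<and> lincomb f B = v" if "v \<in> carrier A" for v
    using basis_criterion[OF B(1) BA] B(2) that by simp
  define cf where "cf v = (THE f. f \<in> B \<rightarrow>\<^sub>E UNIV \<and> lincomb f B = v)" for v
  have cf: "cf v \<in> B \<rightarrow>\<^sub>E UNIV" "lincomb (cf v) B = v" if "v \<in> carrier A" for v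
    using theI'[OF ex[OF that]] by (auto simp: cf_def)
  have uniq: "f x = cf v x" if f: "lincomb f B = v" and v: "v \<in> carrier A" and x: "x \<in> B" for f v x
  proof -
    have "lincomb (restrict f B) B = lincomb f B" using BA by (intro lincomb_cong) auto
    hence "restrict f B \<in> B \<rightarrow>\<^sub>E UNIV \<and> lincomb (restrict f B) B = v" using f by auto
    hence "restrict f B = cf v" using ex[OF v] cf[OF v] by blast
    thus ?thesis using x by (metis restrict_apply)
  qed
  obtain b where b: "bij_betw b {..<card B} B"
    using ex_bij_betw_nat_finite[OF B(1)] by (auto simp: lessThan_atLeast0)
  define co where "co v l = cf v (b l)" for v l
  have bB: "b l \<in> B" if "l < card B" for l using b that by (auto dest: bij_betwE)
  show thesis
  proof (rule that[of "card B" b co], unfold coordinates_def, intro conjI allI ballI impI)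
    fix l assume "l < card B"
    thus "b l \<in> carrier A" using bB BA by blast
  next
    fix \<phi> :: "'a \<Rightarrow> 'k" and x
    assume add: "\<forall>x \<in> carrier A. \<forall>y \<in> carrier A. \<phi> (x \<oplus> y) = \<phi> x + \<phi> y"
      and sm: "\<forall>c. \<forall>x \<in> carrier A. \<phi> (c \<odot> x) = c * \<phi> x" and x: "x \<in> carrier A"
    have "\<phi> (lincomb (cf x) B) = (\<Sum>y\<in>B. cf x y * \<phi> y)"
      using add sm B(1) BA by (intro linear_lincomb) auto
    also have "\<dots> = (\<Sum>l<card B. co x l * \<phi> (b l))"
      unfolding co_def by (rule sum.reindex_bij_betw[OF b, symmetric])
    finally show "\<phi> x = (\<Sum>l<card B. co x l * \<phi> (b l))" using cf(2)[OF x] by simp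
  next
    fix l x y assume l: "l < card B" and x: "x \<in> carrier A" and y: "y \<in> carrier A"
    have "lincomb (\<lambda>v. cf x v + cf y v) B = x \<oplus> y"
      using lincomb_sum[of B "cf x" "cf y"] B(1) BA cf(2)[OF x] cf(2)[OF y] by simp
    from uniq[OF this _ bB[OF l]] x y show "co (x \<oplus> y) l = co x l + co y l" by (simp add: co_def)
  next
    fix l c x assume l: "l < card B" and x: "x \<in> carrier A"
    have "lincomb (\<lambda>v. c * cf x v) B = c \<odot> x"
      using lincomb_smult[of B "cf x" c] B(1) BA cf(2)[OF x] by simp
    from uniq[OF this _ bB[OF l]] x show "co (c \<odot> x) l = c * co x l" by (simp add: co_def)
  next
    fix l j assume l: "l < card B" and j: "j < card B"
    have bj: "b j \<in> carrier A" using bB[OF j] BA by blast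
    have "lincomb (\<lambda>v. if v = b j then 1 else 0) B = lincomb (\<lambda>v. if v = b j then 1 else 0) (B - {b j} \<union> {b j})"
      using bB[OF j] by (simp add: insert_absorb)
    also have "\<dots> = (1 :: 'k) \<odot> b j \<oplus> lincomb (\<lambda>v. if v = b j then 1 else 0) (B - {b j})"
      using B(1) BA bj by (subst lincomb_insert) auto
    also have "lincomb (\<lambda>v. if v = b j then 1 else 0) (B - {b j}) = lincomb (\<lambda>v. 0) (B - {b j})"
      using BA by (intro lincomb_cong) auto
    also have "\<dots> = 0 \<odot> lincomb (\<lambda>v. 0) (B - {b j})"
      using lincomb_smult[of "B - {b j}" "\<lambda>_. 0" 0] BA B(1) by auto
    also have "\<dots> = \<zero>"
    proof -
      have "lincomb (\<lambda>v. 0) (B - {b j}) \<in> carrier A" using BA by (intro lincomb_closed) auto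
      from lmult_0[OF this] show ?thesis by simp
    qed
    finally have "lincomb (\<lambda>v. if v = b j then 1 else 0) B = b j" using bj smult_one by simp
    from uniq[OF this bj bB[OF l]] have "(if b l = b j then 1 else 0) = cf (b j) (b l)" .
    have "b l = b j \<longleftrightarrow> l = j" using b l j by (auto simp: bij_betw_def inj_on_def)
    with \<open>(if b l = b j then 1 else 0) = cf (b j) (b l)\<close>
    show "co (b j) l = (if l = j then 1 else 0)" unfolding co_def by metis
  qed
qed

end

locale fd_algebra_basis = fd_algebra A
  for A :: "('k :: field, 'a) module" (structure) +
  fixes n :: nat and b :: "nat \<Rightarrow> 'a" and co :: "'a \<Rightarrow> nat \<Rightarrow> 'k"
  assumes coordinates: "coordinates n b co"
begin

lemma b_closed [simp]: "l < n \<Longrightarrow> b l \<in> carrier A"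
  using coordinates by (simp add: coordinates_def)

text \<open>Oriented so as to collapse sums over the basis, the shape in which entries of products
  of \<open>regular\<close> and \<open>coregular\<close> matrices appear.\<close>

lemma expand:
  assumes "\<And>x y. x \<in> carrier A \<Longrightarrow> y \<in> carrier A \<Longrightarrow> \<phi> (x \<oplus> y) = \<phi> x + \<phi> y"
    and "\<And>c x. x \<in> carrier A \<Longrightarrow> \<phi> (c \<odot> x) = c * \<phi> x" and "x \<in> carrier A"
  shows "(\<Sum>l<n. co x l * \<phi> (b l)) = \<phi> x"
proof -
  note c = coordinates[unfolded coordinates_def, THEN conjunct2, THEN conjunct1, THEN spec, of \<phi>]
  have "\<forall>x \<in> carrier A. \<phi> x = (\<Sum>l<n. co x l * \<phi> (b l))"
    by (rule c[THEN mp, THEN mp]) (simp_all add: assms(1,2))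
  from bspec[OF this assms(3)] show ?thesis by (rule sym)
qed

lemma co_add: "l < n \<Longrightarrow> x \<in> carrier A \<Longrightarrow> y \<in> carrier A \<Longrightarrow> co (x \<oplus> y) l = co x l + co y l"
  and co_smult: "l < n \<Longrightarrow> x \<in> carrier A \<Longrightarrow> co (c \<odot> x) l = c * co x l"
  and co_basis: "l < n \<Longrightarrow> j < n \<Longrightarrow> co (b j) l = (if l = j then 1 else 0)"
  using coordinates by (auto simp: coordinates_def)

lemma co_sum_right:
  assumes "i < n" "c \<in> carrier A" "x \<in> carrier A"
  shows "(\<Sum>l<n. co x l * co (c \<otimes> b l) i) = co (c \<otimes> x) i"
  using assms by (intro expand) (simp_all add: co_add co_smult A_distrib smult_mult_right)

lemma co_sum_left:
  assumes "i < n" "c \<in> carrier A" "x \<in> carrier A"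
  shows "(\<Sum>l<n. co x l * co (b l \<otimes> c) i) = co (x \<otimes> c) i"
  using assms by (intro expand) (simp_all add: co_add co_smult A_distrib smult_mult_left)

lemma rep_expand:
  assumes r: "(m, r) \<in> fd_modules A" and x: "x \<in> carrier A" and uv: "u < m" "v < m"
  shows "(\<Sum>l<n. co x l * r (b l) $$ (u,v)) = r x $$ (u,v)"
proof (rule expand)
  fix y z assume "y \<in> carrier A" "z \<in> carrier A"
  thus "r (y \<oplus> z) $$ (u,v) = r y $$ (u,v) + r z $$ (u,v)"
    using fd_modulesD(3)[OF r, of y z] fd_modulesD(1)[OF r, of y] fd_modulesD(1)[OF r, of z] uv by simp
next
  fix c y assume "y \<in> carrier A"
  thus "r (c \<odot> y) $$ (u,v) = c * r y $$ (u,v)"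
    using fd_modulesD(4)[OF r, of y c] fd_modulesD(1)[OF r, of y] uv by simp
qed (fact x)

text \<open>\<open>coregular\<close> is the dual of the right regular module and \<open>coregular_endo c\<close> its endomorphism
  \<open>\<xi> \<mapsto> \<xi>(c _)\<close>. An index \<open>a < m\<close> yields the maps \<open>c \<mapsto> c e\<^sub>a\<close> and \<open>v \<mapsto> (c \<mapsto> (c v)\<^sub>a)\<close>.\<close>

definition regular :: "'a \<Rightarrow> 'k mat" where "regular c = mat n n (\<lambda>(i,j). co (c \<otimes> b j) i)"
definition coregular :: "'a \<Rightarrow> 'k mat" where "coregular c = mat n n (\<lambda>(i,l). co (b i \<otimes> c) l)"
definition coregular_endo :: "'a \<Rightarrow> 'k mat" where "coregular_endo c = mat n n (\<lambda>(i,l). co (c \<otimes> b i) l)"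
definition from_regular :: "nat \<Rightarrow> ('a \<Rightarrow> 'k mat) \<Rightarrow> nat \<Rightarrow> 'k mat"
  where "from_regular m r a = mat m n (\<lambda>(u,j). r (b j) $$ (u,a))"
definition to_coregular :: "nat \<Rightarrow> ('a \<Rightarrow> 'k mat) \<Rightarrow> nat \<Rightarrow> 'k mat"
  where "to_coregular m r a = mat n m (\<lambda>(i,v). r (b i) $$ (a,v))"

lemma regular_module: "(n, regular) \<in> fd_modules A"
proof (rule fd_modulesI)
  fix c d assume cd: "c \<in> carrier A" "d \<in> carrier A"
  show "regular (c \<otimes> d) = regular c * regular d"
  proof (rule eq_matI)
    fix i j assume "i < dim_row (regular c * regular d)" "j < dim_col (regular c * regular d)"
    hence ij: "i < n" "j < n" by (auto simp: regular_def)
    have "(\<Sum>l<n. co (d \<otimes> b j) l * co (c \<otimes> b l) i) = co (c \<otimes> (d \<otimes> b j)) i"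
      using cd ij by (intro co_sum_right) auto
    thus "regular (c \<otimes> d) $$ (i,j) = (regular c * regular d) $$ (i,j)"
      using ij cd by (simp add: regular_def scalar_prod_def lessThan_atLeast0 mult.commute A_assoc)
  qed (auto simp: regular_def)
qed (auto simp: regular_def co_add co_smult A_mult A_l_one A_distrib smult_mult_left co_basis intro!: eq_matI)

text \<open>A functional \<xi> is stored by its values on the basis, and \<open>coregular c\<close>
  turns these into the values at \<open>b i \<otimes> c\<close>. Multiplying the argument on the
  right is a left action on functionals.\<close>

lemma coregular_module: "(n, coregular) \<in> fd_modules A"
proof (rule fd_modulesI)
  fix c d assume cd: "c \<in> carrier A" "d \<in> carrier A"
  show "coregular (c \<otimes> d) = coregular c * coregular d"
  proof (rule eq_matI)
    fix i j assume "i < dim_row (coregular c * coregular d)" "j < dim_col (coregular c * coregular d)"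
    hence ij: "i < n" "j < n" by (auto simp: coregular_def)
    have "(\<Sum>l<n. co (b i \<otimes> c) l * co (b l \<otimes> d) j) = co (b i \<otimes> c \<otimes> d) j"
      using cd ij by (intro co_sum_left) auto
    thus "coregular (c \<otimes> d) $$ (i,j) = (coregular c * coregular d) $$ (i,j)"
      using ij cd by (simp add: coregular_def scalar_prod_def lessThan_atLeast0 A_assoc)
  qed (auto simp: coregular_def)
qed (auto simp: coregular_def co_add co_smult A_mult A_r_one A_distrib smult_mult_right co_basis intro!: eq_matI)

text \<open>Multiplications of the argument on the left and on the right commute. This makes an
  arbitrary \<open>c\<close> visible as an endomorphism of a module, although \<open>c\<close>
  itself need not act \<open>A\<close>-linearly.\<close>

lemma coregular_endo_map:
  assumes c: "c \<in> carrier A"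
  shows "coregular_endo c \<in> fd_module_maps A (n, coregular) (n, coregular)"
proof -
  have "coregular_endo c * coregular d = coregular d * coregular_endo c" if d: "d \<in> carrier A" for d
  proof (rule eq_matI)
    fix i j assume "i < dim_row (coregular d * coregular_endo c)" "j < dim_col (coregular d * coregular_endo c)"
    hence ij: "i < n" "j < n" by (auto simp: coregular_def coregular_endo_def)
    have "(\<Sum>l<n. co (c \<otimes> b i) l * co (b l \<otimes> d) j) = co (c \<otimes> b i \<otimes> d) j"
      "(\<Sum>l<n. co (b i \<otimes> d) l * co (c \<otimes> b l) j) = co (c \<otimes> (b i \<otimes> d)) j"
      using c d ij by (intro co_sum_left co_sum_right; auto)+
    thus "(coregular_endo c * coregular d) $$ (i,j) = (coregular d * coregular_endo c) $$ (i,j)"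
      using ij c d by (simp add: coregular_def coregular_endo_def scalar_prod_def lessThan_atLeast0 A_assoc)
  qed (auto simp: coregular_def coregular_endo_def)
  thus ?thesis by (auto simp: fd_module_maps_def coregular_endo_def)
qed

context
  fixes m r assumes r: "(m, r) \<in> fd_modules A"
begin

lemma rep_mult_entry:
  assumes "x \<in> carrier A" "y \<in> carrier A" "u < m" "v < m"
  shows "r (x \<otimes> y) $$ (u,v) = (\<Sum>w<m. r x $$ (u,w) * r y $$ (w,v))"
  using fd_modulesD(2)[OF r assms(1,2)] fd_modulesD(1)[OF r assms(1)] fd_modulesD(1)[OF r assms(2)] assms(3,4)
  by (simp add: scalar_prod_def lessThan_atLeast0)

lemma from_regular_map:
  assumes a: "a < m"
  shows "from_regular m r a \<in> fd_module_maps A (n, regular) (m, r)"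
proof -
  have "from_regular m r a * regular c = r c * from_regular m r a" if c: "c \<in> carrier A" for c
  proof (rule eq_matI)
    note rc = fd_modulesD(1)[OF r c]
    fix u j assume "u < dim_row (r c * from_regular m r a)" "j < dim_col (r c * from_regular m r a)"
    hence uj: "u < m" "j < n" using rc by (auto simp: from_regular_def)
    have "(\<Sum>l<n. co (c \<otimes> b j) l * r (b l) $$ (u,a)) = r (c \<otimes> b j) $$ (u,a)"
      using c uj a by (intro rep_expand[OF r]) auto
    also have "\<dots> = (\<Sum>w<m. r c $$ (u,w) * r (b j) $$ (w,a))"
      using c uj a by (intro rep_mult_entry) auto
    finally show "(from_regular m r a * regular c) $$ (u,j) = (r c * from_regular m r a) $$ (u,j)"
      using uj rc by (simp add: from_regular_def regular_def scalar_prod_def lessThan_atLeast0 mult.commute)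
  qed (use fd_modulesD(1)[OF r c] in \<open>auto simp: from_regular_def regular_def\<close>)
  thus ?thesis by (auto simp: fd_module_maps_def from_regular_def)
qed

lemma to_coregular_map:
  assumes a: "a < m"
  shows "to_coregular m r a \<in> fd_module_maps A (m, r) (n, coregular)"
proof -
  have "to_coregular m r a * r c = coregular c * to_coregular m r a" if c: "c \<in> carrier A" for c
  proof (rule eq_matI)
    note rc = fd_modulesD(1)[OF r c]
    fix i v assume "i < dim_row (coregular c * to_coregular m r a)" "v < dim_col (coregular c * to_coregular m r a)"
    hence iv: "i < n" "v < m" using rc by (auto simp: to_coregular_def coregular_def)
    have "(\<Sum>l<n. co (b i \<otimes> c) l * r (b l) $$ (a,v)) = r (b i \<otimes> c) $$ (a,v)"
      using c iv a by (intro rep_expand[OF r]) auto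
    also have "\<dots> = (\<Sum>w<m. r (b i) $$ (a,w) * r c $$ (w,v))"
      using c iv a by (intro rep_mult_entry) auto
    finally show "(to_coregular m r a * r c) $$ (i,v) = (coregular c * to_coregular m r a) $$ (i,v)"
      using iv rc by (simp add: to_coregular_def coregular_def scalar_prod_def lessThan_atLeast0)
  qed (use fd_modulesD(1)[OF r c] in \<open>auto simp: to_coregular_def coregular_def\<close>)
  thus ?thesis by (auto simp: fd_module_maps_def to_coregular_def)
qed

text \<open>\<open>T\<close> maps the basis vector with index \<open>a\<close> to the combination
  given by column \<open>a\<close> of \<open>T\<close>, so the generators transform by columns.
  \<open>to_coregular_natural\<close> is the dual statement, with rows.\<close>

lemma from_regular_natural:
  assumes s: "(m', s) \<in> fd_modules A" and T: "T \<in> fd_module_maps A (m, r) (m', s)"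
    and a: "a < m" and uj: "u < m'" "j < n"
  shows "(T * from_regular m r a) $$ (u,j) = (\<Sum>w<m'. T $$ (w,a) * from_regular m' s w $$ (u,j))"
proof -
  have Tc: "T \<in> carrier_mat m' m" and com: "T * r (b j) = s (b j) * T"
    using T uj by (auto simp: fd_module_maps_def)
  have "(T * from_regular m r a) $$ (u,j) = (T * r (b j)) $$ (u,a)"
    using Tc fd_modulesD(1)[OF r, of "b j"] a uj by (simp add: from_regular_def scalar_prod_def)
  also have "\<dots> = (\<Sum>w<m'. T $$ (w,a) * from_regular m' s w $$ (u,j))"
    unfolding com using Tc fd_modulesD(1)[OF s, of "b j"] a uj
    by (simp add: from_regular_def scalar_prod_def lessThan_atLeast0 mult.commute)
  finally show ?thesis .
qed

lemma to_coregular_natural: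
  assumes s: "(m', s) \<in> fd_modules A" and T: "T \<in> fd_module_maps A (m, r) (m', s)"
    and a: "a < m'" and iv: "i < n" "v < m"
  shows "(to_coregular m' s a * T) $$ (i,v) = (\<Sum>w<m. T $$ (a,w) * to_coregular m r w $$ (i,v))"
proof -
  have Tc: "T \<in> carrier_mat m' m" and com: "T * r (b i) = s (b i) * T"
    using T iv by (auto simp: fd_module_maps_def)
  have "(to_coregular m' s a * T) $$ (i,v) = (s (b i) * T) $$ (a,v)"
    using Tc fd_modulesD(1)[OF s, of "b i"] a iv by (simp add: to_coregular_def scalar_prod_def)
  also have "\<dots> = (\<Sum>w<m. T $$ (a,w) * to_coregular m r w $$ (i,v))"
    unfolding com[symmetric] using Tc fd_modulesD(1)[OF r, of "b i"] a iv
    by (simp add: to_coregular_def scalar_prod_def lessThan_atLeast0)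
  finally show ?thesis .
qed

text \<open>The functional sending \<open>x\<close> to the \<open>a\<close>-th coordinate of
  \<open>x v\<close> becomes the one sending \<open>x\<close> to the \<open>a\<close>-th coordinate
  of \<open>c x v\<close>. Thus \<open>c\<close> acts on the index \<open>a\<close> through row
  \<open>a\<close> of \<open>r c\<close>.\<close>

lemma coregular_endo_comp:
  assumes c: "c \<in> carrier A" and a: "a < m" and iv: "i < n" "v < m"
  shows "(coregular_endo c * to_coregular m r a) $$ (i,v) = (\<Sum>w<m. r c $$ (a,w) * to_coregular m r w $$ (i,v))"
proof -
  have "(coregular_endo c * to_coregular m r a) $$ (i,v) = (\<Sum>l<n. co (c \<otimes> b i) l * r (b l) $$ (a,v))"
    using iv by (simp add: coregular_endo_def to_coregular_def scalar_prod_def lessThan_atLeast0)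
  also have "\<dots> = r (c \<otimes> b i) $$ (a,v)" using c iv a by (intro rep_expand[OF r]) auto
  also have "\<dots> = (\<Sum>w<m. r c $$ (a,w) * r (b i) $$ (w,v))" using c iv a by (intro rep_mult_entry) auto
  finally show ?thesis using iv by (simp add: to_coregular_def)
qed

text \<open>The summed composite sends \<open>x\<close> to the functional whose value at
  \<open>y\<close> is the trace of \<open>y x\<close>: it is the trace form of the module.\<close>

lemma to_coregular_from_regular:
  assumes "i < n" "j < n"
  shows "(\<Sum>a<m. (to_coregular m r a * from_regular m r a) $$ (i,j)) = (\<Sum>a<m. r (b i \<otimes> b j) $$ (a,a))"
proof (rule sum.cong)
  fix a assume "a \<in> {..<m}"
  thus "(to_coregular m r a * from_regular m r a) $$ (i,j) = r (b i \<otimes> b j) $$ (a,a)"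
    using assms rep_mult_entry[of "b i" "b j" a a]
    by (simp add: to_coregular_def from_regular_def scalar_prod_def lessThan_atLeast0)
qed simp

text \<open>Evaluate at the unit of the algebra, written in coordinates: the maps then become the
  standard basis vectors. The dual lemma evaluates at the unit as well.\<close>

lemma from_regular_independent:
  assumes z: "\<And>u j. u < m \<Longrightarrow> j < n \<Longrightarrow> (\<Sum>a<m. t a * from_regular m r a $$ (u,j)) = 0" and a: "a < m"
  shows "t a = 0"
proof -
  have "0 = (\<Sum>l<n. co \<one> l * (\<Sum>a'<m. t a' * r (b l) $$ (a,a')))"
    using z[OF a] a by (intro sum.neutral[symmetric]) (auto simp: from_regular_def)
  also have "\<dots> = (\<Sum>a'<m. t a' * (\<Sum>l<n. co \<one> l * r (b l) $$ (a,a')))"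
    by (simp add: sum_distrib_left sum.swap[of _ "{..<n}"] mult.left_commute)
  also have "\<dots> = (\<Sum>a'<m. t a' * (if a = a' then 1 else 0))"
    using rep_expand[OF r A_one a] fd_modulesD(5)[OF r A_one] a by (intro sum.cong) auto
  also have "\<dots> = t a" using a by (simp add: if_distrib[of "\<lambda>x. _ * x"] cong: if_cong)
  finally show ?thesis by simp
qed

lemma to_coregular_independent:
  assumes z: "\<And>i v. i < n \<Longrightarrow> v < m \<Longrightarrow> (\<Sum>a<m. t a * to_coregular m r a $$ (i,v)) = 0" and a: "a < m"
  shows "t a = 0"
proof -
  have "0 = (\<Sum>l<n. co \<one> l * (\<Sum>a'<m. t a' * r (b l) $$ (a',a)))"
    using z[OF _ a] a by (intro sum.neutral[symmetric]) (auto simp: to_coregular_def)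
  also have "\<dots> = (\<Sum>a'<m. t a' * (\<Sum>l<n. co \<one> l * r (b l) $$ (a',a)))"
    by (simp add: sum_distrib_left sum.swap[of _ "{..<n}"] mult.left_commute)
  also have "\<dots> = (\<Sum>a'<m. t a' * (if a' = a then 1 else 0))"
    using rep_expand[OF r A_one _ a] fd_modulesD(5)[OF r A_one] a by (intro sum.cong) auto
  also have "\<dots> = t a" using a by (simp add: if_distrib[of "\<lambda>x. _ * x"] cong: if_cong)
  finally show ?thesis by simp
qed

end

end

lemma (in category) Hom_Obj: "f \<in> Hom C X Y \<Longrightarrow> X \<in> Obj C" "f \<in> Hom C X Y \<Longrightarrow> Y \<in> Obj C"
  using Dom_in Cod_in by (auto simp: Hom_def)


section \<open>Categories represented by modules\<close>

text \<open>The format is an argument so that an empty combination is still a zero matrix of known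
  size. Keeping coefficients and matrices apart allows linear operations to be pushed through and
  double sums to be interchanged.\<close>

definition mat_lc :: "nat \<Rightarrow> nat \<Rightarrow> nat \<Rightarrow> (nat \<Rightarrow> 'k :: comm_semiring_0) \<Rightarrow> (nat \<Rightarrow> 'k mat) \<Rightarrow> 'k mat"
  where "mat_lc p q N t G = mat p q (\<lambda>(u,v). \<Sum>a<N. t a * G a $$ (u,v))"

lemma mat_lc_carrier [simp]: "mat_lc p q N t G \<in> carrier_mat p q"
  and mat_lc_dim [simp]: "dim_row (mat_lc p q N t G) = p" "dim_col (mat_lc p q N t G) = q"
  and mat_lc_index [simp]: "u < p \<Longrightarrow> v < q \<Longrightarrow> mat_lc p q N t G $$ (u,v) = (\<Sum>a<N. t a * G a $$ (u,v))"
  by (simp_all add: mat_lc_def)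

lemma mat_lc_cong: "(\<And>a. a < N \<Longrightarrow> t a = t' a) \<Longrightarrow> (\<And>a. a < N \<Longrightarrow> G a = G' a) \<Longrightarrow> mat_lc p q N t G = mat_lc p q N t' G'"
  by (auto simp: mat_lc_def intro!: eq_matI sum.cong)

lemma mult_mat_lc:
  assumes L: "L \<in> carrier_mat p' p" and G: "\<And>a. a < N \<Longrightarrow> G a \<in> carrier_mat p q"
  shows "L * mat_lc p q N t G = mat_lc p' q N t (\<lambda>a. L * G a)"
proof (rule eq_matI)
  fix u v assume "u < dim_row (mat_lc p' q N t (\<lambda>a. L * G a))" "v < dim_col (mat_lc p' q N t (\<lambda>a. L * G a))"
  hence uv: "u < p'" "v < q" by auto
  have "(L * mat_lc p q N t G) $$ (u,v) = (\<Sum>w<p. \<Sum>a<N. L $$ (u,w) * (t a * G a $$ (w,v)))"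
    using uv L by (simp add: scalar_prod_def lessThan_atLeast0 sum_distrib_left)
  also have "\<dots> = (\<Sum>a<N. \<Sum>w<p. L $$ (u,w) * (t a * G a $$ (w,v)))" by (rule sum.swap)
  also have "\<dots> = mat_lc p' q N t (\<lambda>a. L * G a) $$ (u,v)"
    using uv L carrier_matD[OF G]
    by (auto simp: scalar_prod_def lessThan_atLeast0 sum_distrib_left mult.left_commute intro!: sum.cong)
  finally show "(L * mat_lc p q N t G) $$ (u,v) = mat_lc p' q N t (\<lambda>a. L * G a) $$ (u,v)" .
qed (use L in auto)

lemma mat_lc_mult:
  assumes R: "R \<in> carrier_mat q q'" and G: "\<And>a. a < N \<Longrightarrow> G a \<in> carrier_mat p q"
  shows "mat_lc p q N t G * R = mat_lc p q' N t (\<lambda>a. G a * R)"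
proof (rule eq_matI)
  fix u v assume "u < dim_row (mat_lc p q' N t (\<lambda>a. G a * R))" "v < dim_col (mat_lc p q' N t (\<lambda>a. G a * R))"
  hence uv: "u < p" "v < q'" by auto
  have "(mat_lc p q N t G * R) $$ (u,v) = (\<Sum>w<q. \<Sum>a<N. t a * G a $$ (u,w) * R $$ (w,v))"
    using uv R by (simp add: scalar_prod_def lessThan_atLeast0 sum_distrib_right)
  also have "\<dots> = (\<Sum>a<N. \<Sum>w<q. t a * G a $$ (u,w) * R $$ (w,v))" by (rule sum.swap)
  also have "\<dots> = mat_lc p q' N t (\<lambda>a. G a * R) $$ (u,v)"
    using uv R carrier_matD[OF G]
    by (auto simp: scalar_prod_def lessThan_atLeast0 sum_distrib_left mult.assoc intro!: sum.cong)
  finally show "(mat_lc p q N t G * R) $$ (u,v) = mat_lc p q' N t (\<lambda>a. G a * R) $$ (u,v)" .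
qed (use R in auto)

lemma mat_eq_by_vec:
  fixes A B :: "'k :: semiring_1 mat"
  assumes A: "A \<in> carrier_mat m n" and B: "B \<in> carrier_mat m n"
    and e: "\<And>v. v \<in> carrier_vec n \<Longrightarrow> A *\<^sub>v v = B *\<^sub>v v"
  shows "A = B"
proof (rule mat_col_eqI)
  fix j assume "j < dim_col B"
  hence j: "j < n" using B by simp
  show "col A j = col B j" using e[of "unit_vec n j"] mult_mat_unit_vec[OF A j] mult_mat_unit_vec[OF B j] by simp
qed (use A B in auto)

text \<open>\<open>1\<^sub>m m - \<iota> * L\<close> is an idempotent whose kernel is the range of
  \<iota>. A basis of its range splits it as \<open>Y * \<pi>\<close>.\<close>

lemma complement_matrix:
  fixes \<iota> L :: "'k :: field mat"
  assumes \<iota>: "\<iota> \<in> carrier_mat m d" and L: "L \<in> carrier_mat d m" and L\<iota>: "L * \<iota> = 1\<^sub>m d"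
  obtains r \<pi> Y where "\<pi> \<in> carrier_mat r m" "Y \<in> carrier_mat m r" "\<pi> * Y = 1\<^sub>m r" "Y * \<pi> = 1\<^sub>m m - \<iota> * L"
    "\<pi> * \<iota> = 0\<^sub>m r d"
proof -
  define E where "E = 1\<^sub>m m - \<iota> * L"
  have \<iota>L: "\<iota> * L \<in> carrier_mat m m" using \<iota> L by simp
  have Ec: "E \<in> carrier_mat m m" unfolding E_def by (rule minus_carrier_mat[OF \<iota>L])
  have E\<iota>: "E * \<iota> = 0\<^sub>m m d"
  proof -
    have "E * \<iota> = 1\<^sub>m m * \<iota> - (\<iota> * L) * \<iota>" unfolding E_def
      using \<iota> \<iota>L by (intro minus_mult_distrib_mat) auto
    also have "(\<iota> * L) * \<iota> = \<iota>" using \<iota> L L\<iota> by (simp add: assoc_mult_mat[OF \<iota> L \<iota>])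
    finally show ?thesis using \<iota> by simp
  qed
  have EE: "E * E = E"
  proof -
    have "E * E = E * 1\<^sub>m m - E * (\<iota> * L)" unfolding E_def[of]
      using Ec \<iota>L by (subst mult_minus_distrib_mat[symmetric]) (auto simp: E_def)
    also have "E * (\<iota> * L) = (E * \<iota>) * L" using assoc_mult_mat[OF Ec \<iota> L] by simp
    also have "\<dots> = 0\<^sub>m m m" unfolding E\<iota> using L by simp
    finally show ?thesis using Ec by (auto intro!: eq_matI)
  qed
  define W where "W = {w \<in> carrier_vec m. E *\<^sub>v w = w}"
  obtain r Y L2 where Y: "Y \<in> carrier_mat m r" and L2: "L2 \<in> carrier_mat r m" and L2Y: "L2 * Y = 1\<^sub>m r"
    and W: "\<And>w. w \<in> carrier_vec m \<Longrightarrow> w \<in> W \<longleftrightarrow> Y *\<^sub>v (L2 *\<^sub>v w) = w"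
  proof (rule subspace_matrix[of W m])
    show "W \<subseteq> carrier_vec m" by (auto simp: W_def)
    show "0\<^sub>v m \<in> W" using Ec by (auto simp: W_def)
    show "v + w \<in> W" if "v \<in> W" "w \<in> W" for v w
      using that Ec by (auto simp: W_def mult_add_distrib_mat_vec)
    show "c \<cdot>\<^sub>v v \<in> W" if "v \<in> W" for c v
      using that Ec by (auto simp: W_def mult_mat_vec)
  qed blast
  have YL2E: "Y * (L2 * E) = E"
  proof (rule mat_eq_by_vec)
    fix v :: "'k vec" assume v: "v \<in> carrier_vec m"
    have "E *\<^sub>v v \<in> W" using Ec v EE assoc_mult_mat_vec[OF Ec Ec v] by (simp add: W_def)
    hence "Y *\<^sub>v (L2 *\<^sub>v (E *\<^sub>v v)) = E *\<^sub>v v" using W Ec v by simp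
    thus "(Y * (L2 * E)) *\<^sub>v v = E *\<^sub>v v" using assoc_mult_mat_vec[OF Y mult_carrier_mat[OF L2 Ec] v] assoc_mult_mat_vec[OF L2 Ec v] by simp
  qed (use Y L2 Ec in auto)
  have EY: "E * Y = Y"
  proof (rule mat_eq_by_vec)
    fix v :: "'k vec" assume v: "v \<in> carrier_vec r"
    have "L2 *\<^sub>v (Y *\<^sub>v v) = v" using assoc_mult_mat_vec[OF L2 Y v] L2Y v by simp
    hence "Y *\<^sub>v v \<in> W" using W[of "Y *\<^sub>v v"] Y v by simp
    thus "(E * Y) *\<^sub>v v = Y *\<^sub>v v" using assoc_mult_mat_vec[OF Ec Y v] by (simp add: W_def)
  qed (use Y Ec in auto)
  show thesis
  proof (rule that[of "L2 * E" r Y])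
    show "(L2 * E) * Y = 1\<^sub>m r" using assoc_mult_mat[OF L2 Ec Y] EY L2Y by simp
    show "(L2 * E) * \<iota> = 0\<^sub>m r d" using assoc_mult_mat[OF L2 Ec \<iota>] E\<iota> L2 by simp
  qed (use Y L2 Ec YL2E E_def in auto)
qed

text \<open>A fully faithful, essentially surjective linear functor to matrix modules, recorded by
  dimensions, action matrices and matrices of arrows. It is not monoidal: tensor products enter
  later only through the fact that tensoring with an arrow is linear.\<close>

locale represented_category = klinear_category C + A: fd_algebra_basis A n b co
  for C :: "('k :: alg_closed_field, 'o, 'm, 'z) klin_cat_scheme" (structure)
    and A :: "('k, 'a) module" and n b co +
  fixes rank :: "'o \<Rightarrow> nat" and rep :: "'o \<Rightarrow> 'a \<Rightarrow> 'k mat" and mat_of :: "'m \<Rightarrow> 'k mat"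
  assumes rep_module: "X \<in> Obj C \<Longrightarrow> (rank X, rep X) \<in> fd_modules A"
    and mat_of_map: "f \<in> Hom C X Y \<Longrightarrow> mat_of f \<in> fd_module_maps A (rank X, rep X) (rank Y, rep Y)"
    and mat_of_Ide: "X \<in> Obj C \<Longrightarrow> mat_of (Ide C X) = 1\<^sub>m (rank X)"
    and mat_of_Comp: "f \<in> Hom C X Y \<Longrightarrow> g \<in> Hom C Y Z \<Longrightarrow> mat_of (g \<cdot> f) = mat_of g * mat_of f"
    and mat_of_Add: "f \<in> Hom C X Y \<Longrightarrow> g \<in> Hom C X Y \<Longrightarrow> mat_of (Add C f g) = mat_of f + mat_of g"
    and mat_of_Scale: "f \<in> Hom C X Y \<Longrightarrow> mat_of (Scale C x f) = x \<cdot>\<^sub>m mat_of f"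
    and mat_of_inject: "f \<in> Hom C X Y \<Longrightarrow> g \<in> Hom C X Y \<Longrightarrow> mat_of f = mat_of g \<Longrightarrow> f = g"
    and mat_of_full: "X \<in> Obj C \<Longrightarrow> Y \<in> Obj C \<Longrightarrow> T \<in> fd_module_maps A (rank X, rep X) (rank Y, rep Y) \<Longrightarrow>
      \<exists>f \<in> Hom C X Y. mat_of f = T"
    and mat_of_dense: "(m, r) \<in> fd_modules A \<Longrightarrow> \<exists>X \<in> Obj C.
      \<exists>S \<in> fd_module_maps A (m, r) (rank X, rep X). \<exists>S' \<in> fd_module_maps A (rank X, rep X) (m, r).
        S * S' = 1\<^sub>m (rank X) \<and> S' * S = 1\<^sub>m m"
begin

lemma mat_of_carrier: "f \<in> Hom C X Y \<Longrightarrow> mat_of f \<in> carrier_mat (rank Y) (rank X)"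
  using mat_of_map[of f X Y] by (simp add: fd_module_maps_def)

lemma mat_of_intertwines: "f \<in> Hom C X Y \<Longrightarrow> a \<in> carrier A \<Longrightarrow> mat_of f * rep X a = rep Y a * mat_of f"
  using mat_of_map[of f X Y] by (simp add: fd_module_maps_def)

lemma mat_of_fullE:
  assumes "X \<in> Obj C" "Y \<in> Obj C" "T \<in> carrier_mat (rank Y) (rank X)"
    and "\<And>a. a \<in> carrier A \<Longrightarrow> T * rep X a = rep Y a * T"
  obtains f where "f \<in> Hom C X Y" "mat_of f = T"
  using mat_of_full[of X Y T] assms by (auto simp: fd_module_maps_def)

lemmas rep_carrier = fd_modulesD(1)[OF rep_module]
  and rep_mult = fd_modulesD(2)[OF rep_module]
  and rep_add = fd_modulesD(3)[OF rep_module]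
  and rep_smult = fd_modulesD(4)[OF rep_module]
  and rep_one = fd_modulesD(5)[OF rep_module A.A_one]

lemma matrix_algebra: "X \<in> Obj C \<Longrightarrow> matrix_algebra_rep (carrier A) (rank X) (rep X)"
proof (unfold_locales)
  assume X: "X \<in> Obj C"
  show "rep X a \<in> carrier_mat (rank X) (rank X)" if "a \<in> carrier A" for a using rep_carrier X that .
  show "\<exists>a\<in>carrier A. rep X a = 1\<^sub>m (rank X)" using rep_one X A.A_one by blast
  show "\<exists>c\<in>carrier A. rep X c = rep X a + rep X b" if "a \<in> carrier A" "b \<in> carrier A" for a b
    using rep_add[OF X that] ring.ring_simprules(1)[OF A.ring_A that] by blast
  show "\<exists>c\<in>carrier A. rep X c = rep X a * rep X b" if "a \<in> carrier A" "b \<in> carrier A" for a b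
    using rep_mult[OF X that] A.A_mult[OF that] by blast
  show "\<exists>c\<in>carrier A. rep X c = x \<cdot>\<^sub>m rep X a" if "a \<in> carrier A" for a x
    using rep_smult[OF X that] A.smult_closed[OF _ that, of x] by auto
qed

lemma burnside_rep:
  assumes "X \<in> Obj C" "irreducible_rep (carrier A) (rank X) (rep X)" "B \<in> carrier_mat (rank X) (rank X)"
  shows "\<exists>a \<in> carrier A. rep X a = B"
  using burnside[OF matrix_algebra assms(2,3)] assms(1) by blast

lemma Add_Hom:
  assumes "f \<in> Hom C X Y" "g \<in> Hom C X Y"
  shows "Add C f g \<in> Hom C X Y"
proof -
  interpret V: vectorspace "class_ring :: 'k ring" "hom_space C X Y"
    using vectorspace_hom Dom_in Cod_in assms(1) by (auto simp: Hom_def)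
  show ?thesis using V.a_closed[of f g] assms by (simp add: hom_space_def)
qed

lemma Scale_Hom:
  assumes "f \<in> Hom C X Y"
  shows "Scale C x f \<in> Hom C X Y"
proof -
  interpret V: vectorspace "class_ring :: 'k ring" "hom_space C X Y"
    using vectorspace_hom Dom_in Cod_in assms(1) by (auto simp: Hom_def)
  show ?thesis using V.smult_closed[of x f] assms by (simp add: hom_space_def)
qed

lemma Zero_Hom:
  assumes "X \<in> Obj C" "Y \<in> Obj C"
  shows "Zero C X Y \<in> Hom C X Y"
proof -
  interpret V: vectorspace "class_ring :: 'k ring" "hom_space C X Y"
    using vectorspace_hom assms by auto
  show ?thesis using V.zero_closed by (simp add: hom_space_def)
qed

lemma mat_of_Zero:
  assumes "X \<in> Obj C" "Y \<in> Obj C"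
  shows "mat_of (Zero C X Y) = 0\<^sub>m (rank Y) (rank X)"
proof -
  interpret V: vectorspace "class_ring :: 'k ring" "hom_space C X Y"
    using vectorspace_hom assms by auto
  have "Add C (Zero C X Y) (Zero C X Y) = Zero C X Y"
    using V.l_zero[OF V.zero_closed] by (simp add: hom_space_def)
  with mat_of_Add[OF Zero_Hom[OF assms] Zero_Hom[OF assms]]
  have e: "mat_of (Zero C X Y) + mat_of (Zero C X Y) = mat_of (Zero C X Y)" by simp
  note c = mat_of_carrier[OF Zero_Hom[OF assms]]
  show ?thesis
  proof (rule eq_matI)
    fix u v assume "u < dim_row (0\<^sub>m (rank Y) (rank X) :: 'k mat)" "v < dim_col (0\<^sub>m (rank Y) (rank X) :: 'k mat)"
    hence uv: "u < rank Y" "v < rank X" by auto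
    with arg_cong[OF e, of "\<lambda>M. M $$ (u,v)"] c
    have "mat_of (Zero C X Y) $$ (u,v) + mat_of (Zero C X Y) $$ (u,v) = mat_of (Zero C X Y) $$ (u,v)" by auto
    hence "mat_of (Zero C X Y) $$ (u,v) = 0" by (metis add_cancel_right_right)
    with uv show "mat_of (Zero C X Y) $$ (u,v) = 0\<^sub>m (rank Y) (rank X) $$ (u,v)" by simp
  qed (use c in auto)
qed

lemma mat_of_diff:
  assumes "f \<in> Hom C X Y" "g \<in> Hom C X Y"
  obtains d where "d \<in> Hom C X Y" "mat_of d = mat_of f - mat_of g"
proof (rule that[of "Add C f (Scale C (-1) g)"])
  show "Add C f (Scale C (-1) g) \<in> Hom C X Y" using assms Add_Hom Scale_Hom by blast
  show "mat_of (Add C f (Scale C (-1) g)) = mat_of f - mat_of g"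
    using mat_of_Add[OF assms(1) Scale_Hom[OF assms(2)], of "-1"] mat_of_Scale[OF assms(2), of "-1"]
      mat_of_carrier[OF assms(1)] mat_of_carrier[OF assms(2)] by (auto intro!: eq_matI)
qed

lemma ex_lc:
  assumes XY: "X \<in> Obj C" "Y \<in> Obj C" and g: "\<And>a. a < N \<Longrightarrow> g a \<in> Hom C X Y"
  shows "\<exists>h \<in> Hom C X Y. mat_of h = mat_lc (rank Y) (rank X) N t (\<lambda>a. mat_of (g a))"
  using g
proof (induction N)
  case 0
  show ?case using Zero_Hom[OF XY] mat_of_Zero[OF XY]
    by (intro bexI[of _ "Zero C X Y"]) (auto simp: mat_lc_def intro!: eq_matI)
next
  case (Suc N)
  then obtain h where h: "h \<in> Hom C X Y" "mat_of h = mat_lc (rank Y) (rank X) N t (\<lambda>a. mat_of (g a))" by auto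
  note gN = Suc.prems[of N, OF lessI]
  have "mat_of (Add C h (Scale C (t N) (g N))) = mat_lc (rank Y) (rank X) (Suc N) t (\<lambda>a. mat_of (g a))"
    using mat_of_Add[OF h(1) Scale_Hom[OF gN, of "t N"]] mat_of_Scale[OF gN, of "t N"] h(2) mat_of_carrier[OF gN]
    by (auto intro!: eq_matI)
  thus ?case using Add_Hom[OF h(1) Scale_Hom[OF gN]] by blast
qed

definition linear_map :: "('m \<Rightarrow> 'm) \<Rightarrow> 'o \<Rightarrow> 'o \<Rightarrow> 'o \<Rightarrow> 'o \<Rightarrow> bool"
  where "linear_map L X Y V W \<longleftrightarrow> (\<forall>f \<in> Hom C X Y. L f \<in> Hom C V W) \<and>
    (\<forall>f \<in> Hom C X Y. \<forall>g \<in> Hom C X Y. L (Add C f g) = Add C (L f) (L g)) \<and>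
    (\<forall>f \<in> Hom C X Y. \<forall>x. L (Scale C x f) = Scale C x (L f))"

text \<open>Finite sums of arrows are manipulated in this way: a sum is an arrow with a prescribed
  matrix, and every linear operation on arrows may be applied termwise.\<close>

lemma linear_map_lc:
  assumes L: "linear_map L X Y V W" and g: "\<And>a. a < N \<Longrightarrow> g a \<in> Hom C X Y" and h: "h \<in> Hom C X Y"
    and e: "mat_of h = mat_lc (rank Y) (rank X) N t (\<lambda>a. mat_of (g a))"
  shows "mat_of (L h) = mat_lc (rank W) (rank V) N t (\<lambda>a. mat_of (L (g a)))"
  using g h e
proof (induction N arbitrary: h)
  case 0
  \<comment> \<open>An empty combination has zero matrix and so equals its own multiple by
    \<open>0\<close>; linearity carries this over to \<open>L h\<close>.\<close>
  have "h = Scale C 0 h"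
    using mat_of_carrier[OF 0(2)] 0(3) by (intro mat_of_inject[OF 0(2) Scale_Hom[OF 0(2)]])
      (auto simp: mat_of_Scale[OF 0(2)] intro!: eq_matI)
  hence "L h = Scale C 0 (L h)" using L 0(2) unfolding linear_map_def by metis
  moreover have Lh: "L h \<in> Hom C V W" using L 0(2) unfolding linear_map_def by blast
  ultimately have "mat_of (L h) = 0 \<cdot>\<^sub>m mat_of (L h)" using mat_of_Scale[OF Lh, of 0] by simp
  also have "\<dots> = mat_lc (rank W) (rank V) 0 t (\<lambda>a. mat_of (L (g a)))"
    using mat_of_carrier[OF Lh] by (auto intro!: eq_matI)
  finally show ?case .
next
  case (Suc N)
  have XY: "X \<in> Obj C" "Y \<in> Obj C" using Suc.prems(2) Dom_in Cod_in by (auto simp: Hom_def)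
  note gN = Suc.prems(1)[of N, OF lessI]
  have "\<exists>h' \<in> Hom C X Y. mat_of h' = mat_lc (rank Y) (rank X) N t (\<lambda>a. mat_of (g a))"
    using Suc.prems(1) by (intro ex_lc XY) auto
  then obtain h' where h': "h' \<in> Hom C X Y" "mat_of h' = mat_lc (rank Y) (rank X) N t (\<lambda>a. mat_of (g a))"
    by blast
  have "h = Add C h' (Scale C (t N) (g N))"
    using mat_of_Add[OF h'(1) Scale_Hom[OF gN, of "t N"]] mat_of_Scale[OF gN, of "t N"] h'(2) mat_of_carrier[OF gN]
      Suc.prems(3)
    by (intro mat_of_inject[OF Suc.prems(2) Add_Hom[OF h'(1) Scale_Hom[OF gN]]]) (auto intro!: eq_matI)
  moreover have "L (Add C h' (Scale C (t N) (g N))) = Add C (L h') (L (Scale C (t N) (g N)))"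
    using L h'(1) Scale_Hom[OF gN] unfolding linear_map_def by blast
  moreover have "L (Scale C (t N) (g N)) = Scale C (t N) (L (g N))"
    using L gN unfolding linear_map_def by blast
  ultimately have Lh: "L h = Add C (L h') (Scale C (t N) (L (g N)))" by simp
  have H: "L h' \<in> Hom C V W" "L (g N) \<in> Hom C V W" using L gN h'(1) unfolding linear_map_def by blast+
  have IH: "mat_of (L h') = mat_lc (rank W) (rank V) N t (\<lambda>a. mat_of (L (g a)))"
    using Suc.prems(1) by (intro Suc.IH h') auto
  show ?case
    using mat_of_Add[OF H(1) Scale_Hom[OF H(2), of "t N"]] mat_of_Scale[OF H(2), of "t N"] IH mat_of_carrier[OF H(2)]
    by (auto simp: Lh intro!: eq_matI)
qed

text \<open>The bridge to \<open>finsum\<close>, in terms of which direct sums are defined.\<close>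

lemma mat_of_finsum:
  assumes "X \<in> Obj C" "Y \<in> Obj C" "\<And>a. a < N \<Longrightarrow> g a \<in> Hom C X Y"
  shows "finsum (hom_space C X Y) g {..<N} \<in> Hom C X Y"
    and "mat_of (finsum (hom_space C X Y) g {..<N}) = mat_lc (rank Y) (rank X) N (\<lambda>_. 1) (\<lambda>a. mat_of (g a))"
proof -
  interpret V: vectorspace "class_ring :: 'k ring" "hom_space C X Y"
    using vectorspace_hom assms(1,2) by auto
  have "finsum (hom_space C X Y) g {..<N} \<in> Hom C X Y \<and>
    mat_of (finsum (hom_space C X Y) g {..<N}) = mat_lc (rank Y) (rank X) N (\<lambda>_. 1) (\<lambda>a. mat_of (g a))"
    using assms(3)
  proof (induction N)
    case 0
    have "zero (hom_space C X Y) = Zero C X Y" by (simp add: hom_space_def)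
    with V.finsum_empty[of g] have "finsum (hom_space C X Y) g {..<0} = Zero C X Y"
      by (simp only: lessThan_0)
    thus ?case using Zero_Hom[OF assms(1,2)] mat_of_Zero[OF assms(1,2)]
      by (auto simp: mat_lc_def intro!: eq_matI)
  next
    case (Suc N)
    note gN = Suc.prems[of N, OF lessI]
    have IH: "finsum (hom_space C X Y) g {..<N} \<in> Hom C X Y"
      "mat_of (finsum (hom_space C X Y) g {..<N}) = mat_lc (rank Y) (rank X) N (\<lambda>_. 1) (\<lambda>a. mat_of (g a))"
      using Suc by auto
    have "finsum (hom_space C X Y) g {..<Suc N} = Add C (g N) (finsum (hom_space C X Y) g {..<N})"
      unfolding lessThan_Suc using Suc.prems by (subst V.finsum_insert) (auto simp: hom_space_def)
    thus ?case using Add_Hom[OF gN IH(1)] mat_of_Add[OF gN IH(1)] IH(2) mat_of_carrier[OF gN]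
      by (auto intro!: eq_matI)
  qed
  thus "finsum (hom_space C X Y) g {..<N} \<in> Hom C X Y"
    "mat_of (finsum (hom_space C X Y) g {..<N}) = mat_lc (rank Y) (rank X) N (\<lambda>_. 1) (\<lambda>a. mat_of (g a))"
    by auto
qed

end

lemma diff_zero_mat:
  fixes M :: "'k :: group_add mat"
  shows "M \<in> carrier_mat p q \<Longrightarrow> M - 0\<^sub>m p q = M"
  by (intro eq_matI) auto

text \<open>Transport of an action along \<open>L * Y = 1\<^sub>m r\<close>. The condition
  \<open>mult\<close> holds when the range of \<open>Y\<close> is invariant, which yields
  submodules, and also when the kernel of \<open>L\<close> is invariant, which yields
  quotients.\<close>

lemma compressed_module:
  fixes \<rho> :: "'a \<Rightarrow> 'k :: field mat"
  assumes \<rho>: "(m, \<rho>) \<in> fd_modules A" and A: "fd_algebra A"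
    and Y: "Y \<in> carrier_mat m r" and L: "L \<in> carrier_mat r m" and LY: "L * Y = 1\<^sub>m r"
    and mult: "\<And>a b. a \<in> carrier A \<Longrightarrow> b \<in> carrier A \<Longrightarrow>
      L * \<rho> a * (\<rho> b * Y) = (L * \<rho> a * Y) * (L * \<rho> b * Y)"
  shows "(r, \<lambda>a. L * \<rho> a * Y) \<in> fd_modules A"
proof (rule fd_modulesI)
  interpret A: fd_algebra A by fact
  note c = fd_modulesD(1)[OF \<rho>]
  fix a b assume a: "a \<in> carrier A" and b: "b \<in> carrier A"
  show "L * \<rho> a * Y \<in> carrier_mat r r" using L Y c[OF a] by simp
  have "L * \<rho> (a \<otimes>\<^bsub>A\<^esub> b) * Y = L * \<rho> a * (\<rho> b * Y)"
    using fd_modulesD(2)[OF \<rho> a b] assoc_mult_mat[OF L c[OF a] c[OF b]]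
      assoc_mult_mat[OF mult_carrier_mat[OF L c[OF a]] c[OF b] Y] by simp
  thus "L * \<rho> (a \<otimes>\<^bsub>A\<^esub> b) * Y = L * \<rho> a * Y * (L * \<rho> b * Y)" using mult[OF a b] by simp
  show "L * \<rho> (a \<oplus>\<^bsub>A\<^esub> b) * Y = L * \<rho> a * Y + L * \<rho> b * Y"
    using fd_modulesD(3)[OF \<rho> a b] mult_add_distrib_mat[OF L c[OF a] c[OF b]]
      add_mult_distrib_mat[OF mult_carrier_mat[OF L c[OF a]] mult_carrier_mat[OF L c[OF b]] Y] by simp
next
  interpret A: fd_algebra A by fact
  note c = fd_modulesD(1)[OF \<rho>]
  fix x a assume a: "a \<in> carrier A"
  show "L * \<rho> (x \<odot>\<^bsub>A\<^esub> a) * Y = x \<cdot>\<^sub>m (L * \<rho> a * Y)"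
    using fd_modulesD(4)[OF \<rho> a, of x] mult_smult_distrib[OF L c[OF a], of x]
      mult_smult_assoc_mat[OF mult_carrier_mat[OF L c[OF a]] Y, of x] by simp
next
  interpret A: fd_algebra A by fact
  show "L * \<rho> \<one>\<^bsub>A\<^esub> * Y = 1\<^sub>m r" using fd_modulesD(5)[OF \<rho> A.A_one] L LY by simp
qed

section \<open>Subobjects, irreducibility and cokernels\<close>

context represented_category
begin

text \<open>\<open>L\<close> is merely a matrix, not an arrow. Injectivity on the underlying space
  suffices because arrows are determined by their matrices.\<close>

lemma mono_if_left_inverse:
  assumes f: "f \<in> Hom C Z X" and L: "L \<in> carrier_mat (rank Z) (rank X)" "L * mat_of f = 1\<^sub>m (rank Z)"
  shows "is_mono C f"
  unfolding is_mono_def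
proof (intro conjI allI ballI impI)
  show "f \<in> Arr C" using f by (simp add: Hom_def)
  fix W g h assume "g \<in> Hom C W (Dom C f)" "h \<in> Hom C W (Dom C f)" and e: "f \<cdot> g = f \<cdot> h"
  hence g: "g \<in> Hom C W Z" and h: "h \<in> Hom C W Z" using f by (auto simp: Hom_def)
  have *: "L * mat_of (f \<cdot> k) = mat_of k" if k: "k \<in> Hom C W Z" for k
    using mat_of_Comp[OF k f] assoc_mult_mat[OF L(1) mat_of_carrier[OF f] mat_of_carrier[OF k]] L(2)
      mat_of_carrier[OF k] by simp
  show "g = h" using *[OF g] *[OF h] e by (intro mat_of_inject[OF g h]) simp
qed

text \<open>The inclusion of an invariant subspace, with a linear retraction \<open>L\<close> that
  encodes membership as an equation. The compressed module need not come from an object on the nose,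
  so density replaces it by an isomorphic one.\<close>

lemma submodule_object:
  assumes Z: "Z \<in> Obj C" and W: "W \<subseteq> carrier_vec (rank Z)" "0\<^sub>v (rank Z) \<in> W"
    and "\<And>v w. v \<in> W \<Longrightarrow> w \<in> W \<Longrightarrow> v + w \<in> W" "\<And>c v. v \<in> W \<Longrightarrow> c \<cdot>\<^sub>v v \<in> W"
    and inv: "\<And>a v. a \<in> carrier A \<Longrightarrow> v \<in> W \<Longrightarrow> rep Z a *\<^sub>v v \<in> W"
  obtains Z' f L where "f \<in> Hom C Z' Z" "L \<in> carrier_mat (rank Z') (rank Z)" "L * mat_of f = 1\<^sub>m (rank Z')"
    "\<And>w. w \<in> carrier_vec (rank Z) \<Longrightarrow> w \<in> W \<longleftrightarrow> mat_of f *\<^sub>v (L *\<^sub>v w) = w"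
proof -
  let ?m = "rank Z"
  obtain r Y L where Y: "Y \<in> carrier_mat ?m r" and L: "L \<in> carrier_mat r ?m" and LY: "L * Y = 1\<^sub>m r"
    and WY: "\<And>w. w \<in> carrier_vec ?m \<Longrightarrow> w \<in> W \<longleftrightarrow> Y *\<^sub>v (L *\<^sub>v w) = w"
    by (rule subspace_matrix[of W ?m]) (use assms in blast)+
  note c = rep_carrier[OF Z]
  have inv': "Y * (L * (rep Z a * Y)) = rep Z a * Y" if a: "a \<in> carrier A" for a
  proof (rule mat_eq_by_vec)
    fix v :: "'k vec" assume v: "v \<in> carrier_vec r"
    have "L *\<^sub>v (Y *\<^sub>v v) = v" using assoc_mult_mat_vec[OF L Y v] LY v by simp
    hence "Y *\<^sub>v v \<in> W" using WY[of "Y *\<^sub>v v"] Y v by simp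
    from inv[OF a this] have "Y *\<^sub>v (L *\<^sub>v (rep Z a *\<^sub>v (Y *\<^sub>v v))) = rep Z a *\<^sub>v (Y *\<^sub>v v)"
      using WY[of "rep Z a *\<^sub>v (Y *\<^sub>v v)"] c[OF a] Y v by simp
    moreover note assoc_mult_mat_vec[OF Y mult_carrier_mat[OF L mult_carrier_mat[OF c[OF a] Y]] v]
      assoc_mult_mat_vec[OF L mult_carrier_mat[OF c[OF a] Y] v] assoc_mult_mat_vec[OF c[OF a] Y v]
    ultimately show "(Y * (L * (rep Z a * Y))) *\<^sub>v v = (rep Z a * Y) *\<^sub>v v" by simp
  qed (use Y L c[OF a] in auto)
  let ?r = "\<lambda>a. L * rep Z a * Y"
  have ra: "?r a = L * (rep Z a * Y)" if "a \<in> carrier A" for a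
    using assoc_mult_mat[OF L c[OF that] Y] .
  have rc: "?r a \<in> carrier_mat r r" if "a \<in> carrier A" for a using L Y c[OF that] by simp
  have Yr: "Y * ?r a = rep Z a * Y" if "a \<in> carrier A" for a
    using inv'[OF that] ra[OF that] by simp
  have "(r, ?r) \<in> fd_modules A"
  proof (rule compressed_module[OF rep_module[OF Z] A.fd_algebra_axioms Y L LY])
    fix a b assume ab: "a \<in> carrier A" "b \<in> carrier A"
    show "L * rep Z a * (rep Z b * Y) = (L * rep Z a * Y) * (L * rep Z b * Y)"
      using Yr[OF ab(2)] assoc_mult_mat[OF mult_carrier_mat[OF L c[OF ab(1)]] Y rc[OF ab(2)]] by simp
  qed
  from mat_of_dense[OF this] obtain Z' S S' where Z': "Z' \<in> Obj C"
    and S: "S \<in> fd_module_maps A (r, ?r) (rank Z', rep Z')" and S': "S' \<in> fd_module_maps A (rank Z', rep Z') (r, ?r)"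
    and SS: "S * S' = 1\<^sub>m (rank Z')" "S' * S = 1\<^sub>m r" by blast
  have Sc: "S \<in> carrier_mat (rank Z') r" "S' \<in> carrier_mat r (rank Z')"
    and S'i: "\<And>a. a \<in> carrier A \<Longrightarrow> S' * rep Z' a = ?r a * S'"
    using S S' by (auto simp: fd_module_maps_def)
  have YS: "Y * S' \<in> carrier_mat ?m (rank Z')" using Y Sc by simp
  obtain f where f: "f \<in> Hom C Z' Z" "mat_of f = Y * S'"
  proof (rule mat_of_fullE[OF Z' Z YS])
    fix a assume a: "a \<in> carrier A"
    have "Y * S' * rep Z' a = Y * (?r a * S')"
      using assoc_mult_mat[OF Y Sc(2) rep_carrier[OF Z' a]] S'i[OF a] by simp
    also have "\<dots> = rep Z a * Y * S'"
      using assoc_mult_mat[OF Y rc[OF a] Sc(2)] Yr[OF a] by simp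
    finally show "Y * S' * rep Z' a = rep Z a * (Y * S')"
      using assoc_mult_mat[OF c[OF a] Y Sc(2)] by simp
  qed
  show thesis
  proof (rule that[OF f(1)])
    show "S * L \<in> carrier_mat (rank Z') ?m" using Sc L by simp
    have "S * L * (Y * S') = S * (L * (Y * S'))" by (rule assoc_mult_mat[OF Sc(1) L YS])
    also have "L * (Y * S') = S'" using assoc_mult_mat[OF L Y Sc(2)] LY Sc by simp
    finally show "S * L * mat_of f = 1\<^sub>m (rank Z')" using f SS by simp
    fix w :: "'k vec" assume w: "w \<in> carrier_vec ?m"
    have "(Y * S') *\<^sub>v ((S * L) *\<^sub>v w) = Y *\<^sub>v (S' *\<^sub>v (S *\<^sub>v (L *\<^sub>v w)))"
      using assoc_mult_mat_vec[OF Y Sc(2), of "(S * L) *\<^sub>v w"] assoc_mult_mat_vec[OF Sc(1) L w] Sc L w by simp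
    also have "S' *\<^sub>v (S *\<^sub>v (L *\<^sub>v w)) = L *\<^sub>v w"
      using assoc_mult_mat_vec[OF Sc(2) Sc(1), of "L *\<^sub>v w"] SS L w by simp
    finally show "w \<in> W \<longleftrightarrow> mat_of f *\<^sub>v ((S * L) *\<^sub>v w) = w" using WY[OF w] f by simp
  qed
qed

lemma cyclic_subobject:
  assumes Z: "Z \<in> Obj C" and v: "v \<in> carrier_vec (rank Z)"
  obtains Z' f L where "f \<in> Hom C Z' Z" "L \<in> carrier_mat (rank Z') (rank Z)" "L * mat_of f = 1\<^sub>m (rank Z')"
    "\<And>w. w \<in> carrier_vec (rank Z) \<Longrightarrow> (\<exists>a \<in> carrier A. rep Z a *\<^sub>v v = w) \<longleftrightarrow> mat_of f *\<^sub>v (L *\<^sub>v w) = w"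
proof -
  let ?W = "{w. \<exists>a \<in> carrier A. rep Z a *\<^sub>v v = w}"
  interpret R: matrix_algebra_rep "carrier A" "rank Z" "rep Z" by (rule matrix_algebra[OF Z])
  note c = rep_carrier[OF Z]
  show thesis
  proof (rule submodule_object[OF Z, of ?W])
    show "?W \<subseteq> carrier_vec (rank Z)" using mult_mat_vec_carrier[OF c v] by auto
    show add: "x + y \<in> ?W" if xy: "x \<in> ?W" "y \<in> ?W" for x y
    proof -
      from xy obtain a b where ab: "a \<in> carrier A" "b \<in> carrier A" "x = rep Z a *\<^sub>v v" "y = rep Z b *\<^sub>v v" by blast
      obtain d where d: "d \<in> carrier A" "rep Z d = rep Z a + rep Z b" using R.rep_add ab by blast
      have "rep Z d *\<^sub>v v = x + y" using d ab add_mult_distrib_mat_vec[OF c[OF ab(1)] c[OF ab(2)] v] by simp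
      with d show ?thesis by blast
    qed
    show sm: "x \<cdot>\<^sub>v y \<in> ?W" if y: "y \<in> ?W" for x y
    proof -
      from y obtain b where b: "b \<in> carrier A" "y = rep Z b *\<^sub>v v" by blast
      obtain d where d: "d \<in> carrier A" "rep Z d = x \<cdot>\<^sub>m rep Z b" using R.rep_smult b by blast
      have "rep Z d *\<^sub>v v = x \<cdot>\<^sub>v y" using d b c[OF b(1)] v by (auto intro!: eq_vecI)
      with d show ?thesis by blast
    qed
    obtain u where u: "u \<in> carrier A" "rep Z u = 1\<^sub>m (rank Z)" using R.rep_one by blast
    have "rep Z u *\<^sub>v v \<in> ?W" using u by blast
    have z: "0 \<cdot>\<^sub>v v = 0\<^sub>v (rank Z)" using v by auto
    from sm[OF \<open>rep Z u *\<^sub>v v \<in> ?W\<close>, of 0] show "0\<^sub>v (rank Z) \<in> ?W" using u v z by simp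
    show "rep Z a *\<^sub>v y \<in> ?W" if a: "a \<in> carrier A" and y: "y \<in> ?W" for a y
    proof -
      from y obtain b where b: "b \<in> carrier A" "y = rep Z b *\<^sub>v v" by blast
      obtain d where d: "d \<in> carrier A" "rep Z d = rep Z a * rep Z b" using R.rep_mult a b by blast
      have "rep Z d *\<^sub>v v = rep Z a *\<^sub>v y" using d b assoc_mult_mat_vec[OF c[OF a] c[OF b(1)] v] by simp
      with d show ?thesis by blast
    qed
  next
    fix Z' f L assume "f \<in> Hom C Z' Z" "L \<in> carrier_mat (rank Z') (rank Z)" "L * mat_of f = 1\<^sub>m (rank Z')"
      "\<And>w. w \<in> carrier_vec (rank Z) \<Longrightarrow> w \<in> ?W \<longleftrightarrow> mat_of f *\<^sub>v (L *\<^sub>v w) = w"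
    thus thesis by (intro that[of f Z' L]) simp_all
  qed
qed

lemma cyclic_rank_pos:
  assumes Z: "Z \<in> Obj C" and v: "v \<in> carrier_vec (rank Z)" "v \<noteq> 0\<^sub>v (rank Z)"
    and f: "f \<in> Hom C Z' Z" "L \<in> carrier_mat (rank Z') (rank Z)"
    and W: "\<And>w. w \<in> carrier_vec (rank Z) \<Longrightarrow> (\<exists>a \<in> carrier A. rep Z a *\<^sub>v v = w) \<longleftrightarrow> mat_of f *\<^sub>v (L *\<^sub>v w) = w"
  shows "rank Z' > 0"
proof (rule ccontr)
  assume "\<not> rank Z' > 0"
  hence 0: "rank Z' = 0" by simp
  have "\<exists>a \<in> carrier A. rep Z a *\<^sub>v v = v" using rep_one[OF Z] A.A_one v by force
  with W[OF v(1)] have "mat_of f *\<^sub>v (L *\<^sub>v v) = v" by blast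
  moreover have "mat_of f *\<^sub>v (L *\<^sub>v v) = 0\<^sub>v (rank Z)"
    using mat_of_carrier[OF f(1)] f(2) 0 by (intro eq_vecI) (auto simp: scalar_prod_def)
  ultimately show False using v by simp
qed

text \<open>A subobject of least positive rank works: what a nonzero vector generates in it is again
  a subobject of positive rank, hence of the same rank, and an injective map between spaces of equal
  dimension is onto.\<close>

lemma irreducible_subobject:
  assumes X: "X \<in> Obj C" "rank X > 0"
  obtains Z f where "f \<in> Hom C Z X" "is_mono C f" "irreducible_rep (carrier A) (rank Z) (rep Z)"
proof -
  define Q where "Q k \<longleftrightarrow> k > 0 \<and> (\<exists>Z f L. f \<in> Hom C Z X \<and> rank Z = k \<and> L \<in> carrier_mat (rank Z) (rank X) \<and>
    L * mat_of f = 1\<^sub>m (rank Z))" for k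
  have "Q (rank X)" unfolding Q_def
    using X Ide_in[OF X(1)] mat_of_Ide[OF X(1)] by (intro conjI exI[of _ X] exI[of _ "Ide C X"] exI[of _ "1\<^sub>m (rank X)"]) auto
  hence "Q (LEAST k. Q k)" by (rule LeastI)
  then obtain Z f L where Z: "f \<in> Hom C Z X" "rank Z = (LEAST k. Q k)" "L \<in> carrier_mat (rank Z) (rank X)"
    "L * mat_of f = 1\<^sub>m (rank Z)" "rank Z > 0" unfolding Q_def by auto
  note ZO = Hom_Obj(1)[OF Z(1)]
  have "\<exists>a\<in>carrier A. rep Z a *\<^sub>v v = w"
    if v: "v \<in> carrier_vec (rank Z)" "v \<noteq> 0\<^sub>v (rank Z)" and w: "w \<in> carrier_vec (rank Z)" for v w
  proof -
    obtain Z' g K where g: "g \<in> Hom C Z' Z" "K \<in> carrier_mat (rank Z') (rank Z)" "K * mat_of g = 1\<^sub>m (rank Z')"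
      and W: "\<And>w. w \<in> carrier_vec (rank Z) \<Longrightarrow> (\<exists>a \<in> carrier A. rep Z a *\<^sub>v v = w) \<longleftrightarrow> mat_of g *\<^sub>v (K *\<^sub>v w) = w"
      by (rule cyclic_subobject[OF ZO v(1)], rule that)
    note gc = mat_of_carrier[OF g(1)] and fc = mat_of_carrier[OF Z(1)]
    have "Q (rank Z')" unfolding Q_def
    proof (intro conjI exI)
      show "rank Z' > 0" by (rule cyclic_rank_pos[OF ZO v g(1,2) W])
      show "f \<cdot> g \<in> Hom C Z' X" by (rule Comp_in[OF g(1) Z(1)])
      show "K * L \<in> carrier_mat (rank Z') (rank X)" using g Z by simp
      have "K * L * (mat_of f * mat_of g) = K * (L * (mat_of f * mat_of g))"
        by (rule assoc_mult_mat[OF g(2) Z(3) mult_carrier_mat[OF fc gc]])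
      also have "L * (mat_of f * mat_of g) = mat_of g"
        using assoc_mult_mat[OF Z(3) fc gc] Z(4) gc by simp
      finally show "K * L * mat_of (f \<cdot> g) = 1\<^sub>m (rank Z')" using mat_of_Comp[OF g(1) Z(1)] g(3) by simp
    qed simp
    hence "rank Z \<le> rank Z'" using Least_le[of Q "rank Z'"] Z(2) by simp
    moreover have "rank Z' \<le> rank Z" by (rule left_inverse_dim_le[OF gc g(2,3)])
    ultimately have r: "rank Z' = rank Z" by simp
    have "mat_of g * K = 1\<^sub>m (rank Z)"
      using mat_mult_left_right_inverse[of K "rank Z" "mat_of g"] g gc r by simp
    hence "mat_of g *\<^sub>v (K *\<^sub>v w) = w" using assoc_mult_mat_vec[OF gc g(2) w] w by simp
    with W[OF w] show ?thesis by blast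
  qed
  hence "irreducible_rep (carrier A) (rank Z) (rep Z)" unfolding irreducible_rep_def using Z(5) by blast
  moreover have "is_mono C f" by (rule mono_if_left_inverse[OF Z(1,3,4)])
  ultimately show thesis using that Z(1) by blast
qed

lemma is_zero_object_rank:
  assumes "X \<in> Obj C"
  shows "is_zero_object C X \<longleftrightarrow> rank X = 0"
proof
  assume "is_zero_object C X"
  hence "\<exists>!f. f \<in> Hom C X X" using assms by (auto simp: is_zero_object_def)
  hence "Ide C X = Zero C X X" using Ide_in[OF assms] Zero_Hom[OF assms assms] by blast
  hence "1\<^sub>m (rank X) = (0\<^sub>m (rank X) (rank X) :: 'k mat)" using mat_of_Ide[OF assms] mat_of_Zero[OF assms assms] by simp
  hence "(1\<^sub>m (rank X) :: 'k mat) $$ (0,0) = 0\<^sub>m (rank X) (rank X) $$ (0,0)" by simp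
  thus "rank X = 0" by (cases "rank X") auto
next
  assume r: "rank X = 0"
  have "(\<exists>!f. f \<in> Hom C X Y) \<and> (\<exists>!f. f \<in> Hom C Y X)" if Y: "Y \<in> Obj C" for Y
  proof -
    have "f = g" if "f \<in> Hom C X Y" "g \<in> Hom C X Y" for f g
      using mat_of_carrier[OF that(1)] mat_of_carrier[OF that(2)] r by (intro mat_of_inject[OF that]) (auto intro!: eq_matI)
    moreover have "f = g" if "f \<in> Hom C Y X" "g \<in> Hom C Y X" for f g
      using mat_of_carrier[OF that(1)] mat_of_carrier[OF that(2)] r by (intro mat_of_inject[OF that]) (auto intro!: eq_matI)
    ultimately show ?thesis using Zero_Hom[OF assms Y] Zero_Hom[OF Y assms] by blast
  qed
  thus "is_zero_object C X" using assms by (simp add: is_zero_object_def)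
qed

text \<open>Simplicity is a condition on monomorphisms. The submodule generated by a nonzero vector
  is included by one, and its domain is not a zero object, so the inclusion is invertible.\<close>

lemma simple_irreducible:
  assumes X: "is_simple C X"
  shows "irreducible_rep (carrier A) (rank X) (rep X)"
proof -
  have XO: "X \<in> Obj C" and r: "rank X > 0" using X is_zero_object_rank[of X] by (auto simp: is_simple_def)
  have "\<exists>a\<in>carrier A. rep X a *\<^sub>v v = w"
    if v: "v \<in> carrier_vec (rank X)" "v \<noteq> 0\<^sub>v (rank X)" and w: "w \<in> carrier_vec (rank X)" for v w
  proof -
    obtain Z g K where g: "g \<in> Hom C Z X" "K \<in> carrier_mat (rank Z) (rank X)" "K * mat_of g = 1\<^sub>m (rank Z)"
      and W: "\<And>w. w \<in> carrier_vec (rank X) \<Longrightarrow> (\<exists>a \<in> carrier A. rep X a *\<^sub>v v = w) \<longleftrightarrow> mat_of g *\<^sub>v (K *\<^sub>v w) = w"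
      by (rule cyclic_subobject[OF XO v(1)], rule that)
    note gc = mat_of_carrier[OF g(1)] and ZO = Hom_Obj(1)[OF g(1)]
    have "rank Z > 0" by (rule cyclic_rank_pos[OF XO v g(1,2) W])
    hence "\<not> is_zero_object C Z" using is_zero_object_rank[OF ZO] by simp
    moreover have "is_mono C g" by (rule mono_if_left_inverse[OF g])
    ultimately have "is_iso C g" using X ZO g(1) unfolding is_simple_def by blast
    then obtain h where h: "h \<in> Hom C X Z" "g \<cdot> h = Ide C X"
      using g(1) by (auto simp: is_iso_def inverse_arrows_def Hom_def)
    note hc = mat_of_carrier[OF h(1)]
    have gh: "mat_of g * mat_of h = 1\<^sub>m (rank X)" using mat_of_Comp[OF h(1) g(1)] h(2) mat_of_Ide[OF XO] by simp
    have "w = mat_of g *\<^sub>v (mat_of h *\<^sub>v w)" using assoc_mult_mat_vec[OF gc hc w] gh w by simp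
    moreover have "K *\<^sub>v (mat_of g *\<^sub>v (mat_of h *\<^sub>v w)) = mat_of h *\<^sub>v w"
      using assoc_mult_mat_vec[OF g(2) gc, of "mat_of h *\<^sub>v w"] g(3) hc w by simp
    ultimately have "mat_of g *\<^sub>v (K *\<^sub>v w) = w" by simp
    with W[OF w] show ?thesis by blast
  qed
  thus ?thesis unfolding irreducible_rep_def using r by blast
qed

text \<open>Besides the universal property of the cokernel this records that \<iota> is a kernel of
  \<pi>, so the sequence is exact on both sides, and that the rank drops, which drives the later
  induction.\<close>

lemma cokernel_exists:
  assumes i: "\<iota> \<in> Hom C Z X" and L: "L \<in> carrier_mat (rank Z) (rank X)" "L * mat_of \<iota> = 1\<^sub>m (rank Z)"
    and Z: "rank Z > 0"
  obtains W \<pi> where "\<pi> \<in> Hom C X W" "rank W < rank X"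
    "\<And>B x y. x \<in> Hom C W B \<Longrightarrow> y \<in> Hom C W B \<Longrightarrow> x \<cdot> \<pi> = y \<cdot> \<pi> \<Longrightarrow> x = y"
    "\<And>B h. h \<in> Hom C X B \<Longrightarrow> h \<cdot> \<iota> = Zero C Z B \<Longrightarrow> \<exists>h' \<in> Hom C W B. h = h' \<cdot> \<pi>"
    "\<And>V f. f \<in> Hom C V X \<Longrightarrow> \<pi> \<cdot> f = Zero C V W \<Longrightarrow> \<exists>f' \<in> Hom C V Z. f = \<iota> \<cdot> f'"
    "\<pi> \<cdot> \<iota> = Zero C Z W"
proof -
  let ?m = "rank X"
  note XO = Hom_Obj(2)[OF i] and ZO = Hom_Obj(1)[OF i]
  note ic = mat_of_carrier[OF i]
  obtain r p Y where p: "p \<in> carrier_mat r ?m" and Y: "Y \<in> carrier_mat ?m r" and pY: "p * Y = 1\<^sub>m r"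
    and Yp: "Y * p = 1\<^sub>m ?m - mat_of \<iota> * L" and pi: "p * mat_of \<iota> = 0\<^sub>m r (rank Z)"
    by (rule complement_matrix[OF ic L(1,2)])
  note c = rep_carrier[OF XO]
  \<comment> \<open>The kernel of \<open>p\<close> is the range of \<iota>, which is invariant.
    Hence the action descends along \<open>p\<close>.\<close>
  have pa: "(p * rep X a * Y) * p = p * rep X a" if a: "a \<in> carrier A" for a
  proof -
    have pac: "p * rep X a \<in> carrier_mat r ?m" using p c[OF a] by simp
    have "(p * rep X a * Y) * p = (p * rep X a) * (1\<^sub>m ?m - mat_of \<iota> * L)"
      using assoc_mult_mat[OF pac Y p] Yp by simp
    also have "\<dots> = p * rep X a - (p * rep X a) * (mat_of \<iota> * L)"
      using mult_minus_distrib_mat[OF pac one_carrier_mat mult_carrier_mat[OF ic L(1)]] right_mult_one_mat[OF pac] by simp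
    also have "(p * rep X a) * (mat_of \<iota> * L) = (p * rep X a * mat_of \<iota>) * L"
      using assoc_mult_mat[OF pac ic L(1)] by simp
    also have "p * rep X a * mat_of \<iota> = p * (mat_of \<iota> * rep Z a)"
      using assoc_mult_mat[OF p c[OF a] ic] mat_of_intertwines[OF i a] by simp
    also have "\<dots> = 0\<^sub>m r (rank Z)"
      using assoc_mult_mat[OF p ic rep_carrier[OF ZO a]] pi rep_carrier[OF ZO a] by simp
    finally show ?thesis using left_mult_zero_mat[OF L(1), of r] diff_zero_mat[OF pac] by simp
  qed
  have "(r, \<lambda>a. p * rep X a * Y) \<in> fd_modules A"
  proof (rule compressed_module[OF rep_module[OF XO] A.fd_algebra_axioms Y p pY])
    fix a b assume ab: "a \<in> carrier A" "b \<in> carrier A"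
    have q: "p * rep X a * Y \<in> carrier_mat r r" using p c[OF ab(1)] Y by simp
    have "(p * rep X a * Y) * (p * rep X b * Y) = (p * rep X a * Y) * (p * (rep X b * Y))"
      using assoc_mult_mat[OF p c[OF ab(2)] Y] by simp
    also have "\<dots> = ((p * rep X a * Y) * p) * (rep X b * Y)"
      using assoc_mult_mat[OF q p mult_carrier_mat[OF c[OF ab(2)] Y]] by simp
    finally show "p * rep X a * (rep X b * Y) = (p * rep X a * Y) * (p * rep X b * Y)"
      using pa[OF ab(1)] by simp
  qed
  from mat_of_dense[OF this] obtain W S S' where W: "W \<in> Obj C"
    and S: "S \<in> fd_module_maps A (r, \<lambda>a. p * rep X a * Y) (rank W, rep W)"
    and Sc': "S' \<in> carrier_mat r (rank W)"
    and SS: "S * S' = 1\<^sub>m (rank W)" "S' * S = 1\<^sub>m r" by (auto simp: fd_module_maps_def)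
  have Sc: "S \<in> carrier_mat (rank W) r"
    and Si: "\<And>a. a \<in> carrier A \<Longrightarrow> S * (p * rep X a * Y) = rep W a * S" using S by (auto simp: fd_module_maps_def)
  have Sp: "S * p \<in> carrier_mat (rank W) ?m" using Sc p by simp
  obtain \<pi> where \<pi>: "\<pi> \<in> Hom C X W" "mat_of \<pi> = S * p"
  proof (rule mat_of_fullE[OF XO W Sp])
    fix a assume a: "a \<in> carrier A"
    have q: "p * rep X a * Y \<in> carrier_mat r r" using p c[OF a] Y by simp
    have "S * p * rep X a = S * ((p * rep X a * Y) * p)"
      using assoc_mult_mat[OF Sc p c[OF a]] pa[OF a] by simp
    also have "\<dots> = rep W a * S * p"
      using assoc_mult_mat[OF Sc q p] Si[OF a] by simp
    finally show "S * p * rep X a = rep W a * (S * p)"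
      using assoc_mult_mat[OF rep_carrier[OF W a] Sc p] by simp
  qed
  define R where "R = Y * S'"
  have R: "R \<in> carrier_mat ?m (rank W)" using Y Sc' by (simp add: R_def)
  have "S * p * (Y * S') = S * (p * (Y * S'))" by (rule assoc_mult_mat[OF Sc p mult_carrier_mat[OF Y Sc']])
  also have "p * (Y * S') = S'" using assoc_mult_mat[OF p Y Sc'] pY Sc' by simp
  finally have \<pi>R: "mat_of \<pi> * R = 1\<^sub>m (rank W)" using SS \<pi> by (simp add: R_def)
  have "Y * S' * (S * p) = Y * (S' * (S * p))" by (rule assoc_mult_mat[OF Y Sc' mult_carrier_mat[OF Sc p]])
  also have "S' * (S * p) = p" using assoc_mult_mat[OF Sc' Sc p] SS p by simp
  finally have R\<pi>: "R * mat_of \<pi> = 1\<^sub>m ?m - mat_of \<iota> * L" using Yp \<pi> by (simp add: R_def)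
  note \<pi>c = mat_of_carrier[OF \<pi>(1)]
  have iL: "mat_of \<iota> * L \<in> carrier_mat ?m ?m" using ic L by simp
  have \<pi>i: "mat_of \<pi> * mat_of \<iota> = 0\<^sub>m (rank W) (rank Z)"
    using assoc_mult_mat[OF Sc p ic] pi Sc \<pi>(2) by simp
  show thesis
  proof (rule that[OF \<pi>(1)])
    show "rank W < ?m"
    proof (rule ccontr)
      assume "\<not> rank W < ?m"
      moreover have "rank W \<le> ?m" by (rule left_inverse_dim_le[OF R \<pi>c \<pi>R])
      ultimately have e: "rank W = ?m" by simp
      \<comment> \<open>With equal ranks \<pi> would be invertible and \<iota> would vanish, against
        its left inverse and the positive rank of \<open>Z\<close>.\<close>
      have "R * mat_of \<pi> = 1\<^sub>m ?m" using mat_mult_left_right_inverse[of "mat_of \<pi>" ?m R] \<pi>R \<pi>c R e by simp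
      hence "mat_of \<iota> = R * (mat_of \<pi> * mat_of \<iota>)" using assoc_mult_mat[OF R \<pi>c ic] ic by simp
      hence "mat_of \<iota> = 0\<^sub>m ?m (rank Z)" using \<pi>i R by simp
      hence "1\<^sub>m (rank Z) = (0\<^sub>m (rank Z) (rank Z) :: 'k mat)" using L by simp
      hence "(1\<^sub>m (rank Z) :: 'k mat) $$ (0,0) = 0\<^sub>m (rank Z) (rank Z) $$ (0,0)" by simp
      with Z show False by simp
    qed
    show "x = y" if x: "x \<in> Hom C W B" and y: "y \<in> Hom C W B" and e: "x \<cdot> \<pi> = y \<cdot> \<pi>" for B x y
    proof (rule mat_of_inject[OF x y])
      have "mat_of z = mat_of (z \<cdot> \<pi>) * R" if z: "z \<in> Hom C W B" for z
        using mat_of_Comp[OF \<pi>(1) z] assoc_mult_mat[OF mat_of_carrier[OF z] \<pi>c R] \<pi>R mat_of_carrier[OF z] by simp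
      from this[OF x] this[OF y] e show "mat_of x = mat_of y" by simp
    qed
    show "\<exists>h' \<in> Hom C W B. h = h' \<cdot> \<pi>" if h: "h \<in> Hom C X B" and z: "h \<cdot> \<iota> = Zero C Z B" for B h
    proof -
      note hc = mat_of_carrier[OF h] and B = Hom_Obj(2)[OF h]
      have hi: "mat_of h * mat_of \<iota> = 0\<^sub>m (rank B) (rank Z)"
        using mat_of_Comp[OF i h] z mat_of_Zero[OF ZO B] by simp
      have "mat_of h * R * mat_of \<pi> = mat_of h * (1\<^sub>m ?m - mat_of \<iota> * L)"
        using assoc_mult_mat[OF hc R \<pi>c] R\<pi> by simp
      also have "\<dots> = mat_of h - mat_of h * (mat_of \<iota> * L)"
        using mult_minus_distrib_mat[OF hc one_carrier_mat iL] right_mult_one_mat[OF hc] by simp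
      also have "mat_of h * (mat_of \<iota> * L) = 0\<^sub>m (rank B) ?m"
        using assoc_mult_mat[OF hc ic L(1)] hi L(1) by simp
      finally have hR: "mat_of h * R * mat_of \<pi> = mat_of h" using hc by (auto intro!: eq_matI)
      have hRc: "mat_of h * R \<in> carrier_mat (rank B) (rank W)" using hc R by simp
      \<comment> \<open>\<open>mat_of h * R\<close> is a linear factorization. It commutes with the
        action because \<pi> is onto and both \<pi> and \<open>h\<close> are module maps.\<close>
      obtain h' where h': "h' \<in> Hom C W B" "mat_of h' = mat_of h * R"
      proof (rule mat_of_fullE[OF W B hRc])
        fix a assume a: "a \<in> carrier A"
        have "mat_of h * R * rep W a = (mat_of h * R * rep W a) * (mat_of \<pi> * R)"
          using \<pi>R hRc rep_carrier[OF W a] by simp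
        also have "\<dots> = mat_of h * R * (rep W a * mat_of \<pi>) * R"
          using assoc_mult_mat[OF mult_carrier_mat[OF hRc rep_carrier[OF W a]] \<pi>c R]
            assoc_mult_mat[OF hRc rep_carrier[OF W a] \<pi>c] by simp
        also have "mat_of h * R * (rep W a * mat_of \<pi>) = mat_of h * R * mat_of \<pi> * rep X a"
          using mat_of_intertwines[OF \<pi>(1) a] assoc_mult_mat[OF hRc \<pi>c c[OF a]] by simp
        also have "\<dots> = rep B a * mat_of h" using hR mat_of_intertwines[OF h a] by simp
        finally show "mat_of h * R * rep W a = rep B a * (mat_of h * R)"
          using assoc_mult_mat[OF rep_carrier[OF B a] hc R] by simp
      qed
      have "h = h' \<cdot> \<pi>" using hR h' mat_of_Comp[OF \<pi>(1) h'(1)]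
        by (intro mat_of_inject[OF h Comp_in[OF \<pi>(1) h'(1)]]) simp
      with h' show ?thesis by blast
    qed
    show "\<exists>f' \<in> Hom C V Z. f = \<iota> \<cdot> f'" if f: "f \<in> Hom C V X" and z: "\<pi> \<cdot> f = Zero C V W" for V f
    proof -
      note fc = mat_of_carrier[OF f] and V = Hom_Obj(1)[OF f]
      have "mat_of \<pi> * mat_of f = 0\<^sub>m (rank W) (rank V)"
        using mat_of_Comp[OF f \<pi>(1)] z mat_of_Zero[OF V W] by simp
      hence "0\<^sub>m ?m (rank V) = R * mat_of \<pi> * mat_of f" using assoc_mult_mat[OF R \<pi>c fc] R by simp
      also have "\<dots> = mat_of f - mat_of \<iota> * L * mat_of f"
        unfolding R\<pi> using minus_mult_distrib_mat[OF one_carrier_mat iL fc] fc by simp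
      finally have e: "0\<^sub>m ?m (rank V) = mat_of f - mat_of \<iota> * L * mat_of f" .
      have iLfc: "mat_of \<iota> * L * mat_of f \<in> carrier_mat ?m (rank V)" using iL fc by simp
      have iLf: "mat_of \<iota> * (L * mat_of f) = mat_of f"
      proof -
        have "mat_of \<iota> * L * mat_of f = mat_of f"
        proof (rule eq_matI)
          fix u v assume "u < dim_row (mat_of f)" "v < dim_col (mat_of f)"
          with arg_cong[OF e, of "\<lambda>M. M $$ (u,v)"] fc iLfc
          show "(mat_of \<iota> * L * mat_of f) $$ (u,v) = mat_of f $$ (u,v)" by auto
        qed (use fc iLfc in auto)
        thus ?thesis using assoc_mult_mat[OF ic L(1) fc] by simp
      qed
      have Lfc: "L * mat_of f \<in> carrier_mat (rank Z) (rank V)" using L fc by simp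
      \<comment> \<open>Likewise \<open>L * mat_of f\<close> is \<open>A\<close>-linear because
        \<iota> is injective and both \<iota> and \<open>f\<close> are module maps.\<close>
      obtain f' where f': "f' \<in> Hom C V Z" "mat_of f' = L * mat_of f"
      proof (rule mat_of_fullE[OF V ZO Lfc])
        fix a assume a: "a \<in> carrier A"
        have "L * mat_of f * rep V a = L * (rep X a * mat_of f)"
          using assoc_mult_mat[OF L(1) fc rep_carrier[OF V a]] mat_of_intertwines[OF f a] by simp
        also have "\<dots> = L * (rep X a * (mat_of \<iota> * (L * mat_of f)))" using iLf by simp
        also have "rep X a * (mat_of \<iota> * (L * mat_of f)) = mat_of \<iota> * (rep Z a * (L * mat_of f))"
          using assoc_mult_mat[OF c[OF a] ic Lfc] mat_of_intertwines[OF i a] assoc_mult_mat[OF ic rep_carrier[OF ZO a] Lfc]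
          by simp
        also have "L * \<dots> = L * mat_of \<iota> * (rep Z a * (L * mat_of f))"
          using assoc_mult_mat[OF L(1) ic mult_carrier_mat[OF rep_carrier[OF ZO a] Lfc]] by simp
        finally show "L * mat_of f * rep V a = rep Z a * (L * mat_of f)"
          using L(2) left_mult_one_mat[OF mult_carrier_mat[OF rep_carrier[OF ZO a] Lfc]] by simp
      qed
      have "f = \<iota> \<cdot> f'" using iLf f' mat_of_Comp[OF f'(1) i]
        by (intro mat_of_inject[OF f Comp_in[OF f'(1) i]]) simp
      with f' show ?thesis by blast
    qed
    show "\<pi> \<cdot> \<iota> = Zero C Z W"
      using mat_of_Comp[OF i \<pi>(1)] \<pi>i mat_of_Zero[OF ZO W]
      by (intro mat_of_inject[OF Comp_in[OF i \<pi>(1)] Zero_Hom[OF ZO W]]) simp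
  qed
qed

end

lemma index_mult_sum:
  fixes M N :: "'k :: semiring_0 mat"
  assumes "M \<in> carrier_mat m n" "N \<in> carrier_mat n p" "i < m" "j < p"
  shows "(M * N) $$ (i,j) = (\<Sum>k<n. M $$ (i,k) * N $$ (k,j))"
  using assms by (simp add: scalar_prod_def lessThan_atLeast0)

lemma mult_unit_mat_index:
  fixes M :: "'k :: semiring_1 mat"
  assumes "M \<in> carrier_mat m d" "i < d" "j < d" "u < m" "v < d"
  shows "(M * mat d d (\<lambda>(u,v). if u = i \<and> v = j then 1 else 0)) $$ (u,v) = (if v = j then M $$ (u,i) else 0)"
proof -
  have "(M * mat d d (\<lambda>(u,v). if u = i \<and> v = j then 1 else 0)) $$ (u,v) =
      (\<Sum>k<d. if k = i then (if v = j then M $$ (u,i) else 0) else 0)"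
    using assms by (subst index_mult_sum[of _ m d _ d]) (auto simp: if_distrib[of "\<lambda>x. _ * x"] cong: if_cong)
  thus ?thesis using assms by simp
qed

lemma unit_mat_mult_index:
  fixes M :: "'k :: semiring_1 mat"
  assumes "M \<in> carrier_mat d m" "i < d" "j < d" "u < d" "v < m"
  shows "(mat d d (\<lambda>(u,v). if u = i \<and> v = j then 1 else 0) * M) $$ (u,v) = (if u = i then M $$ (j,v) else 0)"
proof -
  have "(mat d d (\<lambda>(u,v). if u = i \<and> v = j then 1 else 0) * M) $$ (u,v) =
      (\<Sum>k<d. if k = j then (if u = i then M $$ (j,v) else 0) else 0)"
    using assms by (subst index_mult_sum[of _ d d _ m]) (auto simp: if_distrib[of "\<lambda>x. x * _"] cong: if_cong)
  thus ?thesis using assms by simp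
qed

section \<open>Modules on which the annihilator of an irreducible module vanishes\<close>

context represented_category
begin

text \<open>The action on \<open>X\<close> factors through the image of \<open>A\<close> in the
  matrices of \<open>I\<close>.\<close>

definition annihilated_with :: "'o \<Rightarrow> 'o \<Rightarrow> bool"
  where "annihilated_with I X \<longleftrightarrow>
    (\<forall>a \<in> carrier A. rep I a = 0\<^sub>m (rank I) (rank I) \<longrightarrow> rep X a = 0\<^sub>m (rank X) (rank X))"

text \<open>\<open>z\<close> is chosen before \<open>X\<close>, since the same element has to serve
  both for \<open>I\<close> and for the module to which a relation is transferred.\<close>

lemma algebra_lc:
  assumes "\<And>l. l < N \<Longrightarrow> y l \<in> carrier A"
  shows "\<exists>z \<in> carrier A. \<forall>X \<in> Obj C. rep X z = mat_lc (rank X) (rank X) N t (\<lambda>l. rep X (y l))"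
  using assms
proof (induction N)
  case 0
  have "rep X (0 \<odot>\<^bsub>A\<^esub> \<one>\<^bsub>A\<^esub>) = mat_lc (rank X) (rank X) 0 t (\<lambda>l. rep X (y l))" if "X \<in> Obj C" for X
    using rep_smult[OF that A.A_one, of 0] rep_carrier[OF that A.A_one] by (auto intro!: eq_matI)
  moreover have "0 \<odot>\<^bsub>A\<^esub> \<one>\<^bsub>A\<^esub> \<in> carrier A" using A.smult_closed[OF _ A.A_one, of 0] by simp
  ultimately show ?case by blast
next
  case (Suc N)
  then obtain z where z: "z \<in> carrier A" "\<And>X. X \<in> Obj C \<Longrightarrow> rep X z = mat_lc (rank X) (rank X) N t (\<lambda>l. rep X (y l))"
    by (metis less_Suc_eq)
  have y: "y N \<in> carrier A" using Suc.prems by simp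
  have ty: "t N \<odot>\<^bsub>A\<^esub> y N \<in> carrier A" using A.smult_closed[OF _ y, of "t N"] by simp
  have "rep X (z \<oplus>\<^bsub>A\<^esub> t N \<odot>\<^bsub>A\<^esub> y N) = mat_lc (rank X) (rank X) (Suc N) t (\<lambda>l. rep X (y l))" if X: "X \<in> Obj C" for X
    using rep_add[OF X z(1) ty] z(2)[OF X] rep_smult[OF X y, of "t N"] rep_carrier[OF X y] by (auto intro!: eq_matI)
  moreover have "z \<oplus>\<^bsub>A\<^esub> t N \<odot>\<^bsub>A\<^esub> y N \<in> carrier A" using ring.ring_simprules(1)[OF A.ring_A z(1) ty] .
  ultimately show ?case by blast
qed

text \<open>The difference of the two sides is the action of one algebra element that kills
  \<open>I\<close>, hence kills \<open>X\<close>. Identities between matrix units can therefore be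
  checked on \<open>I\<close>, where they are explicit.\<close>

lemma annihilated_transfer:
  assumes IX: "annihilated_with I X" "I \<in> Obj C" "X \<in> Obj C"
    and x: "x \<in> carrier A" and y: "\<And>l. l < N \<Longrightarrow> y l \<in> carrier A"
    and e: "rep I x = mat_lc (rank I) (rank I) N t (\<lambda>l. rep I (y l))"
  shows "rep X x = mat_lc (rank X) (rank X) N t (\<lambda>l. rep X (y l))"
proof -
  obtain z where z: "z \<in> carrier A" "\<And>X. X \<in> Obj C \<Longrightarrow> rep X z = mat_lc (rank X) (rank X) N t (\<lambda>l. rep X (y l))"
    using algebra_lc[of N y t] y by blast
  have mz: "(-1) \<odot>\<^bsub>A\<^esub> z \<in> carrier A" using A.smult_closed[OF _ z(1), of "-1"] by simp
  define d where "d = x \<oplus>\<^bsub>A\<^esub> (-1) \<odot>\<^bsub>A\<^esub> z"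
  have d: "d \<in> carrier A" unfolding d_def using ring.ring_simprules(1)[OF A.ring_A x mz] .
  have rd: "rep Y d = rep Y x + (-1) \<cdot>\<^sub>m rep Y z" if "Y \<in> Obj C" for Y
    unfolding d_def using rep_add[OF that x mz] rep_smult[OF that z(1), of "-1"] by simp
  have "rep I d = 0\<^sub>m (rank I) (rank I)"
    unfolding rd[OF IX(2)] e z(2)[OF IX(2)] by (auto intro!: eq_matI)
  hence "rep X d = 0\<^sub>m (rank X) (rank X)" using IX(1) d unfolding annihilated_with_def by blast
  hence 0: "rep X x + (-1) \<cdot>\<^sub>m rep X z = 0\<^sub>m (rank X) (rank X)" using rd[OF IX(3)] by simp
  have "rep X x = rep X z"
  proof (rule eq_matI)
    fix u v assume "u < dim_row (rep X z)" "v < dim_col (rep X z)"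
    with arg_cong[OF 0, of "\<lambda>M. M $$ (u,v)"] rep_carrier[OF IX(3) x] rep_carrier[OF IX(3) z(1)]
    show "rep X x $$ (u,v) = rep X z $$ (u,v)" by auto
  qed (use rep_carrier[OF IX(3) x] rep_carrier[OF IX(3) z(1)] in auto)
  thus ?thesis using z(2)[OF IX(3)] by simp
qed

lemma matrix_units:
  assumes I: "I \<in> Obj C" "irreducible_rep (carrier A) (rank I) (rep I)"
  obtains e where "\<And>i j. e i j \<in> carrier A"
    "\<And>i j. rep I (e i j) = mat (rank I) (rank I) (\<lambda>(u,v). if u = i \<and> v = j then 1 else 0)"
proof -
  have "\<forall>i j. \<exists>a \<in> carrier A. rep I a = mat (rank I) (rank I) (\<lambda>(u,v). if u = i \<and> v = j then 1 else 0)"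
    using burnside_rep[OF I] by auto
  thus thesis using that by metis
qed

context
  fixes I X e
  assumes I: "I \<in> Obj C" "irreducible_rep (carrier A) (rank I) (rep I)" and X: "X \<in> Obj C"
    and ann: "annihilated_with I X"
    and e: "\<And>i j. e i j \<in> carrier A"
      "\<And>i j. rep I (e i j) = mat (rank I) (rank I) (\<lambda>(u,v). if u = i \<and> v = j then 1 else 0)"
begin

lemma e_carrier: "rep X (e i j) \<in> carrier_mat (rank X) (rank X)"
  using rep_carrier[OF X e(1)] .

text \<open>The multiplication rule of a matrix algebra: \<open>c\<close> times the unit at
  \<open>(i,j)\<close> is a combination of the units at \<open>(k,j)\<close> with coefficients from
  column \<open>i\<close> of \<open>c\<close>. It is verified on \<open>I\<close> and transferred;
  multiplication on the right is dual.\<close>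

lemma left_mult_unit:
  assumes c: "c \<in> carrier A" and ij: "i < rank I" "j < rank I"
  shows "rep X c * rep X (e i j) = mat_lc (rank X) (rank X) (rank I) (\<lambda>k. rep I c $$ (k,i)) (\<lambda>k. rep X (e k j))"
proof -
  have "rep I (c \<otimes>\<^bsub>A\<^esub> e i j) = mat_lc (rank I) (rank I) (rank I) (\<lambda>k. rep I c $$ (k,i)) (\<lambda>k. rep I (e k j))"
  proof (rule eq_matI)
    fix u v assume "u < dim_row (mat_lc (rank I) (rank I) (rank I) (\<lambda>k. rep I c $$ (k,i)) (\<lambda>k. rep I (e k j)))"
      "v < dim_col (mat_lc (rank I) (rank I) (rank I) (\<lambda>k. rep I c $$ (k,i)) (\<lambda>k. rep I (e k j)))"
    hence uv: "u < rank I" "v < rank I" by auto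
    have "(\<Sum>k<rank I. rep I c $$ (k,i) * rep I (e k j) $$ (u,v)) =
        (\<Sum>k<rank I. if k = u then (if v = j then rep I c $$ (u,i) else 0) else 0)"
      using uv by (intro sum.cong) (auto simp: e(2))
    thus "rep I (c \<otimes>\<^bsub>A\<^esub> e i j) $$ (u,v) = mat_lc (rank I) (rank I) (rank I) (\<lambda>k. rep I c $$ (k,i)) (\<lambda>k. rep I (e k j)) $$ (u,v)"
      unfolding rep_mult[OF I(1) c e(1)] using mult_unit_mat_index[OF rep_carrier[OF I(1) c] ij uv] uv by (simp add: e(2))
  qed (use rep_carrier[OF I(1) A.A_mult[OF c e(1)], of i j] in auto)
  from annihilated_transfer[OF ann I(1) X A.A_mult[OF c e(1)] e(1) this]
  show ?thesis using rep_mult[OF X c e(1)] by simp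
qed

lemma right_mult_unit:
  assumes c: "c \<in> carrier A" and ij: "i < rank I" "j < rank I"
  shows "rep X (e i j) * rep X c = mat_lc (rank X) (rank X) (rank I) (\<lambda>k. rep I c $$ (j,k)) (\<lambda>k. rep X (e i k))"
proof -
  have "rep I (e i j \<otimes>\<^bsub>A\<^esub> c) = mat_lc (rank I) (rank I) (rank I) (\<lambda>k. rep I c $$ (j,k)) (\<lambda>k. rep I (e i k))"
  proof (rule eq_matI)
    fix u v assume "u < dim_row (mat_lc (rank I) (rank I) (rank I) (\<lambda>k. rep I c $$ (j,k)) (\<lambda>k. rep I (e i k)))"
      "v < dim_col (mat_lc (rank I) (rank I) (rank I) (\<lambda>k. rep I c $$ (j,k)) (\<lambda>k. rep I (e i k)))"
    hence uv: "u < rank I" "v < rank I" by auto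
    have "(\<Sum>k<rank I. rep I c $$ (j,k) * rep I (e i k) $$ (u,v)) =
        (\<Sum>k<rank I. if k = v then (if u = i then rep I c $$ (j,v) else 0) else 0)"
      using uv by (intro sum.cong) (auto simp: e(2))
    thus "rep I (e i j \<otimes>\<^bsub>A\<^esub> c) $$ (u,v) = mat_lc (rank I) (rank I) (rank I) (\<lambda>k. rep I c $$ (j,k)) (\<lambda>k. rep I (e i k)) $$ (u,v)"
      unfolding rep_mult[OF I(1) e(1) c] using unit_mat_mult_index[OF rep_carrier[OF I(1) c] ij uv] uv by (simp add: e(2))
  qed (use rep_carrier[OF I(1) A.A_mult[OF e(1) c], of i j] in auto)
  from annihilated_transfer[OF ann I(1) X A.A_mult[OF e(1) c] e(1) this]
  show ?thesis using rep_mult[OF X e(1) c] by simp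
qed

lemma unit_mult_unit:
  assumes "i < rank I" "j < rank I" "k < rank I" "l < rank I"
  shows "rep X (e i j) * rep X (e k l) = (if j = k then rep X (e i l) else 0\<^sub>m (rank X) (rank X))"
proof -
  have "rep X (e i j) * rep X (e k l) = mat_lc (rank X) (rank X) (rank I) (\<lambda>k'. if j = k \<and> k' = l then 1 else 0) (\<lambda>k'. rep X (e i k'))"
    unfolding right_mult_unit[OF e(1) assms(1,2)] using assms by (intro mat_lc_cong) (auto simp: e(2))
  also have "\<dots> = (if j = k then rep X (e i l) else 0\<^sub>m (rank X) (rank X))"
    using e_carrier[of i l] assms(4)
    by (auto simp: if_distrib[of "\<lambda>x. x * _"] cong: if_cong intro!: eq_matI)
  finally show ?thesis .
qed

lemma unit_sum: "mat_lc (rank X) (rank X) (rank I) (\<lambda>_. 1) (\<lambda>i. rep X (e i i)) = 1\<^sub>m (rank X)"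
proof -
  have "rep I (\<one>\<^bsub>A\<^esub>) = mat_lc (rank I) (rank I) (rank I) (\<lambda>_. 1) (\<lambda>i. rep I (e i i))"
    unfolding rep_one[OF I(1)] e(2) by (auto cong: conj_cong intro!: eq_matI)
  from annihilated_transfer[OF ann I(1) X A.A_one e(1) this] show ?thesis using rep_one[OF X] by simp
qed

text \<open>For fixed \<open>z\<close> the vectors \<open>rep X (e j z) *\<^sub>v v\<close>
  transform like the standard basis of \<open>I\<close>, by \<open>left_mult_unit\<close>.\<close>

lemma map_from_unit:
  assumes v: "v \<in> carrier_vec (rank X)" and z: "z < rank I"
  obtains w where "w \<in> Hom C I X" "mat_of w = mat (rank X) (rank I) (\<lambda>(u,j). (rep X (e j z) *\<^sub>v v) $ u)"
proof (rule mat_of_fullE[OF I(1) X])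
  let ?w = "mat (rank X) (rank I) (\<lambda>(u,j). (rep X (e j z) *\<^sub>v v) $ u)"
  show "?w \<in> carrier_mat (rank X) (rank I)" by simp
  fix c assume c: "c \<in> carrier A"
  note cX = rep_carrier[OF X c] and cI = rep_carrier[OF I(1) c]
  show "?w * rep I c = rep X c * ?w"
  proof (rule eq_matI)
    fix u j assume "u < dim_row (rep X c * ?w)" "j < dim_col (rep X c * ?w)"
    hence uj: "u < rank X" "j < rank I" using cX by auto
    have "col ?w j = rep X (e j z) *\<^sub>v v" using uj e_carrier[of j z] by (intro eq_vecI) auto
    hence "(rep X c * ?w) $$ (u,j) = (rep X c *\<^sub>v (rep X (e j z) *\<^sub>v v)) $ u" using uj cX by simp
    also have "\<dots> = ((rep X c * rep X (e j z)) *\<^sub>v v) $ u" using assoc_mult_mat_vec[OF cX e_carrier v] by simp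
    also have "\<dots> = (\<Sum>l<rank X. \<Sum>k<rank I. rep I c $$ (k,j) * rep X (e k z) $$ (u,l) * v $ l)"
      unfolding left_mult_unit[OF c uj(2) z] using uj v
      by (simp add: scalar_prod_def lessThan_atLeast0 sum_distrib_right)
    also have "\<dots> = (\<Sum>k<rank I. \<Sum>l<rank X. rep I c $$ (k,j) * rep X (e k z) $$ (u,l) * v $ l)"
      by (rule sum.swap)
    also have "\<dots> = (?w * rep I c) $$ (u,j)"
      using uj cI v carrier_matD[OF e_carrier]
      by (auto simp: scalar_prod_def lessThan_atLeast0 sum_distrib_left sum_distrib_right ac_simps intro!: sum.cong)
    finally show "(?w * rep I c) $$ (u,j) = (rep X c * ?w) $$ (u,j)" by simp
  qed (use cX cI in auto)
qed (rule that)

text \<open>The images of maps from \<open>I\<close> span \<open>X\<close>: a vector is the sum over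
  \<open>j\<close> of its images under \<open>e j j\<close>, and \<open>e j j\<close> acts as
  \<open>e j 0\<close> after \<open>e 0 j\<close>, so each summand lies in such an image.\<close>

lemma maps_from_unit_jointly_epi:
  assumes x: "x \<in> Hom C X B" and y: "y \<in> Hom C X B" and xy: "\<And>w. w \<in> Hom C I X \<Longrightarrow> x \<cdot> w = y \<cdot> w"
  shows "x = y"
proof (rule mat_of_inject[OF x y])
  note xc = mat_of_carrier[OF x] and yc = mat_of_carrier[OF y]
  have z: "0 < rank I" using I(2) by (simp add: irreducible_rep_def)
  have e0: "mat_of x * rep X (e j 0) = mat_of y * rep X (e j 0)" if j: "j < rank I" for j
  proof (rule mat_eq_by_vec)
    fix v :: "'k vec" assume v: "v \<in> carrier_vec (rank X)"
    obtain w where w: "w \<in> Hom C I X" "mat_of w = mat (rank X) (rank I) (\<lambda>(u,j). (rep X (e j 0) *\<^sub>v v) $ u)"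
      by (rule map_from_unit[OF v z])
    have "col (mat_of w) j = rep X (e j 0) *\<^sub>v v" unfolding w(2) using j e_carrier[of j 0] by (intro eq_vecI) auto
    moreover have "col (mat_of h * mat_of w) j = mat_of h *\<^sub>v col (mat_of w) j" if "h \<in> Hom C X B" for h
      using col_mult2[OF mat_of_carrier[OF that] mat_of_carrier[OF w(1)] j] .
    moreover have "mat_of x * mat_of w = mat_of y * mat_of w"
      using mat_of_Comp[OF w(1) x] mat_of_Comp[OF w(1) y] xy[OF w(1)] by simp
    ultimately have "mat_of x *\<^sub>v (rep X (e j 0) *\<^sub>v v) = mat_of y *\<^sub>v (rep X (e j 0) *\<^sub>v v)" using x y by metis
    thus "(mat_of x * rep X (e j 0)) *\<^sub>v v = (mat_of y * rep X (e j 0)) *\<^sub>v v"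
      using assoc_mult_mat_vec[OF xc e_carrier v] assoc_mult_mat_vec[OF yc e_carrier v] by simp
  qed (rule mult_carrier_mat[OF xc e_carrier] mult_carrier_mat[OF yc e_carrier])+
  have "mat_of x * rep X (e j j) = mat_of y * rep X (e j j)" if j: "j < rank I" for j
  proof -
    have "rep X (e j j) = rep X (e j 0) * rep X (e 0 j)" using unit_mult_unit[OF j z z j] by simp
    thus ?thesis using e0[OF j] assoc_mult_mat[OF xc e_carrier e_carrier] assoc_mult_mat[OF yc e_carrier e_carrier]
      by metis
  qed
  hence "mat_lc (rank B) (rank X) (rank I) (\<lambda>_. 1) (\<lambda>j. mat_of x * rep X (e j j)) =
    mat_lc (rank B) (rank X) (rank I) (\<lambda>_. 1) (\<lambda>j. mat_of y * rep X (e j j))"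
    by (intro mat_lc_cong) auto
  hence "mat_of x * 1\<^sub>m (rank X) = mat_of y * 1\<^sub>m (rank X)"
    using mult_mat_lc[OF xc, of "rank I" "\<lambda>i. rep X (e i i)" "rank X" "\<lambda>_. 1"]
      mult_mat_lc[OF yc, of "rank I" "\<lambda>i. rep X (e i i)" "rank X" "\<lambda>_. 1"] unit_sum e_carrier by simp
  thus "mat_of x = mat_of y" using right_mult_one_mat[OF xc] right_mult_one_mat[OF yc] by simp
qed

text \<open>The columns of \<open>Y\<close> form a basis of the range of the idempotent \<open>e\<^sub>0\<^sub>0\<close> acting on \<open>X\<close>; each of
  them generates a copy of \<open>I\<close>.\<close>

lemma direct_sum_of_units: "\<exists>r. is_direct_sum_copies C r I X"
proof -
  let ?m = "rank X" and ?d = "rank I"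
  let ?E = "rep X (e 0 0)"
  have z: "0 < ?d" using I(2) by (simp add: irreducible_rep_def)
  note Ec = e_carrier[of 0 0]
  have EE: "?E * ?E = ?E" using unit_mult_unit[OF z z z z] by simp
  define W where "W = {w \<in> carrier_vec ?m. ?E *\<^sub>v w = w}"
  obtain r Y L2 where Y: "Y \<in> carrier_mat ?m r" and L2: "L2 \<in> carrier_mat r ?m" and L2Y: "L2 * Y = 1\<^sub>m r"
    and W: "\<And>w. w \<in> carrier_vec ?m \<Longrightarrow> w \<in> W \<longleftrightarrow> Y *\<^sub>v (L2 *\<^sub>v w) = w"
  proof (rule subspace_matrix[of W ?m])
    show "W \<subseteq> carrier_vec ?m" by (auto simp: W_def)
    show "0\<^sub>v ?m \<in> W" using Ec by (auto simp: W_def)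
    show "v + w \<in> W" if "v \<in> W" "w \<in> W" for v w
      using that Ec by (auto simp: W_def mult_add_distrib_mat_vec)
    show "c \<cdot>\<^sub>v v \<in> W" if "v \<in> W" for c v
      using that Ec by (auto simp: W_def mult_mat_vec)
  qed blast
  \<comment> \<open>Composing with the idempotent makes the retraction vanish on its kernel. Then
    \<open>Y * L\<close> is the idempotent itself and not just some projection onto its
    range.\<close>
  define L where "L = L2 * ?E"
  have L: "L \<in> carrier_mat r ?m" using L2 Ec by (simp add: L_def)
  have YL: "Y * L = ?E"
  proof (rule mat_eq_by_vec)
    fix v :: "'k vec" assume v: "v \<in> carrier_vec ?m"
    have "?E *\<^sub>v v \<in> W" using Ec v EE assoc_mult_mat_vec[OF Ec Ec v] by (simp add: W_def)
    hence "Y *\<^sub>v (L2 *\<^sub>v (?E *\<^sub>v v)) = ?E *\<^sub>v v" using W Ec v by simp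
    thus "(Y * L) *\<^sub>v v = ?E *\<^sub>v v"
      unfolding L_def using assoc_mult_mat_vec[OF Y mult_carrier_mat[OF L2 Ec] v] assoc_mult_mat_vec[OF L2 Ec v] by simp
  qed (use Y L Ec in auto)
  have EY: "?E * Y = Y"
  proof (rule mat_eq_by_vec)
    fix v :: "'k vec" assume v: "v \<in> carrier_vec r"
    have "L2 *\<^sub>v (Y *\<^sub>v v) = v" using assoc_mult_mat_vec[OF L2 Y v] L2Y v by simp
    hence "Y *\<^sub>v v \<in> W" using W[of "Y *\<^sub>v v"] Y v by simp
    thus "(?E * Y) *\<^sub>v v = Y *\<^sub>v v" using assoc_mult_mat_vec[OF Ec Y v] by (simp add: W_def)
  qed (use Y Ec in auto)
  have LY: "L * Y = 1\<^sub>m r" unfolding L_def using assoc_mult_mat[OF L2 Ec Y] EY L2Y by simp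
  have LE: "L * ?E = L" unfolding L_def using assoc_mult_mat[OF L2 Ec Ec] EE by simp
  have "\<exists>w \<in> Hom C I X. mat_of w = mat ?m ?d (\<lambda>(u,j). (rep X (e j 0) * Y) $$ (u,l))" if l: "l < r" for l
  proof -
    have v: "col Y l \<in> carrier_vec ?m" using Y by (metis carrier_matD(1) carrier_vec_dim_vec dim_col)
    have "mat ?m ?d (\<lambda>(u,j). (rep X (e j 0) *\<^sub>v col Y l) $ u) = mat ?m ?d (\<lambda>(u,j). (rep X (e j 0) * Y) $$ (u,l))"
      using l Y carrier_matD[OF e_carrier] by (auto intro!: eq_matI)
    thus ?thesis using map_from_unit[OF v z] by metis
  qed
  then obtain inj where inj: "\<And>l. l < r \<Longrightarrow> inj l \<in> Hom C I X"
    "\<And>l. l < r \<Longrightarrow> mat_of (inj l) = mat ?m ?d (\<lambda>(u,j). (rep X (e j 0) * Y) $$ (u,l))" by metis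
  \<comment> \<open>Dual to the injections: coordinate \<open>j\<close> of the \<open>l\<close>-th
    projection of a vector is the \<open>l\<close>-th coordinate, with respect to \<open>Y\<close>,
    of its image under \<open>e 0 j\<close>.\<close>
  have "\<exists>p \<in> Hom C X I. mat_of p = mat ?d ?m (\<lambda>(j,u). (L * rep X (e 0 j)) $$ (l,u))" if l: "l < r" for l
  proof -
    let ?p = "mat ?d ?m (\<lambda>(j,u). (L * rep X (e 0 j)) $$ (l,u))"
    have "?p * rep X c = rep I c * ?p" if c: "c \<in> carrier A" for c
    proof (rule eq_matI)
      note cX = rep_carrier[OF X c] and cI = rep_carrier[OF I(1) c]
      fix j u assume "j < dim_row (rep I c * ?p)" "u < dim_col (rep I c * ?p)"
      hence ju: "j < ?d" "u < ?m" using cI by auto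
      have "(?p * rep X c) $$ (j,u) = (L * rep X (e 0 j) * rep X c) $$ (l,u)"
        using ju l index_mult_sum[OF mult_carrier_mat[OF L e_carrier[of 0 j]] cX, of l u]
          index_mult_sum[of ?p ?d ?m "rep X c" ?m j u] cX by (simp del: index_mult_mat(1))
      also have "\<dots> = (L * (rep X (e 0 j) * rep X c)) $$ (l,u)" using assoc_mult_mat[OF L e_carrier cX] by simp
      also have "\<dots> = mat_lc r ?m ?d (\<lambda>k. rep I c $$ (j,k)) (\<lambda>k. L * rep X (e 0 k)) $$ (l,u)"
        unfolding right_mult_unit[OF c z ju(1)]
        using mult_mat_lc[OF L, of ?d "\<lambda>k. rep X (e 0 k)" ?m "\<lambda>k. rep I c $$ (j,k)"] e_carrier by simp
      also have "\<dots> = (rep I c * ?p) $$ (j,u)"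
        using ju l index_mult_sum[OF cI, of ?p ?m j u] by (simp del: index_mult_mat(1))
      finally show "(?p * rep X c) $$ (j,u) = (rep I c * ?p) $$ (j,u)" .
    qed (use rep_carrier[OF X c] rep_carrier[OF I(1) c] in auto)
    thus ?thesis using mat_of_fullE[OF X I(1), of ?p] by (metis mat_carrier)
  qed
  then obtain pr where pr: "\<And>l. l < r \<Longrightarrow> pr l \<in> Hom C X I"
    "\<And>l. l < r \<Longrightarrow> mat_of (pr l) = mat ?d ?m (\<lambda>(j,u). (L * rep X (e 0 j)) $$ (l,u))" by metis
  have pi: "pr l \<cdot> inj l' = (if l = l' then Ide C I else Zero C I I)" if l: "l < r" "l' < r" for l l'
  proof -
    have "mat_of (pr l) * mat_of (inj l') = (if l = l' then 1\<^sub>m ?d else 0\<^sub>m ?d ?d)"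
    proof (rule eq_matI)
      fix i j assume "i < dim_row (if l = l' then 1\<^sub>m ?d else (0\<^sub>m ?d ?d :: 'k mat))"
        "j < dim_col (if l = l' then 1\<^sub>m ?d else (0\<^sub>m ?d ?d :: 'k mat))"
      hence ij: "i < ?d" "j < ?d" by (auto split: if_splits)
      have c1: "L * rep X (e 0 i) \<in> carrier_mat r ?m" and c2: "rep X (e j 0) * Y \<in> carrier_mat ?m r"
        by (rule mult_carrier_mat[OF L e_carrier], rule mult_carrier_mat[OF e_carrier Y])
      have "(mat_of (pr l) * mat_of (inj l')) $$ (i,j) = (L * rep X (e 0 i) * (rep X (e j 0) * Y)) $$ (l,l')"
        using index_mult_sum[OF mat_of_carrier[OF pr(1)[OF l(1)]] mat_of_carrier[OF inj(1)[OF l(2)]] ij]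
          index_mult_sum[OF c1 c2 l] pr(2)[OF l(1)] inj(2)[OF l(2)] ij by (simp del: index_mult_mat(1))
      also have "L * rep X (e 0 i) * (rep X (e j 0) * Y) = L * ((rep X (e 0 i) * rep X (e j 0)) * Y)"
        using assoc_mult_mat[OF L e_carrier c2] assoc_mult_mat[OF e_carrier e_carrier Y] by simp
      also have "\<dots> = (if i = j then 1\<^sub>m r else 0\<^sub>m r r)"
        using unit_mult_unit[OF z ij z] EY LY left_mult_zero_mat[OF Y, of ?m] right_mult_zero_mat[OF L, of r] by simp
      finally show "(mat_of (pr l) * mat_of (inj l')) $$ (i,j) = (if l = l' then 1\<^sub>m ?d else 0\<^sub>m ?d ?d) $$ (i,j)"
        using ij l by auto
    qed (auto simp: pr(2)[OF l(1)] inj(2)[OF l(2)])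
    hence "mat_of (pr l \<cdot> inj l') = mat_of (if l = l' then Ide C I else Zero C I I)"
      using mat_of_Comp[OF inj(1)[OF l(2)] pr(1)[OF l(1)]] mat_of_Ide[OF I(1)] mat_of_Zero[OF I(1) I(1)] by simp
    thus ?thesis using Comp_in[OF inj(1)[OF l(2)] pr(1)[OF l(1)]] Ide_in[OF I(1)] Zero_Hom[OF I(1) I(1)]
      by (intro mat_of_inject[of _ I I]) auto
  qed
  have ip: "inj l \<cdot> pr l \<in> Hom C X X" if "l < r" for l using Comp_in[OF pr(1) inj(1)] that by blast
  have "mat_of (finsum (hom_space C X X) (\<lambda>l. inj l \<cdot> pr l) {..<r}) = 1\<^sub>m ?m"
  proof -
    have "mat_lc ?m ?m r (\<lambda>_. 1) (\<lambda>l. mat_of (inj l \<cdot> pr l)) = mat_lc ?m ?m ?d (\<lambda>_. 1) (\<lambda>i. rep X (e i i))"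
    proof (rule eq_matI)
      fix u v assume "u < dim_row (mat_lc ?m ?m ?d (\<lambda>_. 1) (\<lambda>i. rep X (e i i)))" "v < dim_col (mat_lc ?m ?m ?d (\<lambda>_. 1) (\<lambda>i. rep X (e i i)))"
      hence uv: "u < ?m" "v < ?m" by auto
      have "mat_lc ?m ?m r (\<lambda>_. 1) (\<lambda>l. mat_of (inj l \<cdot> pr l)) $$ (u,v) =
        (\<Sum>l<r. \<Sum>j<?d. (rep X (e j 0) * Y) $$ (u,l) * (L * rep X (e 0 j)) $$ (l,v))"
      proof -
        have "mat_of (inj l \<cdot> pr l) $$ (u,v) = (\<Sum>j<?d. (rep X (e j 0) * Y) $$ (u,l) * (L * rep X (e 0 j)) $$ (l,v))"
          if l: "l < r" for l
          using index_mult_sum[OF mat_of_carrier[OF inj(1)[OF l]] mat_of_carrier[OF pr(1)[OF l]] uv]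
            mat_of_Comp[OF pr(1)[OF l] inj(1)[OF l]] pr(2)[OF l] inj(2)[OF l] uv by (simp del: index_mult_mat(1))
        thus ?thesis using uv by simp
      qed
      also have "\<dots> = (\<Sum>j<?d. \<Sum>l<r. (rep X (e j 0) * Y) $$ (u,l) * (L * rep X (e 0 j)) $$ (l,v))"
        by (rule sum.swap)
      \<comment> \<open>The sum over \<open>l\<close> inserts \<open>Y * L\<close>, the action of
        \<open>e 0 0\<close>, between those of \<open>e j 0\<close> and \<open>e 0 j\<close>; the
        product is the action of \<open>e j j\<close>.\<close>
      also have "\<dots> = (\<Sum>j<?d. rep X (e j j) $$ (u,v))"
      proof (rule sum.cong)
        fix j assume "j \<in> {..<?d}"
        hence j: "j < ?d" by simp
        have c1: "L * rep X (e 0 j) \<in> carrier_mat r ?m" and c2: "rep X (e j 0) * Y \<in> carrier_mat ?m r"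
          by (rule mult_carrier_mat[OF L e_carrier], rule mult_carrier_mat[OF e_carrier Y])
        have "(\<Sum>l<r. (rep X (e j 0) * Y) $$ (u,l) * (L * rep X (e 0 j)) $$ (l,v)) =
          ((rep X (e j 0) * Y) * (L * rep X (e 0 j))) $$ (u,v)"
          by (rule index_mult_sum[OF c2 c1 uv, symmetric])
        also have "(rep X (e j 0) * Y) * (L * rep X (e 0 j)) = rep X (e j 0) * ((Y * L) * rep X (e 0 j))"
          using assoc_mult_mat[OF e_carrier Y c1] assoc_mult_mat[OF Y L e_carrier] by simp
        also have "\<dots> = rep X (e j j)"
          using unit_mult_unit[OF z z z j] unit_mult_unit[OF j z z j] YL by simp
        finally show "(\<Sum>l<r. (rep X (e j 0) * Y) $$ (u,l) * (L * rep X (e 0 j)) $$ (l,v)) = rep X (e j j) $$ (u,v)" .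
      qed simp
      finally show "mat_lc ?m ?m r (\<lambda>_. 1) (\<lambda>l. mat_of (inj l \<cdot> pr l)) $$ (u,v) =
        mat_lc ?m ?m ?d (\<lambda>_. 1) (\<lambda>i. rep X (e i i)) $$ (u,v)" using uv by simp
    qed auto
    thus ?thesis using mat_of_finsum(2)[OF X X ip] unit_sum by simp
  qed
  hence "finsum (hom_space C X X) (\<lambda>l. inj l \<cdot> pr l) {..<r} = Ide C X"
    using mat_of_Ide[OF X] by (intro mat_of_inject[OF mat_of_finsum(1)[OF X X ip] Ide_in[OF X]]) simp_all
  hence "is_direct_sum_copies C r I X" unfolding is_direct_sum_copies_def
    using X inj(1) pr(1) pi by (intro conjI exI[of _ inj] exI[of _ pr]) auto
  thus ?thesis by blast
qed

end

text \<open>By Burnside's theorem the entry at \<open>(i,j)\<close> of \<open>rep Z a\<close> is the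
  trace on \<open>Z\<close> of \<open>a\<close> times the matrix unit at \<open>(j,i)\<close>. This
  is a multiple of a trace on \<open>I\<close>, which is zero if \<open>a\<close> kills
  \<open>I\<close>. Nothing is divided by a dimension or by \<open>s\<close>.\<close>

lemma annihilated_with_if_trace:
  assumes I: "I \<in> Obj C" and Z: "Z \<in> Obj C" "irreducible_rep (carrier A) (rank Z) (rep Z)"
    and tr: "\<And>x. x \<in> carrier A \<Longrightarrow> (\<Sum>u<rank Z. rep Z x $$ (u,u)) = s * (\<Sum>u<rank I. rep I x $$ (u,u))"
  shows "annihilated_with I Z"
  unfolding annihilated_with_def
proof (intro ballI impI)
  fix a assume a: "a \<in> carrier A" and 0: "rep I a = 0\<^sub>m (rank I) (rank I)"
  obtain e where e: "\<And>i j. e i j \<in> carrier A"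
    "\<And>i j. rep Z (e i j) = mat (rank Z) (rank Z) (\<lambda>(u,v). if u = i \<and> v = j then 1 else 0)"
    by (rule matrix_units[OF Z], rule that)
  note ac = rep_carrier[OF Z(1) a]
  show "rep Z a = 0\<^sub>m (rank Z) (rank Z)"
  proof (rule eq_matI)
    fix i j assume "i < dim_row (0\<^sub>m (rank Z) (rank Z) :: 'k mat)" "j < dim_col (0\<^sub>m (rank Z) (rank Z) :: 'k mat)"
    hence ij: "i < rank Z" "j < rank Z" by auto
    have ent: "(rep Z a * rep Z (e j i)) $$ (u,u) = (if u = i then rep Z a $$ (i,j) else 0)" if "u < rank Z" for u
      unfolding e(2) using mult_unit_mat_index[OF ac ij(2,1) that that] by simp
    have "rep I a * rep I (e j i) = 0\<^sub>m (rank I) (rank I)" using 0 left_mult_zero_mat[OF rep_carrier[OF I e(1)]] by simp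
    hence "(\<Sum>u<rank Z. (rep Z a * rep Z (e j i)) $$ (u,u)) = 0"
      using tr[OF A.A_mult[OF a e(1)], of j i] rep_mult[OF Z(1) a e(1)] rep_mult[OF I a e(1)] by simp
    moreover have "(\<Sum>u<rank Z. (rep Z a * rep Z (e j i)) $$ (u,u)) = (\<Sum>u<rank Z. if u = i then rep Z a $$ (i,j) else 0)"
      using ent by (intro sum.cong) auto
    ultimately show "rep Z a $$ (i,j) = 0\<^sub>m (rank Z) (rank Z) $$ (i,j)" using ij by simp
  qed (use ac in auto)
qed

text \<open>Composition through \<open>I\<close> is injective on the tensor product of
  \<open>Hom C I V\<close> and \<open>Hom C Q I\<close>: an algebra element acting on
  \<open>I\<close> as a matrix unit, inserted between \<open>z l\<close> and \<open>q l\<close>,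
  isolates one column of the former and one row of the latter, and it can be moved to the far
  right.\<close>

lemma tensor_zero_through_irreducible:
  assumes I: "I \<in> Obj C" "irreducible_rep (carrier A) (rank I) (rep I)"
    and z: "\<And>l. l < N \<Longrightarrow> z l \<in> Hom C I V" and q: "\<And>l. l < N \<Longrightarrow> q l \<in> Hom C Q I"
    and V: "V \<in> Obj C" and Q: "Q \<in> Obj C"
    and s: "mat_lc (rank V) (rank Q) N (\<lambda>_. 1) (\<lambda>l. mat_of (z l \<cdot> q l)) = 0\<^sub>m (rank V) (rank Q)"
    and uv: "u < rank V" "i < rank I" "j < rank I" "v < rank Q"
  shows "(\<Sum>l<N. mat_of (z l) $$ (u,i) * mat_of (q l) $$ (j,v)) = 0"
proof -
  obtain e where e: "\<And>i j. e i j \<in> carrier A"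
    "\<And>i j. rep I (e i j) = mat (rank I) (rank I) (\<lambda>(u,v). if u = i \<and> v = j then 1 else 0)"
    by (rule matrix_units[OF I], rule that)
  note ec = rep_carrier[OF I(1) e(1)[of i j]] and eQ = rep_carrier[OF Q e(1)[of i j]]
  have "0\<^sub>m (rank V) (rank Q) = mat_lc (rank V) (rank Q) N (\<lambda>_. 1) (\<lambda>l. mat_of (z l \<cdot> q l)) * rep Q (e i j)"
    using s left_mult_zero_mat[OF eQ] by simp
  also have "\<dots> = mat_lc (rank V) (rank Q) N (\<lambda>_. 1) (\<lambda>l. mat_of (z l \<cdot> q l) * rep Q (e i j))"
    by (rule mat_lc_mult[OF eQ]) (rule mat_of_carrier[OF Comp_in[OF q z]])
  finally have "0 = mat_lc (rank V) (rank Q) N (\<lambda>_. 1) (\<lambda>l. mat_of (z l \<cdot> q l) * rep Q (e i j)) $$ (u,v)"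
    using uv by (metis index_zero_mat(1))
  also have "\<dots> = (\<Sum>l<N. (mat_of (z l \<cdot> q l) * rep Q (e i j)) $$ (u,v))" using uv by simp
  also have "\<dots> = (\<Sum>l<N. mat_of (z l) $$ (u,i) * mat_of (q l) $$ (j,v))"
  proof (rule sum.cong)
    fix l assume "l \<in> {..<N}"
    hence l: "l < N" by simp
    note zc = mat_of_carrier[OF z[OF l]] and qc = mat_of_carrier[OF q[OF l]]
    have "mat_of (z l \<cdot> q l) * rep Q (e i j) = mat_of (z l) * (rep I (e i j) * mat_of (q l))"
      using mat_of_Comp[OF q[OF l] z[OF l]] assoc_mult_mat[OF zc qc eQ] mat_of_intertwines[OF q[OF l] e(1), of i j] by simp
    moreover have "(rep I (e i j) * mat_of (q l)) $$ (k,v) = (if k = i then mat_of (q l) $$ (j,v) else 0)" if "k < rank I" for k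
      unfolding e(2) by (rule unit_mat_mult_index[OF qc uv(2,3) that uv(4)])
    moreover have "(mat_of (z l) * (rep I (e i j) * mat_of (q l))) $$ (u,v) =
        (\<Sum>k<rank I. mat_of (z l) $$ (u,k) * (rep I (e i j) * mat_of (q l)) $$ (k,v))"
      by (rule index_mult_sum[OF zc mult_carrier_mat[OF ec qc] uv(1,4)])
    ultimately show "(mat_of (z l \<cdot> q l) * rep Q (e i j)) $$ (u,v) = mat_of (z l) $$ (u,i) * mat_of (q l) $$ (j,v)"
      using uv by (simp add: if_distrib[of "\<lambda>x. _ * x"] cong: if_cong)
  qed simp
  finally show ?thesis by simp
qed

text \<open>Multiplying \<open>mat_of f\<close> on the right by the matrix unit at
  \<open>(v,i)\<close> moves column \<open>v\<close> to position \<open>i\<close>, so row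
  \<open>u\<close> becomes the nonzero entry times a unit row. Intertwining rewrites this as row
  \<open>u\<close> of \<open>rep X (e v i)\<close> times \<open>mat_of f\<close>, which explains the
  rows of \<open>L\<close>.\<close>

lemma left_inverse_if_nonzero:
  assumes I: "irreducible_rep (carrier A) (rank I) (rep I)" and f: "f \<in> Hom C I X" "f \<noteq> Zero C I X"
  obtains L where "L \<in> carrier_mat (rank I) (rank X)" "L * mat_of f = 1\<^sub>m (rank I)"
proof -
  note IO = Hom_Obj(1)[OF f(1)] and XO = Hom_Obj(2)[OF f(1)] and fc = mat_of_carrier[OF f(1)]
  have "mat_of f \<noteq> 0\<^sub>m (rank X) (rank I)"
    using f mat_of_inject[OF f(1) Zero_Hom[OF IO XO]] mat_of_Zero[OF IO XO] by auto
  hence "\<exists>u v. u < rank X \<and> v < rank I \<and> mat_of f $$ (u,v) \<noteq> 0"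
    using fc by (metis carrier_matD eq_matI index_zero_mat)
  then obtain u v where uv: "u < rank X" "v < rank I" "mat_of f $$ (u,v) \<noteq> 0" by blast
  obtain e where e: "\<And>i j. e i j \<in> carrier A"
    "\<And>i j. rep I (e i j) = mat (rank I) (rank I) (\<lambda>(u,v). if u = i \<and> v = j then 1 else 0)"
    by (rule matrix_units[OF IO I], rule that)
  define L where "L = mat (rank I) (rank X) (\<lambda>(i,w). rep X (e v i) $$ (u,w) / mat_of f $$ (u,v))"
  have "L * mat_of f = 1\<^sub>m (rank I)"
  proof (rule eq_matI)
    fix i j assume "i < dim_row (1\<^sub>m (rank I) :: 'k mat)" "j < dim_col (1\<^sub>m (rank I) :: 'k mat)"
    hence ij: "i < rank I" "j < rank I" by auto
    have "(L * mat_of f) $$ (i,j) = (rep X (e v i) * mat_of f) $$ (u,j) / mat_of f $$ (u,v)"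
      using ij fc rep_carrier[OF XO e(1)[of v i]] uv
      by (simp add: L_def scalar_prod_def sum_divide_distrib)
    also have "rep X (e v i) * mat_of f = mat_of f * rep I (e v i)" using mat_of_intertwines[OF f(1) e(1)] by simp
    also have "(mat_of f * rep I (e v i)) $$ (u,j) = (if i = j then mat_of f $$ (u,v) else 0)"
      unfolding e(2) using mult_unit_mat_index[OF fc uv(2) ij(1) uv(1) ij(2)] by auto
    finally show "(L * mat_of f) $$ (i,j) = 1\<^sub>m (rank I) $$ (i,j)" using ij uv by auto
  qed (use fc in \<open>auto simp: L_def\<close>)
  thus thesis using that[of L] by (simp add: L_def)
qed

end

section \<open>Characters and the objects \<open>P\<close> and \<open>J\<close>\<close>

context represented_category
begin

lemma sum_diag_expand:
  assumes X: "X \<in> Obj C" and c: "c \<in> carrier A" and x: "x \<in> carrier A"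
  shows "(\<Sum>l<n. co x l * (\<Sum>u<rank X. rep X (c \<otimes>\<^bsub>A\<^esub> b l) $$ (u,u))) = (\<Sum>u<rank X. rep X (c \<otimes>\<^bsub>A\<^esub> x) $$ (u,u))"
proof (rule A.expand[OF _ _ x])
  fix y z assume yz: "y \<in> carrier A" "z \<in> carrier A"
  note cy = A.A_mult[OF c yz(1)] and cz = A.A_mult[OF c yz(2)]
  have "rep X (c \<otimes>\<^bsub>A\<^esub> (y \<oplus>\<^bsub>A\<^esub> z)) = rep X (c \<otimes>\<^bsub>A\<^esub> y) + rep X (c \<otimes>\<^bsub>A\<^esub> z)"
    using A.A_distrib(2)[OF yz c] rep_add[OF X cy cz] by simp
  thus "(\<Sum>u<rank X. rep X (c \<otimes>\<^bsub>A\<^esub> (y \<oplus>\<^bsub>A\<^esub> z)) $$ (u,u)) =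
      (\<Sum>u<rank X. rep X (c \<otimes>\<^bsub>A\<^esub> y) $$ (u,u)) + (\<Sum>u<rank X. rep X (c \<otimes>\<^bsub>A\<^esub> z) $$ (u,u))"
    using rep_carrier[OF X cy] rep_carrier[OF X cz] by (simp add: sum.distrib)
next
  fix t y assume y: "y \<in> carrier A"
  have "rep X (c \<otimes>\<^bsub>A\<^esub> (t \<odot>\<^bsub>A\<^esub> y)) = t \<cdot>\<^sub>m rep X (c \<otimes>\<^bsub>A\<^esub> y)"
    using A.smult_mult_right[OF c y] rep_smult[OF X A.A_mult[OF c y]] by simp
  thus "(\<Sum>u<rank X. rep X (c \<otimes>\<^bsub>A\<^esub> (t \<odot>\<^bsub>A\<^esub> y)) $$ (u,u)) = t * (\<Sum>u<rank X. rep X (c \<otimes>\<^bsub>A\<^esub> y) $$ (u,u))"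
    using rep_carrier[OF X A.A_mult[OF c y]] by (simp add: sum_distrib_left)
qed

text \<open>The character at \<open>x\<close> is the trace form at the pair \<open>(x, 1)\<close>,
  expanded in both arguments.\<close>

lemma trace_expand:
  assumes X: "X \<in> Obj C" and x: "x \<in> carrier A"
  shows "(\<Sum>i<n. co x i * (\<Sum>j<n. co \<one>\<^bsub>A\<^esub> j * (\<Sum>u<rank X. rep X (b i \<otimes>\<^bsub>A\<^esub> b j) $$ (u,u)))) =
    (\<Sum>u<rank X. rep X x $$ (u,u))"
proof -
  have "(\<Sum>j<n. co \<one>\<^bsub>A\<^esub> j * (\<Sum>u<rank X. rep X (b i \<otimes>\<^bsub>A\<^esub> b j) $$ (u,u))) = (\<Sum>u<rank X. rep X (b i) $$ (u,u))"
    if "i < n" for i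
    using sum_diag_expand[OF X A.b_closed[OF that] A.A_one] A.A_r_one[OF A.b_closed[OF that]] by simp
  moreover have "\<one>\<^bsub>A\<^esub> \<otimes>\<^bsub>A\<^esub> b i = b i" if "i < n" for i using A.A_l_one[OF A.b_closed[OF that]] .
  ultimately show ?thesis using sum_diag_expand[OF X A.A_one x] A.A_l_one[OF x] by simp
qed

text \<open>The tensor product is available only for objects of \<open>C\<close>. So the regular and
  coregular modules are replaced by isomorphic objects \<open>P\<close> and \<open>J\<close>, and
  every property of the concrete maps is carried along these isomorphisms.\<close>

lemma regular_objects:
  obtains P J p q \<beta> where "P \<in> Obj C" "J \<in> Obj C"
    "\<And>X a. X \<in> Obj C \<Longrightarrow> a < rank X \<Longrightarrow> p X a \<in> Hom C P X"
    "\<And>X a. X \<in> Obj C \<Longrightarrow> a < rank X \<Longrightarrow> q X a \<in> Hom C X J"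
    "\<And>X Y f a. f \<in> Hom C X Y \<Longrightarrow> a < rank X \<Longrightarrow>
      mat_of (f \<cdot> p X a) = mat_lc (rank Y) (rank P) (rank Y) (\<lambda>w. mat_of f $$ (w,a)) (\<lambda>w. mat_of (p Y w))"
    "\<And>X Y f a. f \<in> Hom C X Y \<Longrightarrow> a < rank Y \<Longrightarrow>
      mat_of (q Y a \<cdot> f) = mat_lc (rank J) (rank X) (rank X) (\<lambda>w. mat_of f $$ (a,w)) (\<lambda>w. mat_of (q X w))"
    "\<And>c. c \<in> carrier A \<Longrightarrow> \<beta> c \<in> Hom C J J"
    "\<And>c X a. c \<in> carrier A \<Longrightarrow> X \<in> Obj C \<Longrightarrow> a < rank X \<Longrightarrow>
      mat_of (\<beta> c \<cdot> q X a) = mat_lc (rank J) (rank X) (rank X) (\<lambda>w. rep X c $$ (a,w)) (\<lambda>w. mat_of (q X w))"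
    "\<And>X t a. X \<in> Obj C \<Longrightarrow> mat_lc (rank X) (rank P) (rank X) t (\<lambda>a. mat_of (p X a)) = 0\<^sub>m (rank X) (rank P) \<Longrightarrow>
      a < rank X \<Longrightarrow> t a = 0"
    "\<And>X t a. X \<in> Obj C \<Longrightarrow> mat_lc (rank J) (rank X) (rank X) t (\<lambda>a. mat_of (q X a)) = 0\<^sub>m (rank J) (rank X) \<Longrightarrow>
      a < rank X \<Longrightarrow> t a = 0"
    "\<And>X Y s x. X \<in> Obj C \<Longrightarrow> Y \<in> Obj C \<Longrightarrow>
      mat_lc (rank J) (rank P) (rank X) (\<lambda>_. 1) (\<lambda>a. mat_of (q X a \<cdot> p X a)) =
      s \<cdot>\<^sub>m mat_lc (rank J) (rank P) (rank Y) (\<lambda>_. 1) (\<lambda>a. mat_of (q Y a \<cdot> p Y a)) \<Longrightarrow>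
      x \<in> carrier A \<Longrightarrow> (\<Sum>u<rank X. rep X x $$ (u,u)) = s * (\<Sum>u<rank Y. rep Y x $$ (u,u))"
proof -
  from mat_of_dense[OF A.regular_module] obtain P S S' where P: "P \<in> Obj C"
    and S: "S \<in> carrier_mat (rank P) n"
    and S'm: "S' \<in> fd_module_maps A (rank P, rep P) (n, A.regular)" and SS: "S' * S = 1\<^sub>m n"
    by (auto simp: fd_module_maps_def)
  from mat_of_dense[OF A.coregular_module] obtain J T T' where J: "J \<in> Obj C"
    and Tm: "T \<in> fd_module_maps A (n, A.coregular) (rank J, rep J)"
    and T'm: "T' \<in> fd_module_maps A (rank J, rep J) (n, A.coregular)" and TT: "T' * T = 1\<^sub>m n"
    by blast
  have S': "S' \<in> carrier_mat n (rank P)" and T: "T \<in> carrier_mat (rank J) n" and T': "T' \<in> carrier_mat n (rank J)"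
    using S'm Tm T'm by (auto simp: fd_module_maps_def)
  define FR where "FR X a = A.from_regular (rank X) (rep X) a" for X a
  define TC where "TC X a = A.to_coregular (rank X) (rep X) a" for X a
  have FR: "FR X a \<in> carrier_mat (rank X) n" and TC: "TC X a \<in> carrier_mat n (rank X)" for X a
    by (auto simp: FR_def TC_def A.from_regular_def A.to_coregular_def)
  have comp_map: "U * V \<in> fd_module_maps A (m1, r1) (m3, r3)"
    if Um: "U \<in> fd_module_maps A (m2, r2) (m3, r3)" and Vm: "V \<in> fd_module_maps A (m1, r1) (m2, r2)"
      and "(m1, r1) \<in> fd_modules A" "(m2, r2) \<in> fd_modules A" "(m3, r3) \<in> fd_modules A" for U V m1 r1 m2 r2 m3 r3
  proof -
    have U: "U \<in> carrier_mat m3 m2" and V: "V \<in> carrier_mat m2 m1" using that by (auto simp: fd_module_maps_def)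
    have "U * V * r1 a = r3 a * (U * V)" if a: "a \<in> carrier A" for a
    proof -
      note c1 = fd_modulesD(1)[OF \<open>(m1, r1) \<in> fd_modules A\<close> a] and c2 = fd_modulesD(1)[OF \<open>(m2, r2) \<in> fd_modules A\<close> a]
        and c3 = fd_modulesD(1)[OF \<open>(m3, r3) \<in> fd_modules A\<close> a]
      have "U * V * r1 a = U * (r2 a * V)"
        using assoc_mult_mat[OF U V c1] Vm a by (simp add: fd_module_maps_def)
      also have "\<dots> = r3 a * (U * V)"
        using assoc_mult_mat[OF U c2 V] assoc_mult_mat[OF c3 U V] Um a
        by (simp add: fd_module_maps_def)
      finally show ?thesis .
    qed
    thus ?thesis using U V by (simp add: fd_module_maps_def)
  qed
  have "\<exists>f \<in> Hom C P X. mat_of f = FR X a * S'" if X: "X \<in> Obj C" and a: "a < rank X" for X a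
    using comp_map[OF A.from_regular_map[OF rep_module[OF X] a] S'm rep_module[OF P] A.regular_module rep_module[OF X]]
    by (intro mat_of_full[OF P X]) (simp add: FR_def)
  then obtain p where p: "\<And>X a. X \<in> Obj C \<Longrightarrow> a < rank X \<Longrightarrow> p X a \<in> Hom C P X"
    "\<And>X a. X \<in> Obj C \<Longrightarrow> a < rank X \<Longrightarrow> mat_of (p X a) = FR X a * S'" by metis
  have "\<exists>f \<in> Hom C X J. mat_of f = T * TC X a" if X: "X \<in> Obj C" and a: "a < rank X" for X a
    using comp_map[OF Tm A.to_coregular_map[OF rep_module[OF X] a] rep_module[OF X] A.coregular_module rep_module[OF J]]
    by (intro mat_of_full[OF X J]) (simp add: TC_def)
  then obtain q where q: "\<And>X a. X \<in> Obj C \<Longrightarrow> a < rank X \<Longrightarrow> q X a \<in> Hom C X J"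
    "\<And>X a. X \<in> Obj C \<Longrightarrow> a < rank X \<Longrightarrow> mat_of (q X a) = T * TC X a" by metis
  define E where "E c = A.coregular_endo c" for c
  have E: "E c \<in> carrier_mat n n" for c by (simp add: E_def A.coregular_endo_def)
  have "\<exists>f \<in> Hom C J J. mat_of f = T * (E c * T')" if c: "c \<in> carrier A" for c
    using comp_map[OF Tm comp_map[OF A.coregular_endo_map[OF c] T'm rep_module[OF J] A.coregular_module A.coregular_module]
        rep_module[OF J] A.coregular_module rep_module[OF J]]
    by (intro mat_of_full[OF J J]) (simp add: E_def)
  then obtain \<beta> where \<beta>: "\<And>c. c \<in> carrier A \<Longrightarrow> \<beta> c \<in> Hom C J J"
    "\<And>c. c \<in> carrier A \<Longrightarrow> mat_of (\<beta> c) = T * (E c * T')" by metis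
  show thesis
  proof (rule that[OF P J p(1) q(1) _ _ \<beta>(1)])
    fix X Y f a assume f: "f \<in> Hom C X Y" and a: "a < rank X"
    note XY = Hom_Obj[OF f] and fc = mat_of_carrier[OF f]
    have "mat_of (f \<cdot> p X a) = mat_of f * FR X a * S'"
      using mat_of_Comp[OF p(1)[OF XY(1) a] f] p(2)[OF XY(1) a] assoc_mult_mat[OF fc FR S'] by simp
    also have "mat_of f * FR X a = mat_lc (rank Y) n (rank Y) (\<lambda>w. mat_of f $$ (w,a)) (\<lambda>w. FR Y w)"
      using A.from_regular_natural[OF rep_module[OF XY(1)] rep_module[OF XY(2)] mat_of_map[OF f] a] fc FR[of X a]
      unfolding FR_def[symmetric] by (intro eq_matI) (auto simp del: index_mult_mat(1))
    also have "\<dots> * S' = mat_lc (rank Y) (rank P) (rank Y) (\<lambda>w. mat_of f $$ (w,a)) (\<lambda>w. FR Y w * S')"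
      by (rule mat_lc_mult[OF S' FR])
    also have "\<dots> = mat_lc (rank Y) (rank P) (rank Y) (\<lambda>w. mat_of f $$ (w,a)) (\<lambda>w. mat_of (p Y w))"
      using p(2)[OF XY(2)] by (intro mat_lc_cong) auto
    finally show "mat_of (f \<cdot> p X a) = mat_lc (rank Y) (rank P) (rank Y) (\<lambda>w. mat_of f $$ (w,a)) (\<lambda>w. mat_of (p Y w))" .
  next
    fix X Y f a assume f: "f \<in> Hom C X Y" and a: "a < rank Y"
    note XY = Hom_Obj[OF f] and fc = mat_of_carrier[OF f]
    have "mat_of (q Y a \<cdot> f) = T * (TC Y a * mat_of f)"
      using mat_of_Comp[OF f q(1)[OF XY(2) a]] q(2)[OF XY(2) a] assoc_mult_mat[OF T TC fc] by simp
    also have "TC Y a * mat_of f = mat_lc n (rank X) (rank X) (\<lambda>w. mat_of f $$ (a,w)) (\<lambda>w. TC X w)"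
      using A.to_coregular_natural[OF rep_module[OF XY(1)] rep_module[OF XY(2)] mat_of_map[OF f] a] fc TC[of Y a]
      unfolding TC_def[symmetric] by (intro eq_matI) (auto simp del: index_mult_mat(1))
    also have "T * \<dots> = mat_lc (rank J) (rank X) (rank X) (\<lambda>w. mat_of f $$ (a,w)) (\<lambda>w. T * TC X w)"
      by (rule mult_mat_lc[OF T TC])
    also have "\<dots> = mat_lc (rank J) (rank X) (rank X) (\<lambda>w. mat_of f $$ (a,w)) (\<lambda>w. mat_of (q X w))"
      using q(2)[OF XY(1)] by (intro mat_lc_cong) auto
    finally show "mat_of (q Y a \<cdot> f) = mat_lc (rank J) (rank X) (rank X) (\<lambda>w. mat_of f $$ (a,w)) (\<lambda>w. mat_of (q X w))" .
  next
    fix c X a assume c: "c \<in> carrier A" and X: "X \<in> Obj C" and a: "a < rank X"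
    have "mat_of (\<beta> c \<cdot> q X a) = T * (E c * T') * (T * TC X a)"
      using mat_of_Comp[OF q(1)[OF X a] \<beta>(1)[OF c]] q(2)[OF X a] \<beta>(2)[OF c] by simp
    also have "\<dots> = T * (E c * T' * (T * TC X a))"
      by (rule assoc_mult_mat[OF T mult_carrier_mat[OF E T'] mult_carrier_mat[OF T TC]])
    also have "E c * T' * (T * TC X a) = E c * (T' * (T * TC X a))"
      by (rule assoc_mult_mat[OF E T' mult_carrier_mat[OF T TC]])
    also have "T' * (T * TC X a) = TC X a" using assoc_mult_mat[OF T' T TC[of X a]] TT TC[of X a] by simp
    also have "E c * TC X a = mat_lc n (rank X) (rank X) (\<lambda>w. rep X c $$ (a,w)) (\<lambda>w. TC X w)"
      using A.coregular_endo_comp[OF rep_module[OF X] c a] TC[of X a] E[of c]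
      unfolding TC_def[symmetric] E_def[symmetric] by (intro eq_matI) (auto simp del: index_mult_mat(1))
    also have "T * \<dots> = mat_lc (rank J) (rank X) (rank X) (\<lambda>w. rep X c $$ (a,w)) (\<lambda>w. T * TC X w)"
      by (rule mult_mat_lc[OF T TC])
    also have "\<dots> = mat_lc (rank J) (rank X) (rank X) (\<lambda>w. rep X c $$ (a,w)) (\<lambda>w. mat_of (q X w))"
      using q(2)[OF X] by (intro mat_lc_cong) auto
    finally show "mat_of (\<beta> c \<cdot> q X a) = mat_lc (rank J) (rank X) (rank X) (\<lambda>w. rep X c $$ (a,w)) (\<lambda>w. mat_of (q X w))" .
  next
    fix X t a assume X: "X \<in> Obj C" and a: "a < rank X"
      and z: "mat_lc (rank X) (rank P) (rank X) t (\<lambda>a. mat_of (p X a)) = 0\<^sub>m (rank X) (rank P)"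
    have "mat_lc (rank X) (rank P) (rank X) t (\<lambda>a. mat_of (p X a)) = mat_lc (rank X) n (rank X) t (\<lambda>a. FR X a) * S'"
      unfolding mat_lc_mult[OF S' FR] using p(2)[OF X] by (intro mat_lc_cong) auto
    with z have "mat_lc (rank X) n (rank X) t (\<lambda>a. FR X a) * S' = 0\<^sub>m (rank X) (rank P)" by (simp only:)
    hence "mat_lc (rank X) n (rank X) t (\<lambda>a. FR X a) * S' * S = 0\<^sub>m (rank X) n"
      using left_mult_zero_mat[OF S] by (simp only:)
    hence "mat_lc (rank X) n (rank X) t (\<lambda>a. FR X a) = 0\<^sub>m (rank X) n"
      using assoc_mult_mat[OF mat_lc_carrier S' S] SS by (simp add: right_mult_one_mat[OF mat_lc_carrier])
    note * = arg_cong[OF this, of "\<lambda>M. M $$ _"]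
    show "t a = 0"
    proof (rule A.from_regular_independent[OF rep_module[OF X] _ a])
      fix u j assume "u < rank X" "j < n"
      thus "(\<Sum>a<rank X. t a * A.from_regular (rank X) (rep X) a $$ (u,j)) = 0"
        using *[of "(u,j)"] by (simp add: FR_def)
    qed
  next
    fix X t a assume X: "X \<in> Obj C" and a: "a < rank X"
      and z: "mat_lc (rank J) (rank X) (rank X) t (\<lambda>a. mat_of (q X a)) = 0\<^sub>m (rank J) (rank X)"
    have "mat_lc (rank J) (rank X) (rank X) t (\<lambda>a. mat_of (q X a)) = T * mat_lc n (rank X) (rank X) t (\<lambda>a. TC X a)"
      unfolding mult_mat_lc[OF T TC] using q(2)[OF X] by (intro mat_lc_cong) auto
    with z have "T * mat_lc n (rank X) (rank X) t (\<lambda>a. TC X a) = 0\<^sub>m (rank J) (rank X)" by (simp only:)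
    hence "T' * (T * mat_lc n (rank X) (rank X) t (\<lambda>a. TC X a)) = 0\<^sub>m n (rank X)"
      using right_mult_zero_mat[OF T'] by (simp only:)
    hence "mat_lc n (rank X) (rank X) t (\<lambda>a. TC X a) = 0\<^sub>m n (rank X)"
      using assoc_mult_mat[OF T' T mat_lc_carrier] TT left_mult_one_mat[OF mat_lc_carrier] by metis
    note * = arg_cong[OF this, of "\<lambda>M. M $$ _"]
    show "t a = 0"
    proof (rule A.to_coregular_independent[OF rep_module[OF X] _ a])
      fix i v assume "i < n" "v < rank X"
      thus "(\<Sum>a<rank X. t a * A.to_coregular (rank X) (rep X) a $$ (i,v)) = 0"
        using *[of "(i,v)"] by (simp add: TC_def)
    qed
  next
    fix X Y s x assume X: "X \<in> Obj C" and Y: "Y \<in> Obj C" and x: "x \<in> carrier A"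
      and e: "mat_lc (rank J) (rank P) (rank X) (\<lambda>_. 1) (\<lambda>a. mat_of (q X a \<cdot> p X a)) =
        s \<cdot>\<^sub>m mat_lc (rank J) (rank P) (rank Y) (\<lambda>_. 1) (\<lambda>a. mat_of (q Y a \<cdot> p Y a))"
    define CH where "CH X = mat n n (\<lambda>(i,j). \<Sum>u<rank X. rep X (b i \<otimes>\<^bsub>A\<^esub> b j) $$ (u,u))" for X
    have CHc: "CH X \<in> carrier_mat n n" for X by (simp add: CH_def)
    have CH: "mat_lc (rank J) (rank P) (rank X) (\<lambda>_. 1) (\<lambda>a. mat_of (q X a \<cdot> p X a)) = T * (CH X * S')"
      if X: "X \<in> Obj C" for X
    proof -
      have "mat_of (q X a \<cdot> p X a) = T * (TC X a * FR X a * S')" if a: "a < rank X" for a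
        using mat_of_Comp[OF p(1)[OF X a] q(1)[OF X a]] p(2)[OF X a] q(2)[OF X a]
          assoc_mult_mat[OF T TC mult_carrier_mat[OF FR S']] assoc_mult_mat[OF TC FR S'] by simp
      hence "mat_lc (rank J) (rank P) (rank X) (\<lambda>_. 1) (\<lambda>a. mat_of (q X a \<cdot> p X a)) =
        mat_lc (rank J) (rank P) (rank X) (\<lambda>_. 1) (\<lambda>a. T * (TC X a * FR X a * S'))" by (intro mat_lc_cong) auto
      also have "\<dots> = T * mat_lc n (rank P) (rank X) (\<lambda>_. 1) (\<lambda>a. TC X a * FR X a * S')"
        by (rule mult_mat_lc[symmetric, OF T mult_carrier_mat[OF mult_carrier_mat[OF TC FR] S']])
      also have "mat_lc n (rank P) (rank X) (\<lambda>_. 1) (\<lambda>a. TC X a * FR X a * S') =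
          mat_lc n n (rank X) (\<lambda>_. 1) (\<lambda>a. TC X a * FR X a) * S'"
        by (rule mat_lc_mult[symmetric, OF S' mult_carrier_mat[OF TC FR]])
      also have "mat_lc n n (rank X) (\<lambda>_. 1) (\<lambda>a. TC X a * FR X a) = CH X"
        using A.to_coregular_from_regular[OF rep_module[OF X]] unfolding CH_def TC_def[symmetric] FR_def[symmetric]
        by (intro eq_matI) (auto simp del: index_mult_mat(1))
      finally show ?thesis .
    qed
    \<comment> \<open>The two isomorphisms cancel, so an equation between arrows
      \<open>P \<rightarrow> J\<close> is an equation between trace forms.\<close>
    have core: "T' * (T * (CH X * S')) * S = CH X" for X
    proof -
      have "T' * (T * (CH X * S')) = CH X * S'"
        using assoc_mult_mat[OF T' T mult_carrier_mat[OF CHc S'], of X] TT left_mult_one_mat[OF mult_carrier_mat[OF CHc S']]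
        by simp
      thus ?thesis using assoc_mult_mat[OF CHc S' S, of X] SS right_mult_one_mat[OF CHc] by simp
    qed
    have TCS: "T * (CH Y * S') \<in> carrier_mat (rank J) (rank P)" by (rule mult_carrier_mat[OF T mult_carrier_mat[OF CHc S']])
    have "CH X = T' * (s \<cdot>\<^sub>m (T * (CH Y * S'))) * S" using e CH[OF X] CH[OF Y] core[of X] by simp
    also have "\<dots> = s \<cdot>\<^sub>m (T' * (T * (CH Y * S')) * S)"
      using mult_smult_distrib[OF T' TCS, of s] mult_smult_assoc_mat[OF mult_carrier_mat[OF T' TCS] S, of s] by simp
    finally have "CH X = s \<cdot>\<^sub>m CH Y" using core by simp
    note * = arg_cong[OF this, of "\<lambda>M. M $$ _"]
    have ij: "(\<Sum>u<rank X. rep X (b i \<otimes>\<^bsub>A\<^esub> b j) $$ (u,u)) = s * (\<Sum>u<rank Y. rep Y (b i \<otimes>\<^bsub>A\<^esub> b j) $$ (u,u))"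
      if "i < n" "j < n" for i j using *[of "(i,j)"] that by (simp add: CH_def)
    have "(\<Sum>u<rank X. rep X x $$ (u,u)) =
      (\<Sum>i<n. co x i * (\<Sum>j<n. co \<one>\<^bsub>A\<^esub> j * (s * (\<Sum>u<rank Y. rep Y (b i \<otimes>\<^bsub>A\<^esub> b j) $$ (u,u)))))"
      unfolding trace_expand[OF X x, symmetric] using ij by simp
    also have "\<dots> = s * (\<Sum>u<rank Y. rep Y x $$ (u,u))"
      unfolding trace_expand[OF Y x, symmetric] sum_distrib_left by (simp add: ac_simps)
    finally show "(\<Sum>u<rank X. rep X x $$ (u,u)) = s * (\<Sum>u<rank Y. rep Y x $$ (u,u))" .
  qed
qed

end

section \<open>Finite abelian categories as categories of matrix modules\<close>

lemma finite_abelian_represented: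
  fixes C :: "('k :: alg_closed_field, 'o, 'm, 'z) klin_cat_scheme"
  assumes "finite_abelian_category C"
  shows "\<exists>(A :: ('k, 'k vec) module) n b co rank rep mat_of. represented_category C A n b co rank rep mat_of"
proof -
  interpret C: finite_abelian_category C by fact
  obtain A :: "('k, 'k vec) module" where A: "fd_algebra A" and eq: "klinear_equivalent C (fd_mod_cat A)"
    using C.equivalent_fd_mod by blast
  interpret A: fd_algebra A by fact
  obtain n b co where co: "A.coordinates n b co" by (rule A.coordinates_exist)
  interpret A: fd_algebra_basis A n b co by unfold_locales (fact co)
  let ?D = "fd_mod_cat A"
  from eq obtain Fo Fm Go Gm \<eta> \<epsilon> where F: "klinear_functor C ?D Fo Fm" and G: "klinear_functor ?D C Go Gm"
    and \<eta>: "natural_iso C C id id (Go \<circ> Fo) (Gm \<circ> Fm) \<eta>"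
    and \<epsilon>: "natural_iso ?D ?D (Fo \<circ> Go) (Fm \<circ> Gm) id id \<epsilon>"
    unfolding klinear_equivalent_def by blast
  interpret F: klinear_functor C ?D Fo Fm by fact
  interpret G: klinear_functor ?D C Go Gm by fact
  have Hom: "f \<in> Hom ?D M N \<longleftrightarrow>
      (\<exists>T. f = (M, N, T) \<and> M \<in> fd_modules A \<and> N \<in> fd_modules A \<and> T \<in> fd_module_maps A M N)" for f M N
    by (auto simp: fd_mod_cat_def Hom_def)
  have Obj: "Obj ?D = fd_modules A" by (simp add: fd_mod_cat_def)
  have ops: "Ide ?D M = (M, M, 1\<^sub>m (fst M))"
    "Comp ?D (N, P, S) (M, N', T) = (M, P, S * T)"
    "Add ?D (M, N, S) (M', N', T) = (M, N, S + T)"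
    "Scale ?D c (M, N, T) = (M, N, c \<cdot>\<^sub>m T)" for M N N' M' P S T c
    by (simp_all add: fd_mod_cat_def)
  have inv: "\<exists>g \<in> Hom B Y X. Comp B g f = Ide B X \<and> Comp B f g = Ide B Y" if "is_iso B f" "f \<in> Hom B X Y"
    for B :: "('k, 'r, 's, 'w) klin_cat_scheme" and f X Y
    using that by (auto simp: is_iso_def inverse_arrows_def Hom_def)
  have \<eta>1: "\<eta> X \<in> Hom C X (Go (Fo X))" "is_iso C (\<eta> X)" if "X \<in> Obj C" for X
    using \<eta> that by (auto simp: natural_iso_def)
  have \<eta>2: "\<eta> Y \<cdot>\<^bsub>C\<^esub> f = Gm (Fm f) \<cdot>\<^bsub>C\<^esub> \<eta> X" if "f \<in> Hom C X Y" for X Y f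
    using \<eta> that by (auto simp: natural_iso_def)
  have \<epsilon>1: "\<epsilon> M \<in> Hom ?D (Fo (Go M)) M" "is_iso ?D (\<epsilon> M)" if "M \<in> Obj ?D" for M
    using \<epsilon> that by (auto simp: natural_iso_def)
  have \<epsilon>2: "\<epsilon> N \<cdot>\<^bsub>?D\<^esub> Fm (Gm f) = f \<cdot>\<^bsub>?D\<^esub> \<epsilon> M" if "f \<in> Hom ?D M N" for M N f
    using conjunct2[OF \<epsilon>[unfolded natural_iso_def], rule_format, OF that] by simp
  have HO: "X \<in> Obj C \<and> Y \<in> Obj C" if "f \<in> Hom C X Y" for f X Y
    using that C.Dom_in C.Cod_in by (auto simp: Hom_def)
  have faithful: "f = g" if f: "f \<in> Hom C X Y" and g: "g \<in> Hom C X Y" and e: "Fm f = Fm g" for X Y f g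
  proof -
    have Y: "Y \<in> Obj C" using HO[OF f] by blast
    obtain h where h: "h \<in> Hom C (Go (Fo Y)) Y" "h \<cdot>\<^bsub>C\<^esub> \<eta> Y = Ide C Y" using inv[OF \<eta>1(2,1)[OF Y]] by blast
    have "k = h \<cdot>\<^bsub>C\<^esub> (Gm (Fm k) \<cdot>\<^bsub>C\<^esub> \<eta> X)" if k: "k \<in> Hom C X Y" for k
      using C.Comp_assoc[OF k \<eta>1(1)[OF Y] h(1)] h(2) C.Ide_left[OF k] \<eta>2[OF k] by simp
    from this[OF f] this[OF g] e show ?thesis by simp
  qed
  have Gfaithful: "f = g" if f: "f \<in> Hom ?D M N" and g: "g \<in> Hom ?D M N" and e: "Gm f = Gm g" for M N f g
  proof -
    have M: "M \<in> Obj ?D" using f by (auto simp: Hom Obj)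
    obtain h where h: "h \<in> Hom ?D M (Fo (Go M))" "\<epsilon> M \<cdot>\<^bsub>?D\<^esub> h = Ide ?D M" using inv[OF \<epsilon>1(2,1)[OF M]] by blast
    have "k = (\<epsilon> N \<cdot>\<^bsub>?D\<^esub> Fm (Gm k)) \<cdot>\<^bsub>?D\<^esub> h" if k: "k \<in> Hom ?D M N" for k
      using F.D.Comp_assoc[OF h(1) \<epsilon>1(1)[OF M] k] h(2) F.D.Ide_right[OF k] \<epsilon>2[OF k] by simp
    from this[OF f] this[OF g] e show ?thesis by simp
  qed
  \<comment> \<open>Conjugating \<open>Gm t\<close> by \<eta> gives \<open>f\<close>, and naturality
    then yields \<open>Gm (Fm f) = Gm t\<close>. Faithfulness of the quasi-inverse, proved just
    before, concludes.\<close>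
  have full: "\<exists>f \<in> Hom C X Y. Fm f = t" if XY: "X \<in> Obj C" "Y \<in> Obj C" and t: "t \<in> Hom ?D (Fo X) (Fo Y)" for X Y t
  proof -
    obtain h where h: "h \<in> Hom C (Go (Fo Y)) Y" "\<eta> Y \<cdot>\<^bsub>C\<^esub> h = Ide C (Go (Fo Y))" using inv[OF \<eta>1(2,1)[OF XY(2)]] by blast
    obtain h' where h': "h' \<in> Hom C (Go (Fo X)) X" "\<eta> X \<cdot>\<^bsub>C\<^esub> h' = Ide C (Go (Fo X))" using inv[OF \<eta>1(2,1)[OF XY(1)]] by blast
    note Gt = G.Fm_in[OF t]
    define f where "f = h \<cdot>\<^bsub>C\<^esub> (Gm t \<cdot>\<^bsub>C\<^esub> \<eta> X)"
    have G\<eta>: "Gm t \<cdot>\<^bsub>C\<^esub> \<eta> X \<in> Hom C X (Go (Fo Y))" by (rule C.Comp_in[OF \<eta>1(1)[OF XY(1)] Gt])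
    have f: "f \<in> Hom C X Y" unfolding f_def by (rule C.Comp_in[OF G\<eta> h(1)])
    have "\<eta> Y \<cdot>\<^bsub>C\<^esub> f = Gm t \<cdot>\<^bsub>C\<^esub> \<eta> X"
      unfolding f_def using C.Comp_assoc[OF G\<eta> h(1) \<eta>1(1)[OF XY(2)]] h(2) C.Ide_left[OF G\<eta>] by simp
    hence e: "Gm (Fm f) \<cdot>\<^bsub>C\<^esub> \<eta> X = Gm t \<cdot>\<^bsub>C\<^esub> \<eta> X" using \<eta>2[OF f] by simp
    note GF = G.Fm_in[OF F.Fm_in[OF f]]
    have k: "k = (k \<cdot>\<^bsub>C\<^esub> \<eta> X) \<cdot>\<^bsub>C\<^esub> h'" if k: "k \<in> Hom C (Go (Fo X)) (Go (Fo Y))" for k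
      by (simp only: C.Comp_assoc[OF h'(1) \<eta>1(1)[OF XY(1)] k] h'(2) C.Ide_right[OF k])
    have "Gm (Fm f) = Gm t"
      by (subst k[OF GF], subst e, rule k[OF Gt, symmetric])
    hence "Fm f = t" by (rule Gfaithful[OF F.Fm_in[OF f] t])
    with f show ?thesis by blast
  qed
  define mat_of where "mat_of f = snd (snd (Fm f))" for f
  have Fm: "Fm f = (Fo X, Fo Y, mat_of f)" "mat_of f \<in> fd_module_maps A (Fo X) (Fo Y)" if "f \<in> Hom C X Y" for f X Y
    using F.Fm_in[OF that] unfolding Hom by (auto simp: mat_of_def)
  have "represented_category C A n b co (fst \<circ> Fo) (snd \<circ> Fo) mat_of"
  proof
    show "((fst \<circ> Fo) X, (snd \<circ> Fo) X) \<in> fd_modules A" if "X \<in> Obj C" for X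
      using F.Fo_in[OF that] by (simp add: Obj)
    show "mat_of f \<in> fd_module_maps A ((fst \<circ> Fo) X, (snd \<circ> Fo) X) ((fst \<circ> Fo) Y, (snd \<circ> Fo) Y)"
      if "f \<in> Hom C X Y" for f X Y using Fm(2)[OF that] by simp
    show "mat_of (Ide C X) = 1\<^sub>m ((fst \<circ> Fo) X)" if "X \<in> Obj C" for X
      using F.Fm_Ide[OF that] by (simp add: mat_of_def ops)
    show "mat_of (g \<cdot>\<^bsub>C\<^esub> f) = mat_of g * mat_of f" if f: "f \<in> Hom C X Y" and g: "g \<in> Hom C Y Z" for f g X Y Z
      using F.Fm_Comp[OF f g] Fm(1)[OF f] Fm(1)[OF g] Fm(1)[OF C.Comp_in[OF f g]] by (simp add: ops)
    show "mat_of (Add C f g) = mat_of f + mat_of g" if f: "f \<in> Hom C X Y" and g: "g \<in> Hom C X Y" for f g X Y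
      unfolding mat_of_def[of "Add C f g"] F.Fm_Add[OF f g] using Fm(1)[OF f] Fm(1)[OF g] by (simp add: ops)
    show "mat_of (Scale C x f) = x \<cdot>\<^sub>m mat_of f" if f: "f \<in> Hom C X Y" for f X Y x
      unfolding mat_of_def[of "Scale C x f"] F.Fm_Scale[OF f] using Fm(1)[OF f] by (simp add: ops)
    show "f = g" if f: "f \<in> Hom C X Y" and g: "g \<in> Hom C X Y" and e: "mat_of f = mat_of g" for f g X Y
      using faithful[OF f g] Fm(1)[OF f] Fm(1)[OF g] e by simp
    show "\<exists>f\<in>Hom C X Y. mat_of f = T" if XY: "X \<in> Obj C" "Y \<in> Obj C"
      and T: "T \<in> fd_module_maps A ((fst \<circ> Fo) X, (snd \<circ> Fo) X) ((fst \<circ> Fo) Y, (snd \<circ> Fo) Y)" for X Y T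
    proof -
      have "(Fo X, Fo Y, T) \<in> Hom ?D (Fo X) (Fo Y)" using T F.Fo_in[OF XY(1)] F.Fo_in[OF XY(2)] by (simp add: Hom Obj)
      from full[OF XY this] obtain f where "f \<in> Hom C X Y" "Fm f = (Fo X, Fo Y, T)" by blast
      thus ?thesis by (intro bexI[of _ f]) (simp_all add: mat_of_def)
    qed
    show "\<exists>X\<in>Obj C. \<exists>S\<in>fd_module_maps A (m, r) ((fst \<circ> Fo) X, (snd \<circ> Fo) X).
        \<exists>S'\<in>fd_module_maps A ((fst \<circ> Fo) X, (snd \<circ> Fo) X) (m, r).
          S * S' = 1\<^sub>m ((fst \<circ> Fo) X) \<and> S' * S = 1\<^sub>m m" if mr: "(m, r) \<in> fd_modules A" for m r
    proof -
      have M: "(m, r) \<in> Obj ?D" using mr by (simp add: Obj)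
      obtain h where h: "h \<in> Hom ?D (m, r) (Fo (Go (m, r)))" "h \<cdot>\<^bsub>?D\<^esub> \<epsilon> (m, r) = Ide ?D (Fo (Go (m, r)))"
        "\<epsilon> (m, r) \<cdot>\<^bsub>?D\<^esub> h = Ide ?D (m, r)" using inv[OF \<epsilon>1(2,1)[OF M]] by blast
      obtain S where S: "h = ((m, r), Fo (Go (m, r)), S)" "S \<in> fd_module_maps A (m, r) (Fo (Go (m, r)))"
        using h(1) by (auto simp: Hom)
      obtain S' where S': "\<epsilon> (m, r) = (Fo (Go (m, r)), (m, r), S')" "S' \<in> fd_module_maps A (Fo (Go (m, r))) (m, r)"
        using \<epsilon>1(1)[OF M] by (auto simp: Hom)
      have "S * S' = 1\<^sub>m (fst (Fo (Go (m, r))))" "S' * S = 1\<^sub>m m"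
        using h(2,3) unfolding S(1) S'(1) by (simp_all add: ops)
      thus ?thesis using S(2) S'(2) G.Fo_in[OF M] by (intro bexI[of _ "Go (m, r)"] bexI[of _ S] bexI[of _ S']) auto
    qed
  qed
  thus ?thesis by blast
qed


section \<open>Duals and coends\<close>

context category
begin

lemma HomD: "f \<in> Hom C X Y \<Longrightarrow> f \<in> Arr C" "f \<in> Hom C X Y \<Longrightarrow> Dom C f = X"
    "f \<in> Hom C X Y \<Longrightarrow> Cod C f = Y"
  by (auto simp: Hom_def)

lemma Hom_iff: "f \<in> Hom C X Y \<longleftrightarrow> f \<in> Arr C \<and> Dom C f = X \<and> Cod C f = Y"
  by (auto simp: Hom_def)

lemma Obj_Dom_Cod [simp]: "f \<in> Arr C \<Longrightarrow> Dom C f \<in> Obj C" "f \<in> Arr C \<Longrightarrow> Cod C f \<in> Obj C"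
  by (fact Dom_in Cod_in)+

lemma Comp_arr [simp]:
  assumes "f \<in> Arr C" "g \<in> Arr C" "Dom C g = Cod C f"
  shows "g \<cdot> f \<in> Arr C" "Dom C (g \<cdot> f) = Dom C f" "Cod C (g \<cdot> f) = Cod C g"
  using Comp_in[of f "Dom C f" "Cod C f" g "Cod C g"] assms by (auto simp: Hom_def)

lemma Ide_arr [simp]:
  assumes "X \<in> Obj C"
  shows "Ide C X \<in> Arr C" "Dom C (Ide C X) = X" "Cod C (Ide C X) = X"
  using Ide_in[OF assms] by (auto simp: Hom_def)

lemma Comp_Ide [simp]:
  assumes "f \<in> Arr C"
  shows "Cod C f = Y \<Longrightarrow> Ide C Y \<cdot> f = f" "Dom C f = X \<Longrightarrow> f \<cdot> Ide C X = f"
  using Ide_left[of f "Dom C f" "Cod C f"] Ide_right[of f "Dom C f" "Cod C f"] assms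
  by (auto simp: Hom_def)

lemma Comp_assoc' :
  assumes "f \<in> Arr C" "g \<in> Arr C" "h \<in> Arr C" "Dom C g = Cod C f" "Dom C h = Cod C g"
  shows "(h \<cdot> g) \<cdot> f = h \<cdot> (g \<cdot> f)"
  using Comp_assoc[of f "Dom C f" "Cod C f" g "Cod C g" h "Cod C h"] assms by (auto simp: Hom_def)

text \<open>Covers single epimorphisms, with \<open>K\<close> a singleton, and the legs of a colimit
  alike; the domains of the arrows in \<open>K\<close> may differ.\<close>

definition jointly_epi :: "'o \<Rightarrow> 'm set \<Rightarrow> bool"
  where "jointly_epi A K \<longleftrightarrow> (\<forall>B. \<forall>x \<in> Hom C A B. \<forall>y \<in> Hom C A B. (\<forall>k \<in> K. x \<cdot> k = y \<cdot> k) \<longrightarrow> x = y)"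

lemma jointly_epiD:
  "jointly_epi A K \<Longrightarrow> x \<in> Hom C A B \<Longrightarrow> y \<in> Hom C A B \<Longrightarrow> (\<And>k. k \<in> K \<Longrightarrow> x \<cdot> k = y \<cdot> k) \<Longrightarrow> x = y"
  unfolding jointly_epi_def by blast

lemma monoD:
  assumes m: "is_mono C m" "m \<in> Hom C X Y" and "g \<in> Hom C W X" "h \<in> Hom C W X" "m \<cdot> g = m \<cdot> h"
  shows "g = h"
  using m(1)[unfolded is_mono_def, THEN conjunct2, rule_format, of g W h] HomD(2)[OF m(2)] assms(3-5)
  by simp

text \<open>A diagram with vertices \<open>D x\<close>, for \<open>x \<in> Obj C\<close>, on which a set \<open>R\<close> of relations
  \<open>k x \<cdot> a = k y \<cdot> b\<close> is imposed.\<close>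

definition cocone :: "('o \<Rightarrow> 'o) \<Rightarrow> ('o \<times> 'm \<times> 'o \<times> 'm) set \<Rightarrow> 'o \<Rightarrow> ('o \<Rightarrow> 'm) \<Rightarrow> bool"
  where "cocone D R B k \<longleftrightarrow> B \<in> Obj C \<and> (\<forall>x \<in> Obj C. k x \<in> Hom C (D x) B) \<and>
    (\<forall>(x, a, y, b) \<in> R. k x \<cdot> a = k y \<cdot> b)"

lemma coconeI:
  assumes "B \<in> Obj C" "\<And>x. x \<in> Obj C \<Longrightarrow> k x \<in> Hom C (D x) B"
    "\<And>x a y b. (x, a, y, b) \<in> R \<Longrightarrow> k x \<cdot> a = k y \<cdot> b"
  shows "cocone D R B k"
  unfolding cocone_def
proof (intro conjI ballI)
  fix r assume r: "r \<in> R"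
  obtain x a y b where "r = (x, a, y, b)" by (cases r)
  with assms(3)[of x a y b] r show "case r of (x, a, y, b) \<Rightarrow> k x \<cdot> a = k y \<cdot> b" by simp
qed (fact assms(1), rule assms(2))

lemma coconeD:
  assumes "cocone D R B k"
  shows "B \<in> Obj C" "x \<in> Obj C \<Longrightarrow> k x \<in> Hom C (D x) B" "(x, a, y, b) \<in> R \<Longrightarrow> k x \<cdot> a = k y \<cdot> b"
proof -
  show "B \<in> Obj C" using assms unfolding cocone_def by (rule conjunct1)
  show "k x \<in> Hom C (D x) B" if "x \<in> Obj C"
    by (rule bspec[OF conjunct1[OF conjunct2[OF assms[unfolded cocone_def]]] that])
  show "k x \<cdot> a = k y \<cdot> b" if "(x, a, y, b) \<in> R"
    using bspec[OF conjunct2[OF conjunct2[OF assms[unfolded cocone_def]]] that] by (simp only: prod.case)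
qed

definition universal_cocone :: "('o \<Rightarrow> 'o) \<Rightarrow> ('o \<times> 'm \<times> 'o \<times> 'm) set \<Rightarrow> 'o \<Rightarrow> ('o \<Rightarrow> 'm) \<Rightarrow> bool"
  where "universal_cocone D R F i \<longleftrightarrow> cocone D R F i \<and>
    (\<forall>B k. cocone D R B k \<longrightarrow> (\<exists>!h. h \<in> Hom C F B \<and> (\<forall>x \<in> Obj C. h \<cdot> i x = k x)))"

lemma universal_coconeE:
  assumes "universal_cocone D R F i" "cocone D R B k"
  obtains h where "h \<in> Hom C F B" "\<And>x. x \<in> Obj C \<Longrightarrow> h \<cdot> i x = k x"
proof -
  from assms(1)[unfolded universal_cocone_def, THEN conjunct2, rule_format, OF assms(2)]
  obtain h where h: "h \<in> Hom C F B \<and> (\<forall>x \<in> Obj C. h \<cdot> i x = k x)" by (rule ex1E)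
  show thesis by (rule that[OF conjunct1[OF h] bspec[OF conjunct2[OF h]]])
qed

definition relations_on :: "('o \<Rightarrow> 'o) \<Rightarrow> ('o \<times> 'm \<times> 'o \<times> 'm) set \<Rightarrow> bool"
  where "relations_on D R \<longleftrightarrow> (\<forall>x \<in> Obj C. D x \<in> Obj C) \<and>
    (\<forall>(x, a, y, b) \<in> R. x \<in> Obj C \<and> y \<in> Obj C \<and> (\<exists>Z. a \<in> Hom C Z (D x) \<and> b \<in> Hom C Z (D y)))"

lemma relations_onD:
  assumes "relations_on D R"
  shows "x \<in> Obj C \<Longrightarrow> D x \<in> Obj C"
    "(x, a, y, b) \<in> R \<Longrightarrow> x \<in> Obj C \<and> y \<in> Obj C \<and> (\<exists>Z. a \<in> Hom C Z (D x) \<and> b \<in> Hom C Z (D y))"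
proof -
  show "D x \<in> Obj C" if "x \<in> Obj C"
    by (rule bspec[OF conjunct1[OF assms[unfolded relations_on_def]] that])
  show "x \<in> Obj C \<and> y \<in> Obj C \<and> (\<exists>Z. a \<in> Hom C Z (D x) \<and> b \<in> Hom C Z (D y))" if "(x, a, y, b) \<in> R"
    using bspec[OF conjunct2[OF assms[unfolded relations_on_def]] that] by (simp only: prod.case)
qed

text \<open>The uniqueness half of the universal property: \<open>x\<close> and \<open>y\<close>
  factor the same cocone, the legs followed by \<open>x\<close>.\<close>

lemma universal_cocone_jointly_epi:
  assumes R: "relations_on D R" and u: "universal_cocone D R F i"
  shows "jointly_epi F (i ` Obj C)"
  unfolding jointly_epi_def
proof (intro allI ballI impI)
  fix B x y assume x: "x \<in> Hom C F B" and y: "y \<in> Hom C F B" and e: "\<forall>k \<in> i ` Obj C. x \<cdot> k = y \<cdot> k"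
  have c: "cocone D R F i" using u unfolding universal_cocone_def by (rule conjunct1)
  have "cocone D R B (\<lambda>z. x \<cdot> i z)"
  proof (rule coconeI)
    show "B \<in> Obj C" using x by (rule Hom_Obj)
    show "x \<cdot> i z \<in> Hom C (D z) B" if "z \<in> Obj C" for z
      by (rule Comp_in[OF coconeD(2)[OF c that] x])
    fix z a w b assume r: "(z, a, w, b) \<in> R"
    from relations_onD(2)[OF R r] obtain Z where h: "z \<in> Obj C" "w \<in> Obj C" "a \<in> Hom C Z (D z)" "b \<in> Hom C Z (D w)"
      by blast
    show "(x \<cdot> i z) \<cdot> a = (x \<cdot> i w) \<cdot> b"
      using Comp_assoc[OF h(3) coconeD(2)[OF c h(1)] x] Comp_assoc[OF h(4) coconeD(2)[OF c h(2)] x]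
        coconeD(3)[OF c r] by (simp only:)
  qed
  note ex = u[unfolded universal_cocone_def, THEN conjunct2, rule_format, OF this]
  have "\<forall>z \<in> Obj C. y \<cdot> i z = x \<cdot> i z"
  proof
    fix z assume "z \<in> Obj C"
    hence "x \<cdot> i z = y \<cdot> i z" by (intro bspec[OF e] imageI)
    thus "y \<cdot> i z = x \<cdot> i z" by (rule sym)
  qed
  hence 1: "y \<in> Hom C F B \<and> (\<forall>z \<in> Obj C. y \<cdot> i z = x \<cdot> i z)" using y by (intro conjI)
  have 2: "x \<in> Hom C F B \<and> (\<forall>z \<in> Obj C. x \<cdot> i z = x \<cdot> i z)" using x by (intro conjI ballI refl)
  from the1_equality[OF ex 2] the1_equality[OF ex 1] show "x = y" by (rule trans[OF sym])
qed

end

text \<open>Reversing the tensor product exchanges left and right duals.\<close>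

definition rev_cat :: "('k, 'o, 'm, 'z) rigid_cat_scheme \<Rightarrow> ('k, 'o, 'm, 'z) rigid_cat_scheme"
  where "rev_cat C = C\<lparr>TensorO := \<lambda>X Y. TensorO C Y X, TensorM := \<lambda>f g. TensorM C g f\<rparr>"

lemma rev_cat_simps [simp]:
  "Obj (rev_cat C) = Obj C" "Arr (rev_cat C) = Arr C" "Dom (rev_cat C) = Dom C" "Cod (rev_cat C) = Cod C"
  "Ide (rev_cat C) = Ide C" "Comp (rev_cat C) = Comp C" "Unit (rev_cat C) = Unit C"
  "TensorO (rev_cat C) X Y = TensorO C Y X" "TensorM (rev_cat C) f g = TensorM C g f"
  "Hom (rev_cat C) = Hom C" "is_mono (rev_cat C) = is_mono C"
  "Zero (rev_cat C) = Zero C"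
  by (auto simp: rev_cat_def Hom_def is_mono_def fun_eq_iff)

section \<open>Interchange calculus in a strict monoidal category\<close>

context strict_monoidal_category
begin

lemma rev_strict_monoidal: "strict_monoidal_category (rev_cat C)"
proof (unfold_locales, unfold rev_cat_simps)
  fix f f' g g' X Y Z U V W
  assume "f \<in> Hom C X Y" "f' \<in> Hom C Y Z" "g \<in> Hom C U V" "g' \<in> Hom C V W"
  thus "(g' \<cdot> g) \<otimes>\<^sub>m (f' \<cdot> f) = (g' \<otimes>\<^sub>m f') \<cdot> (g \<otimes>\<^sub>m f)" by (intro TensorM_Comp)
qed (fact Dom_in Cod_in Ide_in Comp_in Ide_left Ide_right Comp_assoc Unit_in TensorO_Unit TensorM_Unit |
    simp add: TensorO_in TensorM_in TensorM_Ide TensorO_assoc TensorM_assoc)+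

lemma is_left_dual_rev: "is_left_dual (rev_cat C) X Y e c \<longleftrightarrow> is_left_dual C Y X e c"
  by (auto simp: is_left_dual_def)

lemma Unit_Obj [simp]: "\<I> \<in> Obj C" by (fact Unit_in)

lemma TensorO_Obj [simp]: "X \<in> Obj C \<Longrightarrow> Y \<in> Obj C \<Longrightarrow> X \<otimes>\<^sub>o Y \<in> Obj C"
  by (fact TensorO_in)

lemmas TensorO_assoc_simp [simp] = TensorO_assoc
lemmas TensorO_Unit_simp [simp] = TensorO_Unit
lemmas TensorM_assoc_simp [simp] = TensorM_assoc
lemmas TensorM_Unit_simp [simp] = TensorM_Unit

lemma TensorM_arr [simp]:
  assumes "f \<in> Arr C" "g \<in> Arr C"
  shows "f \<otimes>\<^sub>m g \<in> Arr C" "Dom C (f \<otimes>\<^sub>m g) = Dom C f \<otimes>\<^sub>o Dom C g"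
    "Cod C (f \<otimes>\<^sub>m g) = Cod C f \<otimes>\<^sub>o Cod C g"
  using TensorM_in[of f "Dom C f" "Cod C f" g "Dom C g" "Cod C g"] assms by (auto simp: Hom_def)

lemma Ide_TensorO [simp]: "X \<in> Obj C \<Longrightarrow> Y \<in> Obj C \<Longrightarrow> Ide C (X \<otimes>\<^sub>o Y) = Ide C X \<otimes>\<^sub>m Ide C Y"
  by (simp add: TensorM_Ide)

lemma Comp_Ide_TensorO [simp]:
  assumes "f \<in> Arr C" "X \<in> Obj C" "Y \<in> Obj C"
  shows "Dom C f = X \<otimes>\<^sub>o Y \<Longrightarrow> f \<cdot> (Ide C X \<otimes>\<^sub>m Ide C Y) = f"
    "Cod C f = X \<otimes>\<^sub>o Y \<Longrightarrow> (Ide C X \<otimes>\<^sub>m Ide C Y) \<cdot> f = f"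
  using assms Comp_Ide[of f "X \<otimes>\<^sub>o Y"] by auto

lemma interchange:
  assumes "f \<in> Arr C" "f' \<in> Arr C" "g \<in> Arr C" "g' \<in> Arr C" "Dom C f' = Cod C f" "Dom C g' = Cod C g"
  shows "(f' \<otimes>\<^sub>m g') \<cdot> (f \<otimes>\<^sub>m g) = (f' \<cdot> f) \<otimes>\<^sub>m (g' \<cdot> g)"
  using TensorM_Comp[of f "Dom C f" "Cod C f" f' "Cod C f'" g "Dom C g" "Cod C g" g' "Cod C g'"] assms
  by (auto simp: Hom_def)

lemma whisker_left_Comp:
  assumes "V \<in> Obj C" "g \<in> Arr C" "f \<in> Arr C" "Dom C g = Cod C f"
  shows "Ide C V \<otimes>\<^sub>m (g \<cdot> f) = (Ide C V \<otimes>\<^sub>m g) \<cdot> (Ide C V \<otimes>\<^sub>m f)"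
  using assms by (simp add: interchange)

lemma whisker_right_Comp:
  assumes "V \<in> Obj C" "g \<in> Arr C" "f \<in> Arr C" "Dom C g = Cod C f"
  shows "(g \<cdot> f) \<otimes>\<^sub>m Ide C V = (g \<otimes>\<^sub>m Ide C V) \<cdot> (f \<otimes>\<^sub>m Ide C V)"
  using assms by (simp add: interchange)

lemma slide:
  assumes "f \<in> Hom C X Y" "g \<in> Hom C Z W"
  shows "(f \<otimes>\<^sub>m Ide C W) \<cdot> (Ide C X \<otimes>\<^sub>m g) = f \<otimes>\<^sub>m g" "(Ide C Y \<otimes>\<^sub>m g) \<cdot> (f \<otimes>\<^sub>m Ide C Z) = f \<otimes>\<^sub>m g"
proof -
  note [simp] = HomD[OF assms(1)] HomD[OF assms(2)] Hom_Obj[OF assms(1)] Hom_Obj[OF assms(2)]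
  show "(f \<otimes>\<^sub>m Ide C W) \<cdot> (Ide C X \<otimes>\<^sub>m g) = f \<otimes>\<^sub>m g" "(Ide C Y \<otimes>\<^sub>m g) \<cdot> (f \<otimes>\<^sub>m Ide C Z) = f \<otimes>\<^sub>m g"
    by (simp_all add: interchange)
qed

lemma slide_effect:
  assumes "e \<in> Hom C X \<I>" "f \<in> Hom C Z W"
  shows "f \<cdot> (e \<otimes>\<^sub>m Ide C Z) = e \<otimes>\<^sub>m f" "f \<cdot> (Ide C Z \<otimes>\<^sub>m e) = f \<otimes>\<^sub>m e"
  using slide(2)[OF assms(1) assms(2)] slide(1)[OF assms(2,1)] HomD(1)[OF assms(2)] by simp_all

lemma slide_state:
  assumes "c \<in> Hom C \<I> X" "f \<in> Hom C Z W"
  shows "(c \<otimes>\<^sub>m Ide C W) \<cdot> f = c \<otimes>\<^sub>m f" "(Ide C W \<otimes>\<^sub>m c) \<cdot> f = f \<otimes>\<^sub>m c"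
  using slide(1)[OF assms(1) assms(2)] slide(2)[OF assms(2,1)] HomD(1)[OF assms(2)] by simp_all

end

locale dual_pair = strict_monoidal_category C
  for C :: "('k :: field, 'o, 'm, 'z) rigid_cat_scheme" (structure) +
  fixes V' V e c
  assumes is_dual: "is_left_dual C V' V e c"
begin

lemma V_Obj [simp]: "V \<in> Obj C" "V' \<in> Obj C"
  using is_dual by (auto simp: is_left_dual_def)

lemma e_in: "e \<in> Hom C (V \<otimes>\<^sub>o V') \<I>" and c_in: "c \<in> Hom C \<I> (V' \<otimes>\<^sub>o V)"
  and zigzag': "(Ide C V' \<otimes>\<^sub>m e) \<cdot> (c \<otimes>\<^sub>m Ide C V') = Ide C V'"
  and zigzag: "(e \<otimes>\<^sub>m Ide C V) \<cdot> (Ide C V \<otimes>\<^sub>m c) = Ide C V"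
  using is_dual by (auto simp: is_left_dual_def)

lemma ec [simp]: "e \<in> Arr C" "Dom C e = V \<otimes>\<^sub>o V'" "Cod C e = \<I>"
  "c \<in> Arr C" "Dom C c = \<I>" "Cod C c = V' \<otimes>\<^sub>o V"
  using e_in c_in by (simp_all add: Hom_iff)

text \<open>One direction of the adjunction between \<open>V \<otimes>\<^sub>o _\<close> on the left
  and \<open>V' \<otimes>\<^sub>o _\<close> on the right; \<open>untransp\<close> is the
  other.\<close>

definition transp :: "'m \<Rightarrow> 'o \<Rightarrow> 'm"
  where "transp f A = (Ide C V' \<otimes>\<^sub>m f) \<cdot> (c \<otimes>\<^sub>m Ide C A)"

definition untransp :: "'m \<Rightarrow> 'o \<Rightarrow> 'm"
  where "untransp g B = (e \<otimes>\<^sub>m Ide C B) \<cdot> (Ide C V \<otimes>\<^sub>m g)"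

lemma transp_in: "A \<in> Obj C \<Longrightarrow> f \<in> Hom C (V \<otimes>\<^sub>o A) B \<Longrightarrow> transp f A \<in> Hom C A (V' \<otimes>\<^sub>o B)"
  unfolding transp_def Hom_iff by simp

lemma untransp_in: "B \<in> Obj C \<Longrightarrow> g \<in> Hom C A (V' \<otimes>\<^sub>o B) \<Longrightarrow> untransp g B \<in> Hom C (V \<otimes>\<^sub>o A) B"
  unfolding untransp_def Hom_iff by simp

lemma untransp_transp:
  assumes A: "A \<in> Obj C" and f: "f \<in> Hom C (V \<otimes>\<^sub>o A) B"
  shows "untransp (transp f A) B = f"
proof -
  note [simp] = A HomD[OF f] Hom_Obj[OF f]
  have "untransp (transp f A) B = (e \<otimes>\<^sub>m Ide C B) \<cdot> ((Ide C (V \<otimes>\<^sub>o V') \<otimes>\<^sub>m f) \<cdot> (Ide C V \<otimes>\<^sub>m c \<otimes>\<^sub>m Ide C A))"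
    unfolding transp_def untransp_def by (simp add: whisker_left_Comp)
  also have "\<dots> = ((e \<otimes>\<^sub>m Ide C B) \<cdot> (Ide C (V \<otimes>\<^sub>o V') \<otimes>\<^sub>m f)) \<cdot> (Ide C V \<otimes>\<^sub>m c \<otimes>\<^sub>m Ide C A)"
    by (rule Comp_assoc'[symmetric]) simp_all
  also have "(e \<otimes>\<^sub>m Ide C B) \<cdot> (Ide C (V \<otimes>\<^sub>o V') \<otimes>\<^sub>m f) = f \<cdot> (e \<otimes>\<^sub>m Ide C (V \<otimes>\<^sub>o A))"
    using slide(1)[OF e_in f] slide_effect(1)[OF e_in f] by simp
  also have "(f \<cdot> (e \<otimes>\<^sub>m Ide C (V \<otimes>\<^sub>o A))) \<cdot> (Ide C V \<otimes>\<^sub>m c \<otimes>\<^sub>m Ide C A)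
      = f \<cdot> ((e \<otimes>\<^sub>m Ide C (V \<otimes>\<^sub>o A)) \<cdot> (Ide C V \<otimes>\<^sub>m c \<otimes>\<^sub>m Ide C A))"
    by (rule Comp_assoc') simp_all
  also have "(e \<otimes>\<^sub>m Ide C (V \<otimes>\<^sub>o A)) \<cdot> (Ide C V \<otimes>\<^sub>m c \<otimes>\<^sub>m Ide C A)
      = ((e \<otimes>\<^sub>m Ide C V) \<otimes>\<^sub>m Ide C A) \<cdot> ((Ide C V \<otimes>\<^sub>m c) \<otimes>\<^sub>m Ide C A)"
    by simp
  also have "\<dots> = ((e \<otimes>\<^sub>m Ide C V) \<cdot> (Ide C V \<otimes>\<^sub>m c)) \<otimes>\<^sub>m Ide C A"
    by (rule whisker_right_Comp[symmetric]) simp_all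
  finally show ?thesis by (simp add: zigzag)
qed

lemma transp_untransp:
  assumes B: "B \<in> Obj C" and g: "g \<in> Hom C A (V' \<otimes>\<^sub>o B)"
  shows "transp (untransp g B) A = g"
proof -
  note [simp] = B HomD[OF g] Hom_Obj[OF g]
  have "transp (untransp g B) A = ((Ide C V' \<otimes>\<^sub>m e \<otimes>\<^sub>m Ide C B) \<cdot> (Ide C (V' \<otimes>\<^sub>o V) \<otimes>\<^sub>m g)) \<cdot> (c \<otimes>\<^sub>m Ide C A)"
    unfolding transp_def untransp_def by (simp add: whisker_left_Comp)
  also have "\<dots> = (Ide C V' \<otimes>\<^sub>m e \<otimes>\<^sub>m Ide C B) \<cdot> ((Ide C (V' \<otimes>\<^sub>o V) \<otimes>\<^sub>m g) \<cdot> (c \<otimes>\<^sub>m Ide C A))"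
    by (rule Comp_assoc') simp_all
  also have "(Ide C (V' \<otimes>\<^sub>o V) \<otimes>\<^sub>m g) \<cdot> (c \<otimes>\<^sub>m Ide C A) = (c \<otimes>\<^sub>m Ide C (V' \<otimes>\<^sub>o B)) \<cdot> g"
    using slide(2)[OF c_in g] slide_state(1)[OF c_in g] by simp
  also have "(Ide C V' \<otimes>\<^sub>m e \<otimes>\<^sub>m Ide C B) \<cdot> ((c \<otimes>\<^sub>m Ide C (V' \<otimes>\<^sub>o B)) \<cdot> g)
      = ((Ide C V' \<otimes>\<^sub>m e \<otimes>\<^sub>m Ide C B) \<cdot> (c \<otimes>\<^sub>m Ide C (V' \<otimes>\<^sub>o B))) \<cdot> g"
    by (rule Comp_assoc'[symmetric]) simp_all
  also have "(Ide C V' \<otimes>\<^sub>m e \<otimes>\<^sub>m Ide C B) \<cdot> (c \<otimes>\<^sub>m Ide C (V' \<otimes>\<^sub>o B))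
      = ((Ide C V' \<otimes>\<^sub>m e) \<otimes>\<^sub>m Ide C B) \<cdot> ((c \<otimes>\<^sub>m Ide C V') \<otimes>\<^sub>m Ide C B)"
    by simp
  also have "\<dots> = ((Ide C V' \<otimes>\<^sub>m e) \<cdot> (c \<otimes>\<^sub>m Ide C V')) \<otimes>\<^sub>m Ide C B"
    by (rule whisker_right_Comp[symmetric]) simp_all
  finally show ?thesis by (simp add: zigzag')
qed

lemma transp_Comp_right:
  assumes f: "f \<in> Hom C (V \<otimes>\<^sub>o A) B" and k: "k \<in> Hom C A' A"
  shows "transp (f \<cdot> (Ide C V \<otimes>\<^sub>m k)) A' = transp f A \<cdot> k"
proof -
  note [simp] = HomD[OF f] HomD[OF k] Hom_Obj[OF f] Hom_Obj[OF k]
  have "transp (f \<cdot> (Ide C V \<otimes>\<^sub>m k)) A' = (Ide C V' \<otimes>\<^sub>m f) \<cdot> ((Ide C (V' \<otimes>\<^sub>o V) \<otimes>\<^sub>m k) \<cdot> (c \<otimes>\<^sub>m Ide C A'))"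
    unfolding transp_def by (simp add: whisker_left_Comp Comp_assoc')
  also have "(Ide C (V' \<otimes>\<^sub>o V) \<otimes>\<^sub>m k) \<cdot> (c \<otimes>\<^sub>m Ide C A') = (c \<otimes>\<^sub>m Ide C A) \<cdot> k"
    using slide(2)[OF c_in k] slide_state(1)[OF c_in k] by simp
  finally show ?thesis unfolding transp_def by (simp add: Comp_assoc')
qed

lemma transp_Comp_left:
  assumes A: "A \<in> Obj C" and f: "f \<in> Hom C (V \<otimes>\<^sub>o A) B" and k: "k \<in> Hom C B B'"
  shows "transp (k \<cdot> f) A = (Ide C V' \<otimes>\<^sub>m k) \<cdot> transp f A"
proof -
  note [simp] = A HomD[OF f] HomD[OF k] Hom_Obj[OF f] Hom_Obj[OF k]
  show ?thesis unfolding transp_def by (simp add: whisker_left_Comp Comp_assoc')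
qed

lemma untransp_Comp_right:
  assumes B: "B \<in> Obj C" and g: "g \<in> Hom C A (V' \<otimes>\<^sub>o B)" and k: "k \<in> Hom C A' A"
  shows "untransp (g \<cdot> k) B = untransp g B \<cdot> (Ide C V \<otimes>\<^sub>m k)"
proof -
  note [simp] = B HomD[OF g] HomD[OF k] Hom_Obj[OF g] Hom_Obj[OF k]
  show ?thesis unfolding untransp_def by (simp add: whisker_left_Comp Comp_assoc')
qed

lemma untransp_Comp_left:
  assumes g: "g \<in> Hom C A (V' \<otimes>\<^sub>o B)" and k: "k \<in> Hom C B B'"
  shows "untransp ((Ide C V' \<otimes>\<^sub>m k) \<cdot> g) B' = k \<cdot> untransp g B"
proof -
  note [simp] = HomD[OF g] HomD[OF k] Hom_Obj[OF g] Hom_Obj[OF k]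
  have "untransp ((Ide C V' \<otimes>\<^sub>m k) \<cdot> g) B' = ((e \<otimes>\<^sub>m Ide C B') \<cdot> (Ide C (V \<otimes>\<^sub>o V') \<otimes>\<^sub>m k)) \<cdot> (Ide C V \<otimes>\<^sub>m g)"
    unfolding untransp_def by (simp add: whisker_left_Comp Comp_assoc')
  also have "(e \<otimes>\<^sub>m Ide C B') \<cdot> (Ide C (V \<otimes>\<^sub>o V') \<otimes>\<^sub>m k) = k \<cdot> (e \<otimes>\<^sub>m Ide C B)"
    using slide(1)[OF e_in k] slide_effect(1)[OF e_in k] by simp
  finally show ?thesis unfolding untransp_def by (simp add: Comp_assoc')
qed

lemma transp_inject:
  assumes "A \<in> Obj C" "f \<in> Hom C (V \<otimes>\<^sub>o A) B" "g \<in> Hom C (V \<otimes>\<^sub>o A) B" "transp f A = transp g A"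
  shows "f = g"
  using assms untransp_transp by metis

lemma untransp_inject:
  assumes "B \<in> Obj C" "f \<in> Hom C A (V' \<otimes>\<^sub>o B)" "g \<in> Hom C A (V' \<otimes>\<^sub>o B)" "untransp f B = untransp g B"
  shows "f = g"
  using assms transp_untransp by metis

text \<open>Left adjoints preserve jointly epic families: precomposition is compared after
  transposition.\<close>

lemma jointly_epi_tensor:
  assumes A: "A \<in> Obj C" and e: "jointly_epi A K" and K: "\<And>k. k \<in> K \<Longrightarrow> k \<in> Arr C \<and> Cod C k = A"
  shows "jointly_epi (V \<otimes>\<^sub>o A) ((\<lambda>k. Ide C V \<otimes>\<^sub>m k) ` K)"
  unfolding jointly_epi_def
proof (intro allI ballI impI)
  fix B x y assume x: "x \<in> Hom C (V \<otimes>\<^sub>o A) B" and y: "y \<in> Hom C (V \<otimes>\<^sub>o A) B"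
    and xy: "\<forall>k \<in> (\<lambda>k. Ide C V \<otimes>\<^sub>m k) ` K. x \<cdot> k = y \<cdot> k"
  have "transp x A \<cdot> k = transp y A \<cdot> k" if k: "k \<in> K" for k
  proof -
    have "k \<in> Hom C (Dom C k) A" using K[OF k] by (auto simp: Hom_iff)
    from transp_Comp_right[OF x this] transp_Comp_right[OF y this] xy k show ?thesis by auto
  qed
  with transp_in[OF A x] transp_in[OF A y] have "transp x A = transp y A"
    using jointly_epiD[OF e] by blast
  thus "x = y" by (rule transp_inject[OF A x y])
qed

text \<open>Right adjoints preserve monomorphisms.\<close>

lemma mono_tensor:
  assumes m: "is_mono C m"
  shows "is_mono C (Ide C V' \<otimes>\<^sub>m m)"
proof -
  have ma: "m \<in> Arr C" using m by (simp add: is_mono_def)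
  hence mH: "m \<in> Hom C (Dom C m) (Cod C m)" by (simp add: Hom_iff)
  show ?thesis unfolding is_mono_def
  proof (intro conjI allI ballI impI)
    fix W x y assume x: "x \<in> Hom C W (Dom C (Ide C V' \<otimes>\<^sub>m m))" and y: "y \<in> Hom C W (Dom C (Ide C V' \<otimes>\<^sub>m m))"
      and xy: "(Ide C V' \<otimes>\<^sub>m m) \<cdot> x = (Ide C V' \<otimes>\<^sub>m m) \<cdot> y"
    have x': "x \<in> Hom C W (V' \<otimes>\<^sub>o Dom C m)" and y': "y \<in> Hom C W (V' \<otimes>\<^sub>o Dom C m)"
      using x y ma by simp_all
    have o: "Dom C m \<in> Obj C" using ma by simp
    have "m \<cdot> untransp x (Dom C m) = m \<cdot> untransp y (Dom C m)"
      using untransp_Comp_left[OF x' mH] untransp_Comp_left[OF y' mH] xy by simp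
    hence "untransp x (Dom C m) = untransp y (Dom C m)"
      using monoD[OF m mH] untransp_in[OF o x'] untransp_in[OF o y'] by blast
    thus "x = y" by (rule untransp_inject[OF o x' y'])
  qed (use ma in simp)
qed

text \<open>Left adjoints preserve colimits: transpose the cocone, factor it through
  \<open>F\<close> and transpose back. Uniqueness comes from the joint epimorphy of the whiskered
  legs.\<close>

lemma universal_cocone_tensor:
  assumes R: "relations_on D R" and u: "universal_cocone D R F i"
  shows "universal_cocone (\<lambda>x. V \<otimes>\<^sub>o D x) ((\<lambda>(x, a, y, b). (x, Ide C V \<otimes>\<^sub>m a, y, Ide C V \<otimes>\<^sub>m b)) ` R)
    (V \<otimes>\<^sub>o F) (\<lambda>x. Ide C V \<otimes>\<^sub>m i x)"
proof -
  have cF: "cocone D R F i" using u unfolding universal_cocone_def by (rule conjunct1)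
  have F: "F \<in> Obj C" using cF unfolding cocone_def by (rule conjunct1)
  have i: "i x \<in> Hom C (D x) F" if "x \<in> Obj C" for x by (rule coconeD(2)[OF cF that])
  note D [simp] = relations_onD(1)[OF R] and Rd = relations_onD(2)[OF R]
  have j: "jointly_epi F (i ` Obj C)" by (rule universal_cocone_jointly_epi[OF R u])
  have 1: "cocone (\<lambda>x. V \<otimes>\<^sub>o D x) ((\<lambda>(x, a, y, b). (x, Ide C V \<otimes>\<^sub>m a, y, Ide C V \<otimes>\<^sub>m b)) ` R)
    (V \<otimes>\<^sub>o F) (\<lambda>x. Ide C V \<otimes>\<^sub>m i x)"
  proof -
    have *: "(Ide C V \<otimes>\<^sub>m i x) \<cdot> (Ide C V \<otimes>\<^sub>m a) = (Ide C V \<otimes>\<^sub>m i y) \<cdot> (Ide C V \<otimes>\<^sub>m b)"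
      if r: "(x, a, y, b) \<in> R" for x a y b
    proof -
      from Rd[OF r] obtain Z where h: "x \<in> Obj C" "y \<in> Obj C" "a \<in> Hom C Z (D x)" "b \<in> Hom C Z (D y)" by blast
      have "i x \<cdot> a = i y \<cdot> b"
        using coconeD(3)[OF cF r] .
      moreover have "(Ide C V \<otimes>\<^sub>m i x) \<cdot> (Ide C V \<otimes>\<^sub>m a) = Ide C V \<otimes>\<^sub>m (i x \<cdot> a)"
        using h(3) i[OF h(1)] by (intro whisker_left_Comp[symmetric]) (simp_all add: Hom_iff)
      moreover have "(Ide C V \<otimes>\<^sub>m i y) \<cdot> (Ide C V \<otimes>\<^sub>m b) = Ide C V \<otimes>\<^sub>m (i y \<cdot> b)"
        using h(4) i[OF h(2)] by (intro whisker_left_Comp[symmetric]) (simp_all add: Hom_iff)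
      ultimately show ?thesis by (simp only:)
    qed
    show ?thesis
    proof (rule coconeI)
      show "V \<otimes>\<^sub>o F \<in> Obj C" using F by simp
      show "Ide C V \<otimes>\<^sub>m i x \<in> Hom C (V \<otimes>\<^sub>o D x) (V \<otimes>\<^sub>o F)" if "x \<in> Obj C" for x
        using i[OF that] by (simp add: Hom_iff)
      fix x a y b assume "(x, a, y, b) \<in> (\<lambda>(x, a, y, b). (x, Ide C V \<otimes>\<^sub>m a, y, Ide C V \<otimes>\<^sub>m b)) ` R"
      then obtain a' b' where r: "(x, a', y, b') \<in> R" "a = Ide C V \<otimes>\<^sub>m a'" "b = Ide C V \<otimes>\<^sub>m b'" by auto
      show "(Ide C V \<otimes>\<^sub>m i x) \<cdot> a = (Ide C V \<otimes>\<^sub>m i y) \<cdot> b" unfolding r(2,3) by (rule *[OF r(1)])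
    qed
  qed
  have "\<exists>!h. h \<in> Hom C (V \<otimes>\<^sub>o F) B \<and> (\<forall>x\<in>Obj C. h \<cdot> (Ide C V \<otimes>\<^sub>m i x) = k x)"
    if k: "cocone (\<lambda>x. V \<otimes>\<^sub>o D x) ((\<lambda>(x, a, y, b). (x, Ide C V \<otimes>\<^sub>m a, y, Ide C V \<otimes>\<^sub>m b)) ` R) B k" for B k
  proof -
    have B: "B \<in> Obj C" by (rule coconeD(1)[OF k])
    have kx: "k x \<in> Hom C (V \<otimes>\<^sub>o D x) B" if "x \<in> Obj C" for x by (rule coconeD(2)[OF k that])
    have "cocone D R (V' \<otimes>\<^sub>o B) (\<lambda>x. transp (k x) (D x))"
    proof -
      have "transp (k x) (D x) \<cdot> a = transp (k y) (D y) \<cdot> b" if r: "(x, a, y, b) \<in> R" for x a y b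
      proof -
        from Rd[OF r] obtain Z where h: "x \<in> Obj C" "y \<in> Obj C" "a \<in> Hom C Z (D x)" "b \<in> Hom C Z (D y)" by blast
        have "k x \<cdot> (Ide C V \<otimes>\<^sub>m a) = k y \<cdot> (Ide C V \<otimes>\<^sub>m b)"
          by (rule coconeD(3)[OF k]) (rule image_eqI[OF _ r], simp)
        with transp_Comp_right[OF kx[OF h(1)] h(3)] transp_Comp_right[OF kx[OF h(2)] h(4)] show ?thesis
          by (simp only:)
      qed
      thus ?thesis using B transp_in[OF D kx] by (intro coconeI TensorO_Obj V_Obj)
    qed
    then obtain h where h: "h \<in> Hom C F (V' \<otimes>\<^sub>o B)"
      "\<And>x. x \<in> Obj C \<Longrightarrow> h \<cdot> i x = transp (k x) (D x)"
      by (rule universal_coconeE[OF u]) (rule that)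
    have *: "untransp h B \<cdot> (Ide C V \<otimes>\<^sub>m i x) = k x" if x: "x \<in> Obj C" for x
      using untransp_Comp_right[OF B h(1) i[OF x]] h(2)[OF x] untransp_transp[OF D[OF x] kx[OF x]]
      by (simp only:)
    have j: "jointly_epi (V \<otimes>\<^sub>o F) ((\<lambda>k. Ide C V \<otimes>\<^sub>m k) ` i ` Obj C)"
      using i by (intro jointly_epi_tensor[OF F j]) (auto simp: Hom_iff)
    have u: "untransp h B \<in> Hom C (V \<otimes>\<^sub>o F) B" by (rule untransp_in[OF B h(1)])
    show ?thesis
    proof (rule ex1I[of _ "untransp h B"], intro conjI ballI)
      fix h' assume h': "h' \<in> Hom C (V \<otimes>\<^sub>o F) B \<and> (\<forall>x\<in>Obj C. h' \<cdot> (Ide C V \<otimes>\<^sub>m i x) = k x)"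
      show "h' = untransp h B"
      proof (rule jointly_epiD[OF j conjunct1[OF h'] u])
        fix k' assume "k' \<in> (\<lambda>k. Ide C V \<otimes>\<^sub>m k) ` i ` Obj C"
        then obtain x where "x \<in> Obj C" "k' = Ide C V \<otimes>\<^sub>m i x" by blast
        with *[of x] h' show "h' \<cdot> k' = untransp h B \<cdot> k'" by (metis (no_types))
      qed
    qed (fact u, rule *)
  qed
  with 1 show ?thesis unfolding universal_cocone_def by (intro conjI allI impI)
qed

end

section \<open>Tensoring in a rigid category, dual arrows and the coend as a colimit\<close>

context rigid_monoidal_category
begin

lemma dual_pair_left_dual: "X \<in> Obj C \<Longrightarrow> dual_pair C X (X\<^sup>\<star>) (Ev C X) (Coev C X)"
  by (intro dual_pair.intro dual_pair_axioms.intro left_dual strict_monoidal_category_axioms)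

lemma dual_pair_right_dual:
  assumes "V \<in> Obj C"
  obtains V' e c where "dual_pair C V' V e c"
proof -
  obtain V' e c where "is_left_dual C V' V e c" using right_dual[OF assms] by blast
  thus thesis by (intro that[of V' e c] dual_pair.intro dual_pair_axioms.intro strict_monoidal_category_axioms)
qed

lemma dual_pair_rev:
  assumes "is_left_dual C V V' e c"
  shows "dual_pair (rev_cat C) V' V e c"
  using assms by (intro dual_pair.intro dual_pair_axioms.intro rev_strict_monoidal) (simp add: is_left_dual_rev)

lemma rev_category: "category (rev_cat C)"
  using rev_strict_monoidal by (rule strict_monoidal_category.axioms)

lemma jointly_epi_rev: "category.jointly_epi (rev_cat C) A K \<longleftrightarrow> jointly_epi A K"
  unfolding jointly_epi_def category.jointly_epi_def[OF rev_category] by simp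

lemma cocone_rev: "category.cocone (rev_cat C) D R B k \<longleftrightarrow> cocone D R B k"
  unfolding cocone_def category.cocone_def[OF rev_category] by simp

lemma universal_cocone_rev: "category.universal_cocone (rev_cat C) D R B k \<longleftrightarrow> universal_cocone D R B k"
  unfolding universal_cocone_def category.universal_cocone_def[OF rev_category] cocone_rev by simp

lemma relations_on_rev: "category.relations_on (rev_cat C) D R \<longleftrightarrow> relations_on D R"
  unfolding relations_on_def category.relations_on_def[OF rev_category] by simp

text \<open>Tensoring with \<open>V\<close> from the left is a left adjoint thanks to a right dual
  of \<open>V\<close>; tensoring from the right is one thanks to the left dual, seen in the reversed
  category.\<close>

lemma jointly_epi_whisker:
  assumes V: "V \<in> Obj C" and A: "A \<in> Obj C" and e: "jointly_epi A K"
    and K: "\<And>k. k \<in> K \<Longrightarrow> k \<in> Arr C \<and> Cod C k = A"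
  shows "jointly_epi (V \<otimes>\<^sub>o A) ((\<lambda>k. Ide C V \<otimes>\<^sub>m k) ` K)"
    and "jointly_epi (A \<otimes>\<^sub>o V) ((\<lambda>k. k \<otimes>\<^sub>m Ide C V) ` K)"
proof -
  obtain V' ev c where d: "dual_pair C V' V ev c" by (rule dual_pair_right_dual[OF V])
  show "jointly_epi (V \<otimes>\<^sub>o A) ((\<lambda>k. Ide C V \<otimes>\<^sub>m k) ` K)"
    by (rule dual_pair.jointly_epi_tensor[OF d A e K])
  show "jointly_epi (A \<otimes>\<^sub>o V) ((\<lambda>k. k \<otimes>\<^sub>m Ide C V) ` K)"
    using dual_pair.jointly_epi_tensor[OF dual_pair_rev[OF left_dual[OF V]], of A K] A e K
    by (simp add: jointly_epi_rev)
qed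

lemma mono_whisker:
  assumes V: "V \<in> Obj C" and m: "is_mono C m"
  shows "is_mono C (m \<otimes>\<^sub>m Ide C V)"
proof -
  obtain V' e c where d: "is_left_dual C V' V e c" using right_dual[OF V] by blast
  show ?thesis using dual_pair.mono_tensor[OF dual_pair_rev[OF d], of m] m by simp
qed

lemma universal_cocone_whisker:
  assumes V: "V \<in> Obj C" and R: "relations_on D R" and u: "universal_cocone D R F i"
  shows "universal_cocone (\<lambda>x. V \<otimes>\<^sub>o D x) ((\<lambda>(x, a, y, b). (x, Ide C V \<otimes>\<^sub>m a, y, Ide C V \<otimes>\<^sub>m b)) ` R)
      (V \<otimes>\<^sub>o F) (\<lambda>x. Ide C V \<otimes>\<^sub>m i x)"
    and "universal_cocone (\<lambda>x. D x \<otimes>\<^sub>o V) ((\<lambda>(x, a, y, b). (x, a \<otimes>\<^sub>m Ide C V, y, b \<otimes>\<^sub>m Ide C V)) ` R)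
      (F \<otimes>\<^sub>o V) (\<lambda>x. i x \<otimes>\<^sub>m Ide C V)"
proof -
  obtain V' ev c where d: "dual_pair C V' V ev c" by (rule dual_pair_right_dual[OF V])
  show "universal_cocone (\<lambda>x. V \<otimes>\<^sub>o D x) ((\<lambda>(x, a, y, b). (x, Ide C V \<otimes>\<^sub>m a, y, Ide C V \<otimes>\<^sub>m b)) ` R)
      (V \<otimes>\<^sub>o F) (\<lambda>x. Ide C V \<otimes>\<^sub>m i x)"
    by (rule dual_pair.universal_cocone_tensor[OF d R u])
  show "universal_cocone (\<lambda>x. D x \<otimes>\<^sub>o V) ((\<lambda>(x, a, y, b). (x, a \<otimes>\<^sub>m Ide C V, y, b \<otimes>\<^sub>m Ide C V)) ` R)
      (F \<otimes>\<^sub>o V) (\<lambda>x. i x \<otimes>\<^sub>m Ide C V)"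
    using dual_pair.universal_cocone_tensor[OF dual_pair_rev[OF left_dual[OF V]], of D R F i] R u
    by (simp add: relations_on_rev universal_cocone_rev)
qed

lemma Dual_Obj [simp]: "X \<in> Obj C \<Longrightarrow> X\<^sup>\<star> \<in> Obj C"
  using left_dual by (auto simp: is_left_dual_def)

lemma Ev_in: "X \<in> Obj C \<Longrightarrow> Ev C X \<in> Hom C (X\<^sup>\<star> \<otimes>\<^sub>o X) \<I>"
  and Coev_in: "X \<in> Obj C \<Longrightarrow> Coev C X \<in> Hom C \<I> (X \<otimes>\<^sub>o X\<^sup>\<star>)"
  using left_dual by (auto simp: is_left_dual_def)

lemma Ev_arr [simp]:
  assumes "X \<in> Obj C"
  shows "Ev C X \<in> Arr C" "Dom C (Ev C X) = X\<^sup>\<star> \<otimes>\<^sub>o X" "Cod C (Ev C X) = \<I>"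
    "Coev C X \<in> Arr C" "Dom C (Coev C X) = \<I>" "Cod C (Coev C X) = X \<otimes>\<^sub>o X\<^sup>\<star>"
  using HomD[OF Ev_in[OF assms]] HomD[OF Coev_in[OF assms]] by simp_all

lemma dual_arrow_untransp:
  assumes f: "f \<in> Hom C X Y"
  shows "dual_arrow C f = dual_pair.untransp C (Y\<^sup>\<star>) (Ev C Y) ((f \<otimes>\<^sub>m Ide C (X\<^sup>\<star>)) \<cdot> Coev C X) (X\<^sup>\<star>)"
proof -
  note [simp] = HomD[OF f] Hom_Obj[OF f]
  show ?thesis
    unfolding dual_pair.untransp_def[OF dual_pair_left_dual[OF Hom_Obj(2)[OF f]]]
    by (simp add: dual_arrow_def Let_def whisker_left_Comp)
qed

lemma dual_arrow_in:
  assumes f: "f \<in> Hom C X Y"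
  shows "dual_arrow C f \<in> Hom C (Y\<^sup>\<star>) (X\<^sup>\<star>)"
proof -
  note [simp] = HomD[OF f] Hom_Obj[OF f]
  interpret Y: dual_pair C Y "Y\<^sup>\<star>" "Ev C Y" "Coev C Y" by (rule dual_pair_left_dual) simp
  have "Y.untransp ((f \<otimes>\<^sub>m Ide C (X\<^sup>\<star>)) \<cdot> Coev C X) (X\<^sup>\<star>) \<in> Hom C (Y\<^sup>\<star> \<otimes>\<^sub>o \<I>) (X\<^sup>\<star>)"
    by (rule Y.untransp_in) (simp_all add: Hom_iff)
  thus ?thesis by (simp add: dual_arrow_untransp[OF f])
qed

text \<open>The arrow \<open>f\<^sup>\<star>\<close> is defined as the transpose of \<open>(f \<otimes> X\<^sup>\<star>) \<cdot> coev\<close>.\<close>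

lemma Coev_dual_arrow:
  assumes f: "f \<in> Hom C X Y"
  shows "(Ide C Y \<otimes>\<^sub>m dual_arrow C f) \<cdot> Coev C Y = (f \<otimes>\<^sub>m Ide C (X\<^sup>\<star>)) \<cdot> Coev C X"
proof -
  note [simp] = HomD[OF f] Hom_Obj[OF f]
  interpret Y: dual_pair C Y "Y\<^sup>\<star>" "Ev C Y" "Coev C Y" by (rule dual_pair_left_dual) simp
  have "Y.transp (Y.untransp ((f \<otimes>\<^sub>m Ide C (X\<^sup>\<star>)) \<cdot> Coev C X) (X\<^sup>\<star>)) \<I> = (f \<otimes>\<^sub>m Ide C (X\<^sup>\<star>)) \<cdot> Coev C X"
    by (rule Y.transp_untransp) (simp_all add: Hom_iff)
  thus ?thesis unfolding dual_arrow_untransp[OF f, symmetric] Y.transp_def by simp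
qed

text \<open>Both sides have transpose \<open>f\<close>. This is the dinaturality of the evaluation,
  from which that of the pairing will follow.\<close>

lemma Ev_dual_arrow:
  assumes f: "f \<in> Hom C X Y"
  shows "Ev C Y \<cdot> (Ide C (Y\<^sup>\<star>) \<otimes>\<^sub>m f) = Ev C X \<cdot> (dual_arrow C f \<otimes>\<^sub>m Ide C X)"
proof -
  note [simp] = HomD[OF f] Hom_Obj[OF f] HomD[OF dual_arrow_in[OF f]]
  interpret Y: dual_pair C Y "Y\<^sup>\<star>" "Ev C Y" "Coev C Y" by (rule dual_pair_left_dual) simp
  interpret X: dual_pair C X "X\<^sup>\<star>" "Ev C X" "Coev C X" by (rule dual_pair_left_dual) simp
  let ?d = "dual_arrow C f"
  have "Y.transp (Ev C Y \<cdot> (Ide C (Y\<^sup>\<star>) \<otimes>\<^sub>m f)) X = Y.transp (Ev C Y) Y \<cdot> f"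
    by (rule Y.transp_Comp_right[OF Y.e_in f])
  also have "\<dots> = f" unfolding Y.transp_def by (simp add: Y.zigzag')
  finally have 1: "Y.transp (Ev C Y \<cdot> (Ide C (Y\<^sup>\<star>) \<otimes>\<^sub>m f)) X = f" .
  have "Y.transp (Ev C X \<cdot> (?d \<otimes>\<^sub>m Ide C X)) X = (Ide C Y \<otimes>\<^sub>m Ev C X) \<cdot> (((Ide C Y \<otimes>\<^sub>m ?d) \<otimes>\<^sub>m Ide C X) \<cdot> (Coev C Y \<otimes>\<^sub>m Ide C X))"
    unfolding Y.transp_def by (simp add: whisker_left_Comp Comp_assoc')
  also have "((Ide C Y \<otimes>\<^sub>m ?d) \<otimes>\<^sub>m Ide C X) \<cdot> (Coev C Y \<otimes>\<^sub>m Ide C X) = ((Ide C Y \<otimes>\<^sub>m ?d) \<cdot> Coev C Y) \<otimes>\<^sub>m Ide C X"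
    by (rule whisker_right_Comp[symmetric]) simp_all
  also have "\<dots> = ((f \<otimes>\<^sub>m Ide C (X\<^sup>\<star>)) \<otimes>\<^sub>m Ide C X) \<cdot> (Coev C X \<otimes>\<^sub>m Ide C X)"
    unfolding Coev_dual_arrow[OF f] by (rule whisker_right_Comp) simp_all
  also have "(Ide C Y \<otimes>\<^sub>m Ev C X) \<cdot> \<dots> = ((Ide C Y \<otimes>\<^sub>m Ev C X) \<cdot> (f \<otimes>\<^sub>m Ide C (X\<^sup>\<star> \<otimes>\<^sub>o X))) \<cdot> (Coev C X \<otimes>\<^sub>m Ide C X)"
    by (simp add: Comp_assoc')
  also have "(Ide C Y \<otimes>\<^sub>m Ev C X) \<cdot> (f \<otimes>\<^sub>m Ide C (X\<^sup>\<star> \<otimes>\<^sub>o X)) = f \<cdot> (Ide C X \<otimes>\<^sub>m Ev C X)"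
    using slide(2)[OF f X.e_in] slide_effect(2)[OF X.e_in f] by simp
  also have "(f \<cdot> (Ide C X \<otimes>\<^sub>m Ev C X)) \<cdot> (Coev C X \<otimes>\<^sub>m Ide C X) = f"
    by (simp add: Comp_assoc' X.zigzag')
  finally have 2: "Y.transp (Ev C X \<cdot> (?d \<otimes>\<^sub>m Ide C X)) X = f" .
  show ?thesis
    by (rule Y.transp_inject[of X _ \<I>]) (simp_all add: 1 2, simp_all add: Hom_iff)
qed

lemma dual_arrow_Comp:
  assumes f: "f \<in> Hom C X Y" and g: "g \<in> Hom C Y Z"
  shows "dual_arrow C (g \<cdot> f) = dual_arrow C f \<cdot> dual_arrow C g"
proof -
  note [simp] = HomD[OF f] Hom_Obj[OF f] HomD[OF dual_arrow_in[OF f]] HomD[OF g] Hom_Obj[OF g] HomD[OF dual_arrow_in[OF g]]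
  note gf = Comp_in[OF f g]
  interpret Z: dual_pair C Z "Z\<^sup>\<star>" "Ev C Z" "Coev C Z" by (rule dual_pair_left_dual) simp
  have "Z.transp (dual_arrow C f \<cdot> dual_arrow C g) \<I> = (Ide C Z \<otimes>\<^sub>m dual_arrow C f) \<cdot> ((Ide C Z \<otimes>\<^sub>m dual_arrow C g) \<cdot> Coev C Z)"
    unfolding Z.transp_def by (simp add: whisker_left_Comp Comp_assoc')
  also have "\<dots> = ((Ide C Z \<otimes>\<^sub>m dual_arrow C f) \<cdot> (g \<otimes>\<^sub>m Ide C (Y\<^sup>\<star>))) \<cdot> Coev C Y"
    unfolding Coev_dual_arrow[OF g] by (simp add: Comp_assoc')
  also have "(Ide C Z \<otimes>\<^sub>m dual_arrow C f) \<cdot> (g \<otimes>\<^sub>m Ide C (Y\<^sup>\<star>)) = (g \<otimes>\<^sub>m Ide C (X\<^sup>\<star>)) \<cdot> (Ide C Y \<otimes>\<^sub>m dual_arrow C f)"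
    using slide[OF g dual_arrow_in[OF f]] by simp
  also have "\<dots> \<cdot> Coev C Y = (g \<otimes>\<^sub>m Ide C (X\<^sup>\<star>)) \<cdot> ((f \<otimes>\<^sub>m Ide C (X\<^sup>\<star>)) \<cdot> Coev C X)"
    unfolding Coev_dual_arrow[OF f, symmetric] by (simp add: Comp_assoc')
  also have "\<dots> = ((g \<cdot> f) \<otimes>\<^sub>m Ide C (X\<^sup>\<star>)) \<cdot> Coev C X"
    by (simp add: whisker_right_Comp Comp_assoc')
  also have "\<dots> = Z.transp (dual_arrow C (g \<cdot> f)) \<I>"
    unfolding Coev_dual_arrow[OF gf, symmetric] Z.transp_def by simp
  finally have e: "Z.transp (dual_arrow C (g \<cdot> f)) \<I> = Z.transp (dual_arrow C f \<cdot> dual_arrow C g) \<I>" by (rule sym)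
  have o: "Z\<^sup>\<star> \<otimes>\<^sub>o \<I> = Z\<^sup>\<star>" by simp
  show ?thesis
    by (rule Z.transp_inject[OF Unit_Obj, unfolded o, OF dual_arrow_in[OF gf] Comp_in[OF dual_arrow_in[OF g] dual_arrow_in[OF f]] e])
qed

text \<open>Presents a coend as a colimit indexed by objects, so that preservation of colimits under
  tensoring applies to it.\<close>

definition dinatural_relations :: "('o \<times> 'm \<times> 'o \<times> 'm) set"
  where "dinatural_relations = {(Y, Ide C (Y\<^sup>\<star>) \<otimes>\<^sub>m f, X, dual_arrow C f \<otimes>\<^sub>m Ide C X) |X Y f. f \<in> Hom C X Y}"

lemma is_dinatural_cocone: "is_dinatural C Z j \<longleftrightarrow> cocone (\<lambda>X. X\<^sup>\<star> \<otimes>\<^sub>o X) dinatural_relations Z j"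
proof
  assume d: "is_dinatural C Z j"
  show "cocone (\<lambda>X. X\<^sup>\<star> \<otimes>\<^sub>o X) dinatural_relations Z j"
  proof (rule coconeI)
    show "Z \<in> Obj C" using d unfolding is_dinatural_def by (rule conjunct1)
    show "j x \<in> Hom C (x\<^sup>\<star> \<otimes>\<^sub>o x) Z" if "x \<in> Obj C" for x
      by (rule d[unfolded is_dinatural_def, THEN conjunct2, THEN conjunct1, rule_format, OF that])
    fix x a y b assume "(x, a, y, b) \<in> dinatural_relations"
    then obtain f where f: "f \<in> Hom C y x" "a = Ide C (x\<^sup>\<star>) \<otimes>\<^sub>m f" "b = dual_arrow C f \<otimes>\<^sub>m Ide C y"
      by (auto simp: dinatural_relations_def)
    show "j x \<cdot> a = j y \<cdot> b" unfolding f(2,3)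
      by (rule d[unfolded is_dinatural_def, THEN conjunct2, THEN conjunct2, rule_format, OF f(1)])
  qed
next
  assume c: "cocone (\<lambda>X. X\<^sup>\<star> \<otimes>\<^sub>o X) dinatural_relations Z j"
  show "is_dinatural C Z j" unfolding is_dinatural_def
  proof (intro conjI allI ballI)
    show "Z \<in> Obj C" by (rule coconeD(1)[OF c])
    show "j X \<in> Hom C (X\<^sup>\<star> \<otimes>\<^sub>o X) Z" if "X \<in> Obj C" for X by (rule coconeD(2)[OF c that])
    fix X Y f assume "f \<in> Hom C X Y"
    hence "(Y, Ide C (Y\<^sup>\<star>) \<otimes>\<^sub>m f, X, dual_arrow C f \<otimes>\<^sub>m Ide C X) \<in> dinatural_relations"
      by (auto simp: dinatural_relations_def)
    thus "j Y \<cdot> (Ide C (Y\<^sup>\<star>) \<otimes>\<^sub>m f) = j X \<cdot> (dual_arrow C f \<otimes>\<^sub>m Ide C X)" by (rule coconeD(3)[OF c])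
  qed
qed

lemma is_coend_universal_cocone:
  "is_coend C F i \<longleftrightarrow> universal_cocone (\<lambda>X. X\<^sup>\<star> \<otimes>\<^sub>o X) dinatural_relations F i"
  unfolding is_coend_def universal_cocone_def is_dinatural_cocone ..

lemma dinatural_relations_on: "relations_on (\<lambda>X. X\<^sup>\<star> \<otimes>\<^sub>o X) dinatural_relations"
proof -
  have "\<exists>Z. Ide C (Y\<^sup>\<star>) \<otimes>\<^sub>m f \<in> Hom C Z (Y\<^sup>\<star> \<otimes>\<^sub>o Y) \<and> dual_arrow C f \<otimes>\<^sub>m Ide C X \<in> Hom C Z (X\<^sup>\<star> \<otimes>\<^sub>o X)"
    if f: "f \<in> Hom C X Y" for X Y f
    using HomD[OF f] Hom_Obj[OF f] HomD[OF dual_arrow_in[OF f]]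
    by (intro exI[of _ "Y\<^sup>\<star> \<otimes>\<^sub>o X"]) (simp add: Hom_iff)
  thus ?thesis unfolding relations_on_def dinatural_relations_def using Hom_Obj by auto
qed

end


section \<open>Transparent objects and the pairing\<close>

context braided_finite_tensor_category
begin

lemma Braiding_arr [simp]:
  assumes "X \<in> Obj C" "Y \<in> Obj C"
  shows "\<sigma> X Y \<in> Arr C" "Dom C (\<sigma> X Y) = X \<otimes>\<^sub>o Y" "Cod C (\<sigma> X Y) = Y \<otimes>\<^sub>o X"
  using HomD[OF Braiding_in[OF assms]] by simp_all

definition double_braiding :: "'o \<Rightarrow> 'o \<Rightarrow> 'm"
  where "double_braiding X Y = \<sigma> Y X \<cdot> \<sigma> X Y"

definition transparent :: "'o \<Rightarrow> bool"
  where "transparent X \<longleftrightarrow> X \<in> Obj C \<and> (\<forall>Y \<in> Obj C. double_braiding X Y = Ide C (X \<otimes>\<^sub>o Y))"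

lemma double_braiding_in: "X \<in> Obj C \<Longrightarrow> Y \<in> Obj C \<Longrightarrow> double_braiding X Y \<in> Hom C (X \<otimes>\<^sub>o Y) (X \<otimes>\<^sub>o Y)"
  by (simp add: double_braiding_def Hom_iff)

lemma double_braiding_natural:
  assumes f: "f \<in> Hom C X X'" and g: "g \<in> Hom C Y Y'"
  shows "double_braiding X' Y' \<cdot> (f \<otimes>\<^sub>m g) = (f \<otimes>\<^sub>m g) \<cdot> double_braiding X Y"
proof -
  note [simp] = HomD[OF f] HomD[OF g] Hom_Obj[OF f] Hom_Obj[OF g]
  have "double_braiding X' Y' \<cdot> (f \<otimes>\<^sub>m g) = \<sigma> Y' X' \<cdot> (\<sigma> X' Y' \<cdot> (f \<otimes>\<^sub>m g))"
    unfolding double_braiding_def by (rule Comp_assoc') simp_all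
  also have "\<dots> = \<sigma> Y' X' \<cdot> ((g \<otimes>\<^sub>m f) \<cdot> \<sigma> X Y)" by (simp only: Braiding_natural[OF f g])
  also have "\<dots> = (\<sigma> Y' X' \<cdot> (g \<otimes>\<^sub>m f)) \<cdot> \<sigma> X Y" by (rule Comp_assoc'[symmetric]) simp_all
  also have "\<dots> = ((f \<otimes>\<^sub>m g) \<cdot> \<sigma> Y X) \<cdot> \<sigma> X Y" by (simp only: Braiding_natural[OF g f])
  also have "\<dots> = (f \<otimes>\<^sub>m g) \<cdot> double_braiding X Y"
    unfolding double_braiding_def by (rule Comp_assoc') simp_all
  finally show ?thesis .
qed

lemma iso_idempotent:
  assumes f: "f \<in> Hom C X X" "is_iso C f" and i: "f \<cdot> f = f"
  shows "f = Ide C X"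
proof -
  obtain g where g: "g \<in> Hom C X X" "g \<cdot> f = Ide C X"
    using f by (auto simp: is_iso_def inverse_arrows_def Hom_def)
  have "f = (g \<cdot> f) \<cdot> f" unfolding g(2) by (rule Ide_left[OF f(1), symmetric])
  also have "\<dots> = g \<cdot> f" using Comp_assoc[OF f(1) f(1) g(1)] i by simp
  finally show ?thesis using g by simp
qed

text \<open>With unit objects inserted, a hexagon says that the braiding is idempotent; an
  invertible idempotent is an identity.\<close>

lemma Braiding_Unit:
  assumes "X \<in> Obj C"
  shows "\<sigma> \<I> X = Ide C X" "\<sigma> X \<I> = Ide C X"
proof -
  show "\<sigma> \<I> X = Ide C X"
    using hexagon_left[OF Unit_in Unit_in assms] Braiding_in[OF Unit_in assms] Braiding_iso[OF Unit_in assms] assms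
    by (intro iso_idempotent) simp_all
  show "\<sigma> X \<I> = Ide C X"
    using hexagon_right[OF assms Unit_in Unit_in] Braiding_in[OF assms Unit_in] Braiding_iso[OF assms Unit_in] assms
    by (intro iso_idempotent) simp_all
qed

lemma transparent_Unit: "transparent \<I>"
  unfolding transparent_def double_braiding_def by (auto simp: Braiding_Unit)

text \<open>Naturality moves the double braiding across \<open>m\<close>, and tensoring keeps
  \<open>m\<close> monic, so \<open>m\<close> can be cancelled. Quotients are treated
  dually.\<close>

lemma transparent_subobject:
  assumes X: "transparent X" and m: "m \<in> Hom C Z X" "is_mono C m"
  shows "transparent Z"
  unfolding transparent_def
proof (intro conjI ballI)
  show Z: "Z \<in> Obj C" by (rule Hom_Obj[OF m(1)])
  fix Y assume Y: "Y \<in> Obj C"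
  note [simp] = Z Y HomD[OF m(1)] Hom_Obj[OF m(1)]
  have mY: "m \<otimes>\<^sub>m Ide C Y \<in> Hom C (Z \<otimes>\<^sub>o Y) (X \<otimes>\<^sub>o Y)" by (simp add: Hom_iff)
  have T: "double_braiding X Y = Ide C (X \<otimes>\<^sub>o Y)" using X Y by (simp add: transparent_def)
  have "(m \<otimes>\<^sub>m Ide C Y) \<cdot> double_braiding Z Y = double_braiding X Y \<cdot> (m \<otimes>\<^sub>m Ide C Y)"
    by (rule double_braiding_natural[OF m(1) Ide_in[OF Y], symmetric])
  also have "\<dots> = m \<otimes>\<^sub>m Ide C Y" unfolding T by (rule Ide_left[OF mY])
  also have "\<dots> = (m \<otimes>\<^sub>m Ide C Y) \<cdot> Ide C (Z \<otimes>\<^sub>o Y)" by (rule Ide_right[OF mY, symmetric])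
  finally show "double_braiding Z Y = Ide C (Z \<otimes>\<^sub>o Y)"
    by (rule monoD[OF mono_whisker[OF Y m(2)] mY double_braiding_in[OF Z Y] Ide_in[OF TensorO_Obj[OF Z Y]]])
qed

lemma transparent_quotient:
  assumes X: "transparent X" and p: "p \<in> Hom C X W" "jointly_epi W {p}"
  shows "transparent W"
  unfolding transparent_def
proof (intro conjI ballI)
  show W: "W \<in> Obj C" by (rule Hom_Obj[OF p(1)])
  fix Y assume Y: "Y \<in> Obj C"
  note [simp] = W Y HomD[OF p(1)] Hom_Obj[OF p(1)]
  have pY: "p \<otimes>\<^sub>m Ide C Y \<in> Hom C (X \<otimes>\<^sub>o Y) (W \<otimes>\<^sub>o Y)" by (simp add: Hom_iff)
  have T: "double_braiding X Y = Ide C (X \<otimes>\<^sub>o Y)" using X Y by (simp add: transparent_def)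
  have "double_braiding W Y \<cdot> (p \<otimes>\<^sub>m Ide C Y) = (p \<otimes>\<^sub>m Ide C Y) \<cdot> double_braiding X Y"
    by (rule double_braiding_natural[OF p(1) Ide_in[OF Y]])
  also have "\<dots> = p \<otimes>\<^sub>m Ide C Y" unfolding T by (rule Ide_right[OF pY])
  also have "\<dots> = Ide C (W \<otimes>\<^sub>o Y) \<cdot> (p \<otimes>\<^sub>m Ide C Y)" by (rule Ide_left[OF pY, symmetric])
  finally have e: "double_braiding W Y \<cdot> (p \<otimes>\<^sub>m Ide C Y) = Ide C (W \<otimes>\<^sub>o Y) \<cdot> (p \<otimes>\<^sub>m Ide C Y)" .
  have j: "jointly_epi (W \<otimes>\<^sub>o Y) {p \<otimes>\<^sub>m Ide C Y}"
    using jointly_epi_whisker(2)[OF Y W p(2)] by simp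
  show "double_braiding W Y = Ide C (W \<otimes>\<^sub>o Y)"
    by (rule jointly_epiD[OF j double_braiding_in[OF W Y] Ide_in[OF TensorO_Obj[OF W Y]]]) (simp only: singleton_iff e)
qed

text \<open>The value that \<omega> is required to take on
  \<open>i X \<otimes>\<^sub>m i Y\<close>.\<close>

definition pairing :: "'o \<Rightarrow> 'o \<Rightarrow> 'm"
  where "pairing X Y = (Ev C X \<otimes>\<^sub>m Ev C Y) \<cdot>
    (Ide C (X\<^sup>\<star>) \<otimes>\<^sub>m double_braiding X (Y\<^sup>\<star>) \<otimes>\<^sub>m Ide C Y)"

lemma double_braiding_arr [simp]:
  assumes "X \<in> Obj C" "Y \<in> Obj C"
  shows "double_braiding X Y \<in> Arr C" "Dom C (double_braiding X Y) = X \<otimes>\<^sub>o Y" "Cod C (double_braiding X Y) = X \<otimes>\<^sub>o Y"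
  using HomD[OF double_braiding_in[OF assms]] by simp_all

lemma pairing_in: "X \<in> Obj C \<Longrightarrow> Y \<in> Obj C \<Longrightarrow> pairing X Y \<in> Hom C (X\<^sup>\<star> \<otimes>\<^sub>o X \<otimes>\<^sub>o Y\<^sup>\<star> \<otimes>\<^sub>o Y) \<I>"
  by (simp add: pairing_def Hom_iff)

lemma pairing_transparent:
  assumes X: "transparent X" and Y: "Y \<in> Obj C"
  shows "pairing X Y = Ev C X \<otimes>\<^sub>m Ev C Y"
proof -
  have XO: "X \<in> Obj C" using X by (simp add: transparent_def)
  have "double_braiding X (Y\<^sup>\<star>) = Ide C (X \<otimes>\<^sub>o Y\<^sup>\<star>)" using X Y by (simp add: transparent_def)
  hence "pairing X Y = (Ev C X \<otimes>\<^sub>m Ev C Y) \<cdot> Ide C (X\<^sup>\<star> \<otimes>\<^sub>o X \<otimes>\<^sub>o Y\<^sup>\<star> \<otimes>\<^sub>o Y)"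
    unfolding pairing_def using XO Y by simp
  also have "\<dots> = Ev C X \<otimes>\<^sub>m Ev C Y"
    using XO Y by (intro Ide_right[of _ _ \<I>]) (simp add: Hom_iff)
  finally show ?thesis .
qed

lemma interchange3:
  assumes "f \<in> Hom C X X'" "f' \<in> Hom C X' X''" "g \<in> Hom C Y Y'" "g' \<in> Hom C Y' Y''"
    "h \<in> Hom C Z Z'" "h' \<in> Hom C Z' Z''"
  shows "(f' \<otimes>\<^sub>m g' \<otimes>\<^sub>m h') \<cdot> (f \<otimes>\<^sub>m g \<otimes>\<^sub>m h) = (f' \<cdot> f) \<otimes>\<^sub>m (g' \<cdot> g) \<otimes>\<^sub>m (h' \<cdot> h)"
  using TensorM_Comp[OF assms(1,2) TensorM_in[OF assms(3,5)] TensorM_in[OF assms(4,6)]]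
    TensorM_Comp[OF assms(3-6)] by (simp only:)

lemma double_braiding_slide:
  assumes f: "f \<in> Hom C X X'" and g: "g \<in> Hom C Y Y'" and A: "a \<in> Hom C A A'" and B: "b \<in> Hom C B B'"
  shows "(Ide C A' \<otimes>\<^sub>m double_braiding X' Y' \<otimes>\<^sub>m Ide C B') \<cdot> (a \<otimes>\<^sub>m (f \<otimes>\<^sub>m g) \<otimes>\<^sub>m b) =
    (a \<otimes>\<^sub>m (f \<otimes>\<^sub>m g) \<otimes>\<^sub>m b) \<cdot> (Ide C A \<otimes>\<^sub>m double_braiding X Y \<otimes>\<^sub>m Ide C B)"
proof -
  note fg = TensorM_in[OF f g]
  note T = double_braiding_in[OF Hom_Obj(1)[OF f] Hom_Obj(1)[OF g]]
  note T' = double_braiding_in[OF Hom_Obj(2)[OF f] Hom_Obj(2)[OF g]]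
  note I = Ide_in[OF Hom_Obj(1)[OF A]] Ide_in[OF Hom_Obj(2)[OF A]] Ide_in[OF Hom_Obj(1)[OF B]] Ide_in[OF Hom_Obj(2)[OF B]]
  show ?thesis
    unfolding interchange3[OF A I(2) fg T' B I(4)] interchange3[OF I(1) A T fg I(3) B]
    by (simp only: Ide_left[OF A] Ide_right[OF A] Ide_left[OF B] Ide_right[OF B] double_braiding_natural[OF f g])
qed

text \<open>Naturality of the double braiding brings all four arrows to the evaluations at once.
  Dinaturality of the pairing in either variable is then reduced to that of the evaluation.\<close>

lemma pairing_Comp:
  assumes f: "f \<in> Hom C X X'" and g: "g \<in> Hom C (Y\<^sup>\<star>) (Y'\<^sup>\<star>)" and a: "a \<in> Hom C A (X'\<^sup>\<star>)" and b: "b \<in> Hom C B Y'"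
    and Y: "Y \<in> Obj C" "Y' \<in> Obj C"
  shows "pairing X' Y' \<cdot> (a \<otimes>\<^sub>m (f \<otimes>\<^sub>m g) \<otimes>\<^sub>m b) =
    ((Ev C X' \<cdot> (a \<otimes>\<^sub>m f)) \<otimes>\<^sub>m (Ev C Y' \<cdot> (g \<otimes>\<^sub>m b))) \<cdot>
      (Ide C A \<otimes>\<^sub>m double_braiding X (Y\<^sup>\<star>) \<otimes>\<^sub>m Ide C B)"
proof -
  note [simp] = Y HomD[OF f] HomD[OF g] HomD[OF a] HomD[OF b] Hom_Obj[OF f] Hom_Obj[OF g] Hom_Obj[OF a] Hom_Obj[OF b]
  have "pairing X' Y' \<cdot> (a \<otimes>\<^sub>m (f \<otimes>\<^sub>m g) \<otimes>\<^sub>m b) = (Ev C X' \<otimes>\<^sub>m Ev C Y') \<cdot>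
    ((Ide C (X'\<^sup>\<star>) \<otimes>\<^sub>m double_braiding X' (Y'\<^sup>\<star>) \<otimes>\<^sub>m Ide C Y') \<cdot> (a \<otimes>\<^sub>m (f \<otimes>\<^sub>m g) \<otimes>\<^sub>m b))"
    unfolding pairing_def by (rule Comp_assoc') simp_all
  also have "\<dots> = (Ev C X' \<otimes>\<^sub>m Ev C Y') \<cdot> ((a \<otimes>\<^sub>m (f \<otimes>\<^sub>m g) \<otimes>\<^sub>m b) \<cdot> (Ide C A \<otimes>\<^sub>m double_braiding X (Y\<^sup>\<star>) \<otimes>\<^sub>m Ide C B))"
    by (simp only: double_braiding_slide[OF f g a b])
  also have "\<dots> = ((Ev C X' \<otimes>\<^sub>m Ev C Y') \<cdot> ((a \<otimes>\<^sub>m f) \<otimes>\<^sub>m (g \<otimes>\<^sub>m b))) \<cdot> (Ide C A \<otimes>\<^sub>m double_braiding X (Y\<^sup>\<star>) \<otimes>\<^sub>m Ide C B)"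
    by (simp add: Comp_assoc')
  also have "(Ev C X' \<otimes>\<^sub>m Ev C Y') \<cdot> ((a \<otimes>\<^sub>m f) \<otimes>\<^sub>m (g \<otimes>\<^sub>m b)) = (Ev C X' \<cdot> (a \<otimes>\<^sub>m f)) \<otimes>\<^sub>m (Ev C Y' \<cdot> (g \<otimes>\<^sub>m b))"
    by (rule interchange) simp_all
  finally show ?thesis .
qed

lemma pairing_dinatural_right:
  assumes X: "X \<in> Obj C" and f: "f \<in> Hom C Y Y'"
  shows "pairing X Y' \<cdot> (Ide C (X\<^sup>\<star> \<otimes>\<^sub>o X) \<otimes>\<^sub>m (Ide C (Y'\<^sup>\<star>) \<otimes>\<^sub>m f)) =
    pairing X Y \<cdot> (Ide C (X\<^sup>\<star> \<otimes>\<^sub>o X) \<otimes>\<^sub>m (dual_arrow C f \<otimes>\<^sub>m Ide C Y))"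
proof -
  note d = dual_arrow_in[OF f] and Y = Hom_Obj[OF f]
  note [simp] = X HomD[OF f] Y HomD[OF d]
  note I = Ide_in[OF X] Ide_in[OF Dual_Obj[OF X]] Ide_in[OF Dual_Obj[OF Y(2)]] Ide_in[OF Y(1)]
  have "pairing X Y' \<cdot> (Ide C (X\<^sup>\<star> \<otimes>\<^sub>o X) \<otimes>\<^sub>m (Ide C (Y'\<^sup>\<star>) \<otimes>\<^sub>m f)) =
      pairing X Y' \<cdot> (Ide C (X\<^sup>\<star>) \<otimes>\<^sub>m (Ide C X \<otimes>\<^sub>m Ide C (Y'\<^sup>\<star>)) \<otimes>\<^sub>m f)" by simp
  also have "\<dots> = ((Ev C X \<cdot> (Ide C (X\<^sup>\<star>) \<otimes>\<^sub>m Ide C X)) \<otimes>\<^sub>m (Ev C Y \<cdot> (dual_arrow C f \<otimes>\<^sub>m Ide C Y))) \<cdot>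
      (Ide C (X\<^sup>\<star>) \<otimes>\<^sub>m double_braiding X (Y'\<^sup>\<star>) \<otimes>\<^sub>m Ide C Y)"
    unfolding pairing_Comp[OF I(1,3) I(2) f Y(2,2)] Ev_dual_arrow[OF f] ..
  also have "\<dots> = (Ev C X \<otimes>\<^sub>m Ev C Y) \<cdot> ((Ide C (X\<^sup>\<star>) \<otimes>\<^sub>m (Ide C X \<otimes>\<^sub>m dual_arrow C f) \<otimes>\<^sub>m Ide C Y) \<cdot>
      (Ide C (X\<^sup>\<star>) \<otimes>\<^sub>m double_braiding X (Y'\<^sup>\<star>) \<otimes>\<^sub>m Ide C Y))"
  proof -
    have "(Ev C X \<cdot> (Ide C (X\<^sup>\<star>) \<otimes>\<^sub>m Ide C X)) \<otimes>\<^sub>m (Ev C Y \<cdot> (dual_arrow C f \<otimes>\<^sub>m Ide C Y)) =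
        (Ev C X \<otimes>\<^sub>m Ev C Y) \<cdot> ((Ide C (X\<^sup>\<star>) \<otimes>\<^sub>m Ide C X) \<otimes>\<^sub>m (dual_arrow C f \<otimes>\<^sub>m Ide C Y))"
      by (rule interchange[symmetric]) simp_all
    thus ?thesis by (simp add: Comp_assoc')
  qed
  also have "\<dots> = (Ev C X \<otimes>\<^sub>m Ev C Y) \<cdot> ((Ide C (X\<^sup>\<star>) \<otimes>\<^sub>m double_braiding X (Y\<^sup>\<star>) \<otimes>\<^sub>m Ide C Y) \<cdot>
      (Ide C (X\<^sup>\<star>) \<otimes>\<^sub>m (Ide C X \<otimes>\<^sub>m dual_arrow C f) \<otimes>\<^sub>m Ide C Y))"
    by (simp only: double_braiding_slide[OF I(1) d I(2) I(4)])
  also have "\<dots> = pairing X Y \<cdot> (Ide C (X\<^sup>\<star> \<otimes>\<^sub>o X) \<otimes>\<^sub>m (dual_arrow C f \<otimes>\<^sub>m Ide C Y))"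
    unfolding pairing_def by (simp add: Comp_assoc')
  finally show ?thesis .
qed

lemma pairing_dinatural_left:
  assumes Y: "Y \<in> Obj C" and f: "f \<in> Hom C X X'"
  shows "pairing X' Y \<cdot> ((Ide C (X'\<^sup>\<star>) \<otimes>\<^sub>m f) \<otimes>\<^sub>m Ide C (Y\<^sup>\<star> \<otimes>\<^sub>o Y)) =
    pairing X Y \<cdot> ((dual_arrow C f \<otimes>\<^sub>m Ide C X) \<otimes>\<^sub>m Ide C (Y\<^sup>\<star> \<otimes>\<^sub>o Y))"
proof -
  note d = dual_arrow_in[OF f] and X = Hom_Obj[OF f]
  note [simp] = Y HomD[OF f] X HomD[OF d]
  note I = Ide_in[OF Y] Ide_in[OF Dual_Obj[OF Y]] Ide_in[OF Dual_Obj[OF X(2)]] Ide_in[OF X(1)]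
  have "pairing X' Y \<cdot> ((Ide C (X'\<^sup>\<star>) \<otimes>\<^sub>m f) \<otimes>\<^sub>m Ide C (Y\<^sup>\<star> \<otimes>\<^sub>o Y)) =
      pairing X' Y \<cdot> (Ide C (X'\<^sup>\<star>) \<otimes>\<^sub>m (f \<otimes>\<^sub>m Ide C (Y\<^sup>\<star>)) \<otimes>\<^sub>m Ide C Y)" by simp
  also have "\<dots> = ((Ev C X \<cdot> (dual_arrow C f \<otimes>\<^sub>m Ide C X)) \<otimes>\<^sub>m (Ev C Y \<cdot> (Ide C (Y\<^sup>\<star>) \<otimes>\<^sub>m Ide C Y))) \<cdot>
      (Ide C (X'\<^sup>\<star>) \<otimes>\<^sub>m double_braiding X (Y\<^sup>\<star>) \<otimes>\<^sub>m Ide C Y)"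
    unfolding pairing_Comp[OF f I(2) I(3) I(1) Y Y] Ev_dual_arrow[OF f] ..
  also have "\<dots> = pairing X Y \<cdot> (dual_arrow C f \<otimes>\<^sub>m (Ide C X \<otimes>\<^sub>m Ide C (Y\<^sup>\<star>)) \<otimes>\<^sub>m Ide C Y)"
    unfolding pairing_Comp[OF I(4) I(2) d I(1) Y Y] ..
  also have "\<dots> = pairing X Y \<cdot> ((dual_arrow C f \<otimes>\<^sub>m Ide C X) \<otimes>\<^sub>m Ide C (Y\<^sup>\<star> \<otimes>\<^sub>o Y))" by simp
  finally show ?thesis .
qed

end

section \<open>The form \<omega> on the coend\<close>

locale braided_with_coend = braided_finite_tensor_category C
  for C :: "('k :: field, 'o, 'm, 'z) braided_cat_scheme" (structure) +
  fixes F i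
  assumes coend: "is_coend C F i"
begin

lemma universal: "universal_cocone (\<lambda>X. X\<^sup>\<star> \<otimes>\<^sub>o X) dinatural_relations F i"
  using coend by (simp only: is_coend_universal_cocone)

lemma F_Obj [simp]: "F \<in> Obj C"
  using universal unfolding universal_cocone_def cocone_def by blast

lemma i_in: "X \<in> Obj C \<Longrightarrow> i X \<in> Hom C (X\<^sup>\<star> \<otimes>\<^sub>o X) F"
  using coconeD(2)[OF conjunct1[OF universal[unfolded universal_cocone_def]]] .

lemma i_arr [simp]:
  assumes "X \<in> Obj C"
  shows "i X \<in> Arr C" "Dom C (i X) = X\<^sup>\<star> \<otimes>\<^sub>o X" "Cod C (i X) = F"
  using HomD[OF i_in[OF assms]] by simp_all

lemma i_dinatural:
  assumes "f \<in> Hom C X Y"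
  shows "i Y \<cdot> (Ide C (Y\<^sup>\<star>) \<otimes>\<^sub>m f) = i X \<cdot> (dual_arrow C f \<otimes>\<^sub>m Ide C X)"
  using coend[unfolded is_coend_def is_dinatural_def, THEN conjunct1, THEN conjunct2, THEN conjunct2, rule_format, OF assms] .

lemma jointly_epi_i: "jointly_epi F (i ` Obj C)"
  by (rule universal_cocone_jointly_epi[OF dinatural_relations_on universal])

lemma F_left_eqI:
  assumes V: "V \<in> Obj C" and x: "x \<in> Hom C (V \<otimes>\<^sub>o F) B" and y: "y \<in> Hom C (V \<otimes>\<^sub>o F) B"
    and e: "\<And>Y. Y \<in> Obj C \<Longrightarrow> x \<cdot> (Ide C V \<otimes>\<^sub>m i Y) = y \<cdot> (Ide C V \<otimes>\<^sub>m i Y)"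
  shows "x = y"
proof -
  have j: "jointly_epi (V \<otimes>\<^sub>o F) ((\<lambda>k. Ide C V \<otimes>\<^sub>m k) ` i ` Obj C)"
    by (rule jointly_epi_whisker(1)[OF V F_Obj jointly_epi_i]) auto
  show ?thesis
  proof (rule jointly_epiD[OF j x y])
    fix k assume "k \<in> (\<lambda>k. Ide C V \<otimes>\<^sub>m k) ` i ` Obj C"
    then obtain Y where "Y \<in> Obj C" "k = Ide C V \<otimes>\<^sub>m i Y" by blast
    with e[of Y] show "x \<cdot> k = y \<cdot> k" by (simp only:)
  qed
qed

lemma F_right_eqI:
  assumes V: "V \<in> Obj C" and x: "x \<in> Hom C (F \<otimes>\<^sub>o V) B" and y: "y \<in> Hom C (F \<otimes>\<^sub>o V) B"
    and e: "\<And>Y. Y \<in> Obj C \<Longrightarrow> x \<cdot> (i Y \<otimes>\<^sub>m Ide C V) = y \<cdot> (i Y \<otimes>\<^sub>m Ide C V)"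
  shows "x = y"
proof -
  have j: "jointly_epi (F \<otimes>\<^sub>o V) ((\<lambda>k. k \<otimes>\<^sub>m Ide C V) ` i ` Obj C)"
    by (rule jointly_epi_whisker(2)[OF V F_Obj jointly_epi_i]) auto
  show ?thesis
  proof (rule jointly_epiD[OF j x y])
    fix k assume "k \<in> (\<lambda>k. k \<otimes>\<^sub>m Ide C V) ` i ` Obj C"
    then obtain Y where "Y \<in> Obj C" "k = i Y \<otimes>\<^sub>m Ide C V" by blast
    with e[of Y] show "x \<cdot> k = y \<cdot> k" by (simp only:)
  qed
qed

lemma Comp_i_i:
  assumes "w \<in> Hom C (F \<otimes>\<^sub>o F) B" and XY: "X \<in> Obj C" "Y \<in> Obj C"
  shows "w \<cdot> (i X \<otimes>\<^sub>m i Y) = (w \<cdot> (i X \<otimes>\<^sub>m Ide C F)) \<cdot> (Ide C (X\<^sup>\<star> \<otimes>\<^sub>o X) \<otimes>\<^sub>m i Y)"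
proof -
  note w = HomD[OF assms(1)]
  have "w \<cdot> (i X \<otimes>\<^sub>m i Y) = w \<cdot> ((i X \<otimes>\<^sub>m Ide C F) \<cdot> (Ide C (X\<^sup>\<star> \<otimes>\<^sub>o X) \<otimes>\<^sub>m i Y))"
    using slide(1)[OF i_in[OF XY(1)] i_in[OF XY(2)]] by (simp only:)
  also have "\<dots> = (w \<cdot> (i X \<otimes>\<^sub>m Ide C F)) \<cdot> (Ide C (X\<^sup>\<star> \<otimes>\<^sub>o X) \<otimes>\<^sub>m i Y)"
    using XY w by (intro Comp_assoc'[symmetric]) simp_all
  finally show ?thesis .
qed

lemma F_F_eqI:
  assumes x: "x \<in> Hom C (F \<otimes>\<^sub>o F) B" and y: "y \<in> Hom C (F \<otimes>\<^sub>o F) B"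
    and e: "\<And>X Y. X \<in> Obj C \<Longrightarrow> Y \<in> Obj C \<Longrightarrow> x \<cdot> (i X \<otimes>\<^sub>m i Y) = y \<cdot> (i X \<otimes>\<^sub>m i Y)"
  shows "x = y"
proof (rule F_right_eqI[OF F_Obj x y])
  fix X assume X: "X \<in> Obj C"
  have "z \<cdot> (i X \<otimes>\<^sub>m Ide C F) \<in> Hom C ((X\<^sup>\<star> \<otimes>\<^sub>o X) \<otimes>\<^sub>o F) B" if "z \<in> Hom C (F \<otimes>\<^sub>o F) B" for z
    by (rule Comp_in[OF TensorM_in[OF i_in[OF X] Ide_in[OF F_Obj]] that])
  from this[OF x] this[OF y] show "x \<cdot> (i X \<otimes>\<^sub>m Ide C F) = y \<cdot> (i X \<otimes>\<^sub>m Ide C F)"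
  proof (rule F_left_eqI[rotated 1])
    show "X\<^sup>\<star> \<otimes>\<^sub>o X \<in> Obj C" using X by simp
    fix Y assume Y: "Y \<in> Obj C"
    show "(x \<cdot> (i X \<otimes>\<^sub>m Ide C F)) \<cdot> (Ide C (X\<^sup>\<star> \<otimes>\<^sub>o X) \<otimes>\<^sub>m i Y) = (y \<cdot> (i X \<otimes>\<^sub>m Ide C F)) \<cdot> (Ide C (X\<^sup>\<star> \<otimes>\<^sub>o X) \<otimes>\<^sub>m i Y)"
      using Comp_i_i[OF x X Y] Comp_i_i[OF y X Y] e[OF X Y] by (simp only:)
  qed
qed

text \<open>The pairing is extended one variable at a time: in \<open>Y\<close> with
  \<open>X\<^sup>\<star> \<otimes>\<^sub>o X\<close> as a fixed left factor, then in
  \<open>X\<close> with \<open>F\<close> as a fixed right factor. Tensoring preserves the coend in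
  both cases.\<close>

lemma omega_exists:
  "\<exists>w \<in> Hom C (F \<otimes>\<^sub>o F) \<I>. \<forall>X \<in> Obj C. \<forall>Y \<in> Obj C. w \<cdot> (i X \<otimes>\<^sub>m i Y) = pairing X Y"
proof -
  have "\<exists>h. h \<in> Hom C ((X\<^sup>\<star> \<otimes>\<^sub>o X) \<otimes>\<^sub>o F) \<I> \<and> (\<forall>Y \<in> Obj C. h \<cdot> (Ide C (X\<^sup>\<star> \<otimes>\<^sub>o X) \<otimes>\<^sub>m i Y) = pairing X Y)"
    if X: "X \<in> Obj C" for X
  proof -
    have V: "X\<^sup>\<star> \<otimes>\<^sub>o X \<in> Obj C" using X by simp
    have "cocone (\<lambda>Y. (X\<^sup>\<star> \<otimes>\<^sub>o X) \<otimes>\<^sub>o (Y\<^sup>\<star> \<otimes>\<^sub>o Y))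
      ((\<lambda>(x, a, y, b). (x, Ide C (X\<^sup>\<star> \<otimes>\<^sub>o X) \<otimes>\<^sub>m a, y, Ide C (X\<^sup>\<star> \<otimes>\<^sub>o X) \<otimes>\<^sub>m b)) ` dinatural_relations) \<I> (pairing X)"
    proof (rule coconeI)
      show "pairing X Y \<in> Hom C ((X\<^sup>\<star> \<otimes>\<^sub>o X) \<otimes>\<^sub>o (Y\<^sup>\<star> \<otimes>\<^sub>o Y)) \<I>" if "Y \<in> Obj C" for Y
        using pairing_in[OF X that] X that by simp
      fix x a y b assume "(x, a, y, b) \<in> (\<lambda>(x, a, y, b). (x, Ide C (X\<^sup>\<star> \<otimes>\<^sub>o X) \<otimes>\<^sub>m a, y, Ide C (X\<^sup>\<star> \<otimes>\<^sub>o X) \<otimes>\<^sub>m b)) ` dinatural_relations"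
      then obtain f where f: "f \<in> Hom C y x" and ab: "a = Ide C (X\<^sup>\<star> \<otimes>\<^sub>o X) \<otimes>\<^sub>m (Ide C (x\<^sup>\<star>) \<otimes>\<^sub>m f)"
        "b = Ide C (X\<^sup>\<star> \<otimes>\<^sub>o X) \<otimes>\<^sub>m (dual_arrow C f \<otimes>\<^sub>m Ide C y)"
        unfolding dinatural_relations_def by force
      show "pairing X x \<cdot> a = pairing X y \<cdot> b" unfolding ab by (rule pairing_dinatural_right[OF X f])
    qed simp
    then obtain h where "h \<in> Hom C ((X\<^sup>\<star> \<otimes>\<^sub>o X) \<otimes>\<^sub>o F) \<I>"
      "\<And>Y. Y \<in> Obj C \<Longrightarrow> h \<cdot> (Ide C (X\<^sup>\<star> \<otimes>\<^sub>o X) \<otimes>\<^sub>m i Y) = pairing X Y"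
      by (rule universal_coconeE[OF universal_cocone_whisker(1)[OF V dinatural_relations_on universal]]) (rule that)
    thus ?thesis by (intro exI[of _ h] conjI ballI)
  qed
  then obtain h where h: "\<And>X. X \<in> Obj C \<Longrightarrow> h X \<in> Hom C ((X\<^sup>\<star> \<otimes>\<^sub>o X) \<otimes>\<^sub>o F) \<I>"
    "\<And>X Y. X \<in> Obj C \<Longrightarrow> Y \<in> Obj C \<Longrightarrow> h X \<cdot> (Ide C (X\<^sup>\<star> \<otimes>\<^sub>o X) \<otimes>\<^sub>m i Y) = pairing X Y"
    by metis
  have "cocone (\<lambda>X. (X\<^sup>\<star> \<otimes>\<^sub>o X) \<otimes>\<^sub>o F)
      ((\<lambda>(x, a, y, b). (x, a \<otimes>\<^sub>m Ide C F, y, b \<otimes>\<^sub>m Ide C F)) ` dinatural_relations) \<I> h"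
  proof (rule coconeI)
    fix x a y b assume "(x, a, y, b) \<in> (\<lambda>(x, a, y, b). (x, a \<otimes>\<^sub>m Ide C F, y, b \<otimes>\<^sub>m Ide C F)) ` dinatural_relations"
    then obtain f where f: "f \<in> Hom C y x" and ab: "a = (Ide C (x\<^sup>\<star>) \<otimes>\<^sub>m f) \<otimes>\<^sub>m Ide C F"
      "b = (dual_arrow C f \<otimes>\<^sub>m Ide C y) \<otimes>\<^sub>m Ide C F"
      unfolding dinatural_relations_def by force
    note d = dual_arrow_in[OF f] and xy = Hom_Obj[OF f]
    define V where "V = x\<^sup>\<star> \<otimes>\<^sub>o y"
    have V: "V \<in> Obj C" using xy by (simp add: V_def)
    define a' where "a' = Ide C (x\<^sup>\<star>) \<otimes>\<^sub>m f"
    define b' where "b' = dual_arrow C f \<otimes>\<^sub>m Ide C y"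
    have a': "a' \<in> Hom C V (x\<^sup>\<star> \<otimes>\<^sub>o x)" and b': "b' \<in> Hom C V (y\<^sup>\<star> \<otimes>\<^sub>o y)"
      unfolding a'_def b'_def V_def
      by (rule TensorM_in[OF Ide_in[OF Dual_Obj[OF xy(2)]] f], rule TensorM_in[OF d Ide_in[OF xy(1)]])
    have slide_i: "(h z \<cdot> (k \<otimes>\<^sub>m Ide C F)) \<cdot> (Ide C V \<otimes>\<^sub>m i Y) = pairing z Y \<cdot> (k \<otimes>\<^sub>m Ide C (Y\<^sup>\<star> \<otimes>\<^sub>o Y))"
      if k: "k \<in> Hom C V (z\<^sup>\<star> \<otimes>\<^sub>o z)" and z: "z \<in> Obj C" and Y: "Y \<in> Obj C" for k z Y
    proof -
      have "(h z \<cdot> (k \<otimes>\<^sub>m Ide C F)) \<cdot> (Ide C V \<otimes>\<^sub>m i Y) = h z \<cdot> ((k \<otimes>\<^sub>m Ide C F) \<cdot> (Ide C V \<otimes>\<^sub>m i Y))"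
        by (rule Comp_assoc[OF TensorM_in[OF Ide_in[OF V] i_in[OF Y]] TensorM_in[OF k Ide_in[OF F_Obj]] h(1)[OF z]])
      also have "(k \<otimes>\<^sub>m Ide C F) \<cdot> (Ide C V \<otimes>\<^sub>m i Y) = (Ide C (z\<^sup>\<star> \<otimes>\<^sub>o z) \<otimes>\<^sub>m i Y) \<cdot> (k \<otimes>\<^sub>m Ide C (Y\<^sup>\<star> \<otimes>\<^sub>o Y))"
        using slide[OF k i_in[OF Y]] by (simp only:)
      also have "h z \<cdot> \<dots> = (h z \<cdot> (Ide C (z\<^sup>\<star> \<otimes>\<^sub>o z) \<otimes>\<^sub>m i Y)) \<cdot> (k \<otimes>\<^sub>m Ide C (Y\<^sup>\<star> \<otimes>\<^sub>o Y))"
        using z Y by (intro Comp_assoc[symmetric, OF TensorM_in[OF k Ide_in] TensorM_in[OF Ide_in i_in] h(1)]) simp_all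
      finally show ?thesis by (simp only: h(2)[OF z Y])
    qed
    \<comment> \<open>It suffices to test on the legs \<open>i Y\<close>, where the claim becomes
      dinaturality of the pairing in its first variable.\<close>
    have "h x \<cdot> (a' \<otimes>\<^sub>m Ide C F) = h y \<cdot> (b' \<otimes>\<^sub>m Ide C F)"
    proof (rule F_left_eqI[OF V])
      show "h x \<cdot> (a' \<otimes>\<^sub>m Ide C F) \<in> Hom C (V \<otimes>\<^sub>o F) \<I>"
        by (rule Comp_in[OF TensorM_in[OF a' Ide_in[OF F_Obj]] h(1)[OF xy(2)]])
      show "h y \<cdot> (b' \<otimes>\<^sub>m Ide C F) \<in> Hom C (V \<otimes>\<^sub>o F) \<I>"
        by (rule Comp_in[OF TensorM_in[OF b' Ide_in[OF F_Obj]] h(1)[OF xy(1)]])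
      fix Y assume Y: "Y \<in> Obj C"
      show "(h x \<cdot> (a' \<otimes>\<^sub>m Ide C F)) \<cdot> (Ide C V \<otimes>\<^sub>m i Y) = (h y \<cdot> (b' \<otimes>\<^sub>m Ide C F)) \<cdot> (Ide C V \<otimes>\<^sub>m i Y)"
        unfolding slide_i[OF a' xy(2) Y] slide_i[OF b' xy(1) Y] unfolding a'_def b'_def
        by (rule pairing_dinatural_left[OF Y f])
    qed
    thus "h x \<cdot> a = h y \<cdot> b" by (simp only: ab a'_def b'_def)
  qed (use h(1) in simp_all)
  then obtain w where w: "w \<in> Hom C (F \<otimes>\<^sub>o F) \<I>" "\<And>X. X \<in> Obj C \<Longrightarrow> w \<cdot> (i X \<otimes>\<^sub>m Ide C F) = h X"
    by (rule universal_coconeE[OF universal_cocone_whisker(2)[OF F_Obj dinatural_relations_on universal]]) (rule that)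
  have "w \<cdot> (i X \<otimes>\<^sub>m i Y) = pairing X Y" if "X \<in> Obj C" "Y \<in> Obj C" for X Y
    unfolding Comp_i_i[OF w(1) that] w(2)[OF that(1)] by (rule h(2)[OF that])
  with w(1) show ?thesis by (intro bexI[of _ w] ballI)
qed

abbreviation "\<omega> \<equiv> omega C F i"

text \<open>Existence together with joint epimorphy of the \<open>i X \<otimes>\<^sub>m i Y\<close>
  justifies the definite description in \<open>omega\<close>.\<close>

lemma omega_spec:
  "\<omega> \<in> Hom C (F \<otimes>\<^sub>o F) \<I> \<and> (\<forall>X \<in> Obj C. \<forall>Y \<in> Obj C. \<omega> \<cdot> (i X \<otimes>\<^sub>m i Y) = pairing X Y)"
proof -
  obtain w where w: "w \<in> Hom C (F \<otimes>\<^sub>o F) \<I>" "\<And>X Y. X \<in> Obj C \<Longrightarrow> Y \<in> Obj C \<Longrightarrow> w \<cdot> (i X \<otimes>\<^sub>m i Y) = pairing X Y"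
    using omega_exists by (elim bexE) (simp only: Ball_def)
  have "\<omega> = w"
    unfolding omega_def pairing_def[unfolded double_braiding_def, symmetric]
  proof (rule the_equality)
    show "w \<in> Hom C (F \<otimes>\<^sub>o F) \<I> \<and> (\<forall>X \<in> Obj C. \<forall>Y \<in> Obj C. w \<cdot> (i X \<otimes>\<^sub>m i Y) = pairing X Y)"
      by (intro conjI ballI w)
    fix w' assume w': "w' \<in> Hom C (F \<otimes>\<^sub>o F) \<I> \<and> (\<forall>X \<in> Obj C. \<forall>Y \<in> Obj C. w' \<cdot> (i X \<otimes>\<^sub>m i Y) = pairing X Y)"
    show "w' = w"
    proof (rule F_F_eqI[OF conjunct1[OF w'] w(1)])
      fix X Y assume XY: "X \<in> Obj C" "Y \<in> Obj C"
      have "w' \<cdot> (i X \<otimes>\<^sub>m i Y) = pairing X Y" using XY conjunct2[OF w'] by (simp only: Ball_def)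
      thus "w' \<cdot> (i X \<otimes>\<^sub>m i Y) = w \<cdot> (i X \<otimes>\<^sub>m i Y)" using w(2)[OF XY] by (simp only:)
    qed
  qed
  with w show ?thesis by (intro conjI ballI) (simp_all only:)
qed

lemma omega_in: "\<omega> \<in> Hom C (F \<otimes>\<^sub>o F) \<I>"
  by (rule conjunct1[OF omega_spec])

lemma omega_i_i: "X \<in> Obj C \<Longrightarrow> Y \<in> Obj C \<Longrightarrow> \<omega> \<cdot> (i X \<otimes>\<^sub>m i Y) = pairing X Y"
  using conjunct2[OF omega_spec] by (simp only: Ball_def)

end

lemma mat_lc_swap:
  fixes G :: "nat \<Rightarrow> nat \<Rightarrow> 'k :: comm_semiring_1 mat"
  shows "mat_lc r c N (\<lambda>_. 1) (\<lambda>a. mat_lc r c K (t a) (G a)) =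
    mat_lc r c K (\<lambda>_. 1) (\<lambda>w. mat_lc r c N (\<lambda>a. t a w) (\<lambda>a. G a w))"
proof (rule eq_matI, goal_cases)
  case (1 u v)
  hence "u < r" "v < c" by auto
  thus ?case using sum.swap[of "\<lambda>a w. t a w * G a w $$ (u,v)" "{..<K}" "{..<N}"] by simp
qed auto

section \<open>Recovering an arrow from its transposes\<close>

context rigid_monoidal_category
begin

text \<open>The mate determines \<open>dual_arrow C f\<close> by definition, and that arrow
  determines \<open>f\<close> through the evaluation on \<open>Y\<close>.\<close>

lemma mate_inject:
  assumes f: "f \<in> Hom C X Y" and g: "g \<in> Hom C X Y"
    and e: "(f \<otimes>\<^sub>m Ide C (X\<^sup>\<star>)) \<cdot> Coev C X = (g \<otimes>\<^sub>m Ide C (X\<^sup>\<star>)) \<cdot> Coev C X"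
  shows "f = g"
proof -
  note Y = Hom_Obj(2)[OF f]
  interpret Y: dual_pair C Y "Y\<^sup>\<star>" "Ev C Y" "Coev C Y" by (rule dual_pair_left_dual[OF Y])
  have *: "Y.transp (Ev C Y \<cdot> (Ide C (Y\<^sup>\<star>) \<otimes>\<^sub>m h)) X = h" if h: "h \<in> Hom C X Y" for h
  proof -
    note [simp] = HomD[OF h] Hom_Obj[OF h]
    have "Y.transp (Ev C Y \<cdot> (Ide C (Y\<^sup>\<star>) \<otimes>\<^sub>m h)) X = Y.transp (Ev C Y) Y \<cdot> h"
      by (rule Y.transp_Comp_right[OF Y.e_in h])
    also have "\<dots> = h" unfolding Y.transp_def by (simp add: Y.zigzag')
    finally show ?thesis .
  qed
  have "dual_arrow C f = dual_arrow C g"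
    unfolding dual_arrow_untransp[OF f] dual_arrow_untransp[OF g] e ..
  hence "Ev C Y \<cdot> (Ide C (Y\<^sup>\<star>) \<otimes>\<^sub>m f) = Ev C Y \<cdot> (Ide C (Y\<^sup>\<star>) \<otimes>\<^sub>m g)"
    unfolding Ev_dual_arrow[OF f] Ev_dual_arrow[OF g] by (rule arg_cong)
  from arg_cong[OF this, of "\<lambda>h. Y.transp h X"] show ?thesis unfolding *[OF f] *[OF g] .
qed

text \<open>Composition with \<open>e\<close> is a transposition in the reversed category, hence
  injective.\<close>

lemma effect_inject:
  assumes d: "is_left_dual C J' J e c" and f: "f \<in> Hom C X J" and g: "g \<in> Hom C X J"
    and eq: "e \<cdot> (f \<otimes>\<^sub>m Ide C J') = e \<cdot> (g \<otimes>\<^sub>m Ide C J')"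
  shows "f = g"
proof -
  interpret R: dual_pair "rev_cat C" J J' e c by (rule dual_pair_rev[OF d])
  have e: "e \<in> Hom C (J \<otimes>\<^sub>o J') \<I>" and JO: "J \<in> Obj C" "J' \<in> Obj C"
    using d by (auto simp: is_left_dual_def)
  have *: "R.untransp h \<I> = e \<cdot> (h \<otimes>\<^sub>m Ide C J')" for h
    unfolding R.untransp_def using HomD[OF e] by simp
  show ?thesis
    by (rule R.untransp_inject[of \<I> f X g]) (use f g eq JO in \<open>simp_all add: *\<close>)
qed

end


section \<open>Triviality of the Mueger center\<close>

locale represented_braided_category = braided_with_coend C F i + represented_category C A n b co rank rep mat_of
  for C :: "('k :: alg_closed_field, 'o, 'm, 'z) braided_cat_scheme" (structure) and F i
    and A :: "('k, 'a) module" and n b co rank rep mat_of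
begin

lemma linear_map_Zero:
  assumes L: "linear_map L X Y V W" and XY: "X \<in> Obj C" "Y \<in> Obj C"
  shows "L (Zero C X Y) = Zero C V W"
proof -
  have LZ: "L (Zero C X Y) \<in> Hom C V W" using L Zero_Hom[OF XY] by (simp add: linear_map_def)
  note VW = Hom_Obj[OF LZ]
  have "mat_of (Zero C X Y) = mat_lc (rank Y) (rank X) 0 (\<lambda>_. 0) (\<lambda>a. mat_of (Zero C X Y))"
    unfolding mat_of_Zero[OF XY] by (rule eq_matI) simp_all
  from linear_map_lc[OF L _ Zero_Hom[OF XY] this]
  have "mat_of (L (Zero C X Y)) = mat_lc (rank W) (rank V) 0 (\<lambda>_. 0) (\<lambda>a. mat_of (L (Zero C X Y)))" by simp
  also have "\<dots> = mat_of (Zero C V W)" unfolding mat_of_Zero[OF VW] by (rule eq_matI) simp_all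
  finally show ?thesis by (rule mat_of_inject[OF LZ Zero_Hom[OF VW]])
qed

lemma linear_map_Comp_left:
  assumes "g \<in> Hom C Y Z"
  shows "linear_map (\<lambda>f. g \<cdot> f) X Y X Z"
  using Comp_in[OF _ assms] Comp_Add_right[OF _ _ assms] Comp_Scale_right[OF _ assms]
  by (simp add: linear_map_def)

lemma linear_map_Comp_right:
  assumes "g \<in> Hom C W X"
  shows "linear_map (\<lambda>f. f \<cdot> g) X Y W Y"
  using Comp_in[OF assms] Comp_Add_left[OF assms] Comp_Scale_left[OF assms]
  by (simp add: linear_map_def)

lemma linear_map_tensor_left:
  assumes "g \<in> Hom C Z W"
  shows "linear_map (\<lambda>f. f \<otimes>\<^sub>m g) X Y (X \<otimes>\<^sub>o Z) (Y \<otimes>\<^sub>o W)"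
  using TensorM_in[OF _ assms] TensorM_Add_left[OF _ _ assms] TensorM_Scale_left[OF _ assms]
  by (simp add: linear_map_def)

lemma linear_map_tensor_right:
  assumes "g \<in> Hom C Z W"
  shows "linear_map (\<lambda>f. g \<otimes>\<^sub>m f) X Y (Z \<otimes>\<^sub>o X) (W \<otimes>\<^sub>o Y)"
  using TensorM_in[OF assms] TensorM_Add_right[OF assms] TensorM_Scale_right[OF assms]
  by (simp add: linear_map_def)

lemma linear_map_compose:
  assumes "linear_map L X Y V W" "linear_map L' V W V' W'"
  shows "linear_map (\<lambda>f. L' (L f)) X Y V' W'"
  using assms by (simp add: linear_map_def)

lemma linear_map_cong:
  assumes L: "linear_map L X Y V W" and e: "\<And>f. f \<in> Hom C X Y \<Longrightarrow> L' f = L f"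
  shows "linear_map L' X Y V W"
  using L Add_Hom Scale_Hom unfolding linear_map_def by (simp add: e)

lemma linear_map_dual_arrow:
  assumes X: "X \<in> Obj C" and Y: "Y \<in> Obj C"
  shows "linear_map (dual_arrow C) X Y (Y\<^sup>\<star>) (X\<^sup>\<star>)"
proof (rule linear_map_cong)
  have e: "Ev C Y \<otimes>\<^sub>m Ide C (X\<^sup>\<star>) \<in> Hom C (Y\<^sup>\<star> \<otimes>\<^sub>o Y \<otimes>\<^sub>o X\<^sup>\<star>) (X\<^sup>\<star>)" using X Y by (simp add: Hom_iff)
  have 1: "linear_map (\<lambda>f. (f \<otimes>\<^sub>m Ide C (X\<^sup>\<star>)) \<cdot> Coev C X) X Y \<I> (Y \<otimes>\<^sub>o X\<^sup>\<star>)"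
    by (rule linear_map_compose[OF linear_map_tensor_left[OF Ide_in[OF Dual_Obj[OF X]]] linear_map_Comp_right[OF Coev_in[OF X]]])
  have 2: "linear_map (\<lambda>f. (Ev C Y \<otimes>\<^sub>m Ide C (X\<^sup>\<star>)) \<cdot> (Ide C (Y\<^sup>\<star>) \<otimes>\<^sub>m ((f \<otimes>\<^sub>m Ide C (X\<^sup>\<star>)) \<cdot> Coev C X))) X Y (Y\<^sup>\<star> \<otimes>\<^sub>o \<I>) (X\<^sup>\<star>)"
    by (rule linear_map_compose[OF linear_map_compose[OF 1 linear_map_tensor_right[OF Ide_in[OF Dual_Obj[OF Y]]]]
          linear_map_Comp_left[OF e]])
  have o: "Y\<^sup>\<star> \<otimes>\<^sub>o \<I> = Y\<^sup>\<star>" using Y by simp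
  show "linear_map (\<lambda>f. (Ev C Y \<otimes>\<^sub>m Ide C (X\<^sup>\<star>)) \<cdot> (Ide C (Y\<^sup>\<star>) \<otimes>\<^sub>m ((f \<otimes>\<^sub>m Ide C (X\<^sup>\<star>)) \<cdot> Coev C X))) X Y (Y\<^sup>\<star>) (X\<^sup>\<star>)"
    using 2 by (simp only: o)
  show "dual_arrow C f = (Ev C Y \<otimes>\<^sub>m Ide C (X\<^sup>\<star>)) \<cdot> (Ide C (Y\<^sup>\<star>) \<otimes>\<^sub>m ((f \<otimes>\<^sub>m Ide C (X\<^sup>\<star>)) \<cdot> Coev C X))"
    if f: "f \<in> Hom C X Y" for f
    unfolding dual_arrow_untransp[OF f] dual_pair.untransp_def[OF dual_pair_left_dual[OF Y]] ..
qed

lemma Unit_irreducible: "irreducible_rep (carrier A) (rank \<I>) (rep \<I>)"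
  by (rule simple_irreducible[OF Unit_simple])

text \<open>\<open>i \<I>\<close> after identifying the dual of the unit object with the unit
  object. Pairing with \<open>u\<close> turns \<open>i Y\<close> into \<open>Ev C Y\<close>.\<close>

definition u :: 'm where "u = i \<I> \<cdot> Coev C \<I>"

lemma Coev_Unit_in: "Coev C \<I> \<in> Hom C \<I> (\<I>\<^sup>\<star>)"
  by (simp add: Hom_iff)

lemma Ev_Unit_in: "Ev C \<I> \<in> Hom C (\<I>\<^sup>\<star>) \<I>"
  by (simp add: Hom_iff)

lemma u_in: "u \<in> Hom C \<I> F"
  by (simp add: u_def Hom_iff)

text \<open>By strictness the zigzag identities for the unit object say that its evaluation and
  coevaluation are mutually inverse.\<close>

lemma Ev_Coev_Unit: "Ev C \<I> \<cdot> Coev C \<I> = Ide C \<I>" "Coev C \<I> \<cdot> Ev C \<I> = Ide C (\<I>\<^sup>\<star>)"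
proof -
  interpret I: dual_pair C \<I> "\<I>\<^sup>\<star>" "Ev C \<I>" "Coev C \<I>" by (rule dual_pair_left_dual[OF Unit_Obj])
  show "Ev C \<I> \<cdot> Coev C \<I> = Ide C \<I>" using I.zigzag' by simp
  have "(Ev C \<I> \<otimes>\<^sub>m Ide C (\<I>\<^sup>\<star>)) \<cdot> (Ide C (\<I>\<^sup>\<star>) \<otimes>\<^sub>m Coev C \<I>) = Ev C \<I> \<otimes>\<^sub>m Coev C \<I>"
    by (rule slide(1)[OF Ev_Unit_in Coev_Unit_in])
  moreover have "Coev C \<I> \<cdot> Ev C \<I> = Ev C \<I> \<otimes>\<^sub>m Coev C \<I>"
    using slide_effect(1)[OF Ev_Unit_in Coev_Unit_in] by simp
  ultimately show "Coev C \<I> \<cdot> Ev C \<I> = Ide C (\<I>\<^sup>\<star>)" using I.zigzag by (simp only:)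
qed

lemma i_Unit: "i \<I> = u \<cdot> Ev C \<I>"
proof -
  have iI: "i \<I> \<in> Hom C (\<I>\<^sup>\<star>) F" by (simp add: Hom_iff)
  have "u \<cdot> Ev C \<I> = i \<I> \<cdot> (Coev C \<I> \<cdot> Ev C \<I>)"
    unfolding u_def by (rule Comp_assoc[OF Ev_Unit_in Coev_Unit_in iI])
  thus ?thesis unfolding Ev_Coev_Unit(2) by (simp only: Ide_right[OF iI])
qed

lemma omega_whisker:
  assumes g: "g \<in> Hom C W V" and f: "f \<in> Hom C V F"
  shows "\<omega> \<cdot> ((f \<cdot> g) \<otimes>\<^sub>m Ide C F) = (\<omega> \<cdot> (f \<otimes>\<^sub>m Ide C F)) \<cdot> (g \<otimes>\<^sub>m Ide C F)"
proof -
  have "(f \<cdot> g) \<otimes>\<^sub>m Ide C F = (f \<otimes>\<^sub>m Ide C F) \<cdot> (g \<otimes>\<^sub>m Ide C F)"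
    using HomD[OF f] HomD[OF g] by (intro whisker_right_Comp) simp_all
  thus ?thesis
    by (simp only: Comp_assoc[OF TensorM_in[OF g Ide_in[OF F_Obj]] TensorM_in[OF f Ide_in[OF F_Obj]] omega_in])
qed

lemma omega_whisker_i:
  assumes f: "f \<in> Hom C V F" and Y: "Y \<in> Obj C"
  shows "(\<omega> \<cdot> (f \<otimes>\<^sub>m Ide C F)) \<cdot> (Ide C V \<otimes>\<^sub>m i Y) = \<omega> \<cdot> (f \<otimes>\<^sub>m i Y)"
  unfolding slide(1)[OF f i_in[OF Y], symmetric]
  by (rule Comp_assoc[OF TensorM_in[OF Ide_in[OF Hom_Obj(1)[OF f]] i_in[OF Y]] TensorM_in[OF f Ide_in[OF F_Obj]] omega_in])

text \<open>The unit object is transparent, so the double braiding disappears and the evaluation of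
  \<open>\<I>\<close> cancels against the coevaluation in \<open>u\<close>.\<close>

lemma omega_u_i:
  assumes Y: "Y \<in> Obj C"
  shows "\<omega> \<cdot> (u \<otimes>\<^sub>m i Y) = Ev C Y"
proof -
  let ?Y = "Y\<^sup>\<star> \<otimes>\<^sub>o Y"
  have YO: "?Y \<in> Obj C" using Y by simp
  have iI: "i \<I> \<in> Hom C (\<I>\<^sup>\<star>) F" by (simp add: Hom_iff)
  have "u \<otimes>\<^sub>m i Y = (i \<I> \<otimes>\<^sub>m i Y) \<cdot> (Coev C \<I> \<otimes>\<^sub>m Ide C ?Y)"
    using TensorM_Comp[OF Coev_Unit_in iI Ide_in[OF YO] i_in[OF Y]] unfolding u_def by (simp only: Ide_right[OF i_in[OF Y]])
  hence "\<omega> \<cdot> (u \<otimes>\<^sub>m i Y) = (\<omega> \<cdot> (i \<I> \<otimes>\<^sub>m i Y)) \<cdot> (Coev C \<I> \<otimes>\<^sub>m Ide C ?Y)"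
    by (simp only: Comp_assoc[OF TensorM_in[OF Coev_Unit_in Ide_in[OF YO]] TensorM_in[OF iI i_in[OF Y]] omega_in])
  also have "\<dots> = (Ev C \<I> \<otimes>\<^sub>m Ev C Y) \<cdot> (Coev C \<I> \<otimes>\<^sub>m Ide C ?Y)"
    by (simp only: omega_i_i[OF Unit_Obj Y] pairing_transparent[OF transparent_Unit Y])
  also have "\<dots> = (Ev C \<I> \<cdot> Coev C \<I>) \<otimes>\<^sub>m (Ev C Y \<cdot> Ide C ?Y)"
    by (rule TensorM_Comp[OF Coev_Unit_in Ev_Unit_in Ide_in[OF YO] Ev_in[OF Y], symmetric])
  also have "\<dots> = Ev C Y"
    unfolding Ev_Coev_Unit(1) Ide_right[OF Ev_in[OF Y]] using Y by simp
  finally show ?thesis .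
qed

text \<open>Tested on \<open>i Y\<close>, both sides become
  \<open>Ev C X \<otimes>\<^sub>m Ev C Y\<close>: one by transparency of \<open>X\<close>, the other
  by \<open>omega_u_i\<close>.\<close>

lemma omega_transparent:
  assumes X: "transparent X"
  shows "\<omega> \<cdot> (i X \<otimes>\<^sub>m Ide C F) = \<omega> \<cdot> ((u \<cdot> Ev C X) \<otimes>\<^sub>m Ide C F)"
proof -
  have XO: "X \<in> Obj C" using X by (simp add: transparent_def)
  let ?X = "X\<^sup>\<star> \<otimes>\<^sub>o X"
  have V: "?X \<in> Obj C" using XO by simp
  note uev = Comp_in[OF Ev_in[OF XO] u_in]
  show ?thesis
  proof (rule F_left_eqI[OF V])
    show "\<omega> \<cdot> (i X \<otimes>\<^sub>m Ide C F) \<in> Hom C (?X \<otimes>\<^sub>o F) \<I>"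
      by (rule Comp_in[OF TensorM_in[OF i_in[OF XO] Ide_in[OF F_Obj]] omega_in])
    show "\<omega> \<cdot> ((u \<cdot> Ev C X) \<otimes>\<^sub>m Ide C F) \<in> Hom C (?X \<otimes>\<^sub>o F) \<I>"
      by (rule Comp_in[OF TensorM_in[OF uev Ide_in[OF F_Obj]] omega_in])
    fix Y assume Y: "Y \<in> Obj C"
    let ?Y = "Y\<^sup>\<star> \<otimes>\<^sub>o Y"
    have YO: "?Y \<in> Obj C" using Y by simp
    have "\<omega> \<cdot> ((u \<cdot> Ev C X) \<otimes>\<^sub>m i Y) = \<omega> \<cdot> ((u \<otimes>\<^sub>m i Y) \<cdot> (Ev C X \<otimes>\<^sub>m Ide C ?Y))"
      using TensorM_Comp[OF Ev_in[OF XO] u_in Ide_in[OF YO] i_in[OF Y]] by (simp only: Ide_right[OF i_in[OF Y]])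
    also have "\<dots> = (\<omega> \<cdot> (u \<otimes>\<^sub>m i Y)) \<cdot> (Ev C X \<otimes>\<^sub>m Ide C ?Y)"
      by (rule Comp_assoc[symmetric, OF TensorM_in[OF Ev_in[OF XO] Ide_in[OF YO]] TensorM_in[OF u_in i_in[OF Y]] omega_in])
    also have "\<dots> = Ev C X \<otimes>\<^sub>m Ev C Y"
      unfolding omega_u_i[OF Y] by (rule slide_effect(1)[OF Ev_in[OF XO] Ev_in[OF Y]])
    finally show "(\<omega> \<cdot> (i X \<otimes>\<^sub>m Ide C F)) \<cdot> (Ide C ?X \<otimes>\<^sub>m i Y) =
        (\<omega> \<cdot> ((u \<cdot> Ev C X) \<otimes>\<^sub>m Ide C F)) \<cdot> (Ide C ?X \<otimes>\<^sub>m i Y)"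
      unfolding omega_whisker_i[OF i_in[OF XO] Y] omega_whisker_i[OF uev Y] omega_i_i[OF XO Y] pairing_transparent[OF X Y]
      by (rule sym)
  qed
qed

end

text \<open>\<open>P\<close> is the regular module, \<open>J\<close> the dual of the right regular one, and for an \<open>A\<close>-module \<open>X\<close> with
  basis \<open>e\<close> the arrows \<open>p X a\<close> and \<open>q X a\<close> are \<open>c \<mapsto> c e\<^sub>a\<close> and \<open>v \<mapsto> (c \<mapsto> (c v)\<^sub>a)\<close>. Hence
  \<open>\<Sum>\<^sub>a q X a \<cdot> p X a\<close> maps \<open>x\<close> to \<open>c \<mapsto> tr\<^sub>X(c x)\<close> and determines the character of \<open>X\<close>.\<close>

locale regular_data = represented_braided_category C F i A n b co rank rep mat_of
  for C :: "('k :: alg_closed_field, 'o, 'm, 'z) braided_cat_scheme" (structure) and F i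
    and A :: "('k, 'a) module" and n b co rank rep mat_of +
  fixes P J p q \<beta>
  assumes PJ [simp]: "P \<in> Obj C" "J \<in> Obj C"
    and p_in: "\<And>X a. X \<in> Obj C \<Longrightarrow> a < rank X \<Longrightarrow> p X a \<in> Hom C P X"
    and q_in: "\<And>X a. X \<in> Obj C \<Longrightarrow> a < rank X \<Longrightarrow> q X a \<in> Hom C X J"
    and p_natural: "\<And>X Y f a. f \<in> Hom C X Y \<Longrightarrow> a < rank X \<Longrightarrow>
      mat_of (f \<cdot> p X a) = mat_lc (rank Y) (rank P) (rank Y) (\<lambda>w. mat_of f $$ (w,a)) (\<lambda>w. mat_of (p Y w))"
    and q_natural: "\<And>X Y f a. f \<in> Hom C X Y \<Longrightarrow> a < rank Y \<Longrightarrow>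
      mat_of (q Y a \<cdot> f) = mat_lc (rank J) (rank X) (rank X) (\<lambda>w. mat_of f $$ (a,w)) (\<lambda>w. mat_of (q X w))"
    and \<beta>_in: "\<And>c. c \<in> carrier A \<Longrightarrow> \<beta> c \<in> Hom C J J"
    and \<beta>_q: "\<And>c X a. c \<in> carrier A \<Longrightarrow> X \<in> Obj C \<Longrightarrow> a < rank X \<Longrightarrow>
      mat_of (\<beta> c \<cdot> q X a) = mat_lc (rank J) (rank X) (rank X) (\<lambda>w. rep X c $$ (a,w)) (\<lambda>w. mat_of (q X w))"
    and p_independent: "\<And>X t a. X \<in> Obj C \<Longrightarrow>
      mat_lc (rank X) (rank P) (rank X) t (\<lambda>a. mat_of (p X a)) = 0\<^sub>m (rank X) (rank P) \<Longrightarrow> a < rank X \<Longrightarrow> t a = 0"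
    and q_independent: "\<And>X t a. X \<in> Obj C \<Longrightarrow>
      mat_lc (rank J) (rank X) (rank X) t (\<lambda>a. mat_of (q X a)) = 0\<^sub>m (rank J) (rank X) \<Longrightarrow> a < rank X \<Longrightarrow> t a = 0"
    and trace_q_p: "\<And>X Y s x. X \<in> Obj C \<Longrightarrow> Y \<in> Obj C \<Longrightarrow>
      mat_lc (rank J) (rank P) (rank X) (\<lambda>_. 1) (\<lambda>a. mat_of (q X a \<cdot> p X a)) =
      s \<cdot>\<^sub>m mat_lc (rank J) (rank P) (rank Y) (\<lambda>_. 1) (\<lambda>a. mat_of (q Y a \<cdot> p Y a)) \<Longrightarrow>
      x \<in> carrier A \<Longrightarrow> (\<Sum>u<rank X. rep X x $$ (u,u)) = s * (\<Sum>u<rank Y. rep Y x $$ (u,u))"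
    and Omega_inj: "inj_on (Omega C F i) (Hom C \<I> F)"
begin

lemma omega_inject:
  assumes "f \<in> Hom C \<I> F" "g \<in> Hom C \<I> F" "\<omega> \<cdot> (f \<otimes>\<^sub>m Ide C F) = \<omega> \<cdot> (g \<otimes>\<^sub>m Ide C F)"
  shows "f = g"
  using inj_onD[OF Omega_inj _ assms(1,2)] assms(3) by (simp only: Omega_def)

text \<open>The two arrows on \<open>X\<^sup>\<star> \<otimes>\<^sub>o X\<close> pair equally with
  \<open>F\<close>, but injectivity of \<Omega> can be applied only after composing with an arrow
  from the unit object.\<close>

lemma i_state:
  assumes X: "transparent X" and g: "g \<in> Hom C \<I> (X\<^sup>\<star> \<otimes>\<^sub>o X)"
  shows "i X \<cdot> g = u \<cdot> (Ev C X \<cdot> g)"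
proof -
  have XO: "X \<in> Obj C" using X by (simp add: transparent_def)
  note uev = Comp_in[OF Ev_in[OF XO] u_in]
  have "i X \<cdot> g = (u \<cdot> Ev C X) \<cdot> g"
  proof (rule omega_inject)
    show "i X \<cdot> g \<in> Hom C \<I> F" by (rule Comp_in[OF g i_in[OF XO]])
    show "(u \<cdot> Ev C X) \<cdot> g \<in> Hom C \<I> F" by (rule Comp_in[OF g uev])
    show "\<omega> \<cdot> ((i X \<cdot> g) \<otimes>\<^sub>m Ide C F) = \<omega> \<cdot> (((u \<cdot> Ev C X) \<cdot> g) \<otimes>\<^sub>m Ide C F)"
      unfolding omega_whisker[OF g i_in[OF XO]] omega_whisker[OF g uev] omega_transparent[OF X] ..
  qed
  thus ?thesis by (simp only: Comp_assoc[OF g Ev_in[OF XO] u_in])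
qed

text \<open>The dinatural transformation \<open>\<Sum>\<^sub>a p\<^sub>a\<^sup>\<star> \<otimes> q\<^sub>a\<close>. Its naturality reflects that \<open>p X\<close> and \<open>q X\<close>
  transform as dual bases.\<close>

definition matrix_coefficients :: "'o \<Rightarrow> 'm"
  where "matrix_coefficients X = (SOME h. h \<in> Hom C (X\<^sup>\<star> \<otimes>\<^sub>o X) (P\<^sup>\<star> \<otimes>\<^sub>o J) \<and>
    mat_of h = mat_lc (rank (P\<^sup>\<star> \<otimes>\<^sub>o J)) (rank (X\<^sup>\<star> \<otimes>\<^sub>o X)) (rank X) (\<lambda>_. 1)
      (\<lambda>a. mat_of (dual_arrow C (p X a) \<otimes>\<^sub>m q X a)))"

abbreviation "j \<equiv> matrix_coefficients"

lemma dual_p_in: "X \<in> Obj C \<Longrightarrow> a < rank X \<Longrightarrow> dual_arrow C (p X a) \<in> Hom C (X\<^sup>\<star>) (P\<^sup>\<star>)"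
  by (rule dual_arrow_in[OF p_in])

lemma p_q_in: "X \<in> Obj C \<Longrightarrow> a < rank X \<Longrightarrow> dual_arrow C (p X a) \<otimes>\<^sub>m q X a \<in> Hom C (X\<^sup>\<star> \<otimes>\<^sub>o X) (P\<^sup>\<star> \<otimes>\<^sub>o J)"
  by (rule TensorM_in[OF dual_p_in q_in])

lemma j_spec:
  assumes X: "X \<in> Obj C"
  shows "j X \<in> Hom C (X\<^sup>\<star> \<otimes>\<^sub>o X) (P\<^sup>\<star> \<otimes>\<^sub>o J)"
    and "mat_of (j X) = mat_lc (rank (P\<^sup>\<star> \<otimes>\<^sub>o J)) (rank (X\<^sup>\<star> \<otimes>\<^sub>o X)) (rank X) (\<lambda>_. 1)
      (\<lambda>a. mat_of (dual_arrow C (p X a) \<otimes>\<^sub>m q X a))"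
proof -
  have O: "X\<^sup>\<star> \<otimes>\<^sub>o X \<in> Obj C" "P\<^sup>\<star> \<otimes>\<^sub>o J \<in> Obj C" using X by simp_all
  have "\<exists>h \<in> Hom C (X\<^sup>\<star> \<otimes>\<^sub>o X) (P\<^sup>\<star> \<otimes>\<^sub>o J). mat_of h = mat_lc (rank (P\<^sup>\<star> \<otimes>\<^sub>o J)) (rank (X\<^sup>\<star> \<otimes>\<^sub>o X)) (rank X) (\<lambda>_. 1)
      (\<lambda>a. mat_of (dual_arrow C (p X a) \<otimes>\<^sub>m q X a))"
    by (rule ex_lc[OF O p_q_in[OF X]])
  hence "\<exists>h. h \<in> Hom C (X\<^sup>\<star> \<otimes>\<^sub>o X) (P\<^sup>\<star> \<otimes>\<^sub>o J) \<and> mat_of h = mat_lc (rank (P\<^sup>\<star> \<otimes>\<^sub>o J)) (rank (X\<^sup>\<star> \<otimes>\<^sub>o X)) (rank X) (\<lambda>_. 1)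
      (\<lambda>a. mat_of (dual_arrow C (p X a) \<otimes>\<^sub>m q X a))" by (simp only: Bex_def)
  from someI_ex[OF this] show "j X \<in> Hom C (X\<^sup>\<star> \<otimes>\<^sub>o X) (P\<^sup>\<star> \<otimes>\<^sub>o J)"
    and "mat_of (j X) = mat_lc (rank (P\<^sup>\<star> \<otimes>\<^sub>o J)) (rank (X\<^sup>\<star> \<otimes>\<^sub>o X)) (rank X) (\<lambda>_. 1)
      (\<lambda>a. mat_of (dual_arrow C (p X a) \<otimes>\<^sub>m q X a))"
    unfolding matrix_coefficients_def by (rule conjunct1, rule conjunct2)
qed

lemma j_linear_map:
  assumes X: "X \<in> Obj C" and L: "linear_map L (X\<^sup>\<star> \<otimes>\<^sub>o X) (P\<^sup>\<star> \<otimes>\<^sub>o J) V W"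
  shows "mat_of (L (j X)) = mat_lc (rank W) (rank V) (rank X) (\<lambda>_. 1) (\<lambda>a. mat_of (L (dual_arrow C (p X a) \<otimes>\<^sub>m q X a)))"
  by (rule linear_map_lc[OF L p_q_in[OF X] j_spec[OF X]])

text \<open>Both sides are the double sum of the terms
  \<open>dual_arrow C (p Y a) \<otimes>\<^sub>m q X w\<close> weighted by the entry of
  \<open>f\<close> at \<open>(a,w)\<close>: \<open>q\<close> produces rows of the matrix,
  \<open>p\<close> produces columns.\<close>

lemma j_dinatural:
  assumes f: "f \<in> Hom C X Y"
  shows "j Y \<cdot> (Ide C (Y\<^sup>\<star>) \<otimes>\<^sub>m f) = j X \<cdot> (dual_arrow C f \<otimes>\<^sub>m Ide C X)"
proof -
  note O = Hom_Obj[OF f] and d = dual_arrow_in[OF f]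
  note 1 = TensorM_in[OF Ide_in[OF Dual_Obj[OF O(2)]] f] and 2 = TensorM_in[OF d Ide_in[OF O(1)]]
  let ?r = "rank (P\<^sup>\<star> \<otimes>\<^sub>o J)" and ?c = "rank (Y\<^sup>\<star> \<otimes>\<^sub>o X)"
  let ?M = "\<lambda>a w. mat_of (dual_arrow C (p Y a) \<otimes>\<^sub>m q X w)"
  have "mat_of (j Y \<cdot> (Ide C (Y\<^sup>\<star>) \<otimes>\<^sub>m f)) = mat_lc ?r ?c (rank Y) (\<lambda>_. 1)
      (\<lambda>a. mat_of ((dual_arrow C (p Y a) \<otimes>\<^sub>m q Y a) \<cdot> (Ide C (Y\<^sup>\<star>) \<otimes>\<^sub>m f)))"
    by (rule j_linear_map[OF O(2) linear_map_Comp_right[OF 1]])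
  also have "\<dots> = mat_lc ?r ?c (rank Y) (\<lambda>_. 1) (\<lambda>a. mat_lc ?r ?c (rank X) (\<lambda>w. mat_of f $$ (a,w)) (?M a))"
  proof (rule mat_lc_cong)
    fix a assume a: "a < rank Y"
    note dp = dual_p_in[OF O(2) a]
    have "(dual_arrow C (p Y a) \<otimes>\<^sub>m q Y a) \<cdot> (Ide C (Y\<^sup>\<star>) \<otimes>\<^sub>m f) = dual_arrow C (p Y a) \<otimes>\<^sub>m (q Y a \<cdot> f)"
      unfolding TensorM_Comp[OF Ide_in[OF Dual_Obj[OF O(2)]] dp f q_in[OF O(2) a], symmetric] Ide_right[OF dp] ..
    moreover have "mat_of (dual_arrow C (p Y a) \<otimes>\<^sub>m (q Y a \<cdot> f)) = mat_lc ?r ?c (rank X) (\<lambda>w. mat_of f $$ (a,w)) (?M a)"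
      by (rule linear_map_lc[OF linear_map_tensor_right[OF dp] q_in[OF O(1)] Comp_in[OF f q_in[OF O(2) a]] q_natural[OF f a]])
    ultimately show "mat_of ((dual_arrow C (p Y a) \<otimes>\<^sub>m q Y a) \<cdot> (Ide C (Y\<^sup>\<star>) \<otimes>\<^sub>m f)) =
        mat_lc ?r ?c (rank X) (\<lambda>w. mat_of f $$ (a,w)) (?M a)" by (simp only:)
  qed simp
  also have "\<dots> = mat_lc ?r ?c (rank X) (\<lambda>_. 1) (\<lambda>w. mat_lc ?r ?c (rank Y) (\<lambda>a. mat_of f $$ (a,w)) (\<lambda>a. ?M a w))"
    by (rule mat_lc_swap)
  also have "\<dots> = mat_lc ?r ?c (rank X) (\<lambda>_. 1)
      (\<lambda>w. mat_of ((dual_arrow C (p X w) \<otimes>\<^sub>m q X w) \<cdot> (dual_arrow C f \<otimes>\<^sub>m Ide C X)))"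
  proof (rule mat_lc_cong)
    fix w assume w: "w < rank X"
    note dp = dual_p_in[OF O(1) w] and qw = q_in[OF O(1) w]
    have "(dual_arrow C (p X w) \<otimes>\<^sub>m q X w) \<cdot> (dual_arrow C f \<otimes>\<^sub>m Ide C X) = dual_arrow C (f \<cdot> p X w) \<otimes>\<^sub>m q X w"
      unfolding TensorM_Comp[OF d dp Ide_in[OF O(1)] qw, symmetric] Ide_right[OF qw]
        dual_arrow_Comp[OF p_in[OF O(1) w] f] ..
    moreover have "mat_of (dual_arrow C (f \<cdot> p X w) \<otimes>\<^sub>m q X w) = mat_lc ?r ?c (rank Y) (\<lambda>a. mat_of f $$ (a,w)) (\<lambda>a. ?M a w)"
      by (rule linear_map_lc[OF linear_map_compose[OF linear_map_dual_arrow[OF PJ(1) O(2)] linear_map_tensor_left[OF qw]]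
          p_in[OF O(2)] Comp_in[OF p_in[OF O(1) w] f] p_natural[OF f w]])
    ultimately show "mat_lc ?r ?c (rank Y) (\<lambda>a. mat_of f $$ (a,w)) (\<lambda>a. ?M a w) =
        mat_of ((dual_arrow C (p X w) \<otimes>\<^sub>m q X w) \<cdot> (dual_arrow C f \<otimes>\<^sub>m Ide C X))" by (simp only:)
  qed simp
  also have "\<dots> = mat_of (j X \<cdot> (dual_arrow C f \<otimes>\<^sub>m Ide C X))"
    by (rule j_linear_map[OF O(1) linear_map_Comp_right[OF 2], symmetric])
  finally show ?thesis
    by (rule mat_of_inject[OF Comp_in[OF 1 j_spec(1)[OF O(2)]] Comp_in[OF 2 j_spec(1)[OF O(1)]]])
qed

lemma j_factorization:
  obtains \<kappa> where "\<kappa> \<in> Hom C F (P\<^sup>\<star> \<otimes>\<^sub>o J)" "\<And>X. X \<in> Obj C \<Longrightarrow> \<kappa> \<cdot> i X = j X"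
proof -
  have "is_dinatural C (P\<^sup>\<star> \<otimes>\<^sub>o J) j" unfolding is_dinatural_def
  proof (intro conjI ballI allI)
    show "P\<^sup>\<star> \<otimes>\<^sub>o J \<in> Obj C" by simp
    show "j X \<in> Hom C (X\<^sup>\<star> \<otimes>\<^sub>o X) (P\<^sup>\<star> \<otimes>\<^sub>o J)" if "X \<in> Obj C" for X by (rule j_spec(1)[OF that])
    show "j Y \<cdot> (Ide C (Y\<^sup>\<star>) \<otimes>\<^sub>m f) = j X \<cdot> (dual_arrow C f \<otimes>\<^sub>m Ide C X)" if "f \<in> Hom C X Y" for X Y f
      by (rule j_dinatural[OF that])
  qed
  hence "cocone (\<lambda>X. X\<^sup>\<star> \<otimes>\<^sub>o X) dinatural_relations (P\<^sup>\<star> \<otimes>\<^sub>o J) j" by (simp only: is_dinatural_cocone)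
  thus thesis by (rule universal_coconeE[OF universal]) (rule that)
qed

text \<open>The braided trace of \<open>X\<close>, composed with the transformation above, is determined by the
  arrow \<open>\<Sum>\<^sub>a q\<^sub>a \<cdot> p\<^sub>a : P \<rightarrow> J\<close>, which encodes the character of \<open>X\<close> as an \<open>A\<close>-module.\<close>

definition braided_mate :: "'m \<Rightarrow> 'm"
  where "braided_mate h = \<sigma> J (P\<^sup>\<star>) \<cdot> ((h \<otimes>\<^sub>m Ide C (P\<^sup>\<star>)) \<cdot> Coev C P)"

lemma braided_mate_linear: "linear_map braided_mate P J \<I> (P\<^sup>\<star> \<otimes>\<^sub>o J)"
  unfolding braided_mate_def
  by (rule linear_map_compose[OF linear_map_compose[OF linear_map_tensor_left[OF Ide_in[OF Dual_Obj[OF PJ(1)]]]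
        linear_map_Comp_right[OF Coev_in[OF PJ(1)]]] linear_map_Comp_left[OF Braiding_in[OF PJ(2) Dual_Obj[OF PJ(1)]]]])

lemma braided_mate_inject:
  assumes f: "f \<in> Hom C P J" and g: "g \<in> Hom C P J" and e: "braided_mate f = braided_mate g"
  shows "f = g"
proof (rule mate_inject[OF f g])
  note s = Braiding_in[OF PJ(2) Dual_Obj[OF PJ(1)]]
  obtain t where t: "t \<in> Hom C (P\<^sup>\<star> \<otimes>\<^sub>o J) (J \<otimes>\<^sub>o P\<^sup>\<star>)" "t \<cdot> \<sigma> J (P\<^sup>\<star>) = Ide C (J \<otimes>\<^sub>o P\<^sup>\<star>)"
    using Braiding_iso[OF PJ(2) Dual_Obj[OF PJ(1)]] HomD[OF s]
    by (auto simp: is_iso_def inverse_arrows_def)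
  have *: "t \<cdot> braided_mate h = (h \<otimes>\<^sub>m Ide C (P\<^sup>\<star>)) \<cdot> Coev C P" if h: "h \<in> Hom C P J" for h
  proof -
    have m: "(h \<otimes>\<^sub>m Ide C (P\<^sup>\<star>)) \<cdot> Coev C P \<in> Hom C \<I> (J \<otimes>\<^sub>o P\<^sup>\<star>)"
      by (rule Comp_in[OF Coev_in[OF PJ(1)] TensorM_in[OF h Ide_in[OF Dual_Obj[OF PJ(1)]]]])
    show ?thesis unfolding braided_mate_def Comp_assoc[OF m s t(1), symmetric] t(2) by (rule Ide_left[OF m])
  qed
  show "(f \<otimes>\<^sub>m Ide C (P\<^sup>\<star>)) \<cdot> Coev C P = (g \<otimes>\<^sub>m Ide C (P\<^sup>\<star>)) \<cdot> Coev C P"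
    unfolding *[OF f, symmetric] *[OF g, symmetric] e ..
qed

text \<open>Naturality carries the braiding past each summand, and the dual of \<open>p X a\<close>
  slides through the coevaluation and reappears as \<open>p X a\<close>. What is left depends only
  on the composite \<open>P \<rightarrow> J\<close>.\<close>

lemma j_braided_coev:
  assumes X: "X \<in> Obj C"
  obtains k where "k \<in> Hom C P J" "mat_of k = mat_lc (rank J) (rank P) (rank X) (\<lambda>_. 1) (\<lambda>a. mat_of (q X a \<cdot> p X a))"
    "j X \<cdot> (\<sigma> X (X\<^sup>\<star>) \<cdot> Coev C X) = braided_mate k"
proof -
  have qp: "q X a \<cdot> p X a \<in> Hom C P J" if "a < rank X" for a by (rule Comp_in[OF p_in[OF X that] q_in[OF X that]])
  obtain k where k: "k \<in> Hom C P J" "mat_of k = mat_lc (rank J) (rank P) (rank X) (\<lambda>_. 1) (\<lambda>a. mat_of (q X a \<cdot> p X a))"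
    using ex_lc[OF PJ, of "rank X" "\<lambda>a. q X a \<cdot> p X a" "\<lambda>_. 1"] qp by blast
  note s = Braiding_in[OF X Dual_Obj[OF X]]
  note g = Comp_in[OF Coev_in[OF X] s]
  have "mat_of (j X \<cdot> (\<sigma> X (X\<^sup>\<star>) \<cdot> Coev C X)) = mat_lc (rank (P\<^sup>\<star> \<otimes>\<^sub>o J)) (rank \<I>) (rank X) (\<lambda>_. 1)
      (\<lambda>a. mat_of ((dual_arrow C (p X a) \<otimes>\<^sub>m q X a) \<cdot> (\<sigma> X (X\<^sup>\<star>) \<cdot> Coev C X)))"
    by (rule j_linear_map[OF X linear_map_Comp_right[OF g]])
  also have "\<dots> = mat_lc (rank (P\<^sup>\<star> \<otimes>\<^sub>o J)) (rank \<I>) (rank X) (\<lambda>_. 1) (\<lambda>a. mat_of (braided_mate (q X a \<cdot> p X a)))"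
  proof (rule mat_lc_cong)
    fix a assume a: "a < rank X"
    note pa = p_in[OF X a] and qa = q_in[OF X a] and dp = dual_p_in[OF X a] and Ps = Dual_Obj[OF PJ(1)]
    note sJ = Braiding_in[OF PJ(2) Ps]
    have "(dual_arrow C (p X a) \<otimes>\<^sub>m q X a) \<cdot> (\<sigma> X (X\<^sup>\<star>) \<cdot> Coev C X) =
        ((dual_arrow C (p X a) \<otimes>\<^sub>m q X a) \<cdot> \<sigma> X (X\<^sup>\<star>)) \<cdot> Coev C X"
      by (rule Comp_assoc[OF Coev_in[OF X] s p_q_in[OF X a], symmetric])
    also have "\<dots> = (\<sigma> J (P\<^sup>\<star>) \<cdot> (q X a \<otimes>\<^sub>m dual_arrow C (p X a))) \<cdot> Coev C X"
      unfolding Braiding_natural[OF qa dp] ..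
    also have "\<dots> = \<sigma> J (P\<^sup>\<star>) \<cdot> ((q X a \<otimes>\<^sub>m dual_arrow C (p X a)) \<cdot> Coev C X)"
      by (rule Comp_assoc[OF Coev_in[OF X] TensorM_in[OF qa dp] sJ])
    also have "(q X a \<otimes>\<^sub>m dual_arrow C (p X a)) \<cdot> Coev C X =
        (q X a \<otimes>\<^sub>m Ide C (P\<^sup>\<star>)) \<cdot> ((Ide C X \<otimes>\<^sub>m dual_arrow C (p X a)) \<cdot> Coev C X)"
      unfolding slide(1)[OF qa dp, symmetric]
      by (rule Comp_assoc[OF Coev_in[OF X] TensorM_in[OF Ide_in[OF X] dp] TensorM_in[OF qa Ide_in[OF Ps]]])
    also have "\<dots> = ((q X a \<otimes>\<^sub>m Ide C (P\<^sup>\<star>)) \<cdot> (p X a \<otimes>\<^sub>m Ide C (P\<^sup>\<star>))) \<cdot> Coev C P"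
      unfolding Coev_dual_arrow[OF pa]
      by (rule Comp_assoc[OF Coev_in[OF PJ(1)] TensorM_in[OF pa Ide_in[OF Ps]] TensorM_in[OF qa Ide_in[OF Ps]], symmetric])
    also have "(q X a \<otimes>\<^sub>m Ide C (P\<^sup>\<star>)) \<cdot> (p X a \<otimes>\<^sub>m Ide C (P\<^sup>\<star>)) = (q X a \<cdot> p X a) \<otimes>\<^sub>m Ide C (P\<^sup>\<star>)"
      using HomD[OF pa] HomD[OF qa] by (intro whisker_right_Comp[symmetric]) simp_all
    finally show "mat_of ((dual_arrow C (p X a) \<otimes>\<^sub>m q X a) \<cdot> (\<sigma> X (X\<^sup>\<star>) \<cdot> Coev C X)) = mat_of (braided_mate (q X a \<cdot> p X a))"
      unfolding braided_mate_def by (rule arg_cong)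
  qed simp
  also have "\<dots> = mat_of (braided_mate k)"
    by (rule linear_map_lc[OF braided_mate_linear qp k, symmetric])
  finally have "j X \<cdot> (\<sigma> X (X\<^sup>\<star>) \<cdot> Coev C X) = braided_mate k"
    using braided_mate_linear k(1) by (intro mat_of_inject[OF Comp_in[OF g j_spec(1)[OF X]]]) (simp_all add: linear_map_def)
  with k show thesis by (rule that)
qed

lemma End_Unit_scalar:
  assumes s: "s \<in> Hom C \<I> \<I>"
  obtains c where "s = Scale C c (Ide C \<I>)"
proof -
  obtain c where c: "mat_of s = c \<cdot>\<^sub>m 1\<^sub>m (rank \<I>)"
    by (rule schur[OF Unit_irreducible rep_carrier[OF Unit_Obj] mat_of_carrier[OF s] mat_of_intertwines[OF s]])
  have "s = Scale C c (Ide C \<I>)"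
    using c mat_of_Scale[OF Ide_in[OF Unit_Obj]] mat_of_Ide[OF Unit_Obj]
    by (intro mat_of_inject[OF s Scale_Hom[OF Ide_in[OF Unit_Obj]]]) simp
  thus thesis by (rule that)
qed

lemma transparent_irreducible:
  assumes X: "transparent X" and irr: "irreducible_rep (carrier A) (rank X) (rep X)"
  shows "annihilated_with \<I> X"
proof -
  have XO: "X \<in> Obj C" using X by (simp add: transparent_def)
  let ?g = "\<sigma> X (X\<^sup>\<star>) \<cdot> Coev C X"
  note g = Comp_in[OF Coev_in[OF XO] Braiding_in[OF XO Dual_Obj[OF XO]]]
  obtain \<kappa> where \<kappa>: "\<kappa> \<in> Hom C F (P\<^sup>\<star> \<otimes>\<^sub>o J)" "\<And>X. X \<in> Obj C \<Longrightarrow> \<kappa> \<cdot> i X = j X" by (rule j_factorization, rule that)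
  obtain k where k: "k \<in> Hom C P J" "mat_of k = mat_lc (rank J) (rank P) (rank X) (\<lambda>_. 1) (\<lambda>a. mat_of (q X a \<cdot> p X a))"
    "j X \<cdot> ?g = braided_mate k" by (rule j_braided_coev[OF XO])
  obtain l where l: "l \<in> Hom C P J" "mat_of l = mat_lc (rank J) (rank P) (rank \<I>) (\<lambda>_. 1) (\<lambda>a. mat_of (q \<I> a \<cdot> p \<I> a))"
    "j \<I> \<cdot> (\<sigma> \<I> (\<I>\<^sup>\<star>) \<cdot> Coev C \<I>) = braided_mate l" by (rule j_braided_coev[OF Unit_Obj])
  have iI: "i \<I> \<in> Hom C (\<I>\<^sup>\<star>) F" by (simp add: Hom_iff)
  have "\<sigma> \<I> (\<I>\<^sup>\<star>) \<cdot> Coev C \<I> = Coev C \<I>"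
    unfolding Braiding_Unit(1)[OF Dual_Obj[OF Unit_Obj]] by (rule Ide_left[OF Coev_Unit_in])
  hence \<kappa>u: "\<kappa> \<cdot> u = braided_mate l"
    using l(3) unfolding u_def Comp_assoc[OF Coev_Unit_in iI \<kappa>(1), symmetric] \<kappa>(2)[OF Unit_Obj] by (simp only:)
  note evg = Comp_in[OF g Ev_in[OF XO]]
  \<comment> \<open>\<open>c\<close> is a braided dimension of \<open>X\<close>. It serves only as a
    factor of proportionality and is never inverted.\<close>
  obtain c where c: "Ev C X \<cdot> ?g = Scale C c (Ide C \<I>)" by (rule End_Unit_scalar[OF evg])
  note ml = linear_map_def[THEN iffD1, OF braided_mate_linear]
  have mlH: "braided_mate l \<in> Hom C \<I> (P\<^sup>\<star> \<otimes>\<^sub>o J)" using ml l(1) by blast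
  \<comment> \<open>The image under \<kappa> of one arrow \<open>\<I> \<rightarrow> F\<close> is
    computed twice: as the mate encoding the character of \<open>X\<close>, and, since that arrow is
    \<open>c\<close> times \<open>u\<close>, as \<open>c\<close> times the mate encoding the
    character of \<open>\<I>\<close>.\<close>
  have "braided_mate k = (\<kappa> \<cdot> i X) \<cdot> ?g" unfolding \<kappa>(2)[OF XO] by (rule k(3)[symmetric])
  also have "\<dots> = \<kappa> \<cdot> (u \<cdot> (Ev C X \<cdot> ?g))"
    unfolding Comp_assoc[OF g i_in[OF XO] \<kappa>(1)] i_state[OF X g] ..
  also have "\<dots> = braided_mate l \<cdot> (Ev C X \<cdot> ?g)"
    unfolding \<kappa>u[symmetric] by (rule Comp_assoc[OF evg u_in \<kappa>(1), symmetric])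
  also have "\<dots> = Scale C c (braided_mate l)"
    unfolding c Comp_Scale_right[OF Ide_in[OF Unit_Obj] mlH] Ide_right[OF mlH] ..
  also have "\<dots> = braided_mate (Scale C c l)" using ml l(1) by simp
  finally have "k = Scale C c l" by (rule braided_mate_inject[OF k(1) Scale_Hom[OF l(1)]])
  hence "mat_of k = c \<cdot>\<^sub>m mat_of l" using mat_of_Scale[OF l(1)] by simp
  hence "mat_lc (rank J) (rank P) (rank X) (\<lambda>_. 1) (\<lambda>a. mat_of (q X a \<cdot> p X a)) =
      c \<cdot>\<^sub>m mat_lc (rank J) (rank P) (rank \<I>) (\<lambda>_. 1) (\<lambda>a. mat_of (q \<I> a \<cdot> p \<I> a))" by (simp only: k(2) l(2))
  from trace_q_p[OF XO Unit_Obj this] show ?thesis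
    by (rule annihilated_with_if_trace[OF Unit_Obj XO irr])
qed

section \<open>From \<open>i X = u \<cdot> Ev C X\<close> to the annihilator of the unit
  object\<close>

lemma Comp_Zero:
  assumes "f \<in> Hom C X Y"
  shows "Z \<in> Obj C \<Longrightarrow> Zero C Y Z \<cdot> f = Zero C X Z" "Z \<in> Obj C \<Longrightarrow> f \<cdot> Zero C Z X = Zero C Z Y"
  using linear_map_Zero[OF linear_map_Comp_right[OF assms]] linear_map_Zero[OF linear_map_Comp_left[OF assms]]
    Hom_Obj[OF assms] by simp_all

lemma Zero_if_mat_zero:
  assumes f: "f \<in> Hom C X Y" and 0: "mat_of f = 0\<^sub>m (rank Y) (rank X)"
  shows "f = Zero C X Y"
  using 0 by (intro mat_of_inject[OF f Zero_Hom[OF Hom_Obj[OF f]]]) (simp add: mat_of_Zero[OF Hom_Obj[OF f]])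

lemma mat_lc_zero: "(\<And>a. a < N \<Longrightarrow> G a = 0\<^sub>m r s) \<Longrightarrow> mat_lc r s N t G = (0\<^sub>m r s :: 'k mat)"
  by (rule eq_matI) simp_all

text \<open>Transposing \<open>y\<^sup>\<star> \<otimes> q\<close> at both ends makes it factor through the unit object.\<close>

lemma transpose_dual_tensor:
  assumes d: "is_left_dual C J' J e c" and X: "X \<in> Obj C" and y: "y \<in> Hom C P X" and f: "f \<in> Hom C X J"
  shows "(Ide C (X \<otimes>\<^sub>o P\<^sup>\<star>) \<otimes>\<^sub>m e) \<cdot>
      (((Ide C X \<otimes>\<^sub>m (dual_arrow C y \<otimes>\<^sub>m f)) \<cdot> (Coev C X \<otimes>\<^sub>m Ide C X)) \<otimes>\<^sub>m Ide C J') =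
    ((y \<otimes>\<^sub>m Ide C (P\<^sup>\<star>)) \<cdot> Coev C P) \<cdot> (e \<cdot> (f \<otimes>\<^sub>m Ide C J'))"
proof -
  note dy = dual_arrow_in[OF y] and Ps = Dual_Obj[OF PJ(1)]
  have e: "e \<in> Hom C (J \<otimes>\<^sub>o J') \<I>" and J': "J' \<in> Obj C" using d by (auto simp: is_left_dual_def)
  define s where "s = (y \<otimes>\<^sub>m Ide C (P\<^sup>\<star>)) \<cdot> Coev C P"
  have s: "s \<in> Hom C \<I> (X \<otimes>\<^sub>o P\<^sup>\<star>)" unfolding s_def
    by (rule Comp_in[OF Coev_in[OF PJ(1)] TensorM_in[OF y Ide_in[OF Ps]]])
  define t where "t = e \<cdot> (f \<otimes>\<^sub>m Ide C J')"
  have qJ: "f \<otimes>\<^sub>m Ide C J' \<in> Hom C (X \<otimes>\<^sub>o J') (J \<otimes>\<^sub>o J')" by (rule TensorM_in[OF f Ide_in[OF J']])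
  have t: "t \<in> Hom C (X \<otimes>\<^sub>o J') \<I>" unfolding t_def by (rule Comp_in[OF qJ e])
  note V = TensorO_Obj[OF X Ps]
  have "(Ide C X \<otimes>\<^sub>m (dual_arrow C y \<otimes>\<^sub>m f)) \<cdot> (Coev C X \<otimes>\<^sub>m Ide C X) =
      ((Ide C X \<otimes>\<^sub>m dual_arrow C y) \<otimes>\<^sub>m f) \<cdot> (Coev C X \<otimes>\<^sub>m Ide C X)"
    using HomD[OF dy] HomD[OF f] X by simp
  also have "\<dots> = ((Ide C X \<otimes>\<^sub>m dual_arrow C y) \<cdot> Coev C X) \<otimes>\<^sub>m (f \<cdot> Ide C X)"
    by (rule TensorM_Comp[OF Coev_in[OF X] TensorM_in[OF Ide_in[OF X] dy] Ide_in[OF X] f, symmetric])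
  also have "\<dots> = s \<otimes>\<^sub>m f" unfolding Coev_dual_arrow[OF y] Ide_right[OF f] s_def ..
  finally have 1: "(Ide C X \<otimes>\<^sub>m (dual_arrow C y \<otimes>\<^sub>m f)) \<cdot> (Coev C X \<otimes>\<^sub>m Ide C X) = s \<otimes>\<^sub>m f" .
  have "(Ide C (X \<otimes>\<^sub>o P\<^sup>\<star>) \<otimes>\<^sub>m e) \<cdot> ((s \<otimes>\<^sub>m f) \<otimes>\<^sub>m Ide C J') =
      (Ide C (X \<otimes>\<^sub>o P\<^sup>\<star>) \<otimes>\<^sub>m e) \<cdot> (s \<otimes>\<^sub>m (f \<otimes>\<^sub>m Ide C J'))"
    using HomD[OF s] HomD[OF f] J' by simp
  also have "\<dots> = (Ide C (X \<otimes>\<^sub>o P\<^sup>\<star>) \<cdot> s) \<otimes>\<^sub>m t"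
    unfolding t_def by (rule TensorM_Comp[OF s Ide_in[OF V] qJ e, symmetric])
  also have "\<dots> = s \<otimes>\<^sub>m t" unfolding Ide_left[OF s] ..
  also have "\<dots> = s \<cdot> t" using slide_state(1)[OF s t] HomD[OF s] by simp
  finally show ?thesis unfolding 1 s_def t_def .
qed

text \<open>By hypothesis \<open>j X\<close> factors through \<open>j \<I>\<close>, which
  \<open>\<beta> x\<close> kills when \<open>x\<close> kills \<open>\<I>\<close>. So the sum of the
  terms \<open>dual_arrow C (p X a) \<otimes>\<^sub>m q X w\<close>, weighted by the entries of
  \<open>rep X x\<close>, vanishes. Independence of \<open>p\<close> and of \<open>q\<close> does
  not directly exclude such a relation between tensor products of arrows; it is first transposed
  into a relation between composites through \<open>\<I>\<close>, where the tensor product can be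
  taken apart.\<close>

lemma annihilated_if_i_trivial:
  assumes X: "X \<in> Obj C" and iX: "i X = u \<cdot> Ev C X"
  shows "annihilated_with \<I> X"
  unfolding annihilated_with_def
proof (intro ballI impI)
  fix x assume x: "x \<in> carrier A" and 0: "rep \<I> x = 0\<^sub>m (rank \<I>) (rank \<I>)"
  note Ps = Dual_Obj[OF PJ(1)]
  \<comment> \<open>Lets \<open>x\<close> act on the factor \<open>J\<close> alone, that is, on the
    index of \<open>q\<close>.\<close>
  define B where "B = Ide C (P\<^sup>\<star>) \<otimes>\<^sub>m \<beta> x"
  have B: "B \<in> Hom C (P\<^sup>\<star> \<otimes>\<^sub>o J) (P\<^sup>\<star> \<otimes>\<^sub>o J)" unfolding B_def by (rule TensorM_in[OF Ide_in[OF Ps] \<beta>_in[OF x]])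
  let ?r = "rank (P\<^sup>\<star> \<otimes>\<^sub>o J)" and ?c = "rank (X\<^sup>\<star> \<otimes>\<^sub>o X)"
  have Bpq: "B \<cdot> (dual_arrow C (p Y a) \<otimes>\<^sub>m q Y a) = dual_arrow C (p Y a) \<otimes>\<^sub>m (\<beta> x \<cdot> q Y a)"
    if Y: "Y \<in> Obj C" and a: "a < rank Y" for Y a
    unfolding B_def TensorM_Comp[OF dual_p_in[OF Y a] Ide_in[OF Ps] q_in[OF Y a] \<beta>_in[OF x], symmetric]
      Ide_left[OF dual_p_in[OF Y a]] ..
  have mB: "mat_of (B \<cdot> j Y) = mat_lc ?r (rank (Y\<^sup>\<star> \<otimes>\<^sub>o Y)) (rank Y) (\<lambda>_. 1)
      (\<lambda>a. mat_of (dual_arrow C (p Y a) \<otimes>\<^sub>m (\<beta> x \<cdot> q Y a)))" if Y: "Y \<in> Obj C" for Y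
    unfolding j_linear_map[OF Y linear_map_Comp_left[OF B]] using Bpq[OF Y] by (intro mat_lc_cong) simp_all
  have BjI: "B \<cdot> j \<I> = Zero C (\<I>\<^sup>\<star> \<otimes>\<^sub>o \<I>) (P\<^sup>\<star> \<otimes>\<^sub>o J)"
  proof (rule Zero_if_mat_zero[OF Comp_in[OF j_spec(1)[OF Unit_Obj] B]])
    have "mat_of (dual_arrow C (p \<I> a) \<otimes>\<^sub>m (\<beta> x \<cdot> q \<I> a)) = 0\<^sub>m ?r (rank (\<I>\<^sup>\<star> \<otimes>\<^sub>o \<I>))" if a: "a < rank \<I>" for a
    proof -
      note qa = q_in[OF Unit_Obj a] and pa = dual_p_in[OF Unit_Obj a]
      have "mat_of (\<beta> x \<cdot> q \<I> a) = 0\<^sub>m (rank J) (rank \<I>)"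
        unfolding \<beta>_q[OF x Unit_Obj a] 0 using a by (intro eq_matI) simp_all
      hence "\<beta> x \<cdot> q \<I> a = Zero C \<I> J" by (rule Zero_if_mat_zero[OF Comp_in[OF qa \<beta>_in[OF x]]])
      hence "dual_arrow C (p \<I> a) \<otimes>\<^sub>m (\<beta> x \<cdot> q \<I> a) = Zero C (\<I>\<^sup>\<star> \<otimes>\<^sub>o \<I>) (P\<^sup>\<star> \<otimes>\<^sub>o J)"
        using linear_map_Zero[OF linear_map_tensor_right[OF pa] Unit_Obj PJ(2)] by (simp only:)
      thus ?thesis by (simp only: mat_of_Zero[OF Hom_Obj[OF j_spec(1)[OF Unit_Obj]]])
    qed
    thus "mat_of (B \<cdot> j \<I>) = 0\<^sub>m ?r (rank (\<I>\<^sup>\<star> \<otimes>\<^sub>o \<I>))"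
      unfolding mB[OF Unit_Obj] by (rule mat_lc_zero)
  qed
  obtain \<kappa> where \<kappa>: "\<kappa> \<in> Hom C F (P\<^sup>\<star> \<otimes>\<^sub>o J)" "\<And>X. X \<in> Obj C \<Longrightarrow> \<kappa> \<cdot> i X = j X" by (rule j_factorization, rule that)
  have oI: "\<I>\<^sup>\<star> \<otimes>\<^sub>o \<I> = \<I>\<^sup>\<star>" by simp
  have iI: "i \<I> \<in> Hom C (\<I>\<^sup>\<star>) F" by (simp add: Hom_iff)
  have jI: "j \<I> \<in> Hom C (\<I>\<^sup>\<star>) (P\<^sup>\<star> \<otimes>\<^sub>o J)" using j_spec(1)[OF Unit_Obj] by (simp only: oI)
  have \<kappa>u: "\<kappa> \<cdot> u = j \<I> \<cdot> Coev C \<I>"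
    unfolding u_def Comp_assoc[OF Coev_Unit_in iI \<kappa>(1), symmetric] \<kappa>(2)[OF Unit_Obj] ..
  have "j X = (j \<I> \<cdot> Coev C \<I>) \<cdot> Ev C X"
    unfolding \<kappa>(2)[OF X, symmetric] iX \<kappa>u[symmetric] by (rule Comp_assoc[OF Ev_in[OF X] u_in \<kappa>(1), symmetric])
  hence "B \<cdot> j X = (B \<cdot> (j \<I> \<cdot> Coev C \<I>)) \<cdot> Ev C X"
    by (simp only: Comp_assoc[OF Ev_in[OF X] Comp_in[OF Coev_Unit_in jI] B])
  also have "B \<cdot> (j \<I> \<cdot> Coev C \<I>) = (B \<cdot> j \<I>) \<cdot> Coev C \<I>" by (rule Comp_assoc[OF Coev_Unit_in jI B, symmetric])
  also have "\<dots> = Zero C \<I> (P\<^sup>\<star> \<otimes>\<^sub>o J)"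
    unfolding BjI oI by (rule Comp_Zero(1)[OF Coev_Unit_in Hom_Obj(1)[OF B]])
  also have "Zero C \<I> (P\<^sup>\<star> \<otimes>\<^sub>o J) \<cdot> Ev C X = Zero C (X\<^sup>\<star> \<otimes>\<^sub>o X) (P\<^sup>\<star> \<otimes>\<^sub>o J)"
    by (rule Comp_Zero(1)[OF Ev_in[OF X] Hom_Obj(1)[OF B]])
  finally have BjX: "B \<cdot> j X = Zero C (X\<^sup>\<star> \<otimes>\<^sub>o X) (P\<^sup>\<star> \<otimes>\<^sub>o J)" .
  \<comment> \<open>The matrix of \<open>x\<close> is moved from \<open>q\<close> to
    \<open>p\<close>, leaving a single sum over \<open>w\<close> in which \<open>q X w\<close>
    stands alone.\<close>
  have "\<exists>h \<in> Hom C P X. mat_of h = mat_lc (rank X) (rank P) (rank X) (\<lambda>a. rep X x $$ (a,w)) (\<lambda>a. mat_of (p X a))" for w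
    by (rule ex_lc[OF PJ(1) X p_in[OF X]])
  then obtain y where y: "\<And>w. y w \<in> Hom C P X"
    "\<And>w. mat_of (y w) = mat_lc (rank X) (rank P) (rank X) (\<lambda>a. rep X x $$ (a,w)) (\<lambda>a. mat_of (p X a))"
    by metis
  let ?M = "\<lambda>a w. mat_of (dual_arrow C (p X a) \<otimes>\<^sub>m q X w)"
  have "mat_of (Zero C (X\<^sup>\<star> \<otimes>\<^sub>o X) (P\<^sup>\<star> \<otimes>\<^sub>o J)) = mat_lc ?r ?c (rank X) (\<lambda>_. 1)
      (\<lambda>a. mat_lc ?r ?c (rank X) (\<lambda>w. rep X x $$ (a,w)) (?M a))"
    unfolding BjX[symmetric] mB[OF X]
    by (rule mat_lc_cong[OF refl])
      (rule linear_map_lc[OF linear_map_tensor_right[OF dual_p_in[OF X]] q_in[OF X] Comp_in[OF q_in[OF X] \<beta>_in[OF x]] \<beta>_q[OF x X]])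
  also have "\<dots> = mat_lc ?r ?c (rank X) (\<lambda>_. 1) (\<lambda>w. mat_lc ?r ?c (rank X) (\<lambda>a. rep X x $$ (a,w)) (\<lambda>a. ?M a w))"
    by (rule mat_lc_swap)
  also have "\<dots> = mat_lc ?r ?c (rank X) (\<lambda>_. 1) (\<lambda>w. mat_of (dual_arrow C (y w) \<otimes>\<^sub>m q X w))"
    by (rule mat_lc_cong[OF refl], rule linear_map_lc[symmetric, OF linear_map_compose[OF linear_map_dual_arrow[OF PJ(1) X]
          linear_map_tensor_left[OF q_in[OF X]]] p_in[OF X] y(1) y(2)])
  finally have Z: "mat_of (Zero C (X\<^sup>\<star> \<otimes>\<^sub>o X) (P\<^sup>\<star> \<otimes>\<^sub>o J)) =
      mat_lc ?r ?c (rank X) (\<lambda>_. 1) (\<lambda>w. mat_of (dual_arrow C (y w) \<otimes>\<^sub>m q X w))" .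
  obtain J' e c where d: "is_left_dual C J' J e c" using right_dual[OF PJ(2)] by blast
  have e: "e \<in> Hom C (J \<otimes>\<^sub>o J') \<I>" and J': "J' \<in> Obj C" using d by (auto simp: is_left_dual_def)
  let ?V = "X \<otimes>\<^sub>o P\<^sup>\<star>" and ?Q = "X \<otimes>\<^sub>o J'"
  have V: "?V \<in> Obj C" and Q: "?Q \<in> Obj C" using X J' by simp_all
  define N where "N h = (Ide C ?V \<otimes>\<^sub>m e) \<cdot> (((Ide C X \<otimes>\<^sub>m h) \<cdot> (Coev C X \<otimes>\<^sub>m Ide C X)) \<otimes>\<^sub>m Ide C J')" for h
  have cX: "Coev C X \<otimes>\<^sub>m Ide C X \<in> Hom C X (X \<otimes>\<^sub>o (X\<^sup>\<star> \<otimes>\<^sub>o X))" using X by (simp add: Hom_iff)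
  have Ve: "Ide C ?V \<otimes>\<^sub>m e \<in> Hom C ((X \<otimes>\<^sub>o (P\<^sup>\<star> \<otimes>\<^sub>o J)) \<otimes>\<^sub>o J') ?V" using X J' HomD[OF e] by (simp add: Hom_iff)
  have N: "linear_map N (X\<^sup>\<star> \<otimes>\<^sub>o X) (P\<^sup>\<star> \<otimes>\<^sub>o J) ?Q ?V"
    unfolding N_def by (rule linear_map_compose[OF linear_map_compose[OF linear_map_compose[OF
          linear_map_tensor_right[OF Ide_in[OF X]] linear_map_Comp_right[OF cX]] linear_map_tensor_left[OF Ide_in[OF J']]]
          linear_map_Comp_left[OF Ve]])
  define z where "z w = (y w \<otimes>\<^sub>m Ide C (P\<^sup>\<star>)) \<cdot> Coev C P" for w
  define t where "t w = e \<cdot> (q X w \<otimes>\<^sub>m Ide C J')" for w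
  have z: "z w \<in> Hom C \<I> ?V" for w
    unfolding z_def by (rule Comp_in[OF Coev_in[OF PJ(1)] TensorM_in[OF y(1) Ide_in[OF Ps]]])
  have te: "linear_map (\<lambda>h. e \<cdot> (h \<otimes>\<^sub>m Ide C J')) X J ?Q \<I>"
    by (rule linear_map_compose[OF linear_map_tensor_left[OF Ide_in[OF J']] linear_map_Comp_left[OF e]])
  have t: "t w \<in> Hom C ?Q \<I>" if "w < rank X" for w
    unfolding t_def by (rule Comp_in[OF TensorM_in[OF q_in[OF X that] Ide_in[OF J']] e])
  have "mat_of (N (Zero C (X\<^sup>\<star> \<otimes>\<^sub>o X) (P\<^sup>\<star> \<otimes>\<^sub>o J))) =
      mat_lc (rank ?V) (rank ?Q) (rank X) (\<lambda>_. 1) (\<lambda>w. mat_of (N (dual_arrow C (y w) \<otimes>\<^sub>m q X w)))"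
    by (rule linear_map_lc[OF N TensorM_in[OF dual_arrow_in[OF y(1)] q_in[OF X]] Zero_Hom[OF Hom_Obj[OF j_spec(1)[OF X]]] Z])
  also have "\<dots> = mat_lc (rank ?V) (rank ?Q) (rank X) (\<lambda>_. 1) (\<lambda>w. mat_of (z w \<cdot> t w))"
    unfolding N_def z_def t_def using transpose_dual_tensor[OF d X y(1) q_in[OF X]] by (intro mat_lc_cong) simp_all
  finally have "mat_lc (rank ?V) (rank ?Q) (rank X) (\<lambda>_. 1) (\<lambda>w. mat_of (z w \<cdot> t w)) = 0\<^sub>m (rank ?V) (rank ?Q)"
    unfolding linear_map_Zero[OF N Hom_Obj[OF j_spec(1)[OF X]]] mat_of_Zero[OF Q V] by (rule sym)
  \<comment> \<open>From here on the two factors are separated entrywise: first the independence of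
    \<open>q\<close>, then that of \<open>p\<close> is exploited.\<close>
  note tz = tensor_zero_through_irreducible[OF Unit_Obj Unit_irreducible z t V Q this]
  have zt: "(\<Sum>w<rank X. mat_of (z w) $$ (r,s) * mat_of (t w) $$ (v,v')) = 0"
    if "r < rank ?V" "s < rank \<I>" "v < rank \<I>" "v' < rank ?Q" for r s v v'
    by (rule tz[OF _ that])
  \<comment> \<open>A fixed entry of the \<open>z w\<close> serves as a coefficient family. It gives
    a relation between the \<open>t w\<close>, hence by \<open>effect_inject\<close> one between the
    \<open>q X w\<close>.\<close>
  have zent: "mat_of (z w) $$ (r,s) = 0" if r: "r < rank ?V" and s: "s < rank \<I>" and w: "w < rank X" for r s w
  proof -
    let ?t = "\<lambda>w. mat_of (z w) $$ (r,s)"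
    obtain h where h: "h \<in> Hom C X J" "mat_of h = mat_lc (rank J) (rank X) (rank X) ?t (\<lambda>w. mat_of (q X w))"
      using ex_lc[OF X PJ(2), of "rank X" "q X" ?t] q_in[OF X] by blast
    note eh = linear_map_def[THEN iffD1, OF te, THEN conjunct1, rule_format, OF h(1)]
    have "mat_of (e \<cdot> (h \<otimes>\<^sub>m Ide C J')) = mat_lc (rank \<I>) (rank ?Q) (rank X) ?t (\<lambda>w. mat_of (t w))"
      unfolding t_def by (rule linear_map_lc[OF te q_in[OF X] h])
    also have "\<dots> = 0\<^sub>m (rank \<I>) (rank ?Q)"
      by (rule eq_matI) (use zt[OF r s] in simp_all)
    finally have "e \<cdot> (h \<otimes>\<^sub>m Ide C J') = Zero C ?Q \<I>" by (rule Zero_if_mat_zero[OF eh])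
    also have "\<dots> = e \<cdot> (Zero C X J \<otimes>\<^sub>m Ide C J')" by (rule linear_map_Zero[OF te X PJ(2), symmetric])
    finally have "h = Zero C X J" by (rule effect_inject[OF d h(1) Zero_Hom[OF X PJ(2)]])
    hence "mat_lc (rank J) (rank X) (rank X) ?t (\<lambda>w. mat_of (q X w)) = 0\<^sub>m (rank J) (rank X)"
      using h(2) mat_of_Zero[OF X PJ(2)] by (simp only:)
    from q_independent[OF X this w] show ?thesis .
  qed
  have "rep X x $$ (a,w) = 0" if a: "a < rank X" and w: "w < rank X" for a w
  proof -
    note sm = linear_map_compose[OF linear_map_tensor_left[OF Ide_in[OF Ps]] linear_map_Comp_right[OF Coev_in[OF PJ(1)]], of X]
    have "mat_of (z w) = 0\<^sub>m (rank ?V) (rank \<I>)"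
      using zent w mat_of_carrier[OF z[of w]] by (intro eq_matI) auto
    hence "z w = Zero C \<I> ?V" by (rule Zero_if_mat_zero[OF z])
    also have "\<dots> = (Zero C P X \<otimes>\<^sub>m Ide C (P\<^sup>\<star>)) \<cdot> Coev C P" by (rule linear_map_Zero[OF sm PJ(1) X, symmetric])
    finally have "y w = Zero C P X" unfolding z_def by (rule mate_inject[OF y(1) Zero_Hom[OF PJ(1) X]])
    hence "mat_lc (rank X) (rank P) (rank X) (\<lambda>a. rep X x $$ (a,w)) (\<lambda>a. mat_of (p X a)) = 0\<^sub>m (rank X) (rank P)"
      using y(2)[of w] mat_of_Zero[OF PJ(1) X] by (simp only:)
    from p_independent[OF X this a] show ?thesis .
  qed
  thus "rep X x = 0\<^sub>m (rank X) (rank X)" using rep_carrier[OF X x] by (intro eq_matI) auto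
qed

section \<open>Arrows from the unit object into transparent objects\<close>

lemma states_jointly_epi:
  assumes X: "X \<in> Obj C" "annihilated_with \<I> X" and x: "x \<in> Hom C X B" and y: "y \<in> Hom C X B"
    and e: "\<And>w. w \<in> Hom C \<I> X \<Longrightarrow> x \<cdot> w = y \<cdot> w"
  shows "x = y"
proof -
  obtain m where m: "\<And>i j. m i j \<in> carrier A"
    "\<And>i j. rep \<I> (m i j) = mat (rank \<I>) (rank \<I>) (\<lambda>(u,v). if u = i \<and> v = j then 1 else 0)"
    by (rule matrix_units[OF Unit_Obj Unit_irreducible], rule that)
  show ?thesis by (rule maps_from_unit_jointly_epi[OF Unit_Obj Unit_irreducible X m x y e])
qed

text \<open>An irreducible subobject inherits transparency, so arrows from \<open>\<I>\<close>
  separate the arrows out of it. If all of them were zero, its identity would be zero.\<close>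

lemma transparent_state:
  assumes X: "transparent X" and r: "rank X > 0"
  obtains w where "w \<in> Hom C \<I> X" "w \<noteq> Zero C \<I> X"
proof -
  have XO: "X \<in> Obj C" using X by (simp add: transparent_def)
  obtain Z m where m: "m \<in> Hom C Z X" "is_mono C m" and Z: "irreducible_rep (carrier A) (rank Z) (rep Z)"
    by (rule irreducible_subobject[OF XO r])
  note ZO = Hom_Obj(1)[OF m(1)]
  have ann: "annihilated_with \<I> Z" by (rule transparent_irreducible[OF transparent_subobject[OF X m] Z])
  have "\<exists>w \<in> Hom C \<I> Z. w \<noteq> Zero C \<I> Z"
  proof (rule ccontr)
    assume n: "\<not> (\<exists>w \<in> Hom C \<I> Z. w \<noteq> Zero C \<I> Z)"
    have "Ide C Z = Zero C Z Z"
    proof (rule states_jointly_epi[OF ZO ann Ide_in[OF ZO] Zero_Hom[OF ZO ZO]])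
      fix w assume w: "w \<in> Hom C \<I> Z"
      hence "w = Zero C \<I> Z" using n by blast
      thus "Ide C Z \<cdot> w = Zero C Z Z \<cdot> w" using Ide_left[OF w] Comp_Zero(1)[OF w ZO] by (simp only:)
    qed
    hence "1\<^sub>m (rank Z) = (0\<^sub>m (rank Z) (rank Z) :: 'k mat)" using mat_of_Ide[OF ZO] mat_of_Zero[OF ZO ZO] by simp
    hence "(1\<^sub>m (rank Z) :: 'k mat) $$ (0,0) = 0\<^sub>m (rank Z) (rank Z) $$ (0,0)" by simp
    thus False using Z by (simp add: irreducible_rep_def)
  qed
  then obtain w where w: "w \<in> Hom C \<I> Z" "w \<noteq> Zero C \<I> Z" by blast
  have "m \<cdot> w \<noteq> Zero C \<I> X"
  proof
    assume "m \<cdot> w = Zero C \<I> X"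
    also have "\<dots> = m \<cdot> Zero C \<I> Z" by (rule Comp_Zero(2)[OF m(1) Unit_Obj, symmetric])
    finally have "w = Zero C \<I> Z" by (rule monoD[OF m(2,1) w(1) Zero_Hom[OF Unit_Obj ZO]])
    with w(2) show False by simp
  qed
  with Comp_in[OF w(1) m(1)] show thesis by (rule that)
qed

section \<open>Ingredients of the induction on the rank, and the conclusion\<close>

lemma Hom_rank_zero:
  assumes X: "X \<in> Obj C" "rank X = 0" and V: "V \<in> Obj C" and f: "f \<in> Hom C (V \<otimes>\<^sub>o X) B"
  shows "f = Zero C (V \<otimes>\<^sub>o X) B"
proof -
  note VX = TensorO_Obj[OF V X(1)]
  have "Ide C X = Zero C X X"
    using mat_of_carrier[OF Ide_in[OF X(1)]] X(2) by (intro Zero_if_mat_zero[OF Ide_in[OF X(1)]] eq_matI) auto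
  hence "Ide C (V \<otimes>\<^sub>o X) = Ide C V \<otimes>\<^sub>m Zero C X X" using TensorM_Ide[OF V X(1)] by simp
  also have "\<dots> = Zero C (V \<otimes>\<^sub>o X) (V \<otimes>\<^sub>o X)" by (rule linear_map_Zero[OF linear_map_tensor_right[OF Ide_in[OF V]] X(1) X(1)])
  finally have "f = f \<cdot> Zero C (V \<otimes>\<^sub>o X) (V \<otimes>\<^sub>o X)" using Ide_right[OF f] by simp
  thus ?thesis using Comp_Zero(2)[OF f VX] by simp
qed

text \<open>The composite with the evaluation is the dual of the monomorphism \<open>s\<close>,
  hence epic: transposition turns precomposition with it into postcomposition with
  \<open>s \<otimes>\<^sub>m Ide C B\<close>, which is monic.\<close>

lemma Ev_whisker_epi:
  assumes s: "s \<in> Hom C \<I> X" "is_mono C s" and x: "x \<in> Hom C \<I> B" and y: "y \<in> Hom C \<I> B"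
    and e: "x \<cdot> (Ev C X \<cdot> (Ide C (X\<^sup>\<star>) \<otimes>\<^sub>m s)) = y \<cdot> (Ev C X \<cdot> (Ide C (X\<^sup>\<star>) \<otimes>\<^sub>m s))"
  shows "x = y"
proof -
  note X = Hom_Obj(2)[OF s(1)] and BO = Hom_Obj(2)[OF x]
  interpret X: dual_pair C X "X\<^sup>\<star>" "Ev C X" "Coev C X" by (rule dual_pair_left_dual[OF X])
  have Es: "Ev C X \<cdot> (Ide C (X\<^sup>\<star>) \<otimes>\<^sub>m s) \<in> Hom C (X\<^sup>\<star> \<otimes>\<^sub>o \<I>) \<I>"
    by (rule Comp_in[OF TensorM_in[OF Ide_in[OF Dual_Obj[OF X]] s(1)] Ev_in[OF X]])
  have "X.transp (Ev C X) X = Ide C X" unfolding X.transp_def by (rule X.zigzag')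
  hence Es': "X.transp (Ev C X \<cdot> (Ide C (X\<^sup>\<star>) \<otimes>\<^sub>m s)) \<I> = s"
    using X.transp_Comp_right[OF X.e_in s(1)] Ide_left[OF s(1)] by (simp only:)
  have *: "X.transp (z \<cdot> (Ev C X \<cdot> (Ide C (X\<^sup>\<star>) \<otimes>\<^sub>m s))) \<I> = (s \<otimes>\<^sub>m Ide C B) \<cdot> z" if z: "z \<in> Hom C \<I> B" for z
  proof -
    have "X.transp (z \<cdot> (Ev C X \<cdot> (Ide C (X\<^sup>\<star>) \<otimes>\<^sub>m s))) \<I> = (Ide C X \<otimes>\<^sub>m z) \<cdot> s"
      unfolding X.transp_Comp_left[OF Unit_Obj Es z] Es' ..
    also have "\<dots> = (s \<otimes>\<^sub>m Ide C B) \<cdot> z"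
      using slide_state(1)[OF s(1) z] slide_state(2)[OF z s(1)] by (simp only:)
    finally show ?thesis .
  qed
  have sB: "s \<otimes>\<^sub>m Ide C B \<in> Hom C B (X \<otimes>\<^sub>o B)" using TensorM_in[OF s(1) Ide_in[OF BO]] BO by simp
  have "(s \<otimes>\<^sub>m Ide C B) \<cdot> x = (s \<otimes>\<^sub>m Ide C B) \<cdot> y"
    unfolding *[OF x, symmetric] *[OF y, symmetric] e ..
  thus ?thesis by (rule monoD[OF mono_whisker[OF BO s(2)] sB x y])
qed

text \<open>For an exact sequence \<open>\<I> \<rightarrow> X \<rightarrow> W\<close>, an arrow on \<open>X\<^sup>\<star> \<otimes> X\<close> that vanishes on \<open>X\<^sup>\<star> \<otimes> \<I>\<close> and on
  \<open>W\<^sup>\<star> \<otimes> X\<close> factors through the quotient \<open>\<I>\<^sup>\<star> \<otimes> W = W\<close>.\<close>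

lemma factor_through_quotient:
  assumes s: "s \<in> Hom C \<I> X" and \<pi>: "\<pi> \<in> Hom C X W"
    and coker: "\<And>B h. h \<in> Hom C X B \<Longrightarrow> h \<cdot> s = Zero C \<I> B \<Longrightarrow> \<exists>h' \<in> Hom C W B. h = h' \<cdot> \<pi>"
    and ker: "\<And>V f. f \<in> Hom C V X \<Longrightarrow> \<pi> \<cdot> f = Zero C V W \<Longrightarrow> \<exists>f' \<in> Hom C V \<I>. f = s \<cdot> f'"
    and \<pi>j: "jointly_epi W {\<pi>}" and Z: "Z \<in> Obj C" and d: "d \<in> Hom C (X\<^sup>\<star> \<otimes>\<^sub>o X) Z"
    and d1: "d \<cdot> (Ide C (X\<^sup>\<star>) \<otimes>\<^sub>m s) = Zero C (X\<^sup>\<star> \<otimes>\<^sub>o \<I>) Z"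
    and d2: "d \<cdot> (dual_arrow C \<pi> \<otimes>\<^sub>m Ide C X) = Zero C (W\<^sup>\<star> \<otimes>\<^sub>o X) Z"
  obtains f where "f \<in> Hom C W Z"
    "d = (f \<cdot> ((Ev C X \<cdot> (Ide C (X\<^sup>\<star>) \<otimes>\<^sub>m s)) \<otimes>\<^sub>m Ide C W)) \<cdot> (Ide C (X\<^sup>\<star>) \<otimes>\<^sub>m \<pi>)"
proof -
  note XO = Hom_Obj(1)[OF \<pi>] and WO = Hom_Obj(2)[OF \<pi>] and [simp] = Z
  note Xs = Dual_Obj[OF XO]
  define Es where "Es = Ev C X \<cdot> (Ide C (X\<^sup>\<star>) \<otimes>\<^sub>m s)"
  have Xs_s: "Ide C (X\<^sup>\<star>) \<otimes>\<^sub>m s \<in> Hom C (X\<^sup>\<star> \<otimes>\<^sub>o \<I>) (X\<^sup>\<star> \<otimes>\<^sub>o X)" by (rule TensorM_in[OF Ide_in[OF Xs] s])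
  note dp = dual_arrow_in[OF \<pi>]
  interpret X: dual_pair C X "X\<^sup>\<star>" "Ev C X" "Coev C X" by (rule dual_pair_left_dual[OF XO])
  have lin_transp: "linear_map (\<lambda>h. X.transp h V) (X\<^sup>\<star> \<otimes>\<^sub>o V) B V (X \<otimes>\<^sub>o B)" if V: "V \<in> Obj C" for V B
  proof -
    have cV: "Coev C X \<otimes>\<^sub>m Ide C V \<in> Hom C V (X \<otimes>\<^sub>o X\<^sup>\<star> \<otimes>\<^sub>o V)" using XO V by (simp add: Hom_iff)
    show ?thesis unfolding X.transp_def
      by (rule linear_map_compose[OF linear_map_tensor_right[OF Ide_in[OF XO]] linear_map_Comp_right[OF cV]])
  qed
  \<comment> \<open>First factorization: transposed to an arrow out of \<open>X\<close>, the
    vanishing of \<open>d\<close> on the image of \<open>s\<close> lets it pass to the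
    cokernel.\<close>
  have "X.transp d X \<cdot> s = Zero C \<I> (X \<otimes>\<^sub>o Z)"
    unfolding X.transp_Comp_right[OF d s, symmetric] d1
    by (rule linear_map_Zero[OF lin_transp[OF Unit_Obj] TensorO_Obj[OF Xs Unit_Obj] Z])
  from coker[OF X.transp_in[OF XO d] this] obtain h0 where h0: "h0 \<in> Hom C W (X \<otimes>\<^sub>o Z)" "X.transp d X = h0 \<cdot> \<pi>"
    by blast
  define h where "h = X.untransp h0 Z"
  have h: "h \<in> Hom C (X\<^sup>\<star> \<otimes>\<^sub>o W) Z" unfolding h_def by (rule X.untransp_in[OF Z h0(1)])
  have Xs_\<pi>: "Ide C (X\<^sup>\<star>) \<otimes>\<^sub>m \<pi> \<in> Hom C (X\<^sup>\<star> \<otimes>\<^sub>o X) (X\<^sup>\<star> \<otimes>\<^sub>o W)" by (rule TensorM_in[OF Ide_in[OF Xs] \<pi>])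
  have dh: "d = h \<cdot> (Ide C (X\<^sup>\<star>) \<otimes>\<^sub>m \<pi>)"
    unfolding h_def X.untransp_Comp_right[OF Z h0(1) \<pi>, symmetric] h0(2)[symmetric]
    by (rule X.untransp_transp[OF XO d, symmetric])
  have dpX: "dual_arrow C \<pi> \<otimes>\<^sub>m Ide C X \<in> Hom C (W\<^sup>\<star> \<otimes>\<^sub>o X) (X\<^sup>\<star> \<otimes>\<^sub>o X)" by (rule TensorM_in[OF dp Ide_in[OF XO]])
  have dpW: "dual_arrow C \<pi> \<otimes>\<^sub>m Ide C W \<in> Hom C (W\<^sup>\<star> \<otimes>\<^sub>o W) (X\<^sup>\<star> \<otimes>\<^sub>o W)" by (rule TensorM_in[OF dp Ide_in[OF WO]])
  have Ws_\<pi>: "Ide C (W\<^sup>\<star>) \<otimes>\<^sub>m \<pi> \<in> Hom C (W\<^sup>\<star> \<otimes>\<^sub>o X) (W\<^sup>\<star> \<otimes>\<^sub>o W)" by (rule TensorM_in[OF Ide_in[OF Dual_Obj[OF WO]] \<pi>])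
  \<comment> \<open>\<open>W\<^sup>\<star> \<otimes>\<^sub>o \<pi>\<close> is epic, and after
    composing with it the claim is the second vanishing hypothesis on \<open>d\<close>.\<close>
  have hd: "h \<cdot> (dual_arrow C \<pi> \<otimes>\<^sub>m Ide C W) = Zero C (W\<^sup>\<star> \<otimes>\<^sub>o W) Z"
  proof -
    have "(h \<cdot> (dual_arrow C \<pi> \<otimes>\<^sub>m Ide C W)) \<cdot> (Ide C (W\<^sup>\<star>) \<otimes>\<^sub>m \<pi>) = h \<cdot> (dual_arrow C \<pi> \<otimes>\<^sub>m \<pi>)"
      unfolding slide(1)[OF dp \<pi>, symmetric] by (rule Comp_assoc[OF Ws_\<pi> dpW h])
    also have "\<dots> = d \<cdot> (dual_arrow C \<pi> \<otimes>\<^sub>m Ide C X)"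
      unfolding slide(2)[OF dp \<pi>, symmetric] dh by (rule Comp_assoc[OF dpX Xs_\<pi> h, symmetric])
    also have "\<dots> = Zero C (W\<^sup>\<star> \<otimes>\<^sub>o W) Z \<cdot> (Ide C (W\<^sup>\<star>) \<otimes>\<^sub>m \<pi>)"
      unfolding d2 by (rule Comp_Zero(1)[OF Ws_\<pi> Z, symmetric])
    finally have e: "(h \<cdot> (dual_arrow C \<pi> \<otimes>\<^sub>m Ide C W)) \<cdot> (Ide C (W\<^sup>\<star>) \<otimes>\<^sub>m \<pi>) =
        Zero C (W\<^sup>\<star> \<otimes>\<^sub>o W) Z \<cdot> (Ide C (W\<^sup>\<star>) \<otimes>\<^sub>m \<pi>)" .
    have WW: "W\<^sup>\<star> \<otimes>\<^sub>o W \<in> Obj C" using WO by simp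
    have j: "jointly_epi (W\<^sup>\<star> \<otimes>\<^sub>o W) {Ide C (W\<^sup>\<star>) \<otimes>\<^sub>m \<pi>}"
      using jointly_epi_whisker(1)[OF Dual_Obj[OF WO] WO \<pi>j] HomD[OF \<pi>] by simp
    show ?thesis
      by (rule jointly_epiD[OF j Comp_in[OF dpW h] Zero_Hom[OF WW Z]]) (simp only: singleton_iff e)
  qed
  obtain Z' eZ cZ where Z': "is_left_dual C Z' Z eZ cZ" using right_dual[OF Z] by blast
  have \<pi>Z: "\<pi> \<otimes>\<^sub>m Ide C Z \<in> Hom C (X \<otimes>\<^sub>o Z) (W \<otimes>\<^sub>o Z)" by (rule TensorM_in[OF \<pi> Ide_in[OF Z]])
  have "X.transp h W = h0" unfolding h_def by (rule X.transp_untransp[OF Z h0(1)])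
  hence h0': "h0 = (Ide C X \<otimes>\<^sub>m h) \<cdot> (Coev C X \<otimes>\<^sub>m Ide C W)" unfolding X.transp_def by (rule sym)
  \<comment> \<open>Sliding \<pi> through the coevaluation of \<open>X\<close> replaces it by its
    dual arrow next to the coevaluation of \<open>W\<close>, which \<open>h\<close>
    annihilates.\<close>
  have "(\<pi> \<otimes>\<^sub>m Ide C Z) \<cdot> h0 = Zero C W (W \<otimes>\<^sub>o Z)"
  proof -
    have cXW: "Coev C X \<otimes>\<^sub>m Ide C W \<in> Hom C W (X \<otimes>\<^sub>o (X\<^sup>\<star> \<otimes>\<^sub>o W))" using XO WO by (simp add: Hom_iff)
    have cWW: "Coev C W \<otimes>\<^sub>m Ide C W \<in> Hom C W (W \<otimes>\<^sub>o (W\<^sup>\<star> \<otimes>\<^sub>o W))" using WO by (simp add: Hom_iff)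
    have XW: "X\<^sup>\<star> \<otimes>\<^sub>o W \<in> Obj C" using Xs WO by simp
    note \<pi>XW = TensorM_in[OF \<pi> Ide_in[OF XW]]
    have "(\<pi> \<otimes>\<^sub>m Ide C Z) \<cdot> h0 = ((\<pi> \<otimes>\<^sub>m Ide C Z) \<cdot> (Ide C X \<otimes>\<^sub>m h)) \<cdot> (Coev C X \<otimes>\<^sub>m Ide C W)"
      unfolding h0' by (rule Comp_assoc[OF cXW TensorM_in[OF Ide_in[OF XO] h] \<pi>Z, symmetric])
    also have "(\<pi> \<otimes>\<^sub>m Ide C Z) \<cdot> (Ide C X \<otimes>\<^sub>m h) = (Ide C W \<otimes>\<^sub>m h) \<cdot> (\<pi> \<otimes>\<^sub>m Ide C (X\<^sup>\<star> \<otimes>\<^sub>o W))"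
      using slide[OF \<pi> h] by (simp only:)
    also have "\<dots> \<cdot> (Coev C X \<otimes>\<^sub>m Ide C W) =
        (Ide C W \<otimes>\<^sub>m h) \<cdot> ((\<pi> \<otimes>\<^sub>m Ide C (X\<^sup>\<star> \<otimes>\<^sub>o W)) \<cdot> (Coev C X \<otimes>\<^sub>m Ide C W))"
      by (rule Comp_assoc[OF cXW \<pi>XW TensorM_in[OF Ide_in[OF WO] h]])
    also have "(\<pi> \<otimes>\<^sub>m Ide C (X\<^sup>\<star> \<otimes>\<^sub>o W)) \<cdot> (Coev C X \<otimes>\<^sub>m Ide C W) =
        ((\<pi> \<otimes>\<^sub>m Ide C (X\<^sup>\<star>)) \<otimes>\<^sub>m Ide C W) \<cdot> (Coev C X \<otimes>\<^sub>m Ide C W)"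
      using HomD[OF \<pi>] XO WO by simp
    also have "\<dots> = ((\<pi> \<otimes>\<^sub>m Ide C (X\<^sup>\<star>)) \<cdot> Coev C X) \<otimes>\<^sub>m Ide C W"
      using HomD[OF \<pi>] XO WO by (intro whisker_right_Comp[symmetric]) simp_all
    also have "\<dots> = ((Ide C W \<otimes>\<^sub>m dual_arrow C \<pi>) \<cdot> Coev C W) \<otimes>\<^sub>m Ide C W" unfolding Coev_dual_arrow[OF \<pi>] ..
    also have "\<dots> = ((Ide C W \<otimes>\<^sub>m dual_arrow C \<pi>) \<otimes>\<^sub>m Ide C W) \<cdot> (Coev C W \<otimes>\<^sub>m Ide C W)"
      using HomD[OF dp] XO WO by (intro whisker_right_Comp) simp_all
    also have "\<dots> = (Ide C W \<otimes>\<^sub>m (dual_arrow C \<pi> \<otimes>\<^sub>m Ide C W)) \<cdot> (Coev C W \<otimes>\<^sub>m Ide C W)"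
      using HomD[OF dp] XO WO by simp
    also have "(Ide C W \<otimes>\<^sub>m h) \<cdot> \<dots> =
        ((Ide C W \<otimes>\<^sub>m h) \<cdot> (Ide C W \<otimes>\<^sub>m (dual_arrow C \<pi> \<otimes>\<^sub>m Ide C W))) \<cdot> (Coev C W \<otimes>\<^sub>m Ide C W)"
      by (rule Comp_assoc[OF cWW TensorM_in[OF Ide_in[OF WO] dpW] TensorM_in[OF Ide_in[OF WO] h], symmetric])
    also have "(Ide C W \<otimes>\<^sub>m h) \<cdot> (Ide C W \<otimes>\<^sub>m (dual_arrow C \<pi> \<otimes>\<^sub>m Ide C W)) = Ide C W \<otimes>\<^sub>m Zero C (W\<^sup>\<star> \<otimes>\<^sub>o W) Z"
      unfolding hd[symmetric] using HomD[OF dpW] HomD[OF h] WO by (intro whisker_left_Comp[symmetric]) simp_all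
    also have "\<dots> = Zero C (W \<otimes>\<^sub>o (W\<^sup>\<star> \<otimes>\<^sub>o W)) (W \<otimes>\<^sub>o Z)"
      by (rule linear_map_Zero[OF linear_map_tensor_right[OF Ide_in[OF WO]] TensorO_Obj[OF Dual_Obj[OF WO] WO] Z])
    also have "\<dots> \<cdot> (Coev C W \<otimes>\<^sub>m Ide C W) = Zero C W (W \<otimes>\<^sub>o Z)"
      by (rule Comp_Zero(1)[OF cWW TensorO_Obj[OF WO Z]])
    finally show ?thesis .
  qed
  note \<pi>h0 = this
  interpret R: dual_pair "rev_cat C" Z Z' eZ cZ by (rule dual_pair_rev[OF Z'])
  have Z'O: "Z' \<in> Obj C" and eZ: "eZ \<in> Hom C (Z \<otimes>\<^sub>o Z') \<I>" using Z' by (auto simp: is_left_dual_def)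
  have linR: "linear_map (\<lambda>k. R.untransp k B) W (B \<otimes>\<^sub>o Z) (W \<otimes>\<^sub>o Z') B" if B: "B \<in> Obj C" for B
  proof -
    have eB: "Ide C B \<otimes>\<^sub>m eZ \<in> Hom C ((B \<otimes>\<^sub>o Z) \<otimes>\<^sub>o Z') B" using B Z'O HomD[OF eZ] by (simp add: Hom_iff)
    show ?thesis unfolding R.untransp_def rev_cat_simps
      by (rule linear_map_compose[OF linear_map_tensor_left[OF Ide_in[OF Z'O]] linear_map_Comp_left[OF eB]])
  qed
  \<comment> \<open>Second factorization: the kernel property concerns arrows into \<open>X\<close>,
    so the factor \<open>Z\<close> is moved to the domain by means of its right dual and moved back
    afterwards.\<close>
  have "\<pi> \<cdot> R.untransp h0 X = Zero C (W \<otimes>\<^sub>o Z') W"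
    using R.untransp_Comp_left[unfolded rev_cat_simps, OF h0(1) \<pi>] \<pi>h0
      linear_map_Zero[OF linR[OF WO] WO TensorO_Obj[OF WO Z]] by (simp only:)
  from ker[OF R.untransp_in[unfolded rev_cat_simps, OF XO h0(1)] this]
  obtain f0 where f0: "f0 \<in> Hom C (W \<otimes>\<^sub>o Z') \<I>" "R.untransp h0 X = s \<cdot> f0" by blast
  define f where "f = R.transp f0 W"
  have oZ: "\<I> \<otimes>\<^sub>o Z = Z" by simp
  have f: "f \<in> Hom C W Z"
    using R.transp_in[unfolded rev_cat_simps, OF WO f0(1)] unfolding f_def by (simp only: oZ)
  have h0f: "h0 = (s \<otimes>\<^sub>m Ide C Z) \<cdot> f"
    using R.transp_Comp_left[unfolded rev_cat_simps, OF WO f0(1) s] R.transp_untransp[unfolded rev_cat_simps, OF XO h0(1)]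
    unfolding f_def f0(2) by (simp only:)
  have Es: "Es \<in> Hom C (X\<^sup>\<star>) \<I>"
    using Comp_in[OF Xs_s Ev_in[OF XO]] Xs unfolding Es_def by simp
  have hf: "h = f \<cdot> (Es \<otimes>\<^sub>m Ide C W)"
  proof -
    have sZ: "s \<otimes>\<^sub>m Ide C Z \<in> Hom C Z (X \<otimes>\<^sub>o Z)" using TensorM_in[OF s Ide_in[OF Z]] by simp
    have "h = X.untransp (s \<otimes>\<^sub>m Ide C Z) Z \<cdot> (Ide C (X\<^sup>\<star>) \<otimes>\<^sub>m f)"
      unfolding h_def h0f by (rule X.untransp_Comp_right[OF Z sZ f])
    also have "X.untransp (s \<otimes>\<^sub>m Ide C Z) Z = Es \<otimes>\<^sub>m Ide C Z"
    proof -
      have "X.untransp (s \<otimes>\<^sub>m Ide C Z) Z = (Ev C X \<otimes>\<^sub>m Ide C Z) \<cdot> ((Ide C (X\<^sup>\<star>) \<otimes>\<^sub>m s) \<otimes>\<^sub>m Ide C Z)"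
        unfolding X.untransp_def using HomD[OF s] XO by simp
      also have "\<dots> = Es \<otimes>\<^sub>m Ide C Z"
        unfolding Es_def using HomD[OF s] XO by (intro whisker_right_Comp[symmetric]) simp_all
      finally show ?thesis .
    qed
    also have "(Es \<otimes>\<^sub>m Ide C Z) \<cdot> (Ide C (X\<^sup>\<star>) \<otimes>\<^sub>m f) = Es \<otimes>\<^sub>m f" by (rule slide(1)[OF Es f])
    also have "\<dots> = f \<cdot> (Es \<otimes>\<^sub>m Ide C W)" by (rule slide_effect(1)[OF Es f, symmetric])
    finally show ?thesis .
  qed
  show thesis by (rule that[OF f dh[unfolded hf Es_def]])
qed

lemma transparent_i:
  assumes "transparent X"
  shows "i X = u \<cdot> Ev C X"
  using assms
proof (induction "rank X" arbitrary: X rule: less_induct)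
  case less
  note X = less.prems
  have XO: "X \<in> Obj C" using X by (simp add: transparent_def)
  note Xs = Dual_Obj[OF XO]
  note uev = Comp_in[OF Ev_in[OF XO] u_in]
  show ?case
  proof (cases "rank X = 0")
    case True
    from Hom_rank_zero[OF XO True Xs i_in[OF XO]] Hom_rank_zero[OF XO True Xs uev] show ?thesis by (simp only:)
  next
    case False
    then obtain s where s: "s \<in> Hom C \<I> X" "s \<noteq> Zero C \<I> X"
      using transparent_state[OF X] by blast
    obtain L where L: "L \<in> carrier_mat (rank \<I>) (rank X)" "L * mat_of s = 1\<^sub>m (rank \<I>)"
      by (rule left_inverse_if_nonzero[OF Unit_irreducible s])
    have sm: "is_mono C s" by (rule mono_if_left_inverse[OF s(1) L])
    have rI: "rank \<I> > 0" using Unit_irreducible by (simp add: irreducible_rep_def)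
    obtain W \<pi> where \<pi>: "\<pi> \<in> Hom C X W" and rW: "rank W < rank X"
      and \<pi>epi: "\<And>B x y. x \<in> Hom C W B \<Longrightarrow> y \<in> Hom C W B \<Longrightarrow> x \<cdot> \<pi> = y \<cdot> \<pi> \<Longrightarrow> x = y"
      and coker: "\<And>B h. h \<in> Hom C X B \<Longrightarrow> h \<cdot> s = Zero C \<I> B \<Longrightarrow> \<exists>h' \<in> Hom C W B. h = h' \<cdot> \<pi>"
      and ker: "\<And>V f. f \<in> Hom C V X \<Longrightarrow> \<pi> \<cdot> f = Zero C V W \<Longrightarrow> \<exists>f' \<in> Hom C V \<I>. f = s \<cdot> f'"
      by (rule cokernel_exists[OF s(1) L rI], rule that)
    note WO = Hom_Obj(2)[OF \<pi>]
    have \<pi>j: "jointly_epi W {\<pi>}" unfolding jointly_epi_def using \<pi>epi by (intro allI ballI impI) simp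
    have W: "transparent W" by (rule transparent_quotient[OF X \<pi> \<pi>j])
    note iW = less.hyps[OF rW W]
    have annW: "annihilated_with \<I> W" by (rule annihilated_if_i_trivial[OF WO iW])
    let ?X = "X\<^sup>\<star> \<otimes>\<^sub>o X"
    \<comment> \<open>The difference of the two arrows to be identified, formed through
      matrices.\<close>
    obtain d where d: "d \<in> Hom C ?X F" "mat_of d = mat_of (i X) - mat_of (u \<cdot> Ev C X)"
      by (rule mat_of_diff[OF i_in[OF XO] uev])
    have d_zero: "d \<cdot> g = Zero C V F" if g: "g \<in> Hom C V ?X" and e: "i X \<cdot> g = (u \<cdot> Ev C X) \<cdot> g" for g V
    proof (rule Zero_if_mat_zero[OF Comp_in[OF g d(1)]])
      note c = mat_of_carrier[OF i_in[OF XO]] mat_of_carrier[OF uev] mat_of_carrier[OF g]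
      have "mat_of (d \<cdot> g) = mat_of (i X) * mat_of g - mat_of (u \<cdot> Ev C X) * mat_of g"
        unfolding mat_of_Comp[OF g d(1)] d(2) by (rule minus_mult_distrib_mat[OF c])
      also have "\<dots> = mat_of (i X \<cdot> g) - mat_of (i X \<cdot> g)"
        unfolding mat_of_Comp[OF g i_in[OF XO], symmetric] mat_of_Comp[OF g uev, symmetric] e ..
      also have "\<dots> = 0\<^sub>m (rank F) (rank V)"
        using mat_of_carrier[OF Comp_in[OF g i_in[OF XO]]] by (intro minus_r_inv_mat)
      finally show "mat_of (d \<cdot> g) = 0\<^sub>m (rank F) (rank V)" .
    qed
    define Es where "Es = Ev C X \<cdot> (Ide C (X\<^sup>\<star>) \<otimes>\<^sub>m s)"
    have Xs_s: "Ide C (X\<^sup>\<star>) \<otimes>\<^sub>m s \<in> Hom C (X\<^sup>\<star> \<otimes>\<^sub>o \<I>) ?X" by (rule TensorM_in[OF Ide_in[OF Xs] s(1)])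
    note ds = dual_arrow_in[OF s(1)] and dp = dual_arrow_in[OF \<pi>]
    have dsI: "dual_arrow C s \<otimes>\<^sub>m Ide C \<I> \<in> Hom C (X\<^sup>\<star> \<otimes>\<^sub>o \<I>) (\<I>\<^sup>\<star> \<otimes>\<^sub>o \<I>)" by (rule TensorM_in[OF ds Ide_in[OF Unit_Obj]])
    have Xs_\<pi>: "Ide C (X\<^sup>\<star>) \<otimes>\<^sub>m \<pi> \<in> Hom C ?X (X\<^sup>\<star> \<otimes>\<^sub>o W)" by (rule TensorM_in[OF Ide_in[OF Xs] \<pi>])
    have dpX: "dual_arrow C \<pi> \<otimes>\<^sub>m Ide C X \<in> Hom C (W\<^sup>\<star> \<otimes>\<^sub>o X) ?X" by (rule TensorM_in[OF dp Ide_in[OF XO]])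
    have Ws_\<pi>: "Ide C (W\<^sup>\<star>) \<otimes>\<^sub>m \<pi> \<in> Hom C (W\<^sup>\<star> \<otimes>\<^sub>o X) (W\<^sup>\<star> \<otimes>\<^sub>o W)" by (rule TensorM_in[OF Ide_in[OF Dual_Obj[OF WO]] \<pi>])
    \<comment> \<open>Dinaturality along \<open>s\<close> reduces this to the unit object, where
      \<open>i \<I> = u \<cdot> Ev C \<I>\<close>. Dinaturality along \<pi> reduces the next claim
      to the induction hypothesis for \<open>W\<close>.\<close>
    have d1: "d \<cdot> (Ide C (X\<^sup>\<star>) \<otimes>\<^sub>m s) = Zero C (X\<^sup>\<star> \<otimes>\<^sub>o \<I>) F"
    proof (rule d_zero[OF Xs_s])
      have "i X \<cdot> (Ide C (X\<^sup>\<star>) \<otimes>\<^sub>m s) = (u \<cdot> Ev C \<I>) \<cdot> (dual_arrow C s \<otimes>\<^sub>m Ide C \<I>)"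
        unfolding i_dinatural[OF s(1)] i_Unit[symmetric] ..
      also have "\<dots> = u \<cdot> (Ev C \<I> \<cdot> (dual_arrow C s \<otimes>\<^sub>m Ide C \<I>))" by (rule Comp_assoc[OF dsI Ev_in[OF Unit_Obj] u_in])
      also have "\<dots> = (u \<cdot> Ev C X) \<cdot> (Ide C (X\<^sup>\<star>) \<otimes>\<^sub>m s)"
        unfolding Ev_dual_arrow[OF s(1), symmetric] by (rule Comp_assoc[OF Xs_s Ev_in[OF XO] u_in, symmetric])
      finally show "i X \<cdot> (Ide C (X\<^sup>\<star>) \<otimes>\<^sub>m s) = (u \<cdot> Ev C X) \<cdot> (Ide C (X\<^sup>\<star>) \<otimes>\<^sub>m s)" .
    qed
    have d2: "d \<cdot> (dual_arrow C \<pi> \<otimes>\<^sub>m Ide C X) = Zero C (W\<^sup>\<star> \<otimes>\<^sub>o X) F"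
    proof (rule d_zero[OF dpX])
      have "i X \<cdot> (dual_arrow C \<pi> \<otimes>\<^sub>m Ide C X) = (u \<cdot> Ev C W) \<cdot> (Ide C (W\<^sup>\<star>) \<otimes>\<^sub>m \<pi>)"
        unfolding i_dinatural[OF \<pi>, symmetric] iW ..
      also have "\<dots> = u \<cdot> (Ev C W \<cdot> (Ide C (W\<^sup>\<star>) \<otimes>\<^sub>m \<pi>))" by (rule Comp_assoc[OF Ws_\<pi> Ev_in[OF WO] u_in])
      also have "\<dots> = (u \<cdot> Ev C X) \<cdot> (dual_arrow C \<pi> \<otimes>\<^sub>m Ide C X)"
        unfolding Ev_dual_arrow[OF \<pi>] by (rule Comp_assoc[OF dpX Ev_in[OF XO] u_in, symmetric])
      finally show "i X \<cdot> (dual_arrow C \<pi> \<otimes>\<^sub>m Ide C X) = (u \<cdot> Ev C X) \<cdot> (dual_arrow C \<pi> \<otimes>\<^sub>m Ide C X)" .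
    qed
    have Es: "Es \<in> Hom C (X\<^sup>\<star>) \<I>"
      using Comp_in[OF Xs_s Ev_in[OF XO]] Xs unfolding Es_def by simp
    obtain f where f: "f \<in> Hom C W F" and df: "d = (f \<cdot> (Es \<otimes>\<^sub>m Ide C W)) \<cdot> (Ide C (X\<^sup>\<star>) \<otimes>\<^sub>m \<pi>)"
      by (rule factor_through_quotient[OF s(1) \<pi> coker ker \<pi>j F_Obj d(1) d1 d2], assumption, assumption, assumption, assumption, rule that[unfolded Es_def])
    define h where "h = f \<cdot> (Es \<otimes>\<^sub>m Ide C W)"
    note hf = h_def and dh = df[folded h_def]
    have EsW: "Es \<otimes>\<^sub>m Ide C W \<in> Hom C (X\<^sup>\<star> \<otimes>\<^sub>o W) W" using TensorM_in[OF Es Ide_in[OF WO]] WO by simp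
    have h: "h \<in> Hom C (X\<^sup>\<star> \<otimes>\<^sub>o W) F" unfolding h_def by (rule Comp_in[OF EsW f])
    \<comment> \<open>It remains to see that \<open>f\<close> vanishes. On states it does so by injectivity of \<open>\<Omega>\<close>.\<close>
    have lin_\<omega>: "linear_map (\<lambda>k. \<omega> \<cdot> (k \<otimes>\<^sub>m Ide C F)) V F (V \<otimes>\<^sub>o F) \<I>" for V
      by (rule linear_map_compose[OF linear_map_tensor_left[OF Ide_in[OF F_Obj]] linear_map_Comp_left[OF omega_in]])
    have \<omega>d: "\<omega> \<cdot> (d \<otimes>\<^sub>m Ide C F) = Zero C (?X \<otimes>\<^sub>o F) \<I>"
    proof -
      have dH: "\<omega> \<cdot> (k \<otimes>\<^sub>m Ide C F) \<in> Hom C (?X \<otimes>\<^sub>o F) \<I>" if "k \<in> Hom C ?X F" for k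
        by (rule Comp_in[OF TensorM_in[OF that Ide_in[OF F_Obj]] omega_in])
      \<comment> \<open>The coefficients \<open>1\<close> and \<open>- 1\<close> present
        \<open>d\<close> as a linear combination, so that \<open>linear_map_lc\<close> applies to
        it.\<close>
      define t where "t = (\<lambda>a::nat. if a = 0 then 1 else (- 1 :: 'k))"
      define g where "g = (\<lambda>a::nat. if a = 0 then i X else u \<cdot> Ev C X)"
      have g: "g a \<in> Hom C ?X F" for a using i_in[OF XO] uev by (simp add: g_def)
      have "mat_of d = mat_lc (rank F) (rank ?X) 2 t (\<lambda>a. mat_of (g a))"
        unfolding d(2) using mat_of_carrier[OF i_in[OF XO]] mat_of_carrier[OF uev]
        by (intro eq_matI) (simp_all add: t_def g_def numeral_2_eq_2)
      from linear_map_lc[OF lin_\<omega> g d(1) this]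
      have "mat_of (\<omega> \<cdot> (d \<otimes>\<^sub>m Ide C F)) = mat_lc (rank \<I>) (rank (?X \<otimes>\<^sub>o F)) 2 t (\<lambda>a. mat_of (\<omega> \<cdot> (g a \<otimes>\<^sub>m Ide C F)))" .
      also have "\<dots> = 0\<^sub>m (rank \<I>) (rank (?X \<otimes>\<^sub>o F))"
        by (rule eq_matI) (simp_all add: t_def g_def numeral_2_eq_2 omega_transparent[OF X])
      finally show ?thesis by (rule Zero_if_mat_zero[OF dH[OF d(1)]])
    qed
    have XsW: "X\<^sup>\<star> \<otimes>\<^sub>o W \<in> Obj C" using Xs WO by simp
    have \<omega>h: "\<omega> \<cdot> (h \<otimes>\<^sub>m Ide C F) = Zero C ((X\<^sup>\<star> \<otimes>\<^sub>o W) \<otimes>\<^sub>o F) \<I>"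
    proof -
      have j1: "jointly_epi (X\<^sup>\<star> \<otimes>\<^sub>o W) {Ide C (X\<^sup>\<star>) \<otimes>\<^sub>m \<pi>}"
        using jointly_epi_whisker(1)[OF Xs WO \<pi>j] HomD[OF \<pi>] by simp
      have j: "jointly_epi ((X\<^sup>\<star> \<otimes>\<^sub>o W) \<otimes>\<^sub>o F) {(Ide C (X\<^sup>\<star>) \<otimes>\<^sub>m \<pi>) \<otimes>\<^sub>m Ide C F}"
        using jointly_epi_whisker(2)[OF F_Obj XsW j1] HomD[OF Xs_\<pi>] by simp
      have "(\<omega> \<cdot> (h \<otimes>\<^sub>m Ide C F)) \<cdot> ((Ide C (X\<^sup>\<star>) \<otimes>\<^sub>m \<pi>) \<otimes>\<^sub>m Ide C F) = Zero C (?X \<otimes>\<^sub>o F) \<I>"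
        unfolding omega_whisker[OF Xs_\<pi> h, symmetric] dh[symmetric] by (rule \<omega>d)
      also have "\<dots> = Zero C ((X\<^sup>\<star> \<otimes>\<^sub>o W) \<otimes>\<^sub>o F) \<I> \<cdot> ((Ide C (X\<^sup>\<star>) \<otimes>\<^sub>m \<pi>) \<otimes>\<^sub>m Ide C F)"
        by (rule Comp_Zero(1)[OF TensorM_in[OF Xs_\<pi> Ide_in[OF F_Obj]] Unit_Obj, symmetric])
      finally have e: "(\<omega> \<cdot> (h \<otimes>\<^sub>m Ide C F)) \<cdot> ((Ide C (X\<^sup>\<star>) \<otimes>\<^sub>m \<pi>) \<otimes>\<^sub>m Ide C F) =
          Zero C ((X\<^sup>\<star> \<otimes>\<^sub>o W) \<otimes>\<^sub>o F) \<I> \<cdot> ((Ide C (X\<^sup>\<star>) \<otimes>\<^sub>m \<pi>) \<otimes>\<^sub>m Ide C F)" .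
      show ?thesis
        by (rule jointly_epiD[OF j Comp_in[OF TensorM_in[OF h Ide_in[OF F_Obj]] omega_in]
              Zero_Hom[OF TensorO_Obj[OF XsW F_Obj] Unit_Obj]]) (simp only: singleton_iff e)
    qed
    have Es_epi: "jointly_epi \<I> {Es}"
      unfolding jointly_epi_def Es_def using Ev_whisker_epi[OF s(1) sm] by (intro allI ballI impI) simp
    have EsF: "jointly_epi F {Es \<otimes>\<^sub>m Ide C F}"
      using jointly_epi_whisker(2)[OF F_Obj Unit_Obj Es_epi] HomD[OF Es] by simp
    have f_state: "f \<cdot> w = Zero C \<I> F" if w: "w \<in> Hom C \<I> W" for w
    proof (rule omega_inject[OF Comp_in[OF w f] Zero_Hom[OF Unit_Obj F_Obj]])
      note fw = Comp_in[OF w f]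
      have k: "\<omega> \<cdot> ((f \<cdot> w) \<otimes>\<^sub>m Ide C F) \<in> Hom C F \<I>" using Comp_in[OF TensorM_in[OF fw Ide_in[OF F_Obj]] omega_in] by simp
      have Xw: "Ide C (X\<^sup>\<star>) \<otimes>\<^sub>m w \<in> Hom C (X\<^sup>\<star>) (X\<^sup>\<star> \<otimes>\<^sub>o W)" using TensorM_in[OF Ide_in[OF Xs] w] Xs by simp
      \<comment> \<open>\<open>Es\<close> is epic and stays so after tensoring with
        \<open>F\<close>, so the pairing of \<open>f \<cdot> w\<close> may be tested after
        \<open>Es\<close>, where the arrow is expressed by \<open>h\<close>.\<close>
      have "(f \<cdot> w) \<cdot> Es = f \<cdot> (w \<cdot> Es)" by (rule Comp_assoc[OF Es w f])
      also have "w \<cdot> Es = (Es \<otimes>\<^sub>m Ide C W) \<cdot> (Ide C (X\<^sup>\<star>) \<otimes>\<^sub>m w)"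
        unfolding slide(1)[OF Es w] using slide_effect(1)[OF Es w] HomD[OF Es] by simp
      also have "f \<cdot> \<dots> = h \<cdot> (Ide C (X\<^sup>\<star>) \<otimes>\<^sub>m w)" unfolding hf by (rule Comp_assoc[OF Xw EsW f, symmetric])
      finally have fwE: "(f \<cdot> w) \<cdot> Es = h \<cdot> (Ide C (X\<^sup>\<star>) \<otimes>\<^sub>m w)" .
      have "(\<omega> \<cdot> ((f \<cdot> w) \<otimes>\<^sub>m Ide C F)) \<cdot> (Es \<otimes>\<^sub>m Ide C F) = Zero C ((X\<^sup>\<star> \<otimes>\<^sub>o W) \<otimes>\<^sub>o F) \<I> \<cdot> ((Ide C (X\<^sup>\<star>) \<otimes>\<^sub>m w) \<otimes>\<^sub>m Ide C F)"
        unfolding omega_whisker[OF Es fw, symmetric] fwE omega_whisker[OF Xw h] \<omega>h ..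
      also have "\<dots> = Zero C (X\<^sup>\<star> \<otimes>\<^sub>o F) \<I>" by (rule Comp_Zero(1)[OF TensorM_in[OF Xw Ide_in[OF F_Obj]] Unit_Obj])
      also have "\<dots> = Zero C F \<I> \<cdot> (Es \<otimes>\<^sub>m Ide C F)"
        using Comp_Zero(1)[OF TensorM_in[OF Es Ide_in[OF F_Obj]] Unit_Obj] by simp
      finally have e: "(\<omega> \<cdot> ((f \<cdot> w) \<otimes>\<^sub>m Ide C F)) \<cdot> (Es \<otimes>\<^sub>m Ide C F) = Zero C F \<I> \<cdot> (Es \<otimes>\<^sub>m Ide C F)" .
      have "\<omega> \<cdot> ((f \<cdot> w) \<otimes>\<^sub>m Ide C F) = Zero C F \<I>"
        by (rule jointly_epiD[OF EsF k Zero_Hom[OF F_Obj Unit_Obj]]) (simp only: singleton_iff e)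
      also have "\<dots> = \<omega> \<cdot> (Zero C \<I> F \<otimes>\<^sub>m Ide C F)"
        using linear_map_Zero[OF lin_\<omega> Unit_Obj F_Obj] by simp
      finally show "\<omega> \<cdot> ((f \<cdot> w) \<otimes>\<^sub>m Ide C F) = \<omega> \<cdot> (Zero C \<I> F \<otimes>\<^sub>m Ide C F)" .
    qed
    \<comment> \<open>The induction hypothesis is used a second time here: through
      \<open>annW\<close> it ensures that arrows from \<open>\<I>\<close> separate arrows out of
      \<open>W\<close>.\<close>
    have "f = Zero C W F"
    proof (rule states_jointly_epi[OF WO annW f Zero_Hom[OF WO F_Obj]])
      fix w assume w: "w \<in> Hom C \<I> W"
      show "f \<cdot> w = Zero C W F \<cdot> w" unfolding f_state[OF w] by (rule Comp_Zero(1)[OF w F_Obj, symmetric])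
    qed
    hence "h = Zero C (X\<^sup>\<star> \<otimes>\<^sub>o W) F"
      using hf Comp_Zero(1)[OF TensorM_in[OF Es Ide_in[OF WO]] F_Obj] WO by simp
    hence "d = Zero C ?X F" unfolding dh by (simp only: Comp_Zero(1)[OF Xs_\<pi> F_Obj])
    hence 0: "mat_of (i X) - mat_of (u \<cdot> Ev C X) = 0\<^sub>m (rank F) (rank ?X)"
      using d(2) mat_of_Zero[OF Hom_Obj[OF d(1)]] by (simp only:)
    show ?thesis
    proof (rule mat_of_inject[OF i_in[OF XO] uev], rule eq_matI)
      note c = mat_of_carrier[OF i_in[OF XO]] mat_of_carrier[OF uev]
      fix r t assume "r < dim_row (mat_of (u \<cdot> Ev C X))" "t < dim_col (mat_of (u \<cdot> Ev C X))"
      with arg_cong[OF 0, of "\<lambda>M. M $$ (r,t)"] c show "mat_of (i X) $$ (r,t) = mat_of (u \<cdot> Ev C X) $$ (r,t)" by simp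
    qed (use mat_of_carrier[OF i_in[OF XO]] mat_of_carrier[OF uev] in simp_all)
  qed
qed

lemma transparent_direct_sum:
  assumes X: "transparent X"
  shows "\<exists>r. is_direct_sum_copies C r \<I> X"
proof -
  have XO: "X \<in> Obj C" using X by (simp add: transparent_def)
  obtain m where m: "\<And>i j. m i j \<in> carrier A"
    "\<And>i j. rep \<I> (m i j) = mat (rank \<I>) (rank \<I>) (\<lambda>(u,v). if u = i \<and> v = j then 1 else 0)"
    by (rule matrix_units[OF Unit_Obj Unit_irreducible], rule that)
  show ?thesis
    by (rule direct_sum_of_units[OF Unit_Obj Unit_irreducible XO annihilated_if_i_trivial[OF XO transparent_i[OF X]] m])
qed

lemma mueger_center_is_trivial: "mueger_center_trivial C"
  unfolding mueger_center_trivial_def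
proof
  fix X assume "X \<in> Obj (mueger_center C)"
  hence X: "transparent X"
    by (auto simp: mueger_center_def full_subcategory_def transparent_def double_braiding_def)
  hence XO: "X \<in> Obj C" by (simp add: transparent_def)
  have "is_iso C (Ide C X)" unfolding is_iso_def inverse_arrows_def using XO Ide_in[OF XO]
    by (intro exI[of _ "Ide C X"]) simp
  hence "isomorphic C X X" using Ide_in[OF XO] by (auto simp: isomorphic_def)
  with transparent_direct_sum[OF X] show "\<exists>n D. is_direct_sum_copies C n \<I> D \<and> isomorphic C X D" by blast
qed

end

theorem theorem5p2:
  fixes C :: "('k :: alg_closed_field, 'o, 'm) braided_cat"
    and F :: 'o and i :: "'o \<Rightarrow> 'm"
  assumes "braided_finite_tensor_category C"
    and "is_coend C F i"
    and "inj_on (Omega C F i) (Hom C \<I>\<^bsub>C\<^esub> F)"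
  shows "mueger_center_trivial C"
proof -
  interpret C: braided_finite_tensor_category C by fact
  interpret C: braided_with_coend C F i by unfold_locales fact
  obtain A :: "('k, 'k vec) module" and n b co rank rep mat_of
    where "represented_category C A n b co rank rep mat_of"
    using finite_abelian_represented[OF C.finite_abelian_category_axioms] by blast
  then interpret R: represented_category C A n b co rank rep mat_of .
  interpret R: represented_braided_category C F i A n b co rank rep mat_of by unfold_locales
  show ?thesis
  proof (rule R.regular_objects)
    fix P J p q \<beta>
    assume "P \<in> Obj C" "J \<in> Obj C"
      "\<And>X a. X \<in> Obj C \<Longrightarrow> a < rank X \<Longrightarrow> p X a \<in> Hom C P X"
      "\<And>X a. X \<in> Obj C \<Longrightarrow> a < rank X \<Longrightarrow> q X a \<in> Hom C X J"
      "\<And>X Y f a. f \<in> Hom C X Y \<Longrightarrow> a < rank X \<Longrightarrow> mat_of (f \<cdot>\<^bsub>C\<^esub> p X a) =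
        mat_lc (rank Y) (rank P) (rank Y) (\<lambda>w. mat_of f $$ (w,a)) (\<lambda>w. mat_of (p Y w))"
      "\<And>X Y f a. f \<in> Hom C X Y \<Longrightarrow> a < rank Y \<Longrightarrow> mat_of (q Y a \<cdot>\<^bsub>C\<^esub> f) =
        mat_lc (rank J) (rank X) (rank X) (\<lambda>w. mat_of f $$ (a,w)) (\<lambda>w. mat_of (q X w))"
      "\<And>c. c \<in> carrier A \<Longrightarrow> \<beta> c \<in> Hom C J J"
      "\<And>c X a. c \<in> carrier A \<Longrightarrow> X \<in> Obj C \<Longrightarrow> a < rank X \<Longrightarrow> mat_of (\<beta> c \<cdot>\<^bsub>C\<^esub> q X a) =
        mat_lc (rank J) (rank X) (rank X) (\<lambda>w. rep X c $$ (a,w)) (\<lambda>w. mat_of (q X w))"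
      "\<And>X t a. X \<in> Obj C \<Longrightarrow> mat_lc (rank X) (rank P) (rank X) t (\<lambda>a. mat_of (p X a)) = 0\<^sub>m (rank X) (rank P) \<Longrightarrow>
        a < rank X \<Longrightarrow> t a = 0"
      "\<And>X t a. X \<in> Obj C \<Longrightarrow> mat_lc (rank J) (rank X) (rank X) t (\<lambda>a. mat_of (q X a)) = 0\<^sub>m (rank J) (rank X) \<Longrightarrow>
        a < rank X \<Longrightarrow> t a = 0"
      "\<And>X Y s x. X \<in> Obj C \<Longrightarrow> Y \<in> Obj C \<Longrightarrow>
        mat_lc (rank J) (rank P) (rank X) (\<lambda>_. 1) (\<lambda>a. mat_of (q X a \<cdot>\<^bsub>C\<^esub> p X a)) =
        s \<cdot>\<^sub>m mat_lc (rank J) (rank P) (rank Y) (\<lambda>_. 1) (\<lambda>a. mat_of (q Y a \<cdot>\<^bsub>C\<^esub> p Y a)) \<Longrightarrow>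
        x \<in> carrier A \<Longrightarrow> (\<Sum>u<rank X. rep X x $$ (u,u)) = s * (\<Sum>u<rank Y. rep Y x $$ (u,u))"
    then have "regular_data C F i A n b co rank rep mat_of P J p q \<beta>"
      by (intro regular_data.intro regular_data_axioms.intro R.represented_braided_category_axioms assms(3))
    thus ?thesis by (rule regular_data.mueger_center_is_trivial)
  qed
qed

end
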